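(* Let $f\colon(\mathbb{R}^2,0)\to(\mathbb{R}^3,0)$ be a frontal with pure-frontal singular point $0$, with $\kappa_t(0)\ne0$ and principal curvatures nowhere zero. Let $j\in\{1,2\}$ and suppose that $0$ is a first order $\boldsymbol{V}_j$-ridge point of $f$ and a singular point of the first kind of the focal surface $C_j$. Then $C_j$ has a cuspidal cross cap at $0$ if and only if $r_c'\neq0$ and $$\hat\rho_j'\Bigl(\kappa_t^2\kappa_\nu'+2\kappa_t\kappa_t'(\kappa_j-\kappa_\nu)+\frac{r_b'}{3}(\kappa_j-\kappa_\nu)^2\Bigr)\neq\bigl(\kappa_t^2+(\kappa_j-\kappa_\nu)^2\bigr)(\kappa_{j+1}-\kappa_j)(\kappa_\nu-\kappa_j)$$ hold at $0$, where $\kappa_3=\kappa_1$, $\hat\rho_j$ is the composition of $\rho_j=1/\kappa_j$ with the singular curve $\beta(t)$ of $C_j$, and $\hat\rho_j'$ is its derivative.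
   Context: All maps are $C^\infty$. A map germ $f\colon(\mathbb{R}^2,0)\to\mathbb{R}^3$ is a frontal if there is a smooth $\nu\colon(\mathbb{R}^2,0)\to\mathbb{S}^2$ (a unit normal vector field) with $\langle df_q(X),\nu(q)\rangle=0$ for all $q$ and $X\in T_q\mathbb{R}^2$. Put $\lambda=\det(f_u,f_v,\nu)$ and $S(f)=\{q: \operatorname{rank}df_q<2\}=\lambda^{-1}(0)$. A singular point is non-degenerate if $d\lambda\ne0$ there; then near it $S(f)$ is a regular curve $\gamma$ (the singular curve) and there is a nowhere vanishing vector field $\eta$ (null vector field) with $df(\eta)=0$ along $\gamma$. It is of the first kind if $\gamma'$ and $\eta$ are linearly independent there. A singular point of the first kind is a pure-frontal singular point if $\psi(t)=\det((f\circ\gamma)'(t),\nu(\gamma(t)),d\nu_{\gamma(t)}(\eta))$ vanishes identically along $\gamma$. Adapted coordinates: around a pure-frontal singular point there are coordinates $(u,v)$ with $S(f)=\{v=0\}$, $\partial_v$ a null vector field, and $\{f_u,f_{vv},\nu\}$ orthonormal along the $u$-axis; fix such coordinates. Then $f_v=vh$, $\nu_v=v\nu_1$ with $h,\nu_1$ smooth. Put $\tilde E=\langle f_u,f_u\rangle$, $\tilde F=\langle f_u,h\rangle$, $\tilde G=\langle h,h\rangle$, $\tilde L=-\langle f_u,\nu_u\rangle$, $\tilde M=-\langle h,\nu_u\rangle$, $\tilde N_1=-\langle h,\nu_1\rangle$. The Gaussian and mean curvatures of $f$ extend smoothly as $K=\frac{\tilde L\tilde N_1-\tilde M^2}{\tilde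 E\tilde G-\tilde F^2}$, $H=\frac{\tilde E\tilde N_1-2\tilde F\tilde M+\tilde G\tilde L}{2(\tilde E\tilde G-\tilde F^2)}$, and the principal curvatures are $\kappa_1=H+\sqrt{H^2-K}$, $\kappa_2=H-\sqrt{H^2-K}$ (distinct and smooth near $0$ if $\kappa_t(0)\ne0$). Along the $u$-axis: limiting normal curvature $\kappa_\nu(u)=\tilde L(u,0)$, cuspidal torsion $\kappa_t(u)=\tilde M(u,0)$, bias $r_b(u)=3\tilde N_1(u,0)$, secondary cuspidal curvature $r_c(u)=24\bigl((\tilde N_1)_v-2\tilde F_v\tilde M-\tilde G_v\tilde N_1\bigr)(u,0)$; primes on these denote $d/du$. Principal vectors: $\boldsymbol{V}_j=-v(\tilde M-\kappa_j\tilde F)\partial_u+(\tilde L-\kappa_j\tilde E)\partial_v$. The point $0$ is a first order $\boldsymbol{V}_j$-ridge point if $\boldsymbol{V}_j\kappa_j=0$ and $\boldsymbol{V}_j(\boldsymbol{V}_j\kappa_j)\ne0$ at $0$. The focal surface associated to $\kappa_j$ is $C_j=f+\rho_j\nu$, $\rho_j=1/\kappa_j$. When $\kappa_t(0)\ne0$ it is a frontal near $0$ with unit normal $\boldsymbol{e}_j=\boldsymbol{x}_j/|\boldsymbol{x}_j|$, where $\boldsymbol{x}_j=-(\tilde M-\kappa_j\tilde F)f_u+(\tilde L-\kappa_j\tilde E)h$; notions for singular points of $C_j$ are with respect to this structure. The singular curve of $C_j$ through $0$ is parametrized in the adapted coordinates as $\beta(t)=(t,g(t))$ with $g(0)=0$.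 A map has a cuspidal cross cap at a point if its germ there is $\mathcal{A}$-equivalent (equal up to diffeomorphism germs of source and target) to $(u,v)\mapsto(u,v^2,uv^3)$ at the origin. *)

theory Defs
  imports "HOL-Analysis.Analysis"
begin

type_synonym surf = "real \<times> real \<Rightarrow> real^3"


section \<open>Smooth maps, diffeomorphism germs, A-equivalence\<close>

text \<open>Only meant for open \<open>S\<close>: the derivatives are two-sided.\<close>

fun Ck_on :: "nat \<Rightarrow> 'a::euclidean_space set \<Rightarrow> ('a \<Rightarrow> 'b::real_normed_vector) \<Rightarrow> bool" where
  "Ck_on 0 S f \<longleftrightarrow> continuous_on S f"
| "Ck_on (Suc k) S f \<longleftrightarrow>
     (\<forall>x\<in>S. f differentiable (at x)) \<and>
     (\<forall>w. Ck_on k S (\<lambda>x. frechet_derivative f (at x) w))"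

definition smooth_on :: "'a::euclidean_space set \<Rightarrow> ('a \<Rightarrow> 'b::real_normed_vector) \<Rightarrow> bool" where
  "smooth_on S f \<longleftrightarrow> (\<forall>k. Ck_on k S f)"

text \<open>A germ at \<open>p\<close> is represented by a total function, of which only the values near \<open>p\<close> matter.\<close>

definition smooth_germ :: "'a::euclidean_space \<Rightarrow> ('a \<Rightarrow> 'b::real_normed_vector) \<Rightarrow> bool" where
  "smooth_germ p f \<longleftrightarrow> (\<exists>U. open U \<and> p \<in> U \<and> smooth_on U f)"

definition diffeo_germ ::
    "('a::euclidean_space \<Rightarrow> 'b::euclidean_space) \<Rightarrow> 'a \<Rightarrow> 'b \<Rightarrow> bool" where
  "diffeo_germ \<phi> p q \<longleftrightarrow> \<phi> p = q \<and>
     (\<exists>U V \<theta>. open U \<and> open V \<and> p \<in> U \<and> \<phi> ` U = V \<and>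
        smooth_on U \<phi> \<and> smooth_on V \<theta> \<and>
        (\<forall>x\<in>U. \<theta> (\<phi> x) = x) \<and> (\<forall>y\<in>V. \<phi> (\<theta> y) = y))"

definition A_equivalent ::
    "('a::euclidean_space \<Rightarrow> 'b::euclidean_space) \<Rightarrow> 'a \<Rightarrow>
     ('a \<Rightarrow> 'b) \<Rightarrow> 'a \<Rightarrow> bool" where
  "A_equivalent f p g q \<longleftrightarrow>
     (\<exists>\<phi> \<Phi>. diffeo_germ \<phi> p q \<and> diffeo_germ \<Phi> (f p) (g q) \<and>
        (\<forall>\<^sub>F x in nhds p. \<Phi> (f x) = g (\<phi> x)))"

definition std_cuspidal_cross_cap :: surf where
  "std_cuspidal_cross_cap = (\<lambda>(u, v). vector [u, v^2, u * v^3])"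

definition has_cuspidal_cross_cap :: "surf \<Rightarrow> real \<times> real \<Rightarrow> bool" where
  "has_cuspidal_cross_cap f p \<longleftrightarrow> A_equivalent f p std_cuspidal_cross_cap 0"


section \<open>Derivatives in the plane\<close>

definition dir_deriv ::
    "(real \<times> real \<Rightarrow> real \<times> real) \<Rightarrow> (real \<times> real \<Rightarrow> 'b::real_normed_vector) \<Rightarrow>
     real \<times> real \<Rightarrow> 'b" where
  "dir_deriv X f q = frechet_derivative f (at q) (X q)"

definition pd_u :: "(real \<times> real \<Rightarrow> 'b::real_normed_vector) \<Rightarrow> real \<times> real \<Rightarrow> 'b" where
  "pd_u = dir_deriv (\<lambda>_. (1, 0))"

definition pd_v :: "(real \<times> real \<Rightarrow> 'b::real_normed_vector) \<Rightarrow> real \<times> real \<Rightarrow> 'b" where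
  "pd_v = dir_deriv (\<lambda>_. (0, 1))"

definition det3 :: "real^3 \<Rightarrow> real^3 \<Rightarrow> real^3 \<Rightarrow> real" where
  "det3 a b c = det (vector [a, b, c] :: real^3^3)"


section \<open>Frontals and their singular points\<close>

definition frontal_germ ::
    "surf \<Rightarrow> surf \<Rightarrow> real \<times> real \<Rightarrow> bool" where
  "frontal_germ f \<nu> p \<longleftrightarrow> smooth_germ p f \<and> smooth_germ p \<nu> \<and>
     (\<forall>\<^sub>F q in nhds p. norm (\<nu> q) = 1 \<and>
        (\<forall>X. frechet_derivative f (at q) X \<bullet> \<nu> q = 0))"

definition signed_area_density ::
    "surf \<Rightarrow> surf \<Rightarrow> real \<times> real \<Rightarrow> real" where
  "signed_area_density f \<nu> q = det3 (pd_u f q) (pd_v f q) (\<nu> q)"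

definition singular_set :: "surf \<Rightarrow> (real \<times> real) set" where
  "singular_set f = {q. dim (range (frechet_derivative f (at q))) < 2}"

definition nondegenerate_singular ::
    "surf \<Rightarrow> surf \<Rightarrow> real \<times> real \<Rightarrow> bool" where
  "nondegenerate_singular f \<nu> p \<longleftrightarrow> p \<in> singular_set f \<and>
     (\<exists>X. frechet_derivative (signed_area_density f \<nu>) (at p) X \<noteq> 0)"

definition singular_curve ::
    "surf \<Rightarrow> real \<times> real \<Rightarrow> (real \<Rightarrow> real \<times> real) \<Rightarrow> bool" where
  "singular_curve f p \<gamma> \<longleftrightarrow> \<gamma> 0 = p \<and>
     (\<exists>\<delta> W. 0 < \<delta> \<and> open W \<and> p \<in> W \<and>
        smooth_on {-\<delta><..<\<delta>} \<gamma> \<and> inj_on \<gamma> {-\<delta><..<\<delta>} \<and>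
        (\<forall>t\<in>{-\<delta><..<\<delta>}. vector_derivative \<gamma> (at t) \<noteq> 0) \<and>
        \<gamma> ` {-\<delta><..<\<delta>} = singular_set f \<inter> W)"

definition null_vector_field ::
    "surf \<Rightarrow> real \<times> real \<Rightarrow> (real \<times> real \<Rightarrow> real \<times> real) \<Rightarrow> bool" where
  "null_vector_field f p \<eta> \<longleftrightarrow> smooth_germ p \<eta> \<and>
     (\<forall>\<^sub>F q in nhds p. \<eta> q \<noteq> 0 \<and> (q \<in> singular_set f \<longrightarrow> dir_deriv \<eta> f q = 0))"

definition first_kind ::
    "surf \<Rightarrow> surf \<Rightarrow> real \<times> real \<Rightarrow> bool" where
  "first_kind f \<nu> p \<longleftrightarrow> nondegenerate_singular f \<nu> p \<and>
     (\<exists>\<gamma> \<eta>. singular_curve f p \<gamma> \<and> null_vector_field f p \<eta> \<and>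
        (\<forall>a b. a *\<^sub>R vector_derivative \<gamma> (at 0) + b *\<^sub>R \<eta> p = 0 \<longrightarrow> a = 0 \<and> b = 0))"

definition psi ::
    "surf \<Rightarrow> surf \<Rightarrow>
     (real \<Rightarrow> real \<times> real) \<Rightarrow> (real \<times> real \<Rightarrow> real \<times> real) \<Rightarrow> real \<Rightarrow> real" where
  "psi f \<nu> \<gamma> \<eta> t =
     det3 (vector_derivative (f \<circ> \<gamma>) (at t)) (\<nu> (\<gamma> t)) (dir_deriv \<eta> \<nu> (\<gamma> t))"

definition pure_frontal_singular ::
    "surf \<Rightarrow> surf \<Rightarrow> real \<times> real \<Rightarrow> bool" where
  "pure_frontal_singular f \<nu> p \<longleftrightarrow> first_kind f \<nu> p \<and>
     (\<exists>\<gamma> \<eta>. singular_curve f p \<gamma> \<and> null_vector_field f p \<eta> \<and>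
        (\<forall>\<^sub>F t in nhds 0. psi f \<nu> \<gamma> \<eta> t = 0))"


section \<open>Adapted coordinates\<close>

text \<open>
  \<open>\<phi>\<close> maps the coordinates \<open>(u, v)\<close> to points of the source of \<open>f\<close>; the coordinate
  expressions of \<open>f\<close> and \<open>\<nu>\<close> are \<open>f \<circ> \<phi>\<close> and \<open>\<nu> \<circ> \<phi>\<close>.
\<close>

definition adapted_coordinates ::
    "surf \<Rightarrow> surf \<Rightarrow>
     (real \<times> real \<Rightarrow> real \<times> real) \<Rightarrow> bool" where
  "adapted_coordinates f \<nu> \<phi> \<longleftrightarrow> diffeo_germ \<phi> 0 0 \<and>
     (\<forall>\<^sub>F q in nhds 0. q \<in> singular_set (f \<circ> \<phi>) \<longleftrightarrow> snd q = 0) \<and>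
     (\<forall>\<^sub>F u in nhds 0. pd_v (f \<circ> \<phi>) (u, 0) = 0) \<and>
     (\<forall>\<^sub>F u in nhds 0.
        let a = pd_u (f \<circ> \<phi>) (u, 0); b = pd_v (pd_v (f \<circ> \<phi>)) (u, 0); c = \<nu> (\<phi> (u, 0))
        in norm a = 1 \<and> norm b = 1 \<and> norm c = 1 \<and> a \<bullet> b = 0 \<and> a \<bullet> c = 0 \<and> b \<bullet> c = 0)"

text \<open>
  In the rest of this theory \<open>f\<close> and \<open>\<nu>\<close> are expressed in adapted coordinates. The smooth
  factor \<open>h\<close> in \<open>f\<^sub>v = v h\<close> (and likewise \<open>\<nu>\<^sub>1\<close> in \<open>\<nu>\<^sub>v = v \<nu>\<^sub>1\<close>) exists and its germ
  is uniquely determined, off \<open>v = 0\<close> by division and on \<open>v = 0\<close> by continuity.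
\<close>

definition v_factor ::
    "surf \<Rightarrow> surf \<Rightarrow> bool" where
  "v_factor f h \<longleftrightarrow> smooth_germ 0 h \<and> (\<forall>\<^sub>F q in nhds 0. pd_v f q = snd q *\<^sub>R h q)"


section \<open>Fundamental forms, curvatures and focal surfaces\<close>

definition Et :: "surf \<Rightarrow> real \<times> real \<Rightarrow> real" where
  "Et f q = pd_u f q \<bullet> pd_u f q"
definition Ft :: "surf \<Rightarrow> surf \<Rightarrow> real \<times> real \<Rightarrow> real" where
  "Ft f h q = pd_u f q \<bullet> h q"
definition Gt :: "surf \<Rightarrow> real \<times> real \<Rightarrow> real" where
  "Gt h q = h q \<bullet> h q"
definition Lt :: "surf \<Rightarrow> surf \<Rightarrow> real \<times> real \<Rightarrow> real" where
  "Lt f \<nu> q = - (pd_u f q \<bullet> pd_u \<nu> q)"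
definition Mt :: "surf \<Rightarrow> surf \<Rightarrow> real \<times> real \<Rightarrow> real" where
  "Mt \<nu> h q = - (h q \<bullet> pd_u \<nu> q)"
definition N1t :: "surf \<Rightarrow> surf \<Rightarrow> real \<times> real \<Rightarrow> real" where
  "N1t h \<nu>1 q = - (h q \<bullet> \<nu>1 q)"

definition gauss_curv :: "surf \<Rightarrow> surf \<Rightarrow> surf \<Rightarrow> surf \<Rightarrow> real \<times> real \<Rightarrow> real" where
  "gauss_curv f \<nu> h \<nu>1 q =
     (Lt f \<nu> q * N1t h \<nu>1 q - (Mt \<nu> h q)\<^sup>2) / (Et f q * Gt h q - (Ft f h q)\<^sup>2)"

definition mean_curv :: "surf \<Rightarrow> surf \<Rightarrow> surf \<Rightarrow> surf \<Rightarrow> real \<times> real \<Rightarrow> real" where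
  "mean_curv f \<nu> h \<nu>1 q =
     (Et f q * N1t h \<nu>1 q - 2 * Ft f h q * Mt \<nu> h q + Gt h q * Lt f \<nu> q) /
     (2 * (Et f q * Gt h q - (Ft f h q)\<^sup>2))"

text \<open>The index only matters modulo 2, so that \<open>\<kappa>\<^sub>3 = \<kappa>\<^sub>1\<close>.\<close>

definition princ_curv ::
    "surf \<Rightarrow> surf \<Rightarrow> surf \<Rightarrow> surf \<Rightarrow> nat \<Rightarrow> real \<times> real \<Rightarrow> real" where
  "princ_curv f \<nu> h \<nu>1 j q =
     (let H = mean_curv f \<nu> h \<nu>1 q; K = gauss_curv f \<nu> h \<nu>1 q
      in if odd j then H + sqrt (H\<^sup>2 - K) else H - sqrt (H\<^sup>2 - K))"

definition limiting_normal_curv :: "surf \<Rightarrow> surf \<Rightarrow> real \<Rightarrow> real" where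
  "limiting_normal_curv f \<nu> u = Lt f \<nu> (u, 0)"

definition cuspidal_torsion :: "surf \<Rightarrow> surf \<Rightarrow> real \<Rightarrow> real" where
  "cuspidal_torsion \<nu> h u = Mt \<nu> h (u, 0)"

definition bias :: "surf \<Rightarrow> surf \<Rightarrow> real \<Rightarrow> real" where
  "bias h \<nu>1 u = 3 * N1t h \<nu>1 (u, 0)"

definition secondary_cuspidal_curv :: "surf \<Rightarrow> surf \<Rightarrow> surf \<Rightarrow> surf \<Rightarrow> real \<Rightarrow> real" where
  "secondary_cuspidal_curv f \<nu> h \<nu>1 u =
     24 * (pd_v (N1t h \<nu>1) (u, 0) - 2 * pd_v (Ft f h) (u, 0) * Mt \<nu> h (u, 0)
           - pd_v (Gt h) (u, 0) * N1t h \<nu>1 (u, 0))"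

definition princ_vec ::
    "surf \<Rightarrow> surf \<Rightarrow> surf \<Rightarrow> surf \<Rightarrow> nat \<Rightarrow> real \<times> real \<Rightarrow> real \<times> real" where
  "princ_vec f \<nu> h \<nu>1 j q =
     (let k = princ_curv f \<nu> h \<nu>1 j q
      in (- snd q * (Mt \<nu> h q - k * Ft f h q), Lt f \<nu> q - k * Et f q))"

definition first_order_ridge ::
    "surf \<Rightarrow> surf \<Rightarrow> surf \<Rightarrow> surf \<Rightarrow> nat \<Rightarrow> real \<times> real \<Rightarrow> bool" where
  "first_order_ridge f \<nu> h \<nu>1 j p \<longleftrightarrow>
     (let V = princ_vec f \<nu> h \<nu>1 j; k = princ_curv f \<nu> h \<nu>1 j
      in dir_deriv V k p = 0 \<and> dir_deriv V (dir_deriv V k) p \<noteq> 0)"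

definition curv_radius :: "surf \<Rightarrow> surf \<Rightarrow> surf \<Rightarrow> surf \<Rightarrow> nat \<Rightarrow> real \<times> real \<Rightarrow> real" where
  "curv_radius f \<nu> h \<nu>1 j q = 1 / princ_curv f \<nu> h \<nu>1 j q"

definition focal_surface :: "surf \<Rightarrow> surf \<Rightarrow> surf \<Rightarrow> surf \<Rightarrow> nat \<Rightarrow> surf" where
  "focal_surface f \<nu> h \<nu>1 j q = f q + curv_radius f \<nu> h \<nu>1 j q *\<^sub>R \<nu> q"

definition focal_normal :: "surf \<Rightarrow> surf \<Rightarrow> surf \<Rightarrow> surf \<Rightarrow> nat \<Rightarrow> surf" where
  "focal_normal f \<nu> h \<nu>1 j q =
     (let k = princ_curv f \<nu> h \<nu>1 j q;
          x = - (Mt \<nu> h q - k * Ft f h q) *\<^sub>R pd_u f q + (Lt f \<nu> q - k * Et f q) *\<^sub>R h q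
      in x /\<^sub>R norm x)"

end

theory Submission
  imports Defs
begin

text \<open>
  The heart of the matter is Rodrigues' formula: if \<open>V\<close> is the principal vector of the principal
  curvature \<open>\<kappa>\<close>, then \<open>d\<nu>(V) = - \<kappa> df(V)\<close>. Therefore the focal surface \<open>C = f + \<rho> \<nu>\<close> with \<open>\<rho> = 1 / \<kappa>\<close>
  satisfies \<open>dC(V) = V\<rho> \<nu>\<close>. It is singular along the ridge curve \<open>V\<kappa> = 0\<close>, which passes through the
  origin as the graph \<open>v = g u\<close>, and \<open>V\<close> is a null vector field there (\<open>C_null_direction\<close>,
  \<open>singular_curve_is_ridge_curve\<close>).

  A frontal with a singular point of the first kind has a cuspidal cross cap exactly where the
  function \<open>\<psi>\<close> along its singular curve has a simple zero (\<open>cuspidal_cross_cap_criterion\<close>). For the focal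
  surface the derivative of the normal \<open>x\<close> along \<open>V\<close> has the component
  \<open>dx(V) \<bullet> \<nu> = - x \<bullet> d\<nu>(V) = \<kappa> v \<bar>x\<bar>\<^sup>2\<close>, because \<open>df(V) = v x\<close>. So \<open>\<psi>\<close> is \<open>v\<close> times a nonvanishing
  function, and on the singular curve it is \<open>g\<close> times a nonvanishing function. Hence \<open>C\<close> has a cuspidal
  cross cap if and only if \<open>g' 0 \<noteq> 0\<close>, that is, if the singular curve of \<open>C\<close> crosses the one of \<open>f\<close>
  transversally (\<open>focal_cuspidal_cross_cap\<close>).

  Both conditions of the theorem are read off from the characteristic equation of the principal
  curvatures on the \<open>u\<close>-axis. Differentiated in \<open>v\<close> it shows that \<open>V\<kappa>\<close> restricted to the axis is \<open>r\<^sub>c\<close>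
  times a nonvanishing function (\<open>k_v_axis\<close>), so \<open>r\<^sub>c' \<noteq> 0\<close> means that \<open>V\<kappa>\<close> has a simple zero on the axis.
  Since the ridge point is of first order, implicit differentiation of \<open>V\<kappa> = 0\<close> turns this into
  \<open>g' 0 \<noteq> 0\<close> (\<open>ridge_curve\<close>). Differentiated in \<open>u\<close> the characteristic equation shows that the two sides
  of the second condition are \<open>- (\<kappa>\<^sub>u / \<kappa>)\<^sup>2 S \<le> 0\<close> and \<open>S\<^sup>2 > 0\<close>, where \<open>S\<close> is \<open>\<kappa>\<^sub>t\<^sup>2 + (\<kappa> - \<kappa>\<^sub>\<nu>)\<^sup>2\<close>. So this
  condition holds at every first order ridge point (\<open>radius_derivative_inequality\<close>).

  The criterion itself rests on a normal form. The projection of a frontal to its limiting tangent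
  plane at a singular point of the first kind is a fold map. In fold coordinates the frontal becomes
  \<open>(u, v\<^sup>2, v\<^sup>3 m (u, v\<^sup>2))\<close>, and it has a cuspidal cross cap exactly if \<open>m\<close> vanishes at the origin with \<open>m\<^sub>u \<noteq> 0\<close> (\<open>cuspidal_cross_cap_if_normal_form\<close>,
  \<open>normal_form_if_cuspidal_cross_cap\<close>). That even functions of \<open>v\<close> are smooth functions of \<open>v\<^sup>2\<close> is
  Whitney's theorem (\<open>Whitney_even\<close>), which follows from Seeley's extension theorem.
\<close>

section \<open>Smooth maps between Euclidean spaces\<close>

lemma Ck_on_cong:
  assumes "open S" "\<And>x. x \<in> S \<Longrightarrow> f x = g x" "Ck_on k S f"
  shows "Ck_on k S g"
  using assms(2,3)
proof (induction k arbitrary: f g)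
  case 0
  then show ?case by (simp cong: continuous_on_cong)
next
  case (Suc k)
  have D: "(g has_derivative frechet_derivative f (at x)) (at x)" if "x \<in> S" for x
  proof (rule has_derivative_transform_within_open[OF _ assms(1) that])
    show "(f has_derivative frechet_derivative f (at x)) (at x)"
      using Suc.prems that by (simp add: frechet_derivative_works)
  qed (use Suc.prems in auto)
  have "Ck_on k S (\<lambda>x. frechet_derivative g (at x) w)" for w
  proof (rule Suc.IH)
    show "frechet_derivative f (at x) w = frechet_derivative g (at x) w" if "x \<in> S" for x
      using frechet_derivative_at[OF D[OF that]] by simp
    show "Ck_on k S (\<lambda>x. frechet_derivative f (at x) w)"
      using Suc.prems by simp
  qed
  then show ?case using D by (auto simp: differentiable_def)
qed

text \<open>
  Derivatives only have to be given up to equality on the open set, so every closure property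
  of \<open>Ck_on\<close> is an induction on the order in which the derivative is written down explicitly.
\<close>

lemma Ck_on_SucI:
  assumes "open S" and D: "\<And>x. x \<in> S \<Longrightarrow> (f has_derivative D x) (at x)"
    and "\<And>w. Ck_on k S (\<lambda>x. D x w)"
  shows "Ck_on (Suc k) S f"
proof -
  have "Ck_on k S (\<lambda>x. frechet_derivative f (at x) w)" for w
    by (rule Ck_on_cong[OF assms(1) _ assms(3)[of w]]) (use frechet_derivative_at[OF D] in simp)
  then show ?thesis using D by (auto simp: differentiable_def)
qed

lemma Ck_on_Suc_derivative:
  "Ck_on (Suc k) S f \<Longrightarrow> x \<in> S \<Longrightarrow> (f has_derivative frechet_derivative f (at x)) (at x)"
  by (simp add: frechet_derivative_works)

lemma Ck_on_SucD: "Ck_on (Suc k) S f \<Longrightarrow> Ck_on k S f"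
proof (induction k arbitrary: f)
  case 0
  then show ?case
    by (auto intro!: differentiable_imp_continuous_on differentiable_at_imp_differentiable_on)
qed auto

lemma Ck_on_subset: "Ck_on k S f \<Longrightarrow> T \<subseteq> S \<Longrightarrow> Ck_on k T f"
  by (induction k arbitrary: f) (auto intro: continuous_on_subset)

lemma Ck_on_const: "Ck_on k S (\<lambda>x. c)"
  by (induction k arbitrary: c) auto

lemma Ck_on_add:
  assumes "open S" shows "Ck_on k S f \<Longrightarrow> Ck_on k S g \<Longrightarrow> Ck_on k S (\<lambda>x. f x + g x)"
proof (induction k arbitrary: f g)
  case 0 then show ?case by (simp add: continuous_on_add)
next
  case (Suc k)
  show ?case
    by (rule Ck_on_SucI[OF assms has_derivative_add[OF Ck_on_Suc_derivative[OF Suc.prems(1)]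
        Ck_on_Suc_derivative[OF Suc.prems(2)]]]) (use Suc in auto)
qed

lemma (in bounded_bilinear) Ck_on_prod:
  fixes f :: "'x::euclidean_space \<Rightarrow> 'a" and g :: "'x \<Rightarrow> 'b"
  assumes "open S" shows "Ck_on k S f \<Longrightarrow> Ck_on k S g \<Longrightarrow> Ck_on k S (\<lambda>x. f x ** g x)"
proof (induction k arbitrary: f g)
  case 0 then show ?case by (simp add: continuous_on)
next
  case (Suc k)
  show ?case
  proof (rule Ck_on_SucI[OF assms FDERIV[OF Ck_on_Suc_derivative[OF Suc.prems(1)]
        Ck_on_Suc_derivative[OF Suc.prems(2)]]], assumption, assumption)
    fix w show "Ck_on k S (\<lambda>x. f x ** frechet_derivative g (at x) w + frechet_derivative f (at x) w ** g x)"
      using Suc.prems Ck_on_SucD[OF Suc.prems(1)] Ck_on_SucD[OF Suc.prems(2)]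
      by (intro Ck_on_add assms Suc.IH) auto
  qed
qed

text \<open>
  The chain rule expresses the derivative of a composition as a sum over the standard basis, that
  is, through products of derivatives of the outer map along \<^emph>\<open>fixed\<close> directions with
  coefficients that depend on the point. This is the form to which the induction hypothesis and
  the closure under sums and products apply.
\<close>

lemma (in bounded_linear) Ck_on_compose:
  fixes g :: "'x::euclidean_space \<Rightarrow> 'a"
  assumes "open S" shows "Ck_on k S g \<Longrightarrow> Ck_on k S (\<lambda>x. f (g x))"
proof (induction k arbitrary: g)
  case 0 then show ?case by (simp add: continuous_on)
next
  case (Suc k)
  show ?case
    by (rule Ck_on_SucI[OF assms has_derivative[OF Ck_on_Suc_derivative[OF Suc.prems]]]) (use Suc in auto)
qed

lemma Ck_on_id: "open S \<Longrightarrow> Ck_on k S (\<lambda>x. x)"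
  by (cases k) (auto intro!: Ck_on_SucI Ck_on_const continuous_on_id)

lemma Ck_on_sum:
  assumes "open S" "\<And>i. i \<in> I \<Longrightarrow> Ck_on k S (f i)"
  shows "Ck_on k S (\<lambda>x. \<Sum>i\<in>I. f i x)"
  using assms(2)
  by (induction I rule: infinite_finite_induct) (auto intro: Ck_on_const Ck_on_add assms(1))

lemma Ck_on_compose:
  fixes f :: "'a::euclidean_space \<Rightarrow> 'b::euclidean_space" and g :: "'b \<Rightarrow> 'c::real_normed_vector"
  assumes "open S" "open T" "f ` S \<subseteq> T"
  shows "Ck_on k S f \<Longrightarrow> Ck_on k T g \<Longrightarrow> Ck_on k S (\<lambda>x. g (f x))"
proof (induction k arbitrary: g)
  case 0 then show ?case using assms(3) by (auto intro: continuous_on_compose2)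
next
  case (Suc k)
  let ?D = "\<lambda>x w. \<Sum>b\<in>Basis. (frechet_derivative f (at x) w \<bullet> b) *\<^sub>R frechet_derivative g (at (f x)) b"
  show ?case
  proof (rule Ck_on_SucI[OF assms(1)])
    fix x assume x: "x \<in> S"
    have fx: "f x \<in> T" using x assms by auto
    have g: "(g has_derivative frechet_derivative g (at (f x))) (at (f x))"
      by (rule Ck_on_Suc_derivative[OF Suc.prems(2) fx])
    have "((\<lambda>x. g (f x)) has_derivative (\<lambda>w. frechet_derivative g (at (f x)) (frechet_derivative f (at x) w))) (at x)"
      by (rule has_derivative_compose[OF Ck_on_Suc_derivative[OF Suc.prems(1) x] g])
    moreover have "frechet_derivative g (at (f x)) (frechet_derivative f (at x) w) = ?D x w" for w
    proof -
      interpret bounded_linear "frechet_derivative g (at (f x))" by (rule has_derivative_bounded_linear[OF g])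
      show ?thesis
        by (subst (1) euclidean_representation[symmetric]) (simp add: sum scale)
    qed
    ultimately show "((\<lambda>x. g (f x)) has_derivative ?D x) (at x)" by simp
  next
    fix w
    show "Ck_on k S (\<lambda>x. ?D x w)"
      using Suc.prems Ck_on_SucD[OF Suc.prems(1)]
      by (intro Ck_on_sum assms(1) bounded_bilinear.Ck_on_prod[OF bounded_bilinear_scaleR]
          bounded_linear.Ck_on_compose[OF bounded_linear_inner_left] Suc.IH) auto
  qed
qed

lemma Ck_on_inverse:
  fixes f :: "'a::euclidean_space \<Rightarrow> real"
  assumes "open S" "\<And>x. x \<in> S \<Longrightarrow> f x \<noteq> 0"
  shows "Ck_on k S f \<Longrightarrow> Ck_on k S (\<lambda>x. inverse (f x))"
proof (induction k)
  case 0 then show ?case using assms(2) by (simp add: continuous_on_inverse)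
next
  case (Suc k)
  let ?D = "\<lambda>x w. - (inverse (f x) * frechet_derivative f (at x) w * inverse (f x))"
  show ?case
  proof (rule Ck_on_SucI[OF assms(1)])
    fix x assume x: "x \<in> S"
    show "((\<lambda>x. inverse (f x)) has_derivative ?D x) (at x)"
      using assms(2)[OF x] Ck_on_Suc_derivative[OF Suc.prems x] by (rule Deriv.has_derivative_inverse)
  next
    fix w
    have "Ck_on k S (\<lambda>x. inverse (f x))" "Ck_on k S (\<lambda>x. frechet_derivative f (at x) w)"
      using Suc.IH Ck_on_SucD[OF Suc.prems] Suc.prems by auto
    then show "Ck_on k S (\<lambda>x. ?D x w)"
      by (intro bounded_linear.Ck_on_compose[OF bounded_linear_minus[OF bounded_linear_ident]]
          bounded_bilinear.Ck_on_prod[OF bounded_bilinear_mult] assms(1))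
  qed
qed

lemma Ck_on_sqrt:
  fixes f :: "'a::euclidean_space \<Rightarrow> real"
  assumes "open S" "\<And>x. x \<in> S \<Longrightarrow> f x > 0"
  shows "Ck_on k S f \<Longrightarrow> Ck_on k S (\<lambda>x. sqrt (f x))"
proof (induction k)
  case 0 then show ?case by (simp add: continuous_on_real_sqrt)
next
  case (Suc k)
  let ?D = "\<lambda>x w. frechet_derivative f (at x) w * inverse (2 * sqrt (f x))"
  show ?case
  proof (rule Ck_on_SucI[OF assms(1)])
    fix x assume x: "x \<in> S"
    show "((\<lambda>x. sqrt (f x)) has_derivative ?D x) (at x)"
      using assms(2)[OF x]
      by (auto intro!: derivative_eq_intros Ck_on_Suc_derivative[OF Suc.prems x] simp: field_simps)
  next
    fix w
    have "Ck_on k S (\<lambda>x. 2 * sqrt (f x))"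
      using Suc.IH Ck_on_SucD[OF Suc.prems]
      by (intro bounded_linear.Ck_on_compose[OF bounded_linear_mult_right] assms(1))
    moreover have "2 * sqrt (f x) \<noteq> 0" if "x \<in> S" for x using assms(2)[OF that] by simp
    ultimately have "Ck_on k S (\<lambda>x. inverse (2 * sqrt (f x)))" by (intro Ck_on_inverse assms(1))
    then show "Ck_on k S (\<lambda>x. ?D x w)"
      using Suc.prems by (intro bounded_bilinear.Ck_on_prod[OF bounded_bilinear_mult] assms(1)) auto
  qed
qed

named_theorems smooth_intros

lemma smooth_on_subset: "smooth_on S f \<Longrightarrow> T \<subseteq> S \<Longrightarrow> smooth_on T f"
  unfolding smooth_on_def by (blast intro: Ck_on_subset)

lemma smooth_on_continuous: "smooth_on S f \<Longrightarrow> continuous_on S f"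
  unfolding smooth_on_def by (metis Ck_on.simps(1))

lemma smooth_on_has_derivative:
  "smooth_on S f \<Longrightarrow> x \<in> S \<Longrightarrow> (f has_derivative frechet_derivative f (at x)) (at x)"
  unfolding smooth_on_def using Ck_on_Suc_derivative by blast

lemma smooth_on_differentiable: "smooth_on S f \<Longrightarrow> x \<in> S \<Longrightarrow> f differentiable (at x)"
  using smooth_on_has_derivative by (auto simp: differentiable_def)

lemma smooth_on_frechet_derivative:
  "smooth_on S f \<Longrightarrow> smooth_on S (\<lambda>x. frechet_derivative f (at x) w)"
  unfolding smooth_on_def by (metis Ck_on.simps(2))

lemma smooth_on_const [smooth_intros]: "smooth_on S (\<lambda>x. c)"
  by (simp add: smooth_on_def Ck_on_const)

lemma smooth_on_id [smooth_intros]: "open S \<Longrightarrow> smooth_on S (\<lambda>x. x)"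
  by (simp add: smooth_on_def Ck_on_id)

lemma smooth_on_add [smooth_intros]:
  "smooth_on S f \<Longrightarrow> smooth_on S g \<Longrightarrow> open S \<Longrightarrow> smooth_on S (\<lambda>x. f x + g x)"
  by (simp add: smooth_on_def Ck_on_add)

lemma smooth_on_bounded_linear:
  "bounded_linear h \<Longrightarrow> open S \<Longrightarrow> smooth_on S f \<Longrightarrow> smooth_on S (\<lambda>x. h (f x))"
  unfolding smooth_on_def by (blast intro: bounded_linear.Ck_on_compose)

lemma smooth_on_bilinear:
  fixes f :: "'a::euclidean_space \<Rightarrow> 'b::real_normed_vector"
  shows "bounded_bilinear p \<Longrightarrow> open S \<Longrightarrow> smooth_on S f \<Longrightarrow> smooth_on S g \<Longrightarrow> smooth_on S (\<lambda>x. p (f x) (g x))"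
  unfolding smooth_on_def by (blast intro: bounded_bilinear.Ck_on_prod)

lemma smooth_on_minus [smooth_intros]:
  "smooth_on S f \<Longrightarrow> open S \<Longrightarrow> smooth_on S (\<lambda>x. - f x)"
  by (rule smooth_on_bounded_linear[OF bounded_linear_minus[OF bounded_linear_ident]])

lemma smooth_on_diff [smooth_intros]:
  assumes "smooth_on S f" "smooth_on S g" "open S" shows "smooth_on S (\<lambda>x. f x - g x)"
  using smooth_on_add[OF assms(1) smooth_on_minus[OF assms(2,3)] assms(3)] by simp

lemma smooth_on_mult [smooth_intros]:
  fixes f :: "'a::euclidean_space \<Rightarrow> real"
  shows "smooth_on S f \<Longrightarrow> smooth_on S g \<Longrightarrow> open S \<Longrightarrow> smooth_on S (\<lambda>x. f x * g x)"
  by (rule smooth_on_bilinear[OF bounded_bilinear_mult])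

lemma smooth_on_scaleR [smooth_intros]:
  "smooth_on S f \<Longrightarrow> smooth_on S g \<Longrightarrow> open S \<Longrightarrow> smooth_on S (\<lambda>x. f x *\<^sub>R g x)"
  by (rule smooth_on_bilinear[OF bounded_bilinear_scaleR])

lemma smooth_on_inner [smooth_intros]:
  "smooth_on S f \<Longrightarrow> smooth_on S g \<Longrightarrow> open S \<Longrightarrow> smooth_on S (\<lambda>x. f x \<bullet> g x)"
  by (rule smooth_on_bilinear[OF bounded_bilinear_inner])

lemma smooth_on_power [smooth_intros]:
  fixes f :: "'a::euclidean_space \<Rightarrow> real"
  shows "smooth_on S f \<Longrightarrow> open S \<Longrightarrow> smooth_on S (\<lambda>x. f x ^ n)"
  by (induction n) (auto intro: smooth_intros)

lemma smooth_on_inverse [smooth_intros]: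
  fixes f :: "'a::euclidean_space \<Rightarrow> real"
  shows "smooth_on S f \<Longrightarrow> (\<And>x. x \<in> S \<Longrightarrow> f x \<noteq> 0) \<Longrightarrow> open S \<Longrightarrow> smooth_on S (\<lambda>x. inverse (f x))"
  by (simp add: smooth_on_def Ck_on_inverse)

lemma smooth_on_divide [smooth_intros]:
  fixes f :: "'a::euclidean_space \<Rightarrow> real"
  shows "smooth_on S f \<Longrightarrow> smooth_on S g \<Longrightarrow> (\<And>x. x \<in> S \<Longrightarrow> g x \<noteq> 0) \<Longrightarrow> open S \<Longrightarrow> smooth_on S (\<lambda>x. f x / g x)"
  unfolding divide_inverse by (intro smooth_intros)

lemma smooth_on_sqrt [smooth_intros]:
  "smooth_on S f \<Longrightarrow> (\<And>x. x \<in> S \<Longrightarrow> f x > 0) \<Longrightarrow> open S \<Longrightarrow> smooth_on S (\<lambda>x. sqrt (f x))"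
  by (simp add: smooth_on_def Ck_on_sqrt)

lemma smooth_on_fst [smooth_intros]: "smooth_on S f \<Longrightarrow> open S \<Longrightarrow> smooth_on S (\<lambda>x. fst (f x))"
  by (rule smooth_on_bounded_linear[OF bounded_linear_fst])

lemma smooth_on_snd [smooth_intros]: "smooth_on S f \<Longrightarrow> open S \<Longrightarrow> smooth_on S (\<lambda>x. snd (f x))"
  by (rule smooth_on_bounded_linear[OF bounded_linear_snd])

lemma smooth_on_nth [smooth_intros]:
  fixes f :: "'a::euclidean_space \<Rightarrow> real^'n"
  shows "smooth_on S f \<Longrightarrow> open S \<Longrightarrow> smooth_on S (\<lambda>x. f x $ i)"
  by (rule smooth_on_bounded_linear[OF bounded_linear_vec_nth])

lemma smooth_on_Pair [smooth_intros]:
  assumes "smooth_on S f" "smooth_on S g" "open S"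
  shows "smooth_on S (\<lambda>x. (f x, g x))"
proof -
  have "smooth_on S (\<lambda>x. (f x, 0) + (0, g x))"
    by (intro smooth_on_add smooth_on_bounded_linear[OF bounded_linear_Pair[OF bounded_linear_ident bounded_linear_zero]]
      smooth_on_bounded_linear[OF bounded_linear_Pair[OF bounded_linear_zero bounded_linear_ident]] assms)
  then show ?thesis by simp
qed

lemma smooth_on_vector3 [smooth_intros]:
  assumes "smooth_on S f" "smooth_on S g" "smooth_on S h" "open S"
  shows "smooth_on S (\<lambda>x. vector [f x, g x, h x] :: real^3)"
proof -
  have "smooth_on S (\<lambda>x. f x *\<^sub>R axis 1 1 + g x *\<^sub>R axis 2 1 + h x *\<^sub>R (axis 3 1 :: real^3))"
    by (intro smooth_intros assms)
  moreover have "(\<lambda>x. f x *\<^sub>R axis 1 1 + g x *\<^sub>R axis 2 1 + h x *\<^sub>R (axis 3 1 :: real^3)) = (\<lambda>x. vector [f x, g x, h x])"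
    by (simp add: fun_eq_iff vec_eq_iff forall_3 vector_3 axis_def)
  ultimately show ?thesis by simp
qed

lemma smooth_on_compose:
  fixes f :: "'a::euclidean_space \<Rightarrow> 'b::euclidean_space" and g :: "'b \<Rightarrow> 'c::real_normed_vector"
  shows "smooth_on T g \<Longrightarrow> smooth_on S f \<Longrightarrow> f ` S \<subseteq> T \<Longrightarrow> open S \<Longrightarrow> open T \<Longrightarrow> smooth_on S (\<lambda>x. g (f x))"
  unfolding smooth_on_def by (blast intro: Ck_on_compose)

section \<open>Partial derivatives and Hadamard's lemma\<close>

lemma pd_u_eqI: "(f has_derivative D) (at q) \<Longrightarrow> pd_u f q = D (1, 0)"
  and pd_v_eqI: "(f has_derivative D) (at q) \<Longrightarrow> pd_v f q = D (0, 1)"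
  by (simp_all add: pd_u_def pd_v_def dir_deriv_def frechet_derivative_at[symmetric])

lemma frechet_derivative_pd:
  assumes "f differentiable (at q)"
  shows "frechet_derivative f (at q) w = fst w *\<^sub>R pd_u f q + snd w *\<^sub>R pd_v f q"
proof -
  interpret bounded_linear "frechet_derivative f (at q)"
    using assms by (intro has_derivative_bounded_linear) (simp add: frechet_derivative_works)
  have "w = fst w *\<^sub>R (1, 0) + snd w *\<^sub>R (0, 1)" by (simp add: prod_eq_iff)
  then have "frechet_derivative f (at q) w = frechet_derivative f (at q) (fst w *\<^sub>R (1, 0) + snd w *\<^sub>R (0, 1))"
    by simp
  then show ?thesis by (simp only: add scale pd_u_def pd_v_def dir_deriv_def)
qed

lemma has_derivative_pd:
  "f differentiable (at q) \<Longrightarrow> (f has_derivative (\<lambda>w. fst w *\<^sub>R pd_u f q + snd w *\<^sub>R pd_v f q)) (at q)"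
  using ext[of "frechet_derivative f (at q)", OF frechet_derivative_pd[of f q]]
  by (simp add: frechet_derivative_works)

lemma smooth_on_pd [smooth_intros]:
  "smooth_on S f \<Longrightarrow> smooth_on S (pd_u f)" "smooth_on S f \<Longrightarrow> smooth_on S (pd_v f)"
  using smooth_on_frechet_derivative[of S f "(1, 0)"] smooth_on_frechet_derivative[of S f "(0, 1)"]
  by (simp_all only: pd_u_def pd_v_def dir_deriv_def[abs_def])

lemma pd_cong:
  assumes "\<forall>\<^sub>F q in nhds p. f q = g q" "f differentiable (at p)"
  shows "g differentiable (at p)" "pd_u f p = pd_u g p" "pd_v f p = pd_v g p"
proof -
  obtain S where S: "open S" "p \<in> S" "\<And>q. q \<in> S \<Longrightarrow> f q = g q"
    using assms(1) by (auto simp: eventually_nhds)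
  have "(g has_derivative (\<lambda>w. fst w *\<^sub>R pd_u f p + snd w *\<^sub>R pd_v f p)) (at p)"
    by (rule has_derivative_transform_within_open[OF has_derivative_pd[OF assms(2)] S(1,2)]) (simp add: S(3))
  from pd_u_eqI[OF this] pd_v_eqI[OF this] this
  show "g differentiable (at p)" "pd_u f p = pd_u g p" "pd_v f p = pd_v g p" by (auto simp: differentiable_def)
qed

lemma pd_slices:
  assumes "f differentiable (at (u, v))"
  shows "((\<lambda>t. f (t, v)) has_vector_derivative pd_u f (u, v)) (at u)"
    and "((\<lambda>t. f (u, t)) has_vector_derivative pd_v f (u, v)) (at v)"
proof -
  have "((\<lambda>t. (t, v)) has_derivative (\<lambda>t. (t, 0))) (at u)" "((\<lambda>t. (u, t)) has_derivative (\<lambda>t. (0, t))) (at v)"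
    by (auto intro!: derivative_eq_intros)
  from has_derivative_compose[OF this(1) has_derivative_pd[OF assms]]
    has_derivative_compose[OF this(2) has_derivative_pd[OF assms]]
  show "((\<lambda>t. f (t, v)) has_vector_derivative pd_u f (u, v)) (at u)"
    "((\<lambda>t. f (u, t)) has_vector_derivative pd_v f (u, v)) (at v)"
    by (simp_all add: has_vector_derivative_def)
qed

lemma pd_real_slices:
  fixes f :: "real \<times> real \<Rightarrow> real"
  assumes "f differentiable (at (u, v))"
  shows "((\<lambda>t. f (t, v)) has_real_derivative pd_u f (u, v)) (at u)"
    and "((\<lambda>t. f (u, t)) has_real_derivative pd_v f (u, v)) (at v)"
  using pd_slices[OF assms] by (simp_all add: has_real_derivative_iff_has_vector_derivative)

text \<open>
  Functions given by integrals or series are differentiated one variable at a time below, and this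
  is the bridge to total derivatives.
\<close>

lemma has_derivative_if_continuous_partials:
  fixes F :: "real \<times> real \<Rightarrow> real"
  assumes "open S"
    and Fu: "\<And>u v. (u, v) \<in> S \<Longrightarrow> ((\<lambda>t. F (t, v)) has_real_derivative Fu (u, v)) (at u)"
    and Fv: "\<And>u v. (u, v) \<in> S \<Longrightarrow> ((\<lambda>t. F (u, t)) has_real_derivative Fv (u, v)) (at v)"
    and cont: "continuous_on S Fv" and "p \<in> S"
  shows "(F has_derivative (\<lambda>w. fst w * Fu p + snd w * Fv p)) (at p)"
proof -
  obtain a b where p: "p = (a, b)" by (cases p)
  obtain X Y where XY: "open X" "open Y" "a \<in> X" "b \<in> Y" "X \<times> Y \<subseteq> S"
    using open_prod_elim[OF assms(1,5)] p by (metis mem_Sigma_iff)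
  obtain e where e: "e > 0" "ball b e \<subseteq> Y" using XY by (meson openE)
  have sub: "X \<times> ball b e \<subseteq> S" using e XY by auto
  have "((\<lambda>(x, y). F (x, y)) has_derivative (\<lambda>(tx, ty). tx * Fu (a, b) + blinfun_scaleR_left (Fv (a, b)) ty))
      (at (a, b) within X \<times> ball b e)"
  proof (rule has_derivative_partialsI[where fy = "\<lambda>x y. blinfun_scaleR_left (Fv (x, y))" and fx = "\<lambda>tx. tx * Fu (a, b)"])
    have "(a, b) \<in> S" using assms(5) p by simp
    show "((\<lambda>x. F (x, b)) has_derivative (\<lambda>tx. tx * Fu (a, b))) (at a within X)"
      by (rule has_derivative_at_withinI, rule has_derivative_eq_rhs[OF Fu[OF \<open>(a, b) \<in> S\<close>, unfolded has_field_derivative_def]])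
        (rule ext, rule mult.commute)
    show "((\<lambda>y. F (x, y)) has_derivative blinfun_apply (blinfun_scaleR_left (Fv (x, y)))) (at y within ball b e)"
      if "x \<in> X" "y \<in> ball b e" for x y
    proof -
      have "(x, y) \<in> S" using that sub by auto
      show ?thesis
        by (rule has_derivative_at_withinI, rule has_derivative_eq_rhs[OF Fv[OF \<open>(x, y) \<in> S\<close>, unfolded has_field_derivative_def]])
          (rule ext, simp only: blinfun_scaleR_left.rep_eq real_scaleR_def mult.commute)
    qed
    have "isCont Fv (a, b)"
      using cont assms(1) \<open>(a, b) \<in> S\<close> by (simp only: continuous_on_eq_continuous_at)
    then have "continuous (at (a, b) within X \<times> ball b e) Fv"
      by (rule continuous_at_imp_continuous_at_within)
    then have "continuous (at (a, b) within X \<times> ball b e) (\<lambda>p. blinfun_scaleR_left (Fv p) :: real \<Rightarrow>\<^sub>L real)"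
      unfolding continuous_within by (rule bounded_linear.tendsto[OF bounded_linear_blinfun_scaleR_left])
    then show "continuous (at (a, b) within X \<times> ball b e) (\<lambda>(x, y). blinfun_scaleR_left (Fv (x, y)) :: real \<Rightarrow>\<^sub>L real)"
      by (simp only: split_beta' prod.collapse)
  qed (use e in auto)
  moreover have "at (a, b) within X \<times> ball b e = at (a, b)"
    by (intro at_within_open) (use XY e in \<open>auto simp: open_Times\<close>)
  ultimately show ?thesis by (simp add: p split_beta')
qed

text \<open>
  A function is smooth as soon as it belongs to some class of continuous functions that contains
  partial derivatives of each of its members. Integrals with parameters and Seeley's series are
  handled by choosing such a class, which avoids induction on the order of differentiability.
\<close>

lemma smooth_on_if_closed_under_partials:
  fixes F :: "real \<times> real \<Rightarrow> real"
  assumes "open S" and closed: "\<And>F. F \<in> \<F> \<Longrightarrow> continuous_on S F \<and> (\<exists>Fu\<in>\<F>. \<exists>Fv\<in>\<F>. \<forall>u v. (u, v) \<in> S \<longrightarrow>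
      ((\<lambda>t. F (t, v)) has_real_derivative Fu (u, v)) (at u) \<and>
      ((\<lambda>t. F (u, t)) has_real_derivative Fv (u, v)) (at v))"
    and "F \<in> \<F>"
  shows "smooth_on S F"
  unfolding smooth_on_def
proof
  fix k show "Ck_on k S F" using assms(3)
  proof (induction k arbitrary: F)
    case 0 then show ?case using closed by simp
  next
    case (Suc k)
    obtain Fu Fv where F': "Fu \<in> \<F>" "Fv \<in> \<F>"
      "\<And>u v. (u, v) \<in> S \<Longrightarrow> ((\<lambda>t. F (t, v)) has_real_derivative Fu (u, v)) (at u)"
      "\<And>u v. (u, v) \<in> S \<Longrightarrow> ((\<lambda>t. F (u, t)) has_real_derivative Fv (u, v)) (at v)"
      using closed[OF Suc.prems] by blast
    have "continuous_on S Fv" using closed[OF F'(2)] by simp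
    from has_derivative_if_continuous_partials[OF assms(1) F'(3,4) this] Suc.IH[OF F'(1)] Suc.IH[OF F'(2)]
    show ?case
      by (intro Ck_on_SucI[OF assms(1), where D = "\<lambda>p w. fst w * Fu p + snd w * Fv p"])
        (auto intro!: Ck_on_add assms(1) bounded_linear.Ck_on_compose[OF bounded_linear_mult_right])
  qed
qed

text \<open>
  Differentiating in \<open>v\<close> produces a factor \<open>l s\<close>. With an arbitrary continuous weight \<open>k\<close> in front of
  the integrand, the class of all such integrals is closed under partial derivatives.
\<close>

lemma smooth_on_weighted_integral:
  fixes h :: "real \<times> real \<Rightarrow> real" and k l :: "real \<Rightarrow> real"
  assumes "open A" "open B" and star: "\<And>s v. 0 \<le> s \<Longrightarrow> s \<le> 1 \<Longrightarrow> v \<in> B \<Longrightarrow> l s * v \<in> B"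
    and l: "continuous_on {0..1} l" and "continuous_on {0..1} k" "smooth_on (A \<times> B) h"
  shows "smooth_on (A \<times> B) (\<lambda>(u, v). integral {0..1} (\<lambda>s. k s * h (u, l s * v)))"
proof -
  define J where "J k h = (\<lambda>(u, v). integral {0..1} (\<lambda>s. k s * h (u, l s * v)))"
    for k :: "real \<Rightarrow> real" and h :: "real \<times> real \<Rightarrow> real"
  define \<F> where "\<F> = {J k h |k h. continuous_on {0..1} k \<and> smooth_on (A \<times> B) h}"
  have AB: "open (A \<times> B)" using assms by (simp add: open_Times)
  have integrand: "continuous_on ((A \<times> B) \<times> {0..1}) (\<lambda>(p, s). k s * h (fst p, l s * snd p))"
    if "continuous_on {0..1} k" "smooth_on (A \<times> B) h" for k :: "real \<Rightarrow> real" and h :: "real \<times> real \<Rightarrow> real"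
  proof -
    have "continuous_on ((A \<times> B) \<times> {0..1}) (\<lambda>x. l (snd x))" "continuous_on ((A \<times> B) \<times> {0..1}) (\<lambda>x. k (snd x))"
      by (rule continuous_on_compose2[OF l] continuous_on_compose2[OF that(1)]; fastforce intro: continuous_on_snd continuous_on_id)+
    moreover from this(1) have "continuous_on ((A \<times> B) \<times> {0..1}) (\<lambda>x. h (fst (fst x), l (snd x) * snd (fst x)))"
      by (intro continuous_on_compose2[OF smooth_on_continuous[OF that(2)]] continuous_on_Pair continuous_on_mult
          continuous_on_fst continuous_on_snd continuous_on_id) (auto simp: star)
    ultimately show ?thesis unfolding split_beta' by (intro continuous_on_mult)
  qed
  have "continuous_on (A \<times> B) F \<and> (\<exists>Fu\<in>\<F>. \<exists>Fv\<in>\<F>. \<forall>u v. (u, v) \<in> A \<times> B \<longrightarrow>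
      ((\<lambda>t. F (t, v)) has_real_derivative Fu (u, v)) (at u) \<and>
      ((\<lambda>t. F (u, t)) has_real_derivative Fv (u, v)) (at v))" if F: "F \<in> \<F>" for F
  proof -
    obtain k h where kh: "F = J k h" "continuous_on {0..1} k" "smooth_on (A \<times> B) h"
      using F unfolding \<F>_def by blast
    have "continuous_on (A \<times> B) (\<lambda>p. integral (cbox 0 1) (\<lambda>s. k s * h (fst p, l s * snd p)))"
      by (rule integral_continuous_on_param) (use integrand[OF kh(2,3)] in \<open>simp only: cbox_interval\<close>)
    then have cont: "continuous_on (A \<times> B) F" by (simp add: kh J_def split_beta')
    have hd: "h differentiable (at (u, v))" if "u \<in> A" "v \<in> B" for u v
      using smooth_on_differentiable[OF kh(3)] that by auto
    have int: "(\<lambda>s. k s * h (u, l s * v)) integrable_on {0..1}" if "u \<in> A" "v \<in> B" for u v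
    proof (rule integrable_continuous_real)
      have "continuous_on {0..1} (\<lambda>s. case ((u, v), s) of (p, s) \<Rightarrow> k s * h (fst p, l s * snd p))"
        by (rule continuous_on_compose2[OF integrand[OF kh(2,3)]]) (use that in \<open>auto intro!: continuous_intros\<close>)
      then show "continuous_on {0..1} (\<lambda>s. k s * h (u, l s * v))" by simp
    qed
    have kl: "continuous_on {0..1} (\<lambda>s. k s * l s)" by (rule continuous_on_mult[OF kh(2) l])
    have du: "((\<lambda>t. F (t, v)) has_real_derivative J k (pd_u h) (u, v)) (at u)" if uv: "u \<in> A" "v \<in> B" for u v
    proof -
      obtain e where e: "e > 0" "ball u e \<subseteq> A" using uv assms(1) by (meson openE)
      have "((\<lambda>t. integral (cbox 0 1) (\<lambda>s. k s * h (t, l s * v))) has_field_derivative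
          integral (cbox 0 1) (\<lambda>s. k s * pd_u h (u, l s * v))) (at u within ball u e)"
      proof (rule leibniz_rule_field_derivative)
        show "((\<lambda>x. k t * h (x, l t * v)) has_real_derivative k t * pd_u h (x, l t * v)) (at x within ball u e)"
          if "x \<in> ball u e" "t \<in> cbox 0 1" for x t
        proof (rule has_field_derivative_at_within[OF DERIV_cmult[OF pd_real_slices(1)[OF hd]]])
          show "x \<in> A" "l t * v \<in> B" using that e uv star by auto
        qed
        have "continuous_on (ball u e \<times> {0..1}) (\<lambda>q. case ((fst q, v), snd q) of (p, s) \<Rightarrow> k s * pd_u h (fst p, l s * snd p))"
          by (rule continuous_on_compose2[OF integrand[OF kh(2) smooth_on_pd(1)[OF kh(3)]]])
            (use e uv in \<open>auto intro!: continuous_intros\<close>)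
        then show "continuous_on (ball u e \<times> cbox 0 1) (\<lambda>(x, t). k t * pd_u h (x, l t * v))"
          by (simp add: split_beta')
      qed (use e uv int in auto)
      then show ?thesis using e by (simp add: kh J_def at_within_open[of u "ball u e"])
    qed
    have dv: "((\<lambda>t. F (u, t)) has_real_derivative J (\<lambda>s. k s * l s) (pd_v h) (u, v)) (at v)" if uv: "u \<in> A" "v \<in> B" for u v
    proof -
      obtain e where e: "e > 0" "ball v e \<subseteq> B" using uv assms(2) by (meson openE)
      have "((\<lambda>t. integral (cbox 0 1) (\<lambda>s. k s * h (u, l s * t))) has_field_derivative
          integral (cbox 0 1) (\<lambda>s. k s * l s * pd_v h (u, l s * v))) (at v within ball v e)"
      proof (rule leibniz_rule_field_derivative)
        show "((\<lambda>x. k t * h (u, l t * x)) has_real_derivative k t * l t * pd_v h (u, l t * x)) (at x within ball v e)"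
          if "x \<in> ball v e" "t \<in> cbox 0 1" for x t
        proof (rule has_field_derivative_at_within)
          have "x \<in> B" "l t * x \<in> B" using that e star[of t x] by auto
          have "((\<lambda>x. l t * x) has_real_derivative l t) (at x)" by (auto intro!: derivative_eq_intros)
          from DERIV_chain2[OF pd_real_slices(2)[OF hd[OF uv(1) \<open>l t * x \<in> B\<close>]] this]
          have "((\<lambda>x. h (u, l t * x)) has_real_derivative pd_v h (u, l t * x) * l t) (at x)" .
          from DERIV_cmult[OF this, of "k t"]
          show "((\<lambda>x. k t * h (u, l t * x)) has_real_derivative k t * l t * pd_v h (u, l t * x)) (at x)"
            by (simp add: mult_ac)
        qed
        have "continuous_on (ball v e \<times> {0..1}) (\<lambda>q. case ((u, fst q), snd q) of (p, s) \<Rightarrow> k s * l s * pd_v h (fst p, l s * snd p))"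
          by (rule continuous_on_compose2[OF integrand[OF kl smooth_on_pd(2)[OF kh(3)]]])
            (use e uv in \<open>auto intro!: continuous_intros\<close>)
        then show "continuous_on (ball v e \<times> cbox 0 1) (\<lambda>(x, t). k t * l t * pd_v h (u, l t * x))"
          by (simp add: split_beta')
      qed (use e uv int in auto)
      then show ?thesis using e by (simp add: kh J_def at_within_open[of v "ball v e"])
    qed
    have "J k (pd_u h) \<in> \<F>" "J (\<lambda>s. k s * l s) (pd_v h) \<in> \<F>"
      unfolding \<F>_def using kh kl smooth_on_pd[OF kh(3)] by blast+
    then show ?thesis using cont du dv by blast
  qed
  moreover have "J k h \<in> \<F>" using assms unfolding \<F>_def by blast
  ultimately have "smooth_on (A \<times> B) (J k h)" by (rule smooth_on_if_closed_under_partials[OF AB])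
  then show ?thesis unfolding J_def .
qed

lemma scaled_integral_has_derivative:
  fixes F :: "real \<Rightarrow> real"
  assumes F: "continuous_on {-r<..<r} F" and v: "\<bar>v\<bar> < r"
  shows "((\<lambda>v. v * integral {0..1} (\<lambda>s. F (s * v))) has_real_derivative F v) (at v)"
proof -
  define b where "b = (\<bar>v\<bar> + r) / 2"
  have b: "\<bar>v\<bar> < b" "b < r" using v by (auto simp: b_def)
  have "continuous_on {-b..b} F" using b by (intro continuous_on_subset[OF F]) auto
  then obtain G where G: "\<And>x. x \<in> {-b..b} \<Longrightarrow> (G has_vector_derivative F x) (at x within {-b..b})"
    using antiderivative_continuous[of "-b" b F] by blast
  have G': "(G has_real_derivative F x) (at x)" if "\<bar>x\<bar> < b" for x
  proof -
    have "at x within {-b..b} = at x"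
      using that by (intro at_within_interior) (simp add: interior_atLeastAtMost_real abs_less_iff)
    moreover have "x \<in> {-b..b}" using that by auto
    ultimately show ?thesis using G[of x] by (simp add: has_real_derivative_iff_has_vector_derivative)
  qed
  have eq: "w * integral {0..1} (\<lambda>s. F (s * w)) = G w - G 0" if w: "\<bar>w\<bar> < b" for w
  proof -
    have "((\<lambda>s. w * F (s * w)) has_integral G (1 * w) - G (0 * w)) {0..1}"
    proof (rule fundamental_theorem_of_calculus)
      fix s :: real assume s: "s \<in> {0..1}"
      have "\<bar>s * w\<bar> \<le> 1 * \<bar>w\<bar>" unfolding abs_mult using s by (intro mult_right_mono) auto
      then have sw: "\<bar>s * w\<bar> < b" using w by auto
      have "((\<lambda>s. s * w) has_real_derivative w) (at s within {0..1})"
        by (auto intro!: derivative_eq_intros)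
      from DERIV_chain2[OF G'[OF sw] this]
      show "((\<lambda>s. G (s * w)) has_vector_derivative w * F (s * w)) (at s within {0..1})"
        by (simp add: has_real_derivative_iff_has_vector_derivative mult.commute)
    qed simp
    from integral_unique[OF this] show ?thesis by simp
  qed
  have D: "((\<lambda>w. G w - G 0) has_real_derivative F v) (at v)"
    using DERIV_diff[OF G'[OF b(1)] DERIV_const, of "G 0"] by simp
  have "\<forall>\<^sub>F w in nhds v. w * integral {0..1} (\<lambda>s. F (s * w)) = G w - G 0"
    by (rule eventually_mono[OF eventually_nhds_in_open[of "{-b<..<b}" v]]) (use b in \<open>auto intro!: eq\<close>)
  from iffD2[OF DERIV_cong_ev[OF refl this refl] D] show ?thesis .
qed

lemma eq_if_same_derivative:
  fixes f g :: "real \<Rightarrow> real"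
  assumes "\<And>x. \<bar>x\<bar> < r \<Longrightarrow> (f has_real_derivative D x) (at x)"
    and "\<And>x. \<bar>x\<bar> < r \<Longrightarrow> (g has_real_derivative D x) (at x)"
    and "f 0 = g 0" "\<bar>x\<bar> < r"
  shows "f x = g x"
proof -
  have "\<exists>c. \<forall>x\<in>{-r<..<r}. f x - g x = c"
  proof (rule has_field_derivative_zero_constant)
    show "((\<lambda>x. f x - g x) has_field_derivative 0) (at x within {-r<..<r})" if "x \<in> {-r<..<r}" for x
      using has_field_derivative_at_within[OF DERIV_diff[OF assms(1,2), of x]] that by auto
  qed auto
  then obtain c where c: "\<And>x. \<bar>x\<bar> < r \<Longrightarrow> f x - g x = c" by (auto simp: abs_less_iff)
  show ?thesis using c[of 0] c[of x] assms(3,4) by auto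
qed

text \<open>
  The quotient is \<open>\<integral> g\<^sub>v (u, s v) ds\<close>, taken over the unit interval. It is smooth as an integral with
  parameters. On the axis \<open>v = 0\<close> it has the value \<open>g\<^sub>v (u, 0)\<close> by construction.
\<close>

lemma Hadamard_lemma:
  fixes g :: "real \<times> real \<Rightarrow> real"
  assumes "open A" and g: "smooth_on (A \<times> {-r<..<r}) g" and 0: "\<And>u. u \<in> A \<Longrightarrow> g (u, 0) = 0"
  obtains h where "smooth_on (A \<times> {-r<..<r}) h" "\<And>u v. u \<in> A \<Longrightarrow> \<bar>v\<bar> < r \<Longrightarrow> g (u, v) = v * h (u, v)"
    "\<And>u. u \<in> A \<Longrightarrow> h (u, 0) = pd_v g (u, 0)"
proof
  let ?h = "\<lambda>(u, v). integral {0..1} (\<lambda>s. 1 * pd_v g (u, s * v))"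
  have star: "s * v \<in> {-r<..<r}" if "0 \<le> s" "s \<le> 1" "v \<in> {-r<..<r}" for s v
  proof -
    have "\<bar>s * v\<bar> \<le> 1 * \<bar>v\<bar>" unfolding abs_mult using that by (intro mult_right_mono) auto
    then show ?thesis using that by auto
  qed
  show "smooth_on (A \<times> {-r<..<r}) ?h"
    by (rule smooth_on_weighted_integral) (use assms smooth_on_pd(2)[OF g] star in auto)
  show "g (u, v) = v * ?h (u, v)" if "u \<in> A" "\<bar>v\<bar> < r" for u v
  proof (rule eq_if_same_derivative[where x = v and f = "\<lambda>v. g (u, v)"])
    show "((\<lambda>v. g (u, v)) has_real_derivative pd_v g (u, x)) (at x)" if "\<bar>x\<bar> < r" for x
      using smooth_on_differentiable[OF g] that \<open>u \<in> A\<close> by (intro pd_real_slices) (auto simp: abs_less_iff)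
    have "continuous_on {-r<..<r} (\<lambda>v. pd_v g (u, v))"
      by (rule continuous_on_compose2[OF smooth_on_continuous[OF smooth_on_pd(2)[OF g]]])
        (use \<open>u \<in> A\<close> in \<open>auto intro!: continuous_intros\<close>)
    from scaled_integral_has_derivative[OF this]
    show "((\<lambda>v. v * ?h (u, v)) has_real_derivative pd_v g (u, x)) (at x)" if "\<bar>x\<bar> < r" for x
      using that by simp
  qed (use that 0 in auto)
  show "?h (u, 0) = pd_v g (u, 0)" for u by simp
qed

section \<open>Whitney's theorem on even functions\<close>

text \<open>
  The power series coefficients of Euler's product \<open>(1 - z) (1 - z / 4) (1 - z / 16) \<dots>\<close>, an entire
  function that vanishes exactly at the powers of \<open>4\<close>. The recursion is what the functional
  equation of the product says about coefficients.
\<close>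

fun euler_coeff :: "nat \<Rightarrow> real" where
  "euler_coeff 0 = 1"
| "euler_coeff (Suc k) = - ((1/4) ^ k / (1 - (1/4) ^ Suc k)) * euler_coeff k"

lemma abs_euler_coeff_Suc: "\<bar>euler_coeff (Suc k)\<bar> \<le> 4 / 3 * (1/4) ^ k * \<bar>euler_coeff k\<bar>"
proof -
  have "(1/4::real) ^ Suc k \<le> 1/4" by (simp add: power_le_one)
  then have d: "3/4 \<le> 1 - (1/4::real) ^ Suc k" by simp
  have "\<bar>euler_coeff (Suc k)\<bar> = (1/4) ^ k / (1 - (1/4) ^ Suc k) * \<bar>euler_coeff k\<bar>"
    using d by (simp add: abs_mult del: power_Suc)
  also have "\<dots> \<le> (1/4) ^ k / (3/4) * \<bar>euler_coeff k\<bar>"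
    by (intro mult_right_mono divide_left_mono d) (use d in auto)
  finally show ?thesis by simp
qed

lemma summable_euler_coeff: "summable (\<lambda>k. \<bar>euler_coeff k\<bar> * R ^ k)" if "R \<ge> 0" for R :: real
proof -
  have "0 < 3 / (8 * (R + 1))" using that by simp
  from real_arch_pow_inv[OF this, of "1/4"]
  obtain N where N: "(1/4::real) ^ N < 3 / (8 * (R + 1))" by auto
  show ?thesis
  proof (rule summable_ratio_test[of "1/2" N])
    fix k assume k: "N \<le> k"
    have "(1/4::real) ^ k \<le> (1/4) ^ N" using k by (intro power_decreasing) auto
    then have "(1/4) ^ k * R \<le> 3 / (8 * (R + 1)) * R" using N that by (intro mult_right_mono) linarith+
    also have "\<dots> \<le> 3 / 8" using that by (simp add: field_simps)
    finally have q: "4 / 3 * (1/4) ^ k * R \<le> 1/2" by simp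
    have "\<bar>euler_coeff (Suc k)\<bar> * R ^ Suc k \<le> (4 / 3 * (1/4) ^ k * \<bar>euler_coeff k\<bar>) * R ^ Suc k"
      using that by (intro mult_right_mono abs_euler_coeff_Suc) auto
    also have "\<dots> = (4 / 3 * (1/4) ^ k * R) * (\<bar>euler_coeff k\<bar> * R ^ k)" by simp
    also have "\<dots> \<le> 1/2 * (\<bar>euler_coeff k\<bar> * R ^ k)" using q that by (intro mult_right_mono) auto
    finally show "norm (\<bar>euler_coeff (Suc k)\<bar> * R ^ Suc k) \<le> 1/2 * norm (\<bar>euler_coeff k\<bar> * R ^ k)"
      using that by (simp add: abs_mult)
  qed simp
qed

lemma summable_euler_coeff': "summable (\<lambda>k. euler_coeff k * R ^ k)" for R :: real
proof (rule summable_norm_cancel)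
  show "summable (\<lambda>k. norm (euler_coeff k * R ^ k))"
    using summable_euler_coeff[of "\<bar>R\<bar>"] by (simp add: abs_mult power_abs)
qed

lemma euler_product_functional_equation:
  "(\<Sum>k. euler_coeff k * z ^ k) = (1 - z) * (\<Sum>k. euler_coeff k * (z / 4) ^ k)" for z :: real
proof -
  have coeff: "euler_coeff (Suc k) * (1 - (1/4) ^ Suc k) = - ((1/4) ^ k) * euler_coeff k" for k
  proof -
    have "(1/4::real) ^ Suc k \<le> 1/4" by (simp add: power_le_one)
    then show ?thesis by (simp del: power_Suc)
  qed
  have S: "summable (\<lambda>k. euler_coeff k * z ^ k)" "summable (\<lambda>k. euler_coeff k * (z / 4) ^ k)"
    by (rule summable_euler_coeff')+
  have "(\<Sum>k. euler_coeff k * z ^ k) - (\<Sum>k. euler_coeff k * (z / 4) ^ k)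
      = (\<Sum>k. euler_coeff k * z ^ k - euler_coeff k * (z / 4) ^ k)"
    by (rule suminf_diff[OF S])
  also have "\<dots> = (\<Sum>k. euler_coeff (Suc k) * z ^ Suc k - euler_coeff (Suc k) * (z / 4) ^ Suc k)"
    using suminf_split_head[OF summable_diff[OF S]] by simp
  also have "(\<lambda>k. euler_coeff (Suc k) * z ^ Suc k - euler_coeff (Suc k) * (z / 4) ^ Suc k)
      = (\<lambda>k. - z * (euler_coeff k * (z / 4) ^ k))"
  proof
    fix k
    have "euler_coeff (Suc k) * z ^ Suc k - euler_coeff (Suc k) * (z / 4) ^ Suc k
        = (euler_coeff (Suc k) * (1 - (1/4) ^ Suc k)) * z ^ Suc k"
      by (simp add: power_divide right_diff_distrib left_diff_distrib del: power_Suc euler_coeff.simps)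
    then show "euler_coeff (Suc k) * z ^ Suc k - euler_coeff (Suc k) * (z / 4) ^ Suc k
        = - z * (euler_coeff k * (z / 4) ^ k)"
      unfolding coeff by (simp add: power_divide)
  qed
  also have "(\<Sum>k. - z * (euler_coeff k * (z / 4) ^ k)) = - z * (\<Sum>k. euler_coeff k * (z / 4) ^ k)"
    by (rule suminf_mult[OF S(2)])
  finally show ?thesis by (simp add: algebra_simps)
qed

lemma euler_product_root: "(\<Sum>k. euler_coeff k * (4 ^ n) ^ k) = 0"
  by (induction n) (use euler_product_functional_equation[of 1] in simp,
      subst euler_product_functional_equation, simp)

text \<open>
  Seeley's extension operator needs rapidly decreasing weights with all moments at the nodes
  \<open>- (4 ^ k)\<close> equal to \<open>1\<close>. Euler's coefficients at the nodes \<open>4 ^ k\<close> have all moments \<open>0\<close>, because the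
  product vanishes at \<open>4 ^ n\<close>. Dividing the \<open>k\<close>-th coefficient by \<open>4 ^ k + 1\<close> turns this into
  \<open>M (n + 1) + M n = 0\<close>, so the moments \<open>M n\<close> alternate in sign. Reflecting the nodes makes them all
  equal to \<open>M 0\<close>, and \<open>M 0\<close> is positive because its first term dominates the rest.
\<close>

lemma Seeley_weights:
  obtains a :: "nat \<Rightarrow> real" where "\<And>n. summable (\<lambda>k. \<bar>a k\<bar> * (4 ^ k) ^ n)"
    "\<And>n. (\<Sum>k. a k * (- (4 ^ k)) ^ n) = 1"
proof -
  \<comment> \<open>The denominator is what makes two consecutive moments add up to zero.\<close>
  define b where "b k = euler_coeff k / (4 ^ k + 1)" for k
  have b_le: "\<bar>b k\<bar> \<le> \<bar>euler_coeff k\<bar>" for k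
  proof -
    have "1 \<le> (4::real) ^ k + 1" by simp
    then have "\<bar>euler_coeff k\<bar> / (4 ^ k + 1) \<le> \<bar>euler_coeff k\<bar> / 1" by (intro divide_left_mono) (auto intro: add_pos_pos)
    then show ?thesis using \<open>1 \<le> (4::real) ^ k + 1\<close> unfolding b_def abs_divide by simp
  qed
  have sum_abs: "summable (\<lambda>k. \<bar>b k\<bar> * (4 ^ k) ^ n)" for n
  proof (rule summable_comparison_test'[OF summable_euler_coeff[of "4 ^ n"]])
    show "norm (\<bar>b k\<bar> * (4 ^ k) ^ n) \<le> \<bar>euler_coeff k\<bar> * (4 ^ n) ^ k" for k
      using b_le[of k] by (simp add: power_mult[symmetric] mult.commute[of k n])
  qed simp
  define M where "M n = (\<Sum>k. b k * (4 ^ k) ^ n)" for n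
  have sum_b: "summable (\<lambda>k. b k * (4 ^ k) ^ n)" for n
    by (rule summable_norm_cancel) (use sum_abs[of n] in \<open>simp add: abs_mult\<close>)
  have "M (Suc n) = - M n" for n
  proof -
    have "M (Suc n) + M n = (\<Sum>k. b k * (4 ^ k) ^ Suc n + b k * (4 ^ k) ^ n)"
      unfolding M_def by (rule suminf_add[OF sum_b sum_b])
    also have "(\<lambda>k. b k * (4 ^ k) ^ Suc n + b k * (4 ^ k) ^ n) = (\<lambda>k. euler_coeff k * (4 ^ n) ^ k)"
    proof
      fix k
      have "(4::real) ^ k + 1 \<noteq> 0" by (smt (verit) zero_less_power)
      have "b k * (4 ^ k) ^ Suc n + b k * (4 ^ k) ^ n = (b k * (4 ^ k + 1)) * (4 ^ k) ^ n"
        by (simp add: algebra_simps)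
      also have "\<dots> = euler_coeff k * (4 ^ n) ^ k"
        using \<open>4 ^ k + 1 \<noteq> 0\<close> by (simp add: b_def power_mult[symmetric] mult.commute[of k n])
      finally show "b k * (4 ^ k) ^ Suc n + b k * (4 ^ k) ^ n = euler_coeff k * (4 ^ n) ^ k" .
    qed
    finally show ?thesis using euler_product_root[of n] by simp
  qed
  then have M: "M n = (-1) ^ n * M 0" for n by (induction n) auto
  have e_le: "\<bar>euler_coeff (Suc k)\<bar> \<le> 4 / 3 * (4/15) ^ k" for k
  proof (induction k)
    case 0 then show ?case by simp
  next
    case (Suc k)
    have "(1/4::real) ^ Suc (Suc k) \<le> 1/16" using power_decreasing[of 2 "Suc (Suc k)" "1/4::real"]
      by (simp add: power2_eq_square)
    then have d: "15/16 \<le> 1 - (1/4::real) ^ Suc (Suc k)" by simp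
    have "(1/4::real) ^ Suc k \<le> 1/4" by (simp add: power_le_one)
    then have q: "(1/4::real) ^ Suc k / (1 - (1/4) ^ Suc (Suc k)) \<le> (1/4) / (15/16)"
      using d by (intro frac_le) linarith+
    have "\<bar>euler_coeff (Suc (Suc k))\<bar> = (1/4) ^ Suc k / (1 - (1/4) ^ Suc (Suc k)) * \<bar>euler_coeff (Suc k)\<bar>"
      unfolding euler_coeff.simps(2)[of "Suc k"] abs_mult abs_minus_cancel abs_divide
      using d by (simp del: power_Suc euler_coeff.simps)
    also have "\<dots> \<le> (1/4) / (15/16) * \<bar>euler_coeff (Suc k)\<bar>"
      using q by (rule mult_right_mono) simp
    finally have "\<bar>euler_coeff (Suc (Suc k))\<bar> \<le> 4/15 * \<bar>euler_coeff (Suc k)\<bar>" by simp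
    also have "\<dots> \<le> 4/15 * (4 / 3 * (4/15) ^ k)" using Suc.IH by (intro mult_left_mono) auto
    finally show ?case by simp
  qed
  \<comment> \<open>The term for \<open>k = 0\<close> is \<open>1 / 2\<close>; the other terms sum to less than \<open>1 / 2\<close> in absolute value.\<close>
  have "M 0 > 0"
  proof -
    have tail: "\<bar>b (Suc k)\<bar> \<le> (4/15) ^ k * (4/15)" for k
    proof -
      have "(5::real) \<le> 4 ^ Suc k + 1" by simp
      then have "\<bar>b (Suc k)\<bar> \<le> (4 / 3 * (4/15) ^ k) / 5"
        unfolding b_def abs_divide using e_le[of k] by (intro frac_le) auto
      then show ?thesis by simp
    qed
    have geo: "(\<lambda>k. (4/15::real) ^ k * (4/15)) sums (1 / (1 - 4/15) * (4/15))"
      by (intro sums_mult2 geometric_sums) simp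
    have S: "summable b" using sum_b[of 0] by simp
    have S': "summable (\<lambda>k. \<bar>b (Suc k)\<bar>)"
      using sum_abs[of 0] by (simp add: summable_Suc_iff[of "\<lambda>k. \<bar>b k\<bar>"])
    have "\<bar>\<Sum>k. b (Suc k)\<bar> \<le> (\<Sum>k. \<bar>b (Suc k)\<bar>)" by (rule summable_rabs[OF S'])
    also have "\<dots> \<le> (\<Sum>k. (4/15) ^ k * (4/15))"
      by (rule suminf_le[OF tail S' sums_summable[OF geo]])
    also have "\<dots> < 1/2" using sums_unique[OF geo] by simp
    finally have "\<bar>\<Sum>k. b (Suc k)\<bar> < 1/2" .
    moreover have "M 0 = b 0 + (\<Sum>k. b (Suc k))"
      using suminf_split_head[OF S] by (simp add: M_def)
    ultimately show ?thesis by (simp add: b_def)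
  qed
  show thesis
  proof
    show "summable (\<lambda>k. \<bar>b k / M 0\<bar> * (4 ^ k) ^ n)" for n
      using summable_divide[OF sum_abs, of n "\<bar>M 0\<bar>"] by (simp add: abs_divide)
    show "(\<Sum>k. b k / M 0 * (- (4 ^ k)) ^ n) = 1" for n
    proof -
      have "(\<lambda>k. b k / M 0 * (- (4 ^ k)) ^ n) = (\<lambda>k. ((-1) ^ n / M 0) * (b k * (4 ^ k) ^ n))"
        by (simp add: fun_eq_iff power_minus[of "4 ^ _"])
      then have "(\<Sum>k. b k / M 0 * (- (4 ^ k)) ^ n) = ((-1) ^ n / M 0) * M n"
        using suminf_mult[OF sum_b, of "(-1) ^ n / M 0" n] by (simp add: M_def)
      also have "\<dots> = (-1) ^ n * (-1) ^ n" using \<open>M 0 > 0\<close> by (simp add: M[of n])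
      also have "\<dots> = 1" by (simp flip: power_add)
      finally show ?thesis .
    qed
  qed
qed

text \<open>
  A derivative that extends continuously over a single point is the derivative there as well. It
  glues the two halves of an extended function at the boundary.
\<close>

lemma has_derivative_at_limit_point:
  fixes f f' :: "real \<Rightarrow> real"
  assumes "continuous_on UNIV f" and "continuous_on UNIV f'"
    and f': "\<And>x. x \<noteq> 0 \<Longrightarrow> (f has_real_derivative f' x) (at x)"
  shows "(f has_real_derivative f' 0) (at 0)"
proof -
  define g where "g v = v * integral {0..1} (\<lambda>s. f' (s * v))" for v
  have g: "(g has_real_derivative f' v) (at v)" for v
    unfolding g_def[abs_def]
    by (rule scaled_integral_has_derivative[of "\<bar>v\<bar> + 1"]) (auto intro: continuous_on_subset[OF assms(2)])
  have g_cont: "continuous_on UNIV g"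
    by (intro continuous_at_imp_continuous_on ballI DERIV_isCont[OF g])
  have "f x - g x = f 0 - g 0" for x
  proof (rule has_derivative_zero_unique_strong_convex[of UNIV "{0}" "\<lambda>x. f x - g x"])
    show "((\<lambda>x. f x - g x) has_derivative (\<lambda>h. 0)) (at x within UNIV)" if "x \<in> UNIV - {0}" for x
      using DERIV_diff[OF f' g, of x] that by (simp add: has_field_derivative_def lambda_zero)
  qed (use assms(1) g_cont in \<open>auto intro: continuous_on_diff\<close>)
  then have "f = (\<lambda>x. g x + (f 0 - g 0))" by (auto simp: fun_eq_iff algebra_simps)
  moreover have "((\<lambda>x. g x + (f 0 - g 0)) has_real_derivative f' 0 + 0) (at 0)"
    by (rule DERIV_add[OF g DERIV_const])
  ultimately show ?thesis by simp
qed

text \<open>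
  A function on \<open>A \<times> [0, \<infinity>)\<close> all of whose derivatives are bounded and extend continuously to the
  boundary is the restriction of a smooth function on \<open>A \<times> \<real>\<close>. For \<open>s < 0\<close> the extension is
  \<open>\<Sum>k. a k * G (u, - (4 ^ k) * s)\<close>. Differentiating \<open>n\<close> times in \<open>s\<close> inserts the factors \<open>(- (4 ^ k)) ^ n\<close>, and
  by the choice of the weights the resulting series has the boundary value of the \<open>n\<close>-th derivative
  of \<open>G\<close> for every \<open>n\<close>.

  Instead of a cut-off, boundedness of all derivatives makes the series converge uniformly. The
  functions \<open>E n G\<close> of the proof, in which the series already carries the factors of an \<open>n\<close>-th
  derivative, form a class that is closed under partial derivatives.
\<close>

lemma Seeley_extension:
  fixes \<G> :: "(real \<times> real \<Rightarrow> real) set"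
  assumes "open A"
    and cont: "\<And>G. G \<in> \<G> \<Longrightarrow> continuous_on (A \<times> {0..}) G"
    and bdd: "\<And>G. G \<in> \<G> \<Longrightarrow> \<exists>B. \<forall>u\<in>A. \<forall>s\<ge>0. \<bar>G (u, s)\<bar> \<le> B"
    and partials: "\<And>G. G \<in> \<G> \<Longrightarrow> \<exists>Gu\<in>\<G>. \<exists>Gv\<in>\<G>.
        (\<forall>u\<in>A. \<forall>s\<ge>0. ((\<lambda>t. G (t, s)) has_real_derivative Gu (u, s)) (at u)) \<and>
        (\<forall>u\<in>A. \<forall>s>0. ((\<lambda>t. G (u, t)) has_real_derivative Gv (u, s)) (at s))"
    and "G \<in> \<G>"
  obtains E where "smooth_on (A \<times> UNIV) E" "\<And>u s. u \<in> A \<Longrightarrow> 0 \<le> s \<Longrightarrow> E (u, s) = G (u, s)"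
proof -
  obtain a :: "nat \<Rightarrow> real" where a_sum: "\<And>n. summable (\<lambda>k. \<bar>a k\<bar> * (4 ^ k) ^ n)"
    and a_one: "\<And>n. (\<Sum>k. a k * (- (4 ^ k)) ^ n) = 1" using Seeley_weights by blast
  \<comment> \<open>The terms of the series for an \<open>n\<close>-th derivative in \<open>s\<close>.\<close>
  define T where "T n G k = (\<lambda>(u, s). a k * (- (4 ^ k)) ^ n * G (u, - (4 ^ k) * s))"
    for n k and G :: "real \<times> real \<Rightarrow> real"
  define R where "R n G p = (\<Sum>k. T n G k p)" for n and G :: "real \<times> real \<Rightarrow> real" and p
  define E where "E n G = (\<lambda>(u, s). if 0 \<le> s then G (u, s) else R n G (u, s))"
    for n and G :: "real \<times> real \<Rightarrow> real"
  have neg: "0 \<le> - (4 ^ k) * s" if "s \<le> 0" for k and s :: real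
    using that by (simp add: mult_nonneg_nonpos)
  have T_le: "\<exists>M. summable M \<and> (\<forall>k. \<forall>u\<in>A. \<forall>s\<le>0. norm (T n G k (u, s)) \<le> M k)" if G: "G \<in> \<G>" for n G
  proof -
    obtain B where B: "\<And>u s. u \<in> A \<Longrightarrow> 0 \<le> s \<Longrightarrow> \<bar>G (u, s)\<bar> \<le> B" using bdd[OF G] by blast
    have "norm (T n G k (u, s)) \<le> \<bar>a k\<bar> * (4 ^ k) ^ n * B" if "u \<in> A" "s \<le> 0" for k u s
      unfolding T_def using B[OF that(1) neg[OF that(2)]]
      by (auto simp: abs_mult power_abs intro!: mult_left_mono)
    then show ?thesis by (intro exI[of _ "\<lambda>k. \<bar>a k\<bar> * (4 ^ k) ^ n * B"]) (auto intro: summable_mult2 a_sum)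
  qed
  have unif: "uniform_limit (A \<times> {..0}) (\<lambda>N p. \<Sum>k<N. T n G k p) (R n G) sequentially" if G: "G \<in> \<G>" for n G
  proof -
    obtain M where M: "summable M" "\<And>k u s. u \<in> A \<Longrightarrow> s \<le> 0 \<Longrightarrow> norm (T n G k (u, s)) \<le> M k"
      using T_le[OF G, of n] by meson
    show ?thesis unfolding R_def[abs_def]
    proof (rule Weierstrass_m_test[OF _ M(1)])
      show "norm (T n G k p) \<le> M k" if "p \<in> A \<times> {..0}" for k p
        using M(2)[of "fst p" "snd p" k] that by auto
    qed
  qed
  have T_cont: "continuous_on (A \<times> {..0}) (T n G k)" if G: "G \<in> \<G>" for n G k
    unfolding T_def split_beta'
    by (intro continuous_on_mult continuous_on_const continuous_on_compose2[OF cont[OF G]] continuous_on_Pair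
        continuous_on_fst continuous_on_snd continuous_on_id) (auto simp: mult_nonneg_nonpos)
  have R_cont: "continuous_on (A \<times> {..0}) (R n G)" if G: "G \<in> \<G>" for n G
    by (rule uniform_limit_theorem[OF _ unif[OF G]]) (auto intro!: always_eventually continuous_on_sum T_cont[OF G])
  \<comment> \<open>This is where all moments of the weights enter: the two pieces match at the boundary for every \<open>n\<close>.\<close>
  have R0: "R n G (u, 0) = G (u, 0)" for n G u
  proof -
    have "summable (\<lambda>k. a k * (- (4 ^ k)) ^ n)"
      by (rule summable_norm_cancel) (use a_sum[of n] in \<open>simp add: abs_mult power_abs\<close>)
    from suminf_mult2[OF this, of "G (u, 0)"] a_one[of n] show ?thesis by (simp add: R_def T_def)
  qed
  have E_eq: "E n G (u, s) = G (u, max s 0) + R n G (u, min s 0) - G (u, 0)" for n G u s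
    by (simp add: E_def R0 max_def min_def)
  have E_cont: "continuous_on (A \<times> UNIV) (E n G)" if G: "G \<in> \<G>" for n G
  proof -
    have "continuous_on (A \<times> UNIV) (\<lambda>p. G (fst p, max (snd p) 0))"
      "continuous_on (A \<times> UNIV) (\<lambda>p. G (fst p, 0))"
      by (rule continuous_on_compose2[OF cont[OF G]]; auto intro!: continuous_intros)+
    moreover have "continuous_on (A \<times> UNIV) (\<lambda>p. R n G (fst p, min (snd p) 0))"
      by (rule continuous_on_compose2[OF R_cont[OF G]]) (auto intro!: continuous_intros)
    ultimately have "continuous_on (A \<times> UNIV) (\<lambda>p. G (fst p, max (snd p) 0) + R n G (fst p, min (snd p) 0) - G (fst p, 0))"
      by (intro continuous_on_add continuous_on_diff)
    moreover have "E n G = (\<lambda>p. G (fst p, max (snd p) 0) + R n G (fst p, min (snd p) 0) - G (fst p, 0))"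
      by (auto simp: fun_eq_iff E_eq)
    ultimately show ?thesis by simp
  qed
  have term_deriv: "((\<lambda>t. \<Sum>k. f k t) has_real_derivative (\<Sum>k. f' k x)) (at x)"
    if S: "convex S" "open S" "x \<in> S" and f: "\<And>k t. t \<in> S \<Longrightarrow> (f k has_real_derivative f' k t) (at t)"
      and M: "summable M" "\<And>k t. t \<in> S \<Longrightarrow> norm (f' k t) \<le> M k"
      and M': "summable M'" "\<And>k. norm (f k x) \<le> M' k"
    for S x and f f' :: "nat \<Rightarrow> real \<Rightarrow> real" and M M' :: "nat \<Rightarrow> real"
  proof (rule has_field_derivative_series'(2)[OF S(1)])
    show "uniformly_convergent_on S (\<lambda>n x. \<Sum>i<n. f' i x)"
      by (rule Weierstrass_m_test') (use M in auto)
    show "summable (\<lambda>n. f n x)" by (rule summable_comparison_test'[OF M'(1)]) (use M' in auto)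
    show "(f n has_real_derivative f' n t) (at t within S)" if "t \<in> S" for n t
      by (rule has_field_derivative_at_within[OF f[OF that]])
  qed (use S in \<open>auto simp: interior_open\<close>)
  define \<F> where "\<F> = {E n G |n G. G \<in> \<G>}"
  have AU: "open (A \<times> (UNIV :: real set))" using assms(1) by (simp add: open_Times)
  have "continuous_on (A \<times> UNIV) F \<and> (\<exists>Fu\<in>\<F>. \<exists>Fv\<in>\<F>. \<forall>u v. (u, v) \<in> A \<times> UNIV \<longrightarrow>
      ((\<lambda>t. F (t, v)) has_real_derivative Fu (u, v)) (at u) \<and>
      ((\<lambda>t. F (u, t)) has_real_derivative Fv (u, v)) (at v))" if F: "F \<in> \<F>" for F
  proof -
    obtain n G where G: "F = E n G" "G \<in> \<G>" using F unfolding \<F>_def by blast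
    obtain Gu Gv where G': "Gu \<in> \<G>" "Gv \<in> \<G>"
      and Gu: "\<And>u s. u \<in> A \<Longrightarrow> 0 \<le> s \<Longrightarrow> ((\<lambda>t. G (t, s)) has_real_derivative Gu (u, s)) (at u)"
      and Gv: "\<And>u s. u \<in> A \<Longrightarrow> 0 < s \<Longrightarrow> ((\<lambda>t. G (u, t)) has_real_derivative Gv (u, s)) (at s)"
      using partials[OF G(2)] by blast
    obtain M where M: "summable M" "\<And>k u s. u \<in> A \<Longrightarrow> s \<le> 0 \<Longrightarrow> norm (T n G k (u, s)) \<le> M k"
      using T_le[OF G(2), of n] by meson
    obtain Mu where Mu: "summable Mu" "\<And>k u s. u \<in> A \<Longrightarrow> s \<le> 0 \<Longrightarrow> norm (T n Gu k (u, s)) \<le> Mu k"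
      using T_le[OF G'(1), of n] by meson
    obtain Mv where Mv: "summable Mv" "\<And>k u s. u \<in> A \<Longrightarrow> s \<le> 0 \<Longrightarrow> norm (T (Suc n) Gv k (u, s)) \<le> Mv k"
      using T_le[OF G'(2), of "Suc n"] by meson
    have du: "((\<lambda>t. E n G (t, v)) has_real_derivative E n Gu (u, v)) (at u)" if u: "u \<in> A" for u v
    proof (cases "0 \<le> v")
      case True then show ?thesis using Gu[OF u] by (simp add: E_def)
    next
      case False
      obtain e where e: "e > 0" "ball u e \<subseteq> A" using u assms(1) by (meson openE)
      have "((\<lambda>t. \<Sum>k. T n G k (t, v)) has_real_derivative (\<Sum>k. T n Gu k (u, v))) (at u)"
      proof (rule term_deriv[of "ball u e" u, OF _ _ _ _ Mu(1) _ M(1)])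
        show "((\<lambda>t. T n G k (t, v)) has_real_derivative T n Gu k (t, v)) (at t)" if "t \<in> ball u e" for k t
          unfolding T_def prod.case
          by (rule DERIV_cmult[OF Gu]) (use that e False neg[of v k] in auto)
      qed (use e u False Mu(2) M(2) in auto)
      then show ?thesis using False by (simp add: E_def R_def)
    qed
    have dv_nz: "((\<lambda>t. E n G (u, t)) has_real_derivative E (Suc n) Gv (u, v)) (at v)" if u: "u \<in> A" and "v \<noteq> 0" for u v
    proof (cases "0 < v")
      case True
      have "\<forall>\<^sub>F t in nhds v. E n G (u, t) = G (u, t)"
        by (rule eventually_mono[OF eventually_nhds_in_open[of "{0<..}" v]]) (use True in \<open>auto simp: E_def\<close>)
      from iffD2[OF DERIV_cong_ev[OF refl this refl] Gv[OF u True]]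
      show ?thesis using True by (simp add: E_def)
    next
      case False
      then have v: "v < 0" using that by simp
      have "((\<lambda>t. \<Sum>k. T n G k (u, t)) has_real_derivative (\<Sum>k. T (Suc n) Gv k (u, v))) (at v)"
      proof (rule term_deriv[of "{..<0}" v, OF _ _ _ _ Mv(1) _ M(1)])
        show "((\<lambda>t. T n G k (u, t)) has_real_derivative T (Suc n) Gv k (u, t)) (at t)" if "t \<in> {..<0}" for k t
        proof -
          have pos: "0 < - (4 ^ k) * t" using that by (simp add: mult_pos_neg)
          have "((\<lambda>t. - (4 ^ k) * t) has_real_derivative - (4 ^ k)) (at t)"
            using DERIV_cmult[OF DERIV_ident, of "- (4 ^ k)"] by simp
          from DERIV_cmult[OF DERIV_chain2[OF Gv[OF u pos] this], of "a k * (- (4 ^ k)) ^ n"]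
          show ?thesis unfolding T_def prod.case by (simp add: mult_ac)
        qed
      qed (use v u Mv(2) M(2) in auto)
      moreover have "\<forall>\<^sub>F t in nhds v. E n G (u, t) = (\<Sum>k. T n G k (u, t))"
        by (rule eventually_mono[OF eventually_nhds_in_open[of "{..<0}" v]]) (use v in \<open>auto simp: E_def R_def\<close>)
      ultimately have "((\<lambda>t. E n G (u, t)) has_real_derivative (\<Sum>k. T (Suc n) Gv k (u, v))) (at v)"
        by (subst DERIV_cong_ev[OF refl _ refl])
      then show ?thesis using v by (simp add: E_def R_def)
    qed
    have dv: "((\<lambda>t. E n G (u, t)) has_real_derivative E (Suc n) Gv (u, v)) (at v)" if u: "u \<in> A" for u v
    proof (cases "v = 0")
      case True
      have "continuous_on UNIV (\<lambda>t. E n G (u, t))" "continuous_on UNIV (\<lambda>t. E (Suc n) Gv (u, t))"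
        by (rule continuous_on_compose2[OF E_cont[OF G(2)]] continuous_on_compose2[OF E_cont[OF G'(2)]];
            use u in \<open>auto intro!: continuous_intros\<close>)+
      then show ?thesis unfolding True by (rule has_derivative_at_limit_point[OF _ _ dv_nz[OF u]])
    qed (rule dv_nz[OF u])
    have "E n Gu \<in> \<F>" "E (Suc n) Gv \<in> \<F>" using G' unfolding \<F>_def by blast+
    then show ?thesis using du dv E_cont[OF G(2)] unfolding G(1) by blast
  qed
  moreover have "E 0 G \<in> \<F>" using assms(5) unfolding \<F>_def by blast
  ultimately have "smooth_on (A \<times> UNIV) (E 0 G)" by (rule smooth_on_if_closed_under_partials[OF AU])
  then show thesis by (rule that) (simp add: E_def)
qed

text \<open>
  With \<open>k (u, s) = g (u, sqrt s)\<close> the only question is smoothness at \<open>s = 0\<close>. Since \<open>g\<close> is even, \<open>g\<^sub>v\<close> is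
  \<open>v\<close> times a smooth even function by Hadamard's lemma, so \<open>\<partial>\<^sub>s\<close> maps functions of this kind to
  functions of this kind: all derivatives exist up to the boundary \<open>s = 0\<close>, and Seeley's theorem
  extends \<open>k\<close> to negative \<open>s\<close>.

  To work with bounded functions on a whole half line, \<open>s \<ge> 0\<close> is mapped to the interval \<open>[0, 1)\<close> by
  \<open>s / (1 + s)\<close> before the root is taken.
\<close>

lemma Whitney_even_unit_square:
  fixes g :: "real \<times> real \<Rightarrow> real"
  assumes g: "smooth_on ({-2<..<2} \<times> {-2<..<2}) g"
    and even: "\<And>u v. \<bar>u\<bar> < 2 \<Longrightarrow> \<bar>v\<bar> < 2 \<Longrightarrow> g (u, - v) = g (u, v)"
  obtains k where "smooth_on ({-1<..<1} \<times> {-1<..<1}) k"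
    "\<And>u v. \<bar>u\<bar> < 1 \<Longrightarrow> \<bar>v\<bar> < 1 \<Longrightarrow> k (u, v\<^sup>2) = g (u, v)"
proof -
  define W where "W = {-2<..<2::real} \<times> {-2<..<2::real}"
  define r where "r s = sqrt (s / (1 + s))" for s :: real
  define lift where "lift g = (\<lambda>(u, s). g (u, r s))" for g :: "real \<times> real \<Rightarrow> real"
  define ev where "ev g \<longleftrightarrow> smooth_on W g \<and> (\<forall>u v. (u, v) \<in> W \<longrightarrow> g (u, - v) = g (u, v))"
    for g :: "real \<times> real \<Rightarrow> real"
  have W: "open W" "\<And>u v. (u, v) \<in> W \<longleftrightarrow> \<bar>u\<bar> < 2 \<and> \<bar>v\<bar> < 2"
    by (auto simp: W_def open_Times abs_less_iff)
  have r: "0 \<le> r s" "r s < 1" "(r s)\<^sup>2 = s / (1 + s)" if "0 \<le> s" for s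
    using that by (auto simp: r_def real_sqrt_lt_1_iff divide_less_eq)
  have r_cont: "continuous_on {0..} r"
    unfolding r_def by (intro continuous_intros) auto
  define A where "A = {-1<..<1::real}"
  have lift_cont: "continuous_on (A \<times> {0..}) (lift g)" if "ev g" for g
    unfolding lift_def split_beta'
  proof (rule continuous_on_compose2[of W g])
    show "continuous_on W g" using that by (simp add: ev_def smooth_on_continuous)
    show "continuous_on (A \<times> {0..}) (\<lambda>p. (fst p, r (snd p)))"
      by (intro continuous_on_Pair continuous_on_fst continuous_on_id continuous_on_compose2[OF r_cont] continuous_on_snd) auto
    show "(\<lambda>p. (fst p, r (snd p))) ` (A \<times> {0..}) \<subseteq> W"
    proof (clarsimp simp: W A_def)
      fix x s :: real assume "- 1 < x" "x < 1" "0 \<le> s"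
      then show "\<bar>x\<bar> < 2 \<and> \<bar>r s\<bar> < 2" using r[of s] by auto
    qed
  qed
  have lift_bdd: "\<exists>B. \<forall>u\<in>A. \<forall>s\<ge>0. \<bar>lift g (u, s)\<bar> \<le> B" if "ev g" for g
  proof -
    have "compact ({-1..1::real} \<times> {0..1::real})" by (intro compact_Times compact_Icc)
    moreover have "continuous_on ({-1..1} \<times> {0..1}) g"
      using that by (intro continuous_on_subset[OF smooth_on_continuous[of W g]]) (auto simp: ev_def W_def)
    ultimately have "bounded (g ` ({-1..1} \<times> {0..1}))" using compact_continuous_image compact_imp_bounded by blast
    then obtain B where B: "\<And>p. p \<in> {-1..1} \<times> {0..1} \<Longrightarrow> \<bar>g p\<bar> \<le> B"
      by (auto simp: bounded_iff)
    show ?thesis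
    proof (intro exI[of _ B] ballI allI impI)
      fix u s :: real assume "u \<in> A" "0 \<le> s"
      then show "\<bar>lift g (u, s)\<bar> \<le> B" using r[of s] by (auto simp: lift_def A_def intro!: B)
    qed
  qed
  have lift_partials: "\<exists>gu gv. ev gu \<and> ev gv \<and>
      (\<forall>u\<in>A. \<forall>s\<ge>0. ((\<lambda>t. lift g (t, s)) has_real_derivative lift gu (u, s)) (at u)) \<and>
      (\<forall>u\<in>A. \<forall>s>0. ((\<lambda>t. lift g (u, t)) has_real_derivative lift gv (u, s)) (at s))" if "ev g" for g
  proof -
    have sg: "smooth_on W g" and eg: "\<And>u v. (u, v) \<in> W \<Longrightarrow> g (u, - v) = g (u, v)"
      using that by (auto simp: ev_def)
    have d: "g differentiable (at p)" if "p \<in> W" for p by (rule smooth_on_differentiable[OF sg that])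
    have u_even: "pd_u g (u, - v) = pd_u g (u, v)" if uv: "(u, v) \<in> W" for u v
    proof (rule DERIV_unique)
      show "((\<lambda>t. g (t, - v)) has_real_derivative pd_u g (u, - v)) (at u)"
        using uv by (intro pd_real_slices d) (simp add: W)
      have "\<forall>\<^sub>F t in nhds u. g (t, - v) = g (t, v)"
        by (rule eventually_mono[OF eventually_nhds_in_open[of "{-2<..<2}" u]])
          (use uv in \<open>auto simp: W abs_less_iff intro!: eg\<close>)
      from iffD2[OF DERIV_cong_ev[OF refl this refl] pd_real_slices(1)[OF d[OF uv]]]
      show "((\<lambda>t. g (t, - v)) has_real_derivative pd_u g (u, v)) (at u)" .
    qed
    have v_odd: "pd_v g (u, - v) = - pd_v g (u, v)" if uv: "(u, v) \<in> W" for u v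
    proof -
      have "((\<lambda>t. - t) has_real_derivative - 1) (at v)" by (auto intro!: derivative_eq_intros)
      from DERIV_chain2[OF pd_real_slices(2)[of g u "- v", OF d] this]
      have 1: "((\<lambda>t. g (u, - t)) has_real_derivative - pd_v g (u, - v)) (at v)" using uv by (simp add: W)
      have "\<forall>\<^sub>F t in nhds v. g (u, - t) = g (u, t)"
        by (rule eventually_mono[OF eventually_nhds_in_open[of "{-2<..<2}" v]])
          (use uv in \<open>auto simp: W abs_less_iff intro!: eg\<close>)
      from iffD2[OF DERIV_cong_ev[OF refl this refl] pd_real_slices(2)[OF d[OF uv]]]
      have "((\<lambda>t. g (u, - t)) has_real_derivative pd_v g (u, v)) (at v)" .
      from DERIV_unique[OF 1 this] show ?thesis by simp
    qed
    have v0: "pd_v g (u, 0) = 0" if "u \<in> {-2<..<2}" for u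
      using v_odd[of u 0] that by (simp add: W abs_less_iff)
    obtain h where h: "smooth_on W h" "\<And>u v. (u, v) \<in> W \<Longrightarrow> pd_v g (u, v) = v * h (u, v)"
      using Hadamard_lemma[OF open_greaterThanLessThan smooth_on_pd(2)[OF sg[unfolded W_def]] v0]
      unfolding W_def by (metis (no_types, lifting) W(2) W_def abs_less_iff greaterThanLessThan_iff mem_Sigma_iff)
    \<comment> \<open>With \<open>v = r s\<close> one has \<open>ds = 2 v dv / (1 - v\<^sup>2)\<^sup>2\<close>, so the factor \<open>v\<close> of \<open>g\<^sub>v\<close> cancels.\<close>
    define gv where "gv = (\<lambda>p. (1 - (snd p)\<^sup>2)\<^sup>2 * h p / 2)"
    have "ev (pd_u g)" using u_even smooth_on_pd(1)[OF sg] by (simp add: ev_def)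
    moreover have "ev gv"
    proof -
      have "h (u, - v) = h (u, v)" if "(u, v) \<in> W" for u v
      proof (cases "v = 0")
        case False
        have "v * h (u, - v) = v * h (u, v)" using h(2)[OF that] h(2)[of u "- v"] v_odd[OF that] that
          by (metis W(2) abs_minus_cancel minus_equation_iff mult_minus_left)
        then show ?thesis using False by (metis mult_left_cancel)
      qed simp
      moreover have "smooth_on W gv"
        unfolding gv_def by (intro smooth_intros h W(1)) auto
      ultimately show ?thesis by (simp add: ev_def gv_def)
    qed
    moreover have "((\<lambda>t. lift g (t, s)) has_real_derivative lift (pd_u g) (u, s)) (at u)" if "u \<in> A" "0 \<le> s" for u s
      using r[OF that(2)] that(1) unfolding lift_def prod.case
      by (intro pd_real_slices d) (auto simp: W A_def)
    moreover have "((\<lambda>t. lift g (u, t)) has_real_derivative lift gv (u, s)) (at s)" if "u \<in> A" "0 < s" for u s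
    proof -
      have rs: "0 < r s" "r s < 1" "(r s)\<^sup>2 = s / (1 + s)" using r[of s] that(2) by (auto simp: r_def)
      have in_W: "(u, r s) \<in> W" using that rs by (auto simp: W A_def)
      have "(r has_real_derivative (1 / (1 + s)\<^sup>2) / (2 * r s)) (at s)"
        using that(2) unfolding r_def
        by (auto intro!: derivative_eq_intros simp: power2_eq_square divide_simps)
      from DERIV_chain2[OF pd_real_slices(2)[OF d[OF in_W]] this]
      have "((\<lambda>t. g (u, r t)) has_real_derivative pd_v g (u, r s) * ((1 / (1 + s)\<^sup>2) / (2 * r s))) (at s)" .
      moreover have "pd_v g (u, r s) * ((1 / (1 + s)\<^sup>2) / (2 * r s)) = lift gv (u, s)"
      proof -
        have "1 - (r s)\<^sup>2 = 1 / (1 + s)" using that(2) by (simp add: rs(3) field_simps)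
        then show ?thesis using rs(1) by (simp add: lift_def gv_def h(2)[OF in_W] power_divide)
      qed
      ultimately show ?thesis by (simp add: lift_def)
    qed
    ultimately show ?thesis by blast
  qed
  have "ev g" using assms by (auto simp: ev_def W_def abs_less_iff)
  obtain E where E: "smooth_on (A \<times> UNIV) E" "\<And>u s. u \<in> A \<Longrightarrow> 0 \<le> s \<Longrightarrow> E (u, s) = lift g (u, s)"
  proof (rule Seeley_extension[of A "lift ` Collect ev" "lift g"])
    show "open A" by (simp add: A_def)
  next
    fix G assume "G \<in> lift ` Collect ev"
    then show "continuous_on (A \<times> {0..}) G" "\<exists>B. \<forall>u\<in>A. \<forall>s\<ge>0. \<bar>G (u, s)\<bar> \<le> B"
      using lift_cont lift_bdd by auto
    show "\<exists>Gu\<in>lift ` Collect ev. \<exists>Gv\<in>lift ` Collect ev.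
        (\<forall>u\<in>A. \<forall>s\<ge>0. ((\<lambda>t. G (t, s)) has_real_derivative Gu (u, s)) (at u)) \<and>
        (\<forall>u\<in>A. \<forall>s>0. ((\<lambda>t. G (u, t)) has_real_derivative Gv (u, s)) (at s))"
      using \<open>G \<in> lift ` Collect ev\<close> lift_partials by fast
  qed (use \<open>ev g\<close> in auto)
  show thesis
  proof
    show "smooth_on ({-1<..<1} \<times> {-1<..<1}) (\<lambda>p. E (fst p, snd p / (1 - snd p)))"
      by (rule smooth_on_compose[OF E(1)]) (auto simp: A_def open_Times intro!: smooth_intros)
    show "E (fst (u, v\<^sup>2), snd (u, v\<^sup>2) / (1 - snd (u, v\<^sup>2))) = g (u, v)" if "\<bar>u\<bar> < 1" "\<bar>v\<bar> < 1" for u v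
    proof -
      have v2: "v\<^sup>2 < 1" using that by (simp add: abs_square_less_1)
      define s where "s = v\<^sup>2 / (1 - v\<^sup>2)"
      have s: "0 \<le> s" "s / (1 + s) = v\<^sup>2" using v2 by (auto simp: s_def field_simps)
      then have "r s = \<bar>v\<bar>" by (simp add: r_def)
      then have "E (u, s) = g (u, \<bar>v\<bar>)" using E(2)[of u s] s that by (simp add: A_def lift_def abs_less_iff)
      also have "\<dots> = g (u, v)" using even[of u v] that by (cases "0 \<le> v") auto
      finally show ?thesis by (simp add: s_def)
    qed
  qed
qed

text \<open>
  Rescaling reduces this to the unit square. The smaller radius leaves room for bounds on a compact
  square.
\<close>

lemma Whitney_even:
  fixes g :: "real \<times> real \<Rightarrow> real"
  assumes "r > 0" and g: "smooth_on ({-r<..<r} \<times> {-r<..<r}) g"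
    and even: "\<And>u v. \<bar>u\<bar> < r \<Longrightarrow> \<bar>v\<bar> < r \<Longrightarrow> g (u, - v) = g (u, v)"
  obtains d k where "0 < d" "d \<le> r" "smooth_on ({-d<..<d} \<times> {-d\<^sup>2<..<d\<^sup>2}) k"
    "\<And>u v. \<bar>u\<bar> < d \<Longrightarrow> \<bar>v\<bar> < d \<Longrightarrow> k (u, v\<^sup>2) = g (u, v)"
proof -
  define d where "d = r / 2"
  have d: "d > 0" "r = 2 * d" using assms(1) by (auto simp: d_def)
  have "smooth_on ({-2<..<2} \<times> {-2<..<2}) (\<lambda>p. g (d * fst p, d * snd p))"
  proof (rule smooth_on_compose[OF g])
    show "(\<lambda>p. (d * fst p, d * snd p)) ` ({- 2<..<2} \<times> {- 2<..<2}) \<subseteq> {- r<..<r} \<times> {- r<..<r}"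
    proof (rule image_subsetI)
      fix p :: "real \<times> real" assume "p \<in> {-2<..<2} \<times> {-2<..<2}"
      then have "\<bar>fst p\<bar> < 2" "\<bar>snd p\<bar> < 2" by auto
      then have "\<bar>d * fst p\<bar> < r" "\<bar>d * snd p\<bar> < r" using d by (simp_all add: abs_mult)
      then show "(d * fst p, d * snd p) \<in> {- r<..<r} \<times> {- r<..<r}" by (simp add: abs_less_iff)
    qed
  qed (auto simp: open_Times intro!: smooth_intros)
  then obtain k where k: "smooth_on ({-1<..<1} \<times> {-1<..<1}) k"
    "\<And>u v. \<bar>u\<bar> < 1 \<Longrightarrow> \<bar>v\<bar> < 1 \<Longrightarrow> k (u, v\<^sup>2) = g (d * u, d * v)"
    using Whitney_even_unit_square[of "\<lambda>p. g (d * fst p, d * snd p)"] even d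
    by (auto simp: abs_mult)
  show thesis
  proof
    show "0 < d" "d \<le> r" using d by auto
    show "smooth_on ({-d<..<d} \<times> {-d\<^sup>2<..<d\<^sup>2}) (\<lambda>p. k (fst p / d, snd p / d\<^sup>2))"
    proof (rule smooth_on_compose[OF k(1)])
      show "(\<lambda>p. (fst p / d, snd p / d\<^sup>2)) ` ({- d<..<d} \<times> {- d\<^sup>2<..<d\<^sup>2}) \<subseteq> {- 1<..<1} \<times> {- 1<..<1}"
        using d by (auto simp: divide_less_eq less_divide_eq)
    qed (use d in \<open>auto simp: open_Times intro!: smooth_intros\<close>)
    show "k (fst (u, v\<^sup>2) / d, snd (u, v\<^sup>2) / d\<^sup>2) = g (u, v)" if "\<bar>u\<bar> < d" "\<bar>v\<bar> < d" for u v
      using k(2)[of "u / d" "v / d"] that d by (simp add: power_divide)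
  qed
qed

section \<open>Diffeomorphism germs and equivalence of map germs\<close>

text \<open>
  The derivative of the inverse at \<open>y\<close> is a smooth function of \<open>g y\<close>, so differentiability of the
  inverse bootstraps itself to all orders.
\<close>

lemma smooth_on_local_inverse:
  fixes g :: "'b::euclidean_space \<Rightarrow> 'a::euclidean_space"
  assumes "open V" "open U" "g ` V \<subseteq> U"
    and g': "\<And>y. y \<in> V \<Longrightarrow> (g has_derivative J (g y)) (at y)" and J: "\<And>w. smooth_on U (\<lambda>x. J x w)"
  shows "smooth_on V g"
  unfolding smooth_on_def
proof
  fix k show "Ck_on k V g"
  proof (induction k)
    case 0
    then show ?case
      using g' by (auto intro!: continuous_at_imp_continuous_on has_derivative_continuous)
  next
    case (Suc k)
    have "Ck_on k V (\<lambda>y. J (g y) w)" for w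
      using Ck_on_compose[OF assms(1-3) Suc.IH, where g = "\<lambda>x. J x w"] J by (simp add: smooth_on_def)
    then show ?case by (intro Ck_on_SucI[OF assms(1) g'])
  qed
qed

text \<open>
  The nonlinear changes of coordinates below alter a single coordinate, that is, have the form
  \<open>x + q x e\<close> with a fixed vector \<open>e\<close>. For such maps the inverse of the derivative is explicit,
  \<open>w - dq w / (1 + dq e) e\<close>, which gives smoothness of the local inverse without any analysis of matrix
  inversion.
\<close>

lemma diffeo_germ_add_direction:
  fixes q :: "'a::euclidean_space \<Rightarrow> real"
  assumes q: "smooth_on U q" and "open U" "x0 \<in> U" and e: "1 + frechet_derivative q (at x0) e \<noteq> 0"
  shows "diffeo_germ (\<lambda>x. x + q x *\<^sub>R e) x0 (x0 + q x0 *\<^sub>R e)"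
proof -
  define d where "d x w = frechet_derivative q (at x) w" for x w
  have d: "(q has_derivative d x) (at x)" if "x \<in> U" for x
    using smooth_on_has_derivative[OF q that] by (simp add: d_def[abs_def])
  have d_smooth: "smooth_on U (\<lambda>x. d x w)" for w
    using smooth_on_frechet_derivative[OF q] by (simp add: d_def)
  define U1 where "U1 = U \<inter> (\<lambda>x. 1 + d x e) -` (- {0})"
  have U1: "open U1" "x0 \<in> U1" "U1 \<subseteq> U"
  proof -
    have "continuous_on U (\<lambda>x. 1 + d x e)"
      by (intro continuous_on_add continuous_on_const smooth_on_continuous[OF d_smooth])
    then show "open U1" unfolding U1_def by (rule continuous_open_preimage[OF _ assms(2)]) auto
  qed (use assms in \<open>auto simp: U1_def d_def\<close>)
  define D where "D x w = w + d x w *\<^sub>R e" for x w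
  define J where "J x w = w - (d x w / (1 + d x e)) *\<^sub>R e" for x w
  have lin: "bounded_linear (d x)" if "x \<in> U" for x
    using d[OF that] by (rule has_derivative_bounded_linear)
  have D_bl: "bounded_linear (D x)" "bounded_linear (J x)" if "x \<in> U1" for x
  proof -
    have "bounded_linear (d x)" using lin that U1 by auto
    then show "bounded_linear (D x)" "bounded_linear (J x)"
      unfolding D_def J_def
      by (auto intro!: bounded_linear_add bounded_linear_sub bounded_linear_ident
          bounded_linear_compose[OF bounded_linear_scaleR_left] bounded_linear_divide
          bounded_linear_compose[OF bounded_linear_divide])
  qed
  have JD: "J x (D x w) = w" "D x (J x w) = w" if "x \<in> U1" for x w
  proof -
    interpret dx: bounded_linear "d x" using lin that U1 by auto
    have nz: "1 + d x e \<noteq> 0" using that by (auto simp: U1_def)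
    have "d x w * (1 + d x e) / (1 + d x e) = d x w" using nz by simp
    then show "J x (D x w) = w"
      by (simp add: J_def D_def dx.add dx.scale algebra_simps)
    have "d x w - d x w / (1 + d x e) * d x e = d x w / (1 + d x e)" using nz by (simp add: field_simps)
    then show "D x (J x w) = w"
      by (simp add: J_def D_def dx.diff dx.scale)
  qed
  define F' where "F' x = Blinfun (D x)" for x
  have F': "blinfun_apply (F' x) = D x" if "x \<in> U1" for x
    using D_bl[OF that] by (simp add: F'_def bounded_linear_Blinfun_apply)
  have f_der: "((\<lambda>x. x + q x *\<^sub>R e) has_derivative blinfun_apply (F' x)) (at x)" if "x \<in> U1" for x
    unfolding F'[OF that] D_def using that U1 by (auto intro!: derivative_eq_intros d)
  have f_cont: "continuous_on U1 F'"
  proof (rule continuous_on_blinfun_componentwise)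
    fix i :: 'a
    have "continuous_on U1 (\<lambda>x. D x i)" unfolding D_def
      by (intro continuous_intros continuous_on_subset[OF smooth_on_continuous[OF d_smooth] U1(3)])
    then show "continuous_on U1 (\<lambda>x. blinfun_apply (F' x) i)"
      by (simp add: F' cong: continuous_on_cong)
  qed
  have inv: "Blinfun (J x0) o\<^sub>L F' x0 = id_blinfun"
    using JD(1)[OF U1(2)] D_bl[OF U1(2)] by (intro blinfun_eqI) (simp add: F'[OF U1(2)] bounded_linear_Blinfun_apply)
  obtain U' V g g' where IFT: "open U'" "U' \<subseteq> U1" "x0 \<in> U'" "open V" "x0 + q x0 *\<^sub>R e \<in> V"
    "homeomorphism U' V (\<lambda>x. x + q x *\<^sub>R e) g"
    "\<And>y. y \<in> V \<Longrightarrow> (g has_derivative (g' y)) (at y)"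
    "\<And>y. y \<in> V \<Longrightarrow> g' y = Hilbert_Choice.inv (blinfun_apply (F' (g y)))"
    "\<And>y. y \<in> V \<Longrightarrow> bij (blinfun_apply (F' (g y)))"
    by (rule inverse_function_theorem[OF U1(1) f_der f_cont U1(2) inv], assumption) (rule that)
  have gV: "g ` V \<subseteq> U1" using IFT(2,6) by (auto simp: homeomorphism_def)
  have "smooth_on V g"
  proof (rule smooth_on_local_inverse[OF IFT(4) U1(1) gV])
    fix y assume y: "y \<in> V"
    then have gy: "g y \<in> U1" using gV by auto
    have "Hilbert_Choice.inv (D (g y)) = J (g y)"
      by (rule inv_unique_comp) (auto simp: fun_eq_iff JD[OF gy])
    then show "(g has_derivative J (g y)) (at y)" using IFT(7,8)[OF y] F'[OF gy] by simp
  next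
    fix w show "smooth_on U1 (\<lambda>x. J x w)" unfolding J_def
      by (intro smooth_intros smooth_on_subset[OF d_smooth] U1) (auto simp: U1_def)
  qed
  moreover have "smooth_on U' (\<lambda>x. x + q x *\<^sub>R e)"
    using IFT(1,2) U1(3) by (intro smooth_intros smooth_on_subset[OF q]) auto
  ultimately show ?thesis
    unfolding diffeo_germ_def using IFT(1-6) unfolding homeomorphism_def by blast
qed

lemma diffeo_germ_inverse:
  assumes "diffeo_germ \<phi> p q"
  obtains \<theta> where "diffeo_germ \<theta> q p" "\<forall>\<^sub>F x in nhds p. \<theta> (\<phi> x) = x" "\<forall>\<^sub>F y in nhds q. \<phi> (\<theta> y) = y"
proof -
  obtain U V \<theta> where *: "\<phi> p = q" "open U" "open V" "p \<in> U" "\<phi> ` U = V" "smooth_on U \<phi>" "smooth_on V \<theta>"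
    "\<And>x. x \<in> U \<Longrightarrow> \<theta> (\<phi> x) = x" "\<And>y. y \<in> V \<Longrightarrow> \<phi> (\<theta> y) = y"
    using assms unfolding diffeo_germ_def by blast
  have "\<theta> ` V = U" using *(5,8) by force
  then have "diffeo_germ \<theta> q p" unfolding diffeo_germ_def using * by blast
  moreover have "\<forall>\<^sub>F x in nhds p. \<theta> (\<phi> x) = x" "\<forall>\<^sub>F y in nhds q. \<phi> (\<theta> y) = y"
    using * by (auto simp: eventually_nhds)
  ultimately show thesis by (rule that)
qed

lemma diffeo_germ_smooth: "diffeo_germ \<phi> p q \<Longrightarrow> smooth_germ p \<phi>"
  unfolding diffeo_germ_def smooth_germ_def by blast

lemma smooth_germ_isCont: "smooth_germ p f \<Longrightarrow> isCont f p"
  unfolding smooth_germ_def using smooth_on_continuous continuous_on_eq_continuous_at by blast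

lemma diffeo_germ_filterlim: "diffeo_germ \<phi> p q \<Longrightarrow> filterlim \<phi> (nhds q) (nhds p)"
  using smooth_germ_isCont[OF diffeo_germ_smooth, of \<phi> p q]
  by (simp add: isCont_def tendsto_at_iff_tendsto_nhds) (simp add: diffeo_germ_def)

lemma diffeo_germ_eventually:
  "diffeo_germ \<phi> p q \<Longrightarrow> \<forall>\<^sub>F y in nhds q. P y \<Longrightarrow> \<forall>\<^sub>F x in nhds p. P (\<phi> x)"
  by (rule eventually_compose_filterlim[OF _ diffeo_germ_filterlim])

lemma diffeo_germ_compose:
  assumes "diffeo_germ \<phi> p q" "diffeo_germ \<psi> q r"
  shows "diffeo_germ (\<lambda>x. \<psi> (\<phi> x)) p r"
proof -
  obtain U V \<theta> where 1: "\<phi> p = q" "open U" "open V" "p \<in> U" "\<phi> ` U = V" "smooth_on U \<phi>" "smooth_on V \<theta>"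
    "\<And>x. x \<in> U \<Longrightarrow> \<theta> (\<phi> x) = x" "\<And>y. y \<in> V \<Longrightarrow> \<phi> (\<theta> y) = y"
    using assms(1) unfolding diffeo_germ_def by blast
  obtain U' V' \<theta>' where 2: "\<psi> q = r" "open U'" "open V'" "q \<in> U'" "\<psi> ` U' = V'" "smooth_on U' \<psi>" "smooth_on V' \<theta>'"
    "\<And>x. x \<in> U' \<Longrightarrow> \<theta>' (\<psi> x) = x" "\<And>y. y \<in> V' \<Longrightarrow> \<psi> (\<theta>' y) = y"
    using assms(2) unfolding diffeo_germ_def by blast
  define A where "A = U \<inter> \<phi> -` U'"
  define B where "B = V' \<inter> \<theta>' -` V"
  have A: "open A" "A \<subseteq> U" "\<phi> ` A \<subseteq> U'" unfolding A_def
    using continuous_open_preimage[OF smooth_on_continuous[OF 1(6)] 1(2) 2(2)] by auto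
  have B: "open B" "B \<subseteq> V'" "\<theta>' ` B \<subseteq> V" unfolding B_def
    using continuous_open_preimage[OF smooth_on_continuous[OF 2(7)] 2(3) 1(3)] by auto
  have AB: "(\<lambda>x. \<psi> (\<phi> x)) ` A = B"
  proof
    show "(\<lambda>x. \<psi> (\<phi> x)) ` A \<subseteq> B"
      using 1(5) 2(5,8) by (auto simp: A_def B_def)
    show "B \<subseteq> (\<lambda>x. \<psi> (\<phi> x)) ` A"
    proof
      fix y assume y: "y \<in> B"
      then obtain x where x: "x \<in> U" "\<theta>' y = \<phi> x" using 1(5) by (auto simp: B_def)
      obtain z where z: "z \<in> U'" "y = \<psi> z" using y 2(5) by (auto simp: B_def)
      then have "\<theta>' y = z" using 2(8) by simp
      then have "\<phi> x \<in> U'" "\<psi> (\<phi> x) = y" using x z by auto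
      then show "y \<in> (\<lambda>x. \<psi> (\<phi> x)) ` A" using x by (force simp: A_def)
    qed
  qed
  have "smooth_on A (\<lambda>x. \<psi> (\<phi> x))"
    by (rule smooth_on_compose[OF 2(6) smooth_on_subset[OF 1(6) A(2)] A(3) A(1) 2(2)])
  moreover have "smooth_on B (\<lambda>y. \<theta> (\<theta>' y))"
    by (rule smooth_on_compose[OF 1(7) smooth_on_subset[OF 2(7) B(2)] B(3) B(1) 1(3)])
  moreover have "p \<in> A" "\<psi> (\<phi> p) = r" using 1 2 by (auto simp: A_def)
  moreover have "\<forall>x\<in>A. \<theta> (\<theta>' (\<psi> (\<phi> x))) = x" using 1(8) 2(8) by (auto simp: A_def)
  moreover have "\<forall>y\<in>B. \<psi> (\<phi> (\<theta> (\<theta>' y))) = y" using 1(9) 2(9) by (auto simp: B_def)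
  ultimately show ?thesis unfolding diffeo_germ_def using A(1) B(1) AB by blast
qed

lemma diffeo_germ_affine:
  fixes T :: "'a::euclidean_space \<Rightarrow> 'b::euclidean_space"
  assumes "bounded_linear T" "bounded_linear S" "\<And>x. S (T x) = x" "\<And>y. T (S y) = y"
  shows "diffeo_germ (\<lambda>x. T (x - c)) p (T (p - c))"
proof -
  have "range (\<lambda>x. T (x - c)) = UNIV"
  proof -
    have "y = T ((S y + c) - c)" for y using assms by simp
    then show ?thesis by (intro surjI[of _ "\<lambda>y. S y + c"]) (rule sym)
  qed
  moreover have "smooth_on UNIV (\<lambda>x. T (x - c))"
    by (rule smooth_on_bounded_linear[OF assms(1) open_UNIV]) (intro smooth_intros open_UNIV)
  moreover have "smooth_on UNIV (\<lambda>y. S y + c)"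
    by (intro smooth_on_add smooth_on_bounded_linear[OF assms(2)] smooth_intros open_UNIV)
  moreover have "\<forall>x\<in>UNIV. S (T (x - c)) + c = x" "\<forall>y\<in>UNIV. T (S y + c - c) = y"
    using assms(3,4) by simp_all
  ultimately have "open UNIV \<and> open UNIV \<and> p \<in> UNIV \<and> range (\<lambda>x. T (x - c)) = UNIV \<and>
      smooth_on UNIV (\<lambda>x. T (x - c)) \<and> smooth_on UNIV (\<lambda>y. S y + c) \<and>
      (\<forall>x\<in>UNIV. S (T (x - c)) + c = x) \<and> (\<forall>y\<in>UNIV. T (S y + c - c) = y)"
    by simp
  then show ?thesis unfolding diffeo_germ_def
    by (intro conjI[OF refl]) (rule exI, rule exI, rule exI)
qed

lemma diffeo_germ_id: "diffeo_germ (\<lambda>x. x) p (p :: 'a::euclidean_space)"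
  using diffeo_germ_affine[of "\<lambda>x. x" "\<lambda>x. x" 0 p] by (simp add: bounded_linear_ident)

lemma A_equivalent_trans:
  assumes "A_equivalent f p g q" "A_equivalent g q h r"
  shows "A_equivalent f p h r"
proof -
  obtain \<phi> \<Phi> where 1: "diffeo_germ \<phi> p q" "diffeo_germ \<Phi> (f p) (g q)" "\<forall>\<^sub>F x in nhds p. \<Phi> (f x) = g (\<phi> x)"
    using assms(1) unfolding A_equivalent_def by blast
  obtain \<psi> \<Psi> where 2: "diffeo_germ \<psi> q r" "diffeo_germ \<Psi> (g q) (h r)" "\<forall>\<^sub>F x in nhds q. \<Psi> (g x) = h (\<psi> x)"
    using assms(2) unfolding A_equivalent_def by blast
  have "\<forall>\<^sub>F x in nhds p. \<Psi> (\<Phi> (f x)) = h (\<psi> (\<phi> x))"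
    using 1(3) diffeo_germ_eventually[OF 1(1) 2(3)] by eventually_elim simp
  then show ?thesis unfolding A_equivalent_def
    using diffeo_germ_compose[OF 1(1) 2(1)] diffeo_germ_compose[OF 1(2) 2(2)] by blast
qed

lemma A_equivalent_sym:
  assumes "A_equivalent f p g q" and "isCont f p"
  shows "A_equivalent g q f p"
proof -
  obtain \<phi> \<Phi> where 1: "diffeo_germ \<phi> p q" "diffeo_germ \<Phi> (f p) (g q)" "\<forall>\<^sub>F x in nhds p. \<Phi> (f x) = g (\<phi> x)"
    using assms(1) unfolding A_equivalent_def by blast
  obtain \<theta> where t: "diffeo_germ \<theta> q p" "\<forall>\<^sub>F x in nhds p. \<theta> (\<phi> x) = x" "\<forall>\<^sub>F y in nhds q. \<phi> (\<theta> y) = y"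
    using diffeo_germ_inverse[OF 1(1)] .
  obtain \<Theta> where T: "diffeo_germ \<Theta> (g q) (f p)" "\<forall>\<^sub>F x in nhds (f p). \<Theta> (\<Phi> x) = x"
    using diffeo_germ_inverse[OF 1(2)] .
  have "filterlim f (nhds (f p)) (nhds p)" using assms(2) by (simp add: isCont_def tendsto_at_iff_tendsto_nhds)
  from eventually_compose_filterlim[OF T(2) this]
  have "\<forall>\<^sub>F x in nhds p. \<Theta> (\<Phi> (f x)) = f x" .
  then have "\<forall>\<^sub>F y in nhds q. \<Theta> (\<Phi> (f (\<theta> y))) = f (\<theta> y)" by (rule diffeo_germ_eventually[OF t(1)])
  then have "\<forall>\<^sub>F y in nhds q. \<Theta> (g y) = f (\<theta> y)"
    using t(3) diffeo_germ_eventually[OF t(1) 1(3)] by eventually_elim simp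
  then show ?thesis unfolding A_equivalent_def using t(1) T(1) by blast
qed

lemma A_equivalent_source:
  assumes "diffeo_germ \<phi> p q" "\<forall>\<^sub>F x in nhds p. f x = g (\<phi> x)"
  shows "A_equivalent f p g q"
proof -
  have "f p = g q" using eventually_nhds_x_imp_x[OF assms(2)] assms(1) by (simp add: diffeo_germ_def)
  then show ?thesis unfolding A_equivalent_def using assms diffeo_germ_id[of "f p"] by fastforce
qed

lemma A_equivalent_target:
  assumes "diffeo_germ \<Phi> (f p) y" "\<forall>\<^sub>F x in nhds p. \<Phi> (f x) = g x"
  shows "A_equivalent f p g p"
proof -
  have "y = g p" using eventually_nhds_x_imp_x[OF assms(2)] assms(1) by (simp add: diffeo_germ_def)
  then show ?thesis unfolding A_equivalent_def using assms diffeo_germ_id[of p] by blast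
qed

lemma diffeo_germ_has_derivative:
  "diffeo_germ \<phi> p q \<Longrightarrow> (\<phi> has_derivative frechet_derivative \<phi> (at p)) (at p)"
  using diffeo_germ_smooth smooth_on_has_derivative unfolding smooth_germ_def by blast

lemma diffeo_germ_derivative_injective:
  assumes "diffeo_germ \<phi> p q" "frechet_derivative \<phi> (at p) w = 0"
  shows "w = 0"
proof -
  obtain \<theta> where t: "diffeo_germ \<theta> q p" "\<forall>\<^sub>F x in nhds p. \<theta> (\<phi> x) = x" "\<forall>\<^sub>F y in nhds q. \<phi> (\<theta> y) = y"
    using diffeo_germ_inverse[OF assms(1)] .
  note d = diffeo_germ_has_derivative
  have "\<phi> p = q" using assms(1) by (simp add: diffeo_germ_def)
  have "((\<lambda>x. \<theta> (\<phi> x)) has_derivative (\<lambda>w. frechet_derivative \<theta> (at q) (frechet_derivative \<phi> (at p) w))) (at p)"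
    by (rule has_derivative_compose[OF d[OF assms(1)]]) (simp only: \<open>\<phi> p = q\<close> d[OF t(1)])
  moreover obtain S where S: "open S" "p \<in> S" "\<And>x. x \<in> S \<Longrightarrow> \<theta> (\<phi> x) = x"
    using t(2) unfolding eventually_nhds by blast
  ultimately have "((\<lambda>x. x) has_derivative (\<lambda>w. frechet_derivative \<theta> (at q) (frechet_derivative \<phi> (at p) w))) (at p)"
    by (rule has_derivative_transform_within_open)
  from fun_cong[OF has_derivative_unique[OF this has_derivative_ident], of w]
  have "frechet_derivative \<theta> (at q) (frechet_derivative \<phi> (at p) w) = w" .
  moreover have "frechet_derivative \<theta> (at q) 0 = 0"
    using d[OF t(1)] by (intro linear_0 has_derivative_linear)
  ultimately show ?thesis using assms(2) by simp
qed

section \<open>Squares around the origin\<close>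

text \<open>
  Squares are a neighbourhood basis of the origin that is adapted to partial derivatives: they
  contain the segments along which functions are integrated.
\<close>

definition square :: "real \<Rightarrow> (real \<times> real) set" where
  "square r = {-r<..<r} \<times> {-r<..<r}"

lemma mem_square [simp]: "(u, v) \<in> square r \<longleftrightarrow> \<bar>u\<bar> < r \<and> \<bar>v\<bar> < r"
  by (auto simp: square_def abs_less_iff)

lemma open_square [simp]: "open (square r)"
  by (simp add: square_def open_Times)

lemma square_subset_open:
  assumes "open S" "0 \<in> S"
  obtains r where "r > 0" "square r \<subseteq> S"
proof -
  have "(0::real, 0::real) \<in> S" using assms(2) by (simp add: zero_prod_def)
  then obtain A B where AB: "open A" "open B" "(0::real) \<in> A" "(0::real) \<in> B" "A \<times> B \<subseteq> S"
    using open_prod_elim[OF assms(1)] by (metis mem_Sigma_iff)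
  obtain a where a: "a > 0" "ball 0 a \<subseteq> A" using AB(1,3) by (meson openE)
  obtain b where b: "b > 0" "ball 0 b \<subseteq> B" using AB(2,4) by (meson openE)
  have "square (min a b) \<subseteq> S"
  proof
    fix p assume "p \<in> square (min a b)"
    then have "fst p \<in> ball 0 a" "snd p \<in> ball 0 b" by (auto simp: square_def)
    then have "fst p \<in> A" "snd p \<in> B" using a(2) b(2) by blast+
    then have "(fst p, snd p) \<in> A \<times> B" by blast
    then show "p \<in> S" using AB(5) by auto
  qed
  then show thesis using a b that[of "min a b"] by simp
qed

lemma eventually_square: "(\<forall>\<^sub>F q in nhds 0. P q) \<longleftrightarrow> (\<exists>r>0. \<forall>q\<in>square r. P q)"
proof
  assume "\<forall>\<^sub>F q in nhds 0. P q"
  then obtain S where "open S" "0 \<in> S" "\<forall>q\<in>S. P q" by (auto simp: eventually_nhds)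
  then show "\<exists>r>0. \<forall>q\<in>square r. P q" by (metis square_subset_open subsetD)
next
  assume "\<exists>r>0. \<forall>q\<in>square r. P q"
  then obtain r where "r > 0" "\<forall>q\<in>square r. P q" by blast
  then show "\<forall>\<^sub>F q in nhds 0. P q"
    unfolding eventually_nhds by (intro exI[of _ "square r"]) (simp add: zero_prod_def)
qed

lemma square_mono: "r \<le> r' \<Longrightarrow> square r \<subseteq> square r'"
  by (auto simp: square_def)

lemma smooth_germ_square:
  "smooth_germ 0 f \<longleftrightarrow> (\<exists>r>0. smooth_on (square r) f)"
proof
  assume "smooth_germ 0 f"
  then obtain U where "open U" "0 \<in> U" "smooth_on U f" unfolding smooth_germ_def by blast
  then show "\<exists>r>0. smooth_on (square r) f" by (metis square_subset_open smooth_on_subset)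
next
  assume "\<exists>r>0. smooth_on (square r) f"
  then obtain r where "r > 0" "smooth_on (square r) f" by blast
  moreover have "0 \<in> square r" using \<open>r > 0\<close> by (simp add: zero_prod_def)
  ultimately show "smooth_germ 0 f" unfolding smooth_germ_def using open_square by blast
qed

text \<open>
  Hadamard's lemma with the bounds on both variables phrased alike.
\<close>

lemma Hadamard_square:
  fixes g :: "real \<times> real \<Rightarrow> real"
  assumes g: "smooth_on (square r) g" and 0: "\<And>u. \<bar>u\<bar> < r \<Longrightarrow> g (u, 0) = 0"
  obtains h where "smooth_on (square r) h" "\<And>u v. \<bar>u\<bar> < r \<Longrightarrow> \<bar>v\<bar> < r \<Longrightarrow> g (u, v) = v * h (u, v)"
    "\<And>u. \<bar>u\<bar> < r \<Longrightarrow> h (u, 0) = pd_v g (u, 0)"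
proof (rule Hadamard_lemma[OF open_greaterThanLessThan g[unfolded square_def]])
  show "g (u, 0) = 0" if "u \<in> {-r<..<r}" for u using 0[of u] that by (simp add: abs_less_iff)
next
  fix h assume *: "smooth_on ({-r<..<r} \<times> {-r<..<r}) h"
    "\<And>u v. u \<in> {-r<..<r} \<Longrightarrow> \<bar>v\<bar> < r \<Longrightarrow> g (u, v) = v * h (u, v)"
    "\<And>u. u \<in> {-r<..<r} \<Longrightarrow> h (u, 0) = pd_v g (u, 0)"
  show thesis by (rule that[of h]) (use * in \<open>auto simp: square_def abs_less_iff\<close>)
qed

lemma parabolic_box_mono:
  fixes d e :: real
  assumes "0 < d" "d \<le> e"
  shows "{-d<..<d} \<times> {-d\<^sup>2<..<d\<^sup>2} \<subseteq> {-e<..<e} \<times> {-e\<^sup>2<..<e\<^sup>2}"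
proof -
  have box: "{-d<..<d} \<times> {-D<..<D} \<subseteq> {-e<..<e} \<times> {-E<..<E}" if "D \<le> E" for D E :: real
    using that assms by auto
  have "d\<^sup>2 \<le> e\<^sup>2" using assms by (intro power_mono) auto
  then show ?thesis by (rule box)
qed

section \<open>Functions of a folded variable\<close>

text \<open>
  The even part is a smooth function of \<open>(u, v\<^sup>2)\<close> by Whitney's theorem, and so is the odd part after
  division by \<open>v\<close>. The domain of such a function is \<open>\<bar>u\<bar> < d\<close>, \<open>\<bar>y\<bar> < d\<^sup>2\<close>.
\<close>

lemma even_odd_decomposition:
  fixes f :: "real \<times> real \<Rightarrow> real"
  assumes "r > 0" and f: "smooth_on (square r) f"
  obtains d k0 k1 where "0 < d" "d \<le> r"
    "smooth_on ({-d<..<d} \<times> {-d\<^sup>2<..<d\<^sup>2}) k0" "smooth_on ({-d<..<d} \<times> {-d\<^sup>2<..<d\<^sup>2}) k1"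
    "\<And>u v. \<bar>u\<bar> < d \<Longrightarrow> \<bar>v\<bar> < d \<Longrightarrow> f (u, v) = k0 (u, v\<^sup>2) + v * k1 (u, v\<^sup>2)"
    "\<And>u. \<bar>u\<bar> < d \<Longrightarrow> k1 (u, 0) = pd_v f (u, 0)"
proof -
  have refl: "smooth_on (square r) (\<lambda>p. f (fst p, - snd p))"
    by (rule smooth_on_compose[OF f]) (auto simp: square_def intro!: smooth_intros open_Times)
  define fo where "fo = (\<lambda>p. (f p - f (fst p, - snd p)) / 2)"
  define fe where "fe = (\<lambda>p. (f p + f (fst p, - snd p)) / 2)"
  have smooth: "smooth_on (square r) fo" "smooth_on (square r) fe"
    unfolding fo_def fe_def by (auto intro!: smooth_intros f refl)
  have fo0: "fo (u, 0) = 0" for u by (simp add: fo_def)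
  obtain h where h: "smooth_on (square r) h"
    "\<And>u v. \<bar>u\<bar> < r \<Longrightarrow> \<bar>v\<bar> < r \<Longrightarrow> fo (u, v) = v * h (u, v)"
    "\<And>u. \<bar>u\<bar> < r \<Longrightarrow> h (u, 0) = pd_v fo (u, 0)"
    by (rule Hadamard_square[OF smooth(1) fo0]) (rule that)
  have h_even: "h (u, - v) = h (u, v)" if "\<bar>u\<bar> < r" "\<bar>v\<bar> < r" for u v
  proof (cases "v = 0")
    case False
    have "v * h (u, v) = fo (u, v)" "- v * h (u, - v) = fo (u, - v)" using h(2)[of u v] h(2)[of u "- v"] that by auto
    moreover have "fo (u, - v) = - fo (u, v)" by (simp add: fo_def field_simps)
    ultimately have "v * h (u, - v) = v * h (u, v)" by simp
    then show ?thesis using False by (metis mult_left_cancel)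
  qed simp
  obtain d0 k0 where k0: "0 < d0" "d0 \<le> r" "smooth_on ({-d0<..<d0} \<times> {-d0\<^sup>2<..<d0\<^sup>2}) k0"
    "\<And>u v. \<bar>u\<bar> < d0 \<Longrightarrow> \<bar>v\<bar> < d0 \<Longrightarrow> k0 (u, v\<^sup>2) = fe (u, v)"
    by (rule Whitney_even[OF assms(1) smooth(2)[unfolded square_def]]) (auto simp: fe_def)
  obtain d1 k1 where k1: "0 < d1" "d1 \<le> r" "smooth_on ({-d1<..<d1} \<times> {-d1\<^sup>2<..<d1\<^sup>2}) k1"
    "\<And>u v. \<bar>u\<bar> < d1 \<Longrightarrow> \<bar>v\<bar> < d1 \<Longrightarrow> k1 (u, v\<^sup>2) = h (u, v)"
    by (rule Whitney_even[OF assms(1) h(1)[unfolded square_def] h_even]) (assumption+, rule that)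
  define d where "d = min d0 d1"
  have d: "0 < d" "d \<le> d0" "d \<le> d1" "d \<le> r" using k0 k1 by (auto simp: d_def)
  show thesis
  proof
    show "0 < d" "d \<le> r" by fact+
    have "{-d<..<d} \<times> {-d\<^sup>2<..<d\<^sup>2} \<subseteq> {-d0<..<d0} \<times> {-d0\<^sup>2<..<d0\<^sup>2}"
      "{-d<..<d} \<times> {-d\<^sup>2<..<d\<^sup>2} \<subseteq> {-d1<..<d1} \<times> {-d1\<^sup>2<..<d1\<^sup>2}"
      by (rule parabolic_box_mono; use d in simp)+
    then show "smooth_on ({-d<..<d} \<times> {-d\<^sup>2<..<d\<^sup>2}) k0" "smooth_on ({-d<..<d} \<times> {-d\<^sup>2<..<d\<^sup>2}) k1"
      using smooth_on_subset[OF k0(3)] smooth_on_subset[OF k1(3)] by blast+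
    show "f (u, v) = k0 (u, v\<^sup>2) + v * k1 (u, v\<^sup>2)" if "\<bar>u\<bar> < d" "\<bar>v\<bar> < d" for u v
    proof -
      have "f (u, v) = fe (u, v) + fo (u, v)" by (simp add: fe_def fo_def field_simps)
      then show ?thesis using that d k0(4)[of u v] k1(4)[of u v] h(2)[of u v] by simp
    qed
    show "k1 (u, 0) = pd_v f (u, 0)" if "\<bar>u\<bar> < d" for u
    proof -
      have d0: "f differentiable (at (u, 0))" "fo differentiable (at (u, 0))"
        using smooth_on_differentiable[OF f] smooth_on_differentiable[OF smooth(1)] that d by auto
      have f1: "((\<lambda>t. f (u, t)) has_real_derivative pd_v f (u, 0)) (at 0)" by (rule pd_real_slices(2)[OF d0(1)])
      then have f1': "((\<lambda>t. f (u, t)) has_real_derivative pd_v f (u, 0)) (at (- 0))" by simp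
      have "((\<lambda>t::real. - t) has_real_derivative - 1) (at 0)" by (auto intro!: derivative_eq_intros)
      from DERIV_chain2[OF f1' this]
      have f2: "((\<lambda>t. f (u, - t)) has_real_derivative - pd_v f (u, 0)) (at 0)" by simp
      from DERIV_cdivide[OF DERIV_diff[OF f1 f2], of 2]
      have "((\<lambda>t. fo (u, t)) has_real_derivative pd_v f (u, 0)) (at 0)" by (simp add: fo_def)
      from DERIV_unique[OF this pd_real_slices(2)[OF d0(2)]] have "pd_v fo (u, 0) = pd_v f (u, 0)" by simp
      then show ?thesis using k1(4)[of u 0] h(3)[of u] that d by simp
    qed
  qed
qed

text \<open>
  If \<open>c\<^sub>v\<close> is \<open>v\<close> times a smooth function, then \<open>c\<close> is a function of \<open>(u, v\<^sup>2)\<close> plus \<open>v ^ 3\<close> times another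
  one: integrate the even-odd decomposition of \<open>f\<close> in \<open>v\<close>. The lowest odd coefficient of \<open>c\<close> records
  \<open>f\<^sub>v\<close> on the axis, and it decides later whether a frontal has a cuspidal cross cap.
\<close>

lemma fold_primitive:
  fixes c f :: "real \<times> real \<Rightarrow> real"
  assumes "r > 0" and c: "smooth_on (square r) c" and f: "smooth_on (square r) f"
    and c_v: "\<And>u v. \<bar>u\<bar> < r \<Longrightarrow> \<bar>v\<bar> < r \<Longrightarrow> pd_v c (u, v) = 2 * a * v * f (u, v)"
  obtains d k m where "0 < d" "d \<le> r"
    "smooth_on ({-d<..<d} \<times> {-d\<^sup>2<..<d\<^sup>2}) k" "smooth_on ({-d<..<d} \<times> {-d\<^sup>2<..<d\<^sup>2}) m"
    "\<And>u v. \<bar>u\<bar> < d \<Longrightarrow> \<bar>v\<bar> < d \<Longrightarrow> c (u, v) = k (u, v\<^sup>2) + v ^ 3 * m (u, v\<^sup>2)"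
    "\<And>u. \<bar>u\<bar> < d \<Longrightarrow> m (u, 0) = 2 * a / 3 * pd_v f (u, 0)"
proof -
  obtain d k0 k1 where d: "0 < d" "d \<le> r"
    and k: "smooth_on ({-d<..<d} \<times> {-d\<^sup>2<..<d\<^sup>2}) k0" "smooth_on ({-d<..<d} \<times> {-d\<^sup>2<..<d\<^sup>2}) k1"
    and f_eq: "\<And>u v. \<bar>u\<bar> < d \<Longrightarrow> \<bar>v\<bar> < d \<Longrightarrow> f (u, v) = k0 (u, v\<^sup>2) + v * k1 (u, v\<^sup>2)"
    and k1_0: "\<And>u. \<bar>u\<bar> < d \<Longrightarrow> k1 (u, 0) = pd_v f (u, 0)"
    using even_odd_decomposition[OF assms(1) f] by blast
  define B where "B = {-d\<^sup>2<..<d\<^sup>2}"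
  have star: "s * y \<in> B" if "0 \<le> s" "s \<le> 1" "y \<in> B" for s y
  proof -
    have "\<bar>s * y\<bar> \<le> 1 * \<bar>y\<bar>" unfolding abs_mult using that by (intro mult_right_mono) auto
    then show ?thesis using that by (auto simp: B_def abs_less_iff)
  qed
  have star2: "s\<^sup>2 * y \<in> B" if "0 \<le> s" "s \<le> 1" "y \<in> B" for s y :: real
    using that by (intro star) (auto simp: power_le_one)
  define I0 where "I0 = (\<lambda>(u, y). integral {0..1} (\<lambda>s. 1 * k0 (u, s * y)))"
  define I1 where "I1 = (\<lambda>(u, y). integral {0..1} (\<lambda>s. s\<^sup>2 * k1 (u, s\<^sup>2 * y)))"
  have I: "smooth_on ({-d<..<d} \<times> B) I0" "smooth_on ({-d<..<d} \<times> B) I1"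
    unfolding I0_def I1_def
    by (rule smooth_on_weighted_integral; use k star star2 in \<open>auto simp: B_def intro!: continuous_intros\<close>)+
  define K where "K = (\<lambda>p. c (fst p, 0) + a * (snd p * I0 p))"
  define m where "m = (\<lambda>p. 2 * a * I1 p)"
  have opn: "open ({-d<..<d} \<times> B)" by (simp add: B_def open_Times)
  have K_smooth: "smooth_on ({-d<..<d} \<times> B) K"
    unfolding K_def
  proof (intro smooth_intros I opn)
    show "smooth_on ({-d<..<d} \<times> B) (\<lambda>p. c (fst p, 0))"
      by (rule smooth_on_compose[OF c]) (use d in \<open>auto intro!: smooth_intros opn\<close>)
  qed
  have m_smooth: "smooth_on ({-d<..<d} \<times> B) m"
    unfolding m_def by (intro smooth_intros I opn)
  have c_eq: "c (u, v) = K (u, v\<^sup>2) + v ^ 3 * m (u, v\<^sup>2)" if u: "\<bar>u\<bar> < d" and v: "\<bar>v\<bar> < d" for u v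
  proof (rule eq_if_same_derivative[OF _ _ _ v])
    fix x assume x: "\<bar>x\<bar> < d"
    have x2: "\<bar>x\<^sup>2\<bar> < d\<^sup>2" using power_strict_mono[of "\<bar>x\<bar>" d 2] x by simp
    show "((\<lambda>v. c (u, v)) has_real_derivative 2 * a * x * f (u, x)) (at x)"
      using pd_real_slices(2)[OF smooth_on_differentiable[OF c], of u x] c_v[of u x] u x d by simp
    have "continuous_on {-d\<^sup>2<..<d\<^sup>2} (\<lambda>y. k0 (u, y))"
      by (rule continuous_on_compose2[OF smooth_on_continuous[OF k(1)]])
        (use u in \<open>auto intro!: continuous_intros\<close>)
    from scaled_integral_has_derivative[OF this x2]
    have D0: "((\<lambda>y. y * I0 (u, y)) has_real_derivative k0 (u, x\<^sup>2)) (at (x\<^sup>2))" by (simp add: I0_def)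
    have "((\<lambda>v. v\<^sup>2) has_real_derivative 2 * x) (at x)" by (auto intro!: derivative_eq_intros)
    from DERIV_chain2[OF D0 this]
    have D1: "((\<lambda>v. v\<^sup>2 * I0 (u, v\<^sup>2)) has_real_derivative k0 (u, x\<^sup>2) * (2 * x)) (at x)" .
    have "continuous_on {-d<..<d} (\<lambda>v. v\<^sup>2 * k1 (u, v\<^sup>2))"
    proof (intro continuous_intros continuous_on_compose2[OF smooth_on_continuous[OF k(2)]])
      show "(\<lambda>v. (u, v\<^sup>2)) ` {-d<..<d} \<subseteq> {-d<..<d} \<times> {-d\<^sup>2<..<d\<^sup>2}"
      proof (rule image_subsetI)
        fix v assume "v \<in> {-d<..<d}"
        then have "\<bar>v\<bar> < d" by auto
        then have "v\<^sup>2 < d\<^sup>2" using power_strict_mono[of "\<bar>v\<bar>" d 2] by simp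
        moreover have "- (d\<^sup>2) < v\<^sup>2" using d by (smt (verit) zero_le_power2 zero_less_power)
        ultimately show "(u, v\<^sup>2) \<in> {-d<..<d} \<times> {-d\<^sup>2<..<d\<^sup>2}" using u by auto
      qed
    qed
    from scaled_integral_has_derivative[OF this x]
    have D2: "((\<lambda>v. v * integral {0..1} (\<lambda>s. (s * v)\<^sup>2 * k1 (u, (s * v)\<^sup>2))) has_real_derivative x\<^sup>2 * k1 (u, x\<^sup>2)) (at x)" .
    have "v * integral {0..1} (\<lambda>s. (s * v)\<^sup>2 * k1 (u, (s * v)\<^sup>2)) = v ^ 3 * I1 (u, v\<^sup>2)" for v
    proof -
      have "(\<lambda>s. (s * v)\<^sup>2 * k1 (u, (s * v)\<^sup>2)) = (\<lambda>s. v\<^sup>2 * (s\<^sup>2 * k1 (u, s\<^sup>2 * v\<^sup>2)))"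
        by (simp add: fun_eq_iff power_mult_distrib)
      then show ?thesis by (simp add: I1_def power3_eq_cube power2_eq_square)
    qed
    then have D2': "((\<lambda>v. v ^ 3 * I1 (u, v\<^sup>2)) has_real_derivative x\<^sup>2 * k1 (u, x\<^sup>2)) (at x)" using D2 by simp
    have "((\<lambda>v. (c (u, 0) + a * (v\<^sup>2 * I0 (u, v\<^sup>2))) + 2 * a * (v ^ 3 * I1 (u, v\<^sup>2)))
        has_real_derivative (0 + a * (k0 (u, x\<^sup>2) * (2 * x))) + 2 * a * (x\<^sup>2 * k1 (u, x\<^sup>2))) (at x)"
      by (intro DERIV_add DERIV_const DERIV_cmult D1 D2')
    moreover have "(0 + a * (k0 (u, x\<^sup>2) * (2 * x))) + 2 * a * (x\<^sup>2 * k1 (u, x\<^sup>2)) = 2 * a * x * f (u, x)"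
      using f_eq[OF u x] by (simp add: algebra_simps power2_eq_square)
    moreover have "(\<lambda>v. (c (u, 0) + a * (v\<^sup>2 * I0 (u, v\<^sup>2))) + 2 * a * (v ^ 3 * I1 (u, v\<^sup>2)))
        = (\<lambda>v. K (u, v\<^sup>2) + v ^ 3 * m (u, v\<^sup>2))"
      by (simp add: K_def m_def fun_eq_iff)
    ultimately show "((\<lambda>v. K (u, v\<^sup>2) + v ^ 3 * m (u, v\<^sup>2)) has_real_derivative 2 * a * x * f (u, x)) (at x)"
      by simp
  qed (simp add: K_def)
  have "((\<lambda>s. s\<^sup>2) has_integral (1/3::real)) {0..1}"
  proof -
    have "((\<lambda>s::real. s\<^sup>2) has_integral (\<lambda>s. s ^ 3 / 3) 1 - (\<lambda>s. s ^ 3 / 3) 0) {0..1}"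
      by (rule fundamental_theorem_of_calculus)
        (auto intro!: derivative_eq_intros simp flip: has_real_derivative_iff_has_vector_derivative)
    then show ?thesis by simp
  qed
  then have int: "integral {0..1} (\<lambda>s. s\<^sup>2) = (1/3::real)" by (rule integral_unique)
  have "m (u, 0) = 2 * a / 3 * pd_v f (u, 0)" if "\<bar>u\<bar> < d" for u
    using k1_0[OF that] by (simp add: m_def I1_def int)
  then show thesis using that[OF d K_smooth[unfolded B_def] m_smooth[unfolded B_def] c_eq] by blast
qed

text \<open>
  A product rule at a zero of one factor: the other factor only needs to be continuous.
\<close>

lemma vanishing_times_continuous:
  fixes f k :: "real \<Rightarrow> real"
  assumes "(f has_real_derivative D) (at 0)" "f 0 = 0" "isCont k 0"
  shows "((\<lambda>t. f t * k t) has_real_derivative D * k 0) (at 0)"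
proof -
  obtain q where q: "\<forall>z. f z - f 0 = q z * (z - 0)" "isCont q 0" "q 0 = D"
    using assms(1) unfolding CARAT_DERIV by blast
  have "\<forall>z. f z * k z - f 0 * k 0 = (q z * k z) * (z - 0)" using q(1) assms(2) by simp
  moreover have "isCont (\<lambda>z. q z * k z) 0" by (rule continuous_mult[OF q(2) assms(3)])
  ultimately show ?thesis unfolding CARAT_DERIV by (intro exI[of _ "\<lambda>z. q z * k z"]) (simp add: q(3))
qed

section \<open>The normal form of a cuspidal cross cap\<close>

text \<open>
  Difference quotients at \<open>z\<close> converge to a directional derivative even if the direction varies with
  the step, provided that it converges.
\<close>

lemma derivative_along_convergent_directions:
  fixes f :: "'a::real_normed_vector \<Rightarrow> 'b::real_normed_vector"
  assumes f: "(f has_derivative L) (at z)" and e: "(e \<longlongrightarrow> e0) F" and s: "(s \<longlongrightarrow> (0::real)) F"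
    and nz: "\<forall>\<^sub>F x in F. s x \<noteq> 0"
  shows "((\<lambda>x. (f (z + s x *\<^sub>R e x) - f z) /\<^sub>R s x) \<longlongrightarrow> L e0) F"
proof -
  interpret L: bounded_linear L by (rule has_derivative_bounded_linear[OF f])
  define N where "N h = norm (f (z + h) - f z - L h) / norm h" for h
  have "N \<midarrow>0\<rightarrow> N 0" using f by (simp add: has_derivative_at N_def[abs_def])
  then have "(N \<longlongrightarrow> N 0) (nhds 0)" by (simp add: tendsto_at_iff_tendsto_nhds)
  moreover have "((\<lambda>x. s x *\<^sub>R e x) \<longlongrightarrow> 0) F" using tendsto_scaleR[OF s e] by simp
  ultimately have "((\<lambda>x. N (s x *\<^sub>R e x)) \<longlongrightarrow> N 0) F" by (rule filterlim_compose)
  from tendsto_mult[OF this tendsto_norm[OF e]]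
  have "((\<lambda>x. N (s x *\<^sub>R e x) * norm (e x)) \<longlongrightarrow> 0) F" by (simp add: N_def)
  moreover have "\<forall>\<^sub>F x in F. N (s x *\<^sub>R e x) * norm (e x) = norm ((f (z + s x *\<^sub>R e x) - f z) /\<^sub>R s x - L (e x))"
    using nz
  proof eventually_elim
    case (elim x)
    have eq: "(f (z + s x *\<^sub>R e x) - f z) /\<^sub>R s x - L (e x) = (f (z + s x *\<^sub>R e x) - f z - L (s x *\<^sub>R e x)) /\<^sub>R s x"
      using elim by (simp add: L.scale scaleR_diff_right)
    show ?case unfolding eq by (cases "e x = 0") (use elim in \<open>auto simp: N_def divide_simps\<close>)
  qed
  ultimately have "((\<lambda>x. norm ((f (z + s x *\<^sub>R e x) - f z) /\<^sub>R s x - L (e x))) \<longlongrightarrow> 0) F"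
    by (rule Lim_transform_eventually)
  then have "((\<lambda>x. (f (z + s x *\<^sub>R e x) - f z) /\<^sub>R s x - L (e x)) \<longlongrightarrow> 0) F" by (rule tendsto_norm_zero_cancel)
  from tendsto_add[OF this L.tendsto[OF e]] show ?thesis by simp
qed

lemma diffeo_germ_derivative_surjective:
  assumes "diffeo_germ \<phi> p q"
  obtains z where "frechet_derivative \<phi> (at p) z = w"
proof -
  obtain \<theta> where t: "diffeo_germ \<theta> q p" "\<forall>\<^sub>F x in nhds p. \<theta> (\<phi> x) = x" "\<forall>\<^sub>F y in nhds q. \<phi> (\<theta> y) = y"
    using diffeo_germ_inverse[OF assms(1)] .
  note d = diffeo_germ_has_derivative
  have "\<theta> q = p" using t(1) by (simp add: diffeo_germ_def)
  have "((\<lambda>x. \<phi> (\<theta> x)) has_derivative (\<lambda>w. frechet_derivative \<phi> (at p) (frechet_derivative \<theta> (at q) w))) (at q)"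
    by (rule has_derivative_compose[OF d[OF t(1)]]) (simp only: \<open>\<theta> q = p\<close> d[OF assms])
  moreover obtain S where S: "open S" "q \<in> S" "\<And>x. x \<in> S \<Longrightarrow> \<phi> (\<theta> x) = x"
    using t(3) unfolding eventually_nhds by blast
  ultimately have "((\<lambda>x. x) has_derivative (\<lambda>w. frechet_derivative \<phi> (at p) (frechet_derivative \<theta> (at q) w))) (at q)"
    by (rule has_derivative_transform_within_open)
  from fun_cong[OF has_derivative_unique[OF this has_derivative_ident], of w] show thesis by (rule that)
qed

text \<open>
  The shape to which every frontal with a fold-like singularity along a curve can be brought. The
  case \<open>m (u, y) = u\<close> is the standard cuspidal cross cap, and a nonzero constant gives a cuspidal edge.
\<close>

definition cuspidal_normal_form :: "(real \<times> real \<Rightarrow> real) \<Rightarrow> surf" where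
  "cuspidal_normal_form m = (\<lambda>(u, v). vector [u, v\<^sup>2, v ^ 3 * m (u, v\<^sup>2)])"

lemma smooth_on_fold_map:
  assumes m: "smooth_on (square r) m" and "d \<le> r" "d\<^sup>2 \<le> r" and "d \<ge> 0"
  shows "smooth_on (square d) (\<lambda>p. m (fst p, (snd p)\<^sup>2))"
proof (rule smooth_on_compose[OF m])
  show "(\<lambda>p. (fst p, (snd p)\<^sup>2)) ` square d \<subseteq> square r"
  proof (rule image_subsetI)
    fix p assume p: "p \<in> square d"
    then have "\<bar>fst p\<bar> < d" "\<bar>snd p\<bar> < d" by (cases p; simp)+
    moreover from this(2) have "(snd p)\<^sup>2 < d\<^sup>2" using power_strict_mono[of "\<bar>snd p\<bar>" d 2] by simp
    ultimately show "(fst p, (snd p)\<^sup>2) \<in> square r" using assms by simp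
  qed
qed (auto intro!: smooth_intros)

lemma small_square:
  fixes r :: real assumes "r > 0"
  obtains d where "d > 0" "d \<le> r" "d\<^sup>2 \<le> r"
proof
  show "min r 1 > 0" "min r 1 \<le> r" using assms by auto
  have "(min r 1)\<^sup>2 \<le> min r 1 * 1" unfolding power2_eq_square using assms by (intro mult_left_mono) auto
  then show "(min r 1)\<^sup>2 \<le> r" by simp
qed

text \<open>
  Since \<open>m\<^sub>u \<noteq> 0\<close>, the function \<open>m (u, v\<^sup>2)\<close> can replace \<open>u\<close> as a coordinate in the source, and
  \<open>m (x, y)\<close> can replace \<open>x\<close> as a coordinate in the target.
\<close>

lemma cuspidal_cross_cap_if_normal_form:
  assumes "smooth_germ 0 m" "m 0 = 0" "pd_u m 0 \<noteq> 0"
  shows "has_cuspidal_cross_cap (cuspidal_normal_form m) 0"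
proof -
  obtain r where r: "r > 0" "smooth_on (square r) m" using assms(1) by (auto simp: smooth_germ_square)
  obtain d where d: "d > 0" "d \<le> r" "d\<^sup>2 \<le> r" using small_square[OF r(1)] .
  have m_d: "m differentiable (at (0, 0))" using smooth_on_differentiable[OF r(2)] r(1) by simp
  define q where "q p = m (fst p, (snd p)\<^sup>2) - fst p" for p
  have q: "smooth_on (square d) q"
    unfolding q_def[abs_def] using d by (intro smooth_intros smooth_on_fold_map[OF r(2)]) auto
  have zero: "(0 :: real \<times> real) \<in> square d" using d by (simp add: zero_prod_def)
  have q_d: "q differentiable (at (0, 0))" using smooth_on_differentiable[OF q] d by simp
  have "((\<lambda>t. m (t, 0) - t) has_real_derivative pd_u m (0, 0) - 1) (at 0)"
    by (intro DERIV_diff DERIV_ident pd_real_slices m_d)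
  then have "((\<lambda>t. q (t, 0)) has_real_derivative pd_u m (0, 0) - 1) (at 0)" by (simp add: q_def)
  from DERIV_unique[OF this pd_real_slices(1)[OF q_d]]
  have "1 + frechet_derivative q (at 0) (1, 0) = pd_u m 0"
    using frechet_derivative_pd[OF q_d] by (simp add: zero_prod_def)
  then have src: "diffeo_germ (\<lambda>p. p + q p *\<^sub>R (1, 0)) 0 (0 + q 0 *\<^sub>R (1, 0))"
    by (intro diffeo_germ_add_direction[OF q open_square zero]) (use assms in simp)
  define pr where "pr z = (z $ 1, z $ 2)" for z :: "real^3"
  have pr_bl: "bounded_linear pr" unfolding pr_def[abs_def]
    by (intro bounded_linear_Pair bounded_linear_vec_nth)
  define Q where "Q z = m (pr z) - z $ 1" for z :: "real^3"
  define O3 where "O3 = pr -` square r"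
  have O3: "open O3" unfolding O3_def
    using pr_bl by (intro open_vimage open_square) (simp add: linear_continuous_on)
  have O3_0: "0 \<in> O3" using r by (simp add: O3_def pr_def)
  have pr_smooth: "smooth_on O3 pr" by (intro smooth_on_bounded_linear[OF pr_bl O3] smooth_on_id O3)
  have Q: "smooth_on O3 Q" unfolding Q_def[abs_def]
    by (intro smooth_intros smooth_on_compose[OF r(2) pr_smooth] O3 open_square) (auto simp: O3_def)
  have pr_at: "(pr has_derivative pr) (at 0)" by (rule bounded_linear_imp_has_derivative[OF pr_bl])
  have "pr 0 = (0, 0)" by (simp add: pr_def)
  then have "(m has_derivative (\<lambda>w. fst w *\<^sub>R pd_u m (0, 0) + snd w *\<^sub>R pd_v m (0, 0))) (at (pr 0))"
    using has_derivative_pd[OF m_d] by simp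
  from has_derivative_diff[OF has_derivative_compose[OF pr_at this]
      bounded_linear_imp_has_derivative[OF bounded_linear_vec_nth[of 1]]]
  have "(Q has_derivative (\<lambda>w. fst (pr w) *\<^sub>R pd_u m (0, 0) + snd (pr w) *\<^sub>R pd_v m (0, 0) - w $ 1)) (at 0)"
    unfolding Q_def[abs_def] .
  from fun_cong[OF frechet_derivative_at[OF this], of "axis 1 1"]
  have "1 + frechet_derivative Q (at 0) (axis 1 1) = pd_u m 0"
    by (simp add: pr_def zero_prod_def) (simp add: axis_def)
  then have tgt: "diffeo_germ (\<lambda>z. z + Q z *\<^sub>R axis 1 1) 0 (0 + Q 0 *\<^sub>R axis 1 1)"
    by (intro diffeo_germ_add_direction[OF Q O3 O3_0]) (use assms in simp)
  have m0: "m (0, 0) = 0" using assms(2) by (simp add: zero_prod_def)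
  have "q 0 = 0" "Q 0 = 0" using m0 by (simp_all add: q_def Q_def pr_def)
  moreover have "cuspidal_normal_form m 0 = 0" "std_cuspidal_cross_cap 0 = 0"
    by (simp_all add: cuspidal_normal_form_def std_cuspidal_cross_cap_def vec_eq_iff forall_3 zero_prod_def)
  moreover have "cuspidal_normal_form m p + Q (cuspidal_normal_form m p) *\<^sub>R axis 1 1
      = std_cuspidal_cross_cap (p + q p *\<^sub>R (1, 0))" for p
    by (cases p) (simp add: cuspidal_normal_form_def std_cuspidal_cross_cap_def vec_eq_iff forall_3 Q_def q_def pr_def
        axis_def mult.commute)
  ultimately show ?thesis
    unfolding has_cuspidal_cross_cap_def A_equivalent_def using src tgt
    by (intro exI[of _ "\<lambda>p. p + q p *\<^sub>R (1, 0)"] exI[of _ "\<lambda>z. z + Q z *\<^sub>R axis 1 1"])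
      (simp add: zero_prod_def)
qed

lemma eq_at_limit_point:
  fixes f g :: "real \<Rightarrow> real"
  assumes "isCont f 0" "isCont g 0" "d > 0" "\<And>t. 0 < \<bar>t\<bar> \<Longrightarrow> \<bar>t\<bar> < d \<Longrightarrow> f t = g t"
  shows "f 0 = g 0"
proof -
  have "\<forall>\<^sub>F t in at 0. f t = g t"
    unfolding eventually_at by (rule exI[of _ d]) (use assms in \<open>auto simp: dist_real_def\<close>)
  moreover have "f \<midarrow>0\<rightarrow> f 0" "g \<midarrow>0\<rightarrow> g 0" using assms(1,2) by (auto simp: isCont_def)
  ultimately have "g \<midarrow>0\<rightarrow> f 0" using Lim_transform_eventually by blast
  then show ?thesis using \<open>g \<midarrow>0\<rightarrow> g 0\<close> LIM_unique by blast
qed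

lemma isCont_tendsto_nhds: "isCont f a \<Longrightarrow> (f \<longlongrightarrow> f a) (nhds a)"
  by (simp add: isCont_def tendsto_at_iff_tendsto_nhds)

lemma eventually_abs_less: "0 < r \<Longrightarrow> \<forall>\<^sub>F v in nhds (0::real). \<bar>v\<bar> < r"
  using eventually_nhds_in_open[of "{-r<..<r}" 0]
  by (auto elim!: eventually_mono simp: abs_less_iff)

lemma vector3_eq: "(vector [a, b, c] :: real^3) = a *\<^sub>R axis 1 1 + b *\<^sub>R axis 2 1 + c *\<^sub>R axis 3 1"
  by (simp add: vec_eq_iff forall_3 axis_def)

lemma has_derivative_coordinate_lines:
  fixes \<Psi> :: "real^3 \<Rightarrow> real"
  assumes "\<Psi> differentiable (at (vector [a, b, c]))"
  shows "((\<lambda>z. \<Psi> (vector [a, b, z])) has_real_derivative frechet_derivative \<Psi> (at (vector [a, b, c])) (axis 3 1)) (at c)"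
    and "((\<lambda>z. \<Psi> (vector [z, b, c])) has_real_derivative frechet_derivative \<Psi> (at (vector [a, b, c])) (axis 1 1)) (at a)"
proof -
  let ?D = "frechet_derivative \<Psi> (at (vector [a, b, c]))"
  have D: "(\<Psi> has_derivative ?D) (at (vector [a, b, c]))" using assms by (simp add: frechet_derivative_works)
  interpret bounded_linear ?D by (rule has_derivative_bounded_linear[OF D])
  have "((\<lambda>z. vector [a, b, z] :: real^3) has_derivative (\<lambda>h. h *\<^sub>R axis 3 1)) (at c)"
    "((\<lambda>z. vector [z, b, c] :: real^3) has_derivative (\<lambda>h. h *\<^sub>R axis 1 1)) (at a)"
    unfolding vector3_eq by (auto intro!: derivative_eq_intros)
  from has_derivative_compose[OF this(1) D] has_derivative_compose[OF this(2) D]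
  show "((\<lambda>z. \<Psi> (vector [a, b, z])) has_real_derivative ?D (axis 3 1)) (at c)"
    "((\<lambda>z. \<Psi> (vector [z, b, c])) has_real_derivative ?D (axis 1 1)) (at a)"
    by (auto simp: has_field_derivative_def scale mult.commute[of "?D _"] elim!: has_derivative_eq_rhs)
qed

text \<open>
  Let \<open>G\<close> be the normal form, \<open>\<Phi> \<circ> G\<close> the standard cross cap \<open>(P, Q\<^sup>2, P Q\<^sup>3)\<close> in the new source
  coordinates \<open>(P, Q)\<close>, and \<open>\<Psi>\<close> the third component of \<open>\<Phi>\<close>. The null direction of \<open>G\<close> is \<open>\<partial>\<^sub>v\<close> on the
  axis \<open>v = 0\<close>, hence \<open>P\<^sub>v = 0\<close> and \<open>Q Q\<^sub>v = 0\<close> there. Injectivity of \<open>d(P, Q)\<close> gives \<open>Q\<^sub>v \<noteq> 0\<close>, so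
  \<open>Q = v q\<close> with \<open>q \<noteq> 0\<close> on the axis.

  The odd part in \<open>v\<close> of \<open>\<Psi> \<circ> G = P Q\<^sup>3\<close> is divisible by \<open>v ^ 3\<close> on both sides. Dividing and letting \<open>v\<close>
  tend to \<open>0\<close> yields \<open>m (u, 0) \<omega> u = P (u, 0) q (u, 0) ^ 3\<close>, where \<open>\<omega>\<close> is the derivative of \<open>\<Psi>\<close> in
  the third coordinate. As \<open>\<omega> 0 \<noteq> 0\<close>, the zero of \<open>m (u, 0)\<close> at the origin is as simple as the one of
  \<open>P (u, 0)\<close>, and that one is simple because \<open>Q\<close> vanishes on the axis.
\<close>

lemma normal_form_if_cuspidal_cross_cap:
  assumes "smooth_germ 0 m" and ccr: "has_cuspidal_cross_cap (cuspidal_normal_form m) 0"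
  shows "m 0 = 0 \<and> pd_u m 0 \<noteq> 0"
proof -
  define G where "G = cuspidal_normal_form m"
  have G: "G (u, v) = vector [u, v\<^sup>2, v ^ 3 * m (u, v\<^sup>2)]" for u v by (simp add: G_def cuspidal_normal_form_def)
  have zero: "(0, 0) = (0 :: real \<times> real)" by (simp add: zero_prod_def)
  have G0: "G 0 = 0" unfolding zero[symmetric] G by (simp add: vec_eq_iff forall_3)
  obtain rm where rm: "rm > 0" "smooth_on (square rm) m" using assms(1) by (auto simp: smooth_germ_square)
  obtain rg where rg: "rg > 0" "rg \<le> rm" "rg\<^sup>2 \<le> rm" using small_square[OF rm(1)] .
  have G_smooth: "smooth_on (square rg) G"
  proof -
    have "smooth_on (square rg) (\<lambda>p. vector [fst p, (snd p)\<^sup>2, snd p ^ 3 * m (fst p, (snd p)\<^sup>2)] :: real^3)"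
      using rg by (intro smooth_intros smooth_on_fold_map[OF rm(2)] open_square) auto
    moreover have "(\<lambda>p. vector [fst p, (snd p)\<^sup>2, snd p ^ 3 * m (fst p, (snd p)\<^sup>2)] :: real^3) = G"
      by (auto simp: fun_eq_iff G)
    ultimately show ?thesis by simp
  qed
  have "std_cuspidal_cross_cap 0 = 0"
    by (simp add: std_cuspidal_cross_cap_def vec_eq_iff forall_3 zero_prod_def)
  then obtain \<phi> \<Phi> where \<phi>: "diffeo_germ \<phi> 0 0" and \<Phi>: "diffeo_germ \<Phi> 0 0"
    and eq: "\<forall>\<^sub>F p in nhds 0. \<Phi> (G p) = std_cuspidal_cross_cap (\<phi> p)"
    using ccr G0 unfolding has_cuspidal_cross_cap_def A_equivalent_def G_def by auto
  obtain U V \<theta> where U: "open U" "open V" "0 \<in> U" "\<phi> ` U = V" "smooth_on U \<phi>" "smooth_on V \<theta>"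
    "\<And>x. x \<in> U \<Longrightarrow> \<theta> (\<phi> x) = x" "\<And>y. y \<in> V \<Longrightarrow> \<phi> (\<theta> y) = y"
    using \<phi> unfolding diffeo_germ_def by blast
  have \<phi>_inj: "w = 0" if "frechet_derivative \<phi> (at p) w = 0" "p \<in> U" for p w
  proof (rule diffeo_germ_derivative_injective[OF _ that(1)])
    show "diffeo_germ \<phi> p (\<phi> p)" unfolding diffeo_germ_def using U that(2) by blast
  qed
  obtain Op where Op: "open Op" "0 \<in> Op" "smooth_on Op \<Phi>"
    using diffeo_germ_smooth[OF \<Phi>] unfolding smooth_germ_def by blast
  obtain \<epsilon> where \<epsilon>: "\<epsilon> > 0" "ball 0 \<epsilon> \<subseteq> Op" using Op(1,2) by (meson openE)
  define \<eta> where "\<eta> = \<epsilon> / 3"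
  have \<eta>: "\<eta> > 0" using \<epsilon> by (simp add: \<eta>_def)
  have cube: "vector [a, b, c] \<in> Op" if "\<bar>a\<bar> < \<eta>" "\<bar>b\<bar> < \<eta>" "\<bar>c\<bar> < \<eta>" for a b c
  proof -
    have "norm (vector [a, b, c] :: real^3) \<le> (\<Sum>i\<in>UNIV. \<bar>(vector [a, b, c] :: real^3) $ i\<bar>)" by (rule norm_le_l1_cart)
    also have "\<dots> < \<epsilon>" using that by (simp add: sum_3 \<eta>_def)
    finally show ?thesis using \<epsilon>(2) by auto
  qed
  define \<Psi> where "\<Psi> z = \<Phi> z $ 3" for z
  have \<Psi>: "smooth_on Op \<Psi>" unfolding \<Psi>_def[abs_def] by (intro smooth_intros Op)
  obtain e where e: "e > 0" "e \<le> \<eta>" "e\<^sup>2 \<le> \<eta>" using small_square[OF \<eta>] .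
  have "isCont (\<lambda>p. G p $ 3) 0"
    using smooth_on_continuous[OF smooth_on_nth[OF G_smooth open_square]] rg(1)
    by (simp add: continuous_on_eq_continuous_at zero_prod_def)
  then have "((\<lambda>p. G p $ 3) \<longlongrightarrow> 0) (nhds 0)"
    using isCont_tendsto_nhds[where f = "\<lambda>p. G p $ 3" and a = 0] G0 by simp
  from tendstoD[OF this e(1)]
  have "\<forall>\<^sub>F p in nhds 0. \<bar>G p $ 3\<bar> < e" by (simp add: dist_real_def)
  moreover have "\<forall>\<^sub>F p in nhds (0 :: real \<times> real). p \<in> U" by (rule eventually_nhds_in_open[OF U(1,3)])
  ultimately have "\<forall>\<^sub>F p in nhds 0. \<Phi> (G p) = std_cuspidal_cross_cap (\<phi> p) \<and> \<bar>G p $ 3\<bar> < e \<and> p \<in> U"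
    using eq by eventually_elim simp
  then obtain r0 where r0: "r0 > 0" "\<And>p. p \<in> square r0 \<Longrightarrow> \<Phi> (G p) = std_cuspidal_cross_cap (\<phi> p) \<and> \<bar>G p $ 3\<bar> < e \<and> p \<in> U"
    unfolding eventually_square by blast
  define r where "r = min r0 (min rg e)"
  have r: "r > 0" "r \<le> r0" "r \<le> rg" "r \<le> e" using r0 rg e by (auto simp: r_def)
  have sq: "\<Phi> (G p) = std_cuspidal_cross_cap (\<phi> p)" "\<bar>G p $ 3\<bar> < e" "p \<in> U" if "p \<in> square r" for p
    using r0(2)[of p] square_mono[OF r(2)] that by auto
  define P where "P p = fst (\<phi> p)" for p
  define Q where "Q p = snd (\<phi> p)" for p
  have "square r \<subseteq> U" using sq(3) by blast
  then have \<phi>_sm: "smooth_on (square r) \<phi>" by (rule smooth_on_subset[OF U(5)])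
  have PQ: "smooth_on (square r) P" "smooth_on (square r) Q"
    unfolding P_def[abs_def] Q_def[abs_def] by (intro smooth_intros \<phi>_sm open_square)+
  have dPQ: "P differentiable (at p)" "Q differentiable (at p)" "\<phi> differentiable (at p)" if "p \<in> square r" for p
    using smooth_on_differentiable[OF PQ(1) that] smooth_on_differentiable[OF PQ(2) that]
      smooth_on_differentiable[OF \<phi>_sm that] by auto
  have D\<phi>: "frechet_derivative \<phi> (at p) w = (frechet_derivative P (at p) w, frechet_derivative Q (at p) w)"
    if "p \<in> square r" for p w
  proof -
    have D: "(\<phi> has_derivative frechet_derivative \<phi> (at p)) (at p)"
      using dPQ(3)[OF that] by (simp add: frechet_derivative_works)
    from fun_cong[OF frechet_derivative_at[OF bounded_linear.has_derivative[OF bounded_linear_fst D]], of w]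
      fun_cong[OF frechet_derivative_at[OF bounded_linear.has_derivative[OF bounded_linear_snd D]], of w]
    show ?thesis by (simp add: P_def[abs_def] Q_def[abs_def] prod_eq_iff)
  qed
  have std: "\<Phi> (G (u, v)) = vector [P (u, v), (Q (u, v))\<^sup>2, P (u, v) * Q (u, v) ^ 3]" if "\<bar>u\<bar> < r" "\<bar>v\<bar> < r" for u v
    using sq(1)[of "(u, v)"] that by (simp add: std_cuspidal_cross_cap_def P_def Q_def split_beta)
  have \<Psi>_G: "\<Psi> (G (u, v)) = P (u, v) * Q (u, v) ^ 3" if "\<bar>u\<bar> < r" "\<bar>v\<bar> < r" for u v
    using std[OF that] by (simp add: \<Psi>_def)
  have m_cont: "isCont (\<lambda>v. m (u, v\<^sup>2)) 0" if "\<bar>u\<bar> < r" for u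
  proof -
    have "isCont m (u, 0\<^sup>2)"
      using smooth_on_continuous[OF rm(2)] that r rg by (simp add: continuous_on_eq_continuous_at)
    moreover have "isCont (\<lambda>v. (u, v\<^sup>2)) (0::real)"
      by (intro continuous_Pair continuous_const continuous_power continuous_ident)
    ultimately show ?thesis by (rule isCont_o2[where g = m and f = "\<lambda>v. (u, v\<^sup>2)", rotated])
  qed
  have QP_v: "Q (u, 0) = 0 \<and> pd_v Q (u, 0) \<noteq> 0" if u: "\<bar>u\<bar> < r" for u
  proof -
    have in_sq: "(u, 0) \<in> square r" using u r by simp
    have "((\<lambda>v. v ^ 3) has_real_derivative 0) (at 0)" by (auto intro!: derivative_eq_intros)
    from vanishing_times_continuous[OF this _ m_cont[OF u]]
    have c3: "((\<lambda>v. v ^ 3 * m (u, v\<^sup>2)) has_real_derivative 0) (at 0)" by simp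
    have c2: "((\<lambda>v::real. v\<^sup>2) has_real_derivative 0) (at 0)" by (auto intro!: derivative_eq_intros)
    have "((\<lambda>v. G (u, v)) has_derivative (\<lambda>h. 0)) (at 0)"
    proof -
      have "((\<lambda>v. u *\<^sub>R axis 1 1 + v\<^sup>2 *\<^sub>R axis 2 1 + (v ^ 3 * m (u, v\<^sup>2)) *\<^sub>R axis 3 1 :: real^3)
          has_derivative (\<lambda>h. 0 + (0 * h) *\<^sub>R axis 2 1 + (0 * h) *\<^sub>R axis 3 1)) (at 0)"
        by (intro has_derivative_add has_derivative_const has_derivative_scaleR_left
            c2[unfolded has_field_derivative_def] c3[unfolded has_field_derivative_def])
      then show ?thesis unfolding G vector3_eq by simp
    qed
    moreover have "(\<Phi> has_derivative frechet_derivative \<Phi> (at (G (u, 0)))) (at (G (u, 0)))"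
      by (rule smooth_on_has_derivative[OF Op(3)]) (use u r e in \<open>auto simp: G intro!: cube\<close>)
    ultimately have "((\<lambda>v. \<Phi> (G (u, v))) has_derivative (\<lambda>h. frechet_derivative \<Phi> (at (G (u, 0))) 0)) (at 0)"
      and lin0: "frechet_derivative \<Phi> (at (G (u, 0))) 0 = 0"
      by (rule has_derivative_compose, intro linear_0 has_derivative_linear)
    then have D: "((\<lambda>v. \<Phi> (G (u, v))) has_derivative (\<lambda>h. 0)) (at 0)" by simp
    have nth: "((\<lambda>v. \<Phi> (G (u, v)) $ i) has_real_derivative 0) (at 0)" for i
      using bounded_linear.has_derivative[OF bounded_linear_vec_nth D, of i]
      by (simp add: has_field_derivative_def lambda_zero)
    have near: "\<forall>\<^sub>F v in nhds 0. \<bar>v\<bar> < r"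
      by (rule eventually_abs_less[OF r(1)])
    have "\<forall>\<^sub>F v in nhds 0. \<Phi> (G (u, v)) $ 1 = P (u, v)" "\<forall>\<^sub>F v in nhds 0. \<Phi> (G (u, v)) $ 2 = (Q (u, v))\<^sup>2"
      by (rule eventually_mono[OF near], use std[OF u] in simp)+
    from DERIV_cong_ev[OF refl this(1) refl] DERIV_cong_ev[OF refl this(2) refl] nth
    have "((\<lambda>v. P (u, v)) has_real_derivative 0) (at 0)" "((\<lambda>v. (Q (u, v))\<^sup>2) has_real_derivative 0) (at 0)"
      by blast+
    from DERIV_unique[OF pd_real_slices(2)[OF dPQ(1)[OF in_sq]] this(1)]
      DERIV_unique[OF DERIV_power[OF pd_real_slices(2)[OF dPQ(2)[OF in_sq]], of 2] this(2)]
    have "pd_v P (u, 0) = 0" "2 * Q (u, 0) * pd_v Q (u, 0) = 0" by auto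
    moreover have "frechet_derivative \<phi> (at (u, 0)) (0, 1) \<noteq> 0"
      using \<phi>_inj[of "(u, 0)" "(0, 1)"] sq(3)[OF in_sq] by (auto simp: zero_prod_def)
    then have "pd_v P (u, 0) \<noteq> 0 \<or> pd_v Q (u, 0) \<noteq> 0"
      using D\<phi>[OF in_sq] by (simp add: zero_prod_def pd_v_def dir_deriv_def)
    ultimately show ?thesis by auto
  qed
  obtain q where q: "smooth_on (square r) q" "\<And>u v. \<bar>u\<bar> < r \<Longrightarrow> \<bar>v\<bar> < r \<Longrightarrow> Q (u, v) = v * q (u, v)"
    "\<And>u. \<bar>u\<bar> < r \<Longrightarrow> q (u, 0) = pd_v Q (u, 0)"
    by (rule Hadamard_square[OF PQ(2)]) (rule conjunct1[OF QP_v], assumption, rule that)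
  have slice_cont: "isCont (\<lambda>v. k (u, c * v)) 0" if "smooth_on (square r) k" "\<bar>u\<bar> < r"
    for k :: "real \<times> real \<Rightarrow> real" and u c
  proof -
    have "isCont k (u, c * 0)"
      using smooth_on_continuous[OF that(1)] that(2) r(1) by (simp add: continuous_on_eq_continuous_at)
    moreover have "isCont (\<lambda>v. (u, c * v)) (0::real)"
      by (intro continuous_Pair continuous_const continuous_mult continuous_ident)
    ultimately show ?thesis by (rule isCont_o2[where g = k and f = "\<lambda>v. (u, c * v)", rotated])
  qed
  define \<omega> where "\<omega> u = frechet_derivative \<Psi> (at (vector [u, 0, 0])) (axis 3 1)" for u
  \<comment> \<open>The limit of the odd part of \<open>\<Psi> \<circ> G\<close> divided by \<open>v ^ 3\<close>.\<close>
  have key: "m (u, 0) * \<omega> u = P (u, 0) * q (u, 0) ^ 3" if u: "\<bar>u\<bar> < r" for u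
  proof -
    define F where "F p = \<Psi> (vector [u, (fst p)\<^sup>2, snd p]) - \<Psi> (vector [u, (fst p)\<^sup>2, - snd p])" for p
    have emb: "vector [u, (fst p)\<^sup>2, c * snd p] \<in> Op" if p: "p \<in> square e" and c: "\<bar>c\<bar> = 1" for p and c :: real
    proof (rule cube)
      have p: "\<bar>fst p\<bar> < e" "\<bar>snd p\<bar> < e" using p by (cases p; simp)+
      have "(fst p)\<^sup>2 < e\<^sup>2" using power_strict_mono[OF p(1), of 2] by simp
      then show "\<bar>u\<bar> < \<eta>" "\<bar>(fst p)\<^sup>2\<bar> < \<eta>" "\<bar>c * snd p\<bar> < \<eta>" using u r e p c by (auto simp: abs_mult)
    qed
    have F: "smooth_on (square e) F"
      unfolding F_def[abs_def]
      by (intro smooth_on_diff smooth_on_compose[OF \<Psi>] smooth_intros Op open_square image_subsetI)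
        (use emb[of _ 1] emb[of _ "-1"] in auto)
    have F0: "F (v, 0) = 0" for v by (simp add: F_def)
    obtain H where H: "smooth_on (square e) H" "\<And>v z. \<bar>v\<bar> < e \<Longrightarrow> \<bar>z\<bar> < e \<Longrightarrow> F (v, z) = z * H (v, z)"
      "\<And>v. \<bar>v\<bar> < e \<Longrightarrow> H (v, 0) = pd_v F (v, 0)"
      by (rule Hadamard_square[OF F F0]) (rule that)
    have "vector [u, 0, 0] \<in> Op" using u r e by (intro cube) auto
    from has_derivative_coordinate_lines(1)[OF smooth_on_differentiable[OF \<Psi> this]]
    have D1: "((\<lambda>z. \<Psi> (vector [u, 0, z])) has_real_derivative \<omega> u) (at 0)" by (simp add: \<omega>_def)
    then have D1': "((\<lambda>z. \<Psi> (vector [u, 0, z])) has_real_derivative \<omega> u) (at (- 0))" by simp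
    have "((\<lambda>t::real. - t) has_real_derivative - 1) (at 0)" by (auto intro!: derivative_eq_intros)
    from DERIV_diff[OF D1 DERIV_chain2[OF D1' this]]
    have "((\<lambda>z. F (0, z)) has_real_derivative 2 * \<omega> u) (at 0)" by (simp add: F_def)
    moreover have "F differentiable (at (0, 0))" using smooth_on_differentiable[OF F] e(1) by simp
    ultimately have "pd_v F (0, 0) = 2 * \<omega> u" using DERIV_unique pd_real_slices(2) by blast
    then have H0: "H (0, 0) = 2 * \<omega> u" using H(3)[of 0] e(1) by simp
    have "m (u, 0\<^sup>2) * H (0, 0 ^ 3 * m (u, 0\<^sup>2))
        = P (u, 1 * 0) * q (u, 1 * 0) ^ 3 + P (u, -1 * 0) * q (u, -1 * 0) ^ 3"
    proof (rule eq_at_limit_point[where f = "\<lambda>v. m (u, v\<^sup>2) * H (v, v ^ 3 * m (u, v\<^sup>2))"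
          and g = "\<lambda>v. P (u, 1 * v) * q (u, 1 * v) ^ 3 + P (u, -1 * v) * q (u, -1 * v) ^ 3", OF _ _ r(1)])
      have "isCont H (0, 0 ^ 3 * m (u, 0\<^sup>2))"
        using smooth_on_continuous[OF H(1)] e(1) by (simp add: continuous_on_eq_continuous_at)
      moreover have "isCont (\<lambda>v. (v, v ^ 3 * m (u, v\<^sup>2))) 0"
        by (intro continuous_Pair continuous_mult continuous_power continuous_ident m_cont u)
      ultimately have "isCont (\<lambda>v. H (v, v ^ 3 * m (u, v\<^sup>2))) 0" by (rule isCont_o2[where g = H and f = "\<lambda>v. (v, v ^ 3 * m (u, v\<^sup>2))", rotated])
      then show "isCont (\<lambda>v. m (u, v\<^sup>2) * H (v, v ^ 3 * m (u, v\<^sup>2))) 0"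
        by (intro continuous_mult m_cont u)
      show "isCont (\<lambda>v. P (u, 1 * v) * q (u, 1 * v) ^ 3 + P (u, -1 * v) * q (u, -1 * v) ^ 3) 0"
        by (intro continuous_add continuous_mult continuous_power slice_cont PQ q u)
      fix v :: real assume v: "0 < \<bar>v\<bar>" "\<bar>v\<bar> < r"
      have small: "\<bar>v ^ 3 * m (u, v\<^sup>2)\<bar> < e" using sq(2)[of "(u, v)"] u v by (simp add: G)
      have "F (v, v ^ 3 * m (u, v\<^sup>2)) = \<Psi> (G (u, v)) - \<Psi> (G (u, - v))"
        by (simp add: F_def G)
      also have "\<dots> = v ^ 3 * (P (u, v) * q (u, v) ^ 3 + P (u, - v) * q (u, - v) ^ 3)"
        using u v by (simp add: \<Psi>_G q(2) power_mult_distrib algebra_simps)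
      finally have "v ^ 3 * (m (u, v\<^sup>2) * H (v, v ^ 3 * m (u, v\<^sup>2)))
          = v ^ 3 * (P (u, v) * q (u, v) ^ 3 + P (u, - v) * q (u, - v) ^ 3)"
        using H(2)[OF _ small, of v] v r e by (simp add: mult.assoc)
      then show "m (u, v\<^sup>2) * H (v, v ^ 3 * m (u, v\<^sup>2))
          = P (u, 1 * v) * q (u, 1 * v) ^ 3 + P (u, -1 * v) * q (u, -1 * v) ^ 3"
        using v(1) by simp
    qed
    then show ?thesis by (simp add: H0)
  qed
  have zero3: "vector [0, 0, 0] = (0 :: real^3)" by (simp add: vec_eq_iff forall_3)
  \<comment> \<open>Otherwise \<open>d\<Psi>\<close> vanishes at the origin: on the first axis because \<open>\<Psi>\<close> does, and on the second
    because \<open>G (0, v)\<close> approaches the origin in that direction while \<open>\<Psi> (G (0, v)) = O(v ^ 3)\<close>.\<close>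
  have \<omega>0: "\<omega> 0 \<noteq> 0"
  proof
    assume \<omega>0: "\<omega> 0 = 0"
    define L where "L = frechet_derivative \<Psi> (at (0 :: real^3))"
    have D\<Psi>: "(\<Psi> has_derivative L) (at 0)" unfolding L_def by (rule smooth_on_has_derivative[OF \<Psi> Op(2)])
    interpret L: bounded_linear L by (rule has_derivative_bounded_linear[OF D\<Psi>])
    have near: "\<forall>\<^sub>F v in nhds 0. \<bar>v\<bar> < r"
      by (rule eventually_abs_less[OF r(1)])
    have L3: "L (axis 3 1) = 0" using \<omega>0 by (simp add: \<omega>_def L_def zero3)
    have "((\<lambda>u. \<Psi> (vector [u, 0, 0])) has_real_derivative L (axis 1 1)) (at 0)"
      using has_derivative_coordinate_lines(2)[of \<Psi> 0 0 0] smooth_on_differentiable[OF \<Psi> Op(2)]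
      by (simp add: zero3 L_def)
    moreover have "\<forall>\<^sub>F u in nhds 0. \<Psi> (vector [u, 0, 0]) = 0"
    proof (rule eventually_mono[OF near])
      fix u :: real assume u: "\<bar>u\<bar> < r"
      show "\<Psi> (vector [u, 0, 0]) = 0" using \<Psi>_G[OF u, of 0] QP_v[OF u] r(1) by (simp add: G)
    qed
    then have "((\<lambda>u. \<Psi> (vector [u, 0, 0])) has_real_derivative 0) (at 0)"
      by (subst DERIV_cong_ev[OF refl _ refl]) auto
    ultimately have L1: "L (axis 1 1) = 0" by (rule DERIV_unique)
    have at0: "\<forall>\<^sub>F v in at 0. \<bar>v\<bar> < r" "\<forall>\<^sub>F v in at (0::real). v \<noteq> 0"
      using near by (auto simp: eventually_at_filter elim: eventually_mono)
    have e0: "((\<lambda>v. axis 2 1 + (v * m (0, v\<^sup>2)) *\<^sub>R axis 3 1) \<longlongrightarrow> axis 2 1 + (0 * m (0, 0\<^sup>2)) *\<^sub>R axis 3 (1::real)) (at 0)"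
      using m_cont[of 0] r(1) by (intro tendsto_intros) (auto simp: isCont_def)
    have s0: "((\<lambda>v::real. v\<^sup>2) \<longlongrightarrow> 0) (at 0)" by (auto intro!: tendsto_eq_intros)
    have s_nz: "\<forall>\<^sub>F v in at (0::real). v\<^sup>2 \<noteq> 0" using at0(2) by (auto elim: eventually_mono)
    from derivative_along_convergent_directions[OF D\<Psi> e0 s0 s_nz]
    have "((\<lambda>v. (\<Psi> (0 + v\<^sup>2 *\<^sub>R (axis 2 1 + (v * m (0, v\<^sup>2)) *\<^sub>R axis 3 1)) - \<Psi> 0) /\<^sub>R v\<^sup>2)
        \<longlongrightarrow> L (axis 2 1)) (at 0)" by simp
    moreover have "\<forall>\<^sub>F v in at 0. (\<Psi> (0 + v\<^sup>2 *\<^sub>R (axis 2 1 + (v * m (0, v\<^sup>2)) *\<^sub>R axis 3 1)) - \<Psi> 0) /\<^sub>R v\<^sup>2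
        = v * (P (0, 1 * v) * q (0, 1 * v) ^ 3)"
      using at0
    proof eventually_elim
      case (elim v)
      have "0 + v\<^sup>2 *\<^sub>R (axis 2 1 + (v * m (0, v\<^sup>2)) *\<^sub>R axis 3 1) = G (0, v)"
        unfolding G vector3_eq by (simp add: scaleR_add_right power2_eq_square power3_eq_cube)
      moreover have "\<Psi> 0 = 0" using \<Psi>_G[of 0 0] QP_v[of 0] r(1) by (simp add: G zero3)
      ultimately show ?case using \<Psi>_G[of 0 v] q(2)[of 0 v] r(1) elim
        by (simp add: power_mult_distrib power2_eq_square power3_eq_cube field_simps)
    qed
    ultimately have "((\<lambda>v. v * (P (0, 1 * v) * q (0, 1 * v) ^ 3)) \<longlongrightarrow> L (axis 2 1)) (at 0)"
      by (rule Lim_transform_eventually)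
    moreover have "isCont (\<lambda>v. v * (P (0, 1 * v) * q (0, 1 * v) ^ 3)) 0"
      using r(1) by (intro continuous_ident continuous_mult continuous_power slice_cont PQ q) auto
    then have "((\<lambda>v. v * (P (0, 1 * v) * q (0, 1 * v) ^ 3)) \<longlongrightarrow> 0) (at 0)" by (simp add: isCont_def)
    ultimately have L2: "L (axis 2 1) = 0" using LIM_unique by blast
    obtain z where z: "frechet_derivative \<Phi> (at 0) z = axis 3 1" using diffeo_germ_derivative_surjective[OF \<Phi>] .
    have "L z = frechet_derivative \<Phi> (at 0) z $ 3"
      using frechet_derivative_at[OF bounded_linear.has_derivative[OF bounded_linear_vec_nth diffeo_germ_has_derivative[OF \<Phi>]], of 3]
      by (simp add: L_def \<Psi>_def[abs_def] fun_eq_iff)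
    then have "L z = 1" using z by (simp add: axis_def)
    moreover have "z = vector [z $ 1, z $ 2, z $ 3]" by (simp add: vec_eq_iff forall_3)
    then have "L z = L (z $ 1 *\<^sub>R axis 1 1 + z $ 2 *\<^sub>R axis 2 1 + z $ 3 *\<^sub>R axis 3 1)" by (simp add: vector3_eq)
    then have "L z = 0" by (simp add: L.add L.scale L1 L2 L3)
    ultimately show False by simp
  qed
  have \<omega>_cont: "isCont \<omega> 0"
  proof -
    have "isCont (\<lambda>z. frechet_derivative \<Psi> (at z) (axis 3 1)) (vector [0, 0, 0])"
      using smooth_on_continuous[OF smooth_on_frechet_derivative[OF \<Psi>]] Op by (simp add: continuous_on_eq_continuous_at zero3)
    moreover have "isCont (\<lambda>u. vector [u, 0, 0] :: real^3) 0"
      unfolding vector3_eq by (intro continuous_add continuous_scaleR continuous_const continuous_ident)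
    ultimately show ?thesis unfolding \<omega>_def[abs_def] by
      (rule isCont_o2[where g = "\<lambda>z. frechet_derivative \<Psi> (at z) (axis 3 1)" and f = "\<lambda>u. vector [u, 0, 0]", rotated])
  qed
  have sq0: "(0, 0) \<in> square r" using r by simp
  have "frechet_derivative \<phi> (at (0, 0)) (1, 0) \<noteq> 0"
    using \<phi>_inj[of "(0, 0)" "(1, 0)"] sq(3)[OF sq0] by (auto simp: zero_prod_def)
  then have "pd_u P (0, 0) \<noteq> 0 \<or> pd_u Q (0, 0) \<noteq> 0"
    using D\<phi>[OF sq0] by (simp add: zero_prod_def pd_u_def dir_deriv_def)
  moreover have "pd_u Q (0, 0) = 0"
  proof (rule DERIV_unique[OF pd_real_slices(1)[OF dPQ(2)[OF sq0]]])
    have "\<forall>\<^sub>F u in nhds 0. Q (u, 0) = 0"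
      by (rule eventually_mono[OF eventually_nhds_in_open[of "{-r<..<r}" 0]]) (use QP_v r(1) in \<open>auto simp: abs_less_iff\<close>)
    then show "((\<lambda>u. Q (u, 0)) has_real_derivative 0) (at 0)"
      by (subst DERIV_cong_ev[OF refl _ refl]) auto
  qed
  ultimately have Pu: "pd_u P (0, 0) \<noteq> 0" by simp
  have P0: "P (0, 0) = 0" using \<phi> by (simp add: P_def diffeo_germ_def zero_prod_def)
  have qcont: "isCont (\<lambda>u. q (u, 0)) 0"
  proof -
    have "isCont q (0, 0)" using smooth_on_continuous[OF q(1)] r(1) by (simp add: continuous_on_eq_continuous_at)
    moreover have "isCont (\<lambda>u. (u, 0::real)) (0::real)"
      by (intro continuous_Pair continuous_const continuous_ident)
    ultimately show ?thesis by (rule isCont_o2[where g = q and f = "\<lambda>u. (u, 0)", rotated])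
  qed
  have "((\<lambda>u. P (u, 0) * (q (u, 0) ^ 3 / \<omega> u)) has_real_derivative pd_u P (0, 0) * (q (0, 0) ^ 3 / \<omega> 0)) (at 0)"
    by (rule vanishing_times_continuous[OF pd_real_slices(1)[OF dPQ(1)[OF sq0]] P0])
      (intro isCont_divide isCont_power qcont \<omega>_cont \<omega>0)
  moreover have "\<forall>\<^sub>F u in nhds 0. m (u, 0) = P (u, 0) * (q (u, 0) ^ 3 / \<omega> u)"
  proof -
    have "(\<omega> \<longlongrightarrow> \<omega> 0) (nhds 0)" using \<omega>_cont by (simp add: isCont_def tendsto_at_iff_tendsto_nhds)
    from tendsto_imp_eventually_ne[OF this \<omega>0]
    have "\<forall>\<^sub>F u in nhds 0. \<omega> u \<noteq> 0" .
    moreover have "\<forall>\<^sub>F u in nhds 0. u \<in> {-r<..<r}" by (rule eventually_nhds_in_open) (use r(1) in auto)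
    ultimately show ?thesis
    proof eventually_elim
      case (elim u)
      then show ?case using key[of u] by (simp add: field_simps abs_less_iff)
    qed
  qed
  ultimately have "((\<lambda>u. m (u, 0)) has_real_derivative pd_u P (0, 0) * (q (0, 0) ^ 3 / \<omega> 0)) (at 0)"
    by (subst DERIV_cong_ev[OF refl _ refl]) auto
  moreover have "m differentiable (at (0, 0))" using smooth_on_differentiable[OF rm(2)] rm(1) by simp
  ultimately have "pd_u m (0, 0) = pd_u P (0, 0) * (q (0, 0) ^ 3 / \<omega> 0)"
    using DERIV_unique pd_real_slices(1) by blast
  moreover have "q (0, 0) \<noteq> 0" using q(3)[of 0] QP_v[of 0] r(1) by simp
  moreover have "m (0, 0) = 0" using key[of 0] P0 \<omega>0 r(1) by simp
  ultimately show ?thesis using Pu \<omega>0 by (simp add: zero_prod_def)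
qed

section \<open>Coordinates adapted to a fold\<close>

text \<open>
  Parseval's identity for the orthogonal frame \<open>p\<close>, \<open>cross3 q p\<close>, \<open>q\<close>, cleared of denominators.
\<close>

lemma inner_orthogonal_frame:
  fixes p q x y :: "real^3"
  assumes "p \<bullet> q = 0"
  shows "(p \<bullet> p) * (q \<bullet> q) * (x \<bullet> y) = (x \<bullet> p) * (y \<bullet> p) * (q \<bullet> q)
    + (x \<bullet> cross3 q p) * (y \<bullet> cross3 q p) + (x \<bullet> q) * (y \<bullet> q) * (p \<bullet> p)"
proof -
  have "((p \<bullet> p) * (q \<bullet> q) - (p \<bullet> q) * (p \<bullet> q)) * (x \<bullet> y) = (x \<bullet> p) * (y \<bullet> p) * (q \<bullet> q)
    + (x \<bullet> cross3 q p) * (y \<bullet> cross3 q p) + (x \<bullet> q) * (y \<bullet> q) * (p \<bullet> p)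
    - (p \<bullet> q) * ((x \<bullet> p) * (y \<bullet> q) + (x \<bullet> q) * (y \<bullet> p))"
    by (simp add: inner_vec_def sum_3 cross3_def) (simp add: algebra_simps)
  then show ?thesis by (simp add: assms)
qed

lemma pd_replace_first:
  fixes k :: "real \<times> real \<Rightarrow> real"
  assumes "f differentiable (at p)" "k differentiable (at (f p, snd p))"
  shows "(\<lambda>p. k (f p, snd p)) differentiable (at p)"
    and "pd_u (\<lambda>p. k (f p, snd p)) p = pd_u k (f p, snd p) * pd_u f p"
    and "pd_v (\<lambda>p. k (f p, snd p)) p = pd_u k (f p, snd p) * pd_v f p + pd_v k (f p, snd p)"
proof -
  have "((\<lambda>p. (f p, snd p)) has_derivative (\<lambda>w. (fst w *\<^sub>R pd_u f p + snd w *\<^sub>R pd_v f p, snd w))) (at p)"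
    by (intro has_derivative_Pair has_derivative_pd[OF assms(1)] bounded_linear_imp_has_derivative bounded_linear_snd)
  from has_derivative_compose[OF this has_derivative_pd[OF assms(2)]]
  have D: "((\<lambda>p. k (f p, snd p)) has_derivative (\<lambda>w. fst (fst w *\<^sub>R pd_u f p + snd w *\<^sub>R pd_v f p, snd w) *\<^sub>R pd_u k (f p, snd p)
      + snd (fst w *\<^sub>R pd_u f p + snd w *\<^sub>R pd_v f p, snd w) *\<^sub>R pd_v k (f p, snd p))) (at p)" .
  show "(\<lambda>p. k (f p, snd p)) differentiable (at p)" using D by (auto simp: differentiable_def)
  show "pd_u (\<lambda>p. k (f p, snd p)) p = pd_u k (f p, snd p) * pd_u f p"
    "pd_v (\<lambda>p. k (f p, snd p)) p = pd_u k (f p, snd p) * pd_v f p + pd_v k (f p, snd p)"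
    by (simp_all add: pd_u_eqI[OF D] pd_v_eqI[OF D])
qed

text \<open>
  The map \<open>(D1, D2)\<close> of the plane has a fold whose singular curve is the axis \<open>v = 0\<close>. First \<open>D1\<close>
  replaces the first coordinate. In the new coordinates \<open>D2\<close> has the form \<open>B\<close> with \<open>B\<^sub>v = 0\<close> on the
  axis, by the vanishing of the Jacobian determinant there. Applying Hadamard's lemma twice gives
  \<open>B (u, v) = b u + v\<^sup>2 h2 (u, v)\<close> with \<open>h2 \<noteq> 0\<close>, and then \<open>v sqrt \<bar>h2\<bar>\<close> replaces \<open>v\<close>.
\<close>

lemma fold_coordinates_axis:
  fixes D1 D2 :: "real \<times> real \<Rightarrow> real"
  assumes r: "r > 0" and D1: "smooth_on (square r) D1" and D2: "smooth_on (square r) D2"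
    and "D1 (0, 0) = 0" "pd_u D1 (0, 0) \<noteq> 0" "pd_v D1 (0, 0) = 0" "pd_u D2 (0, 0) = 0" "pd_v (pd_v D2) (0, 0) \<noteq> 0"
    and jac: "\<forall>\<^sub>F u in nhds 0. pd_u D1 (u, 0) * pd_v D2 (u, 0) = pd_v D1 (u, 0) * pd_u D2 (u, 0)"
  obtains \<theta> b a e where "diffeo_germ \<theta> 0 0" "a * a = (1::real)" "e > 0" "smooth_on {-e<..<e} b"
    "\<And>p. p \<in> square e \<Longrightarrow> D1 (\<theta> p) = fst p \<and> D2 (\<theta> p) = b (fst p) + a * (snd p)\<^sup>2"
    "\<forall>\<^sub>F u in nhds 0. \<theta> (D1 (u, 0), 0) = (u, 0)"
proof -
  have zero: "(0, 0) = (0 :: real \<times> real)" by (simp add: zero_prod_def)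
  \<comment> \<open>The first component becomes a coordinate.\<close>
  define Z2 where "Z2 p = p + (D1 p - fst p) *\<^sub>R (1, 0)" for p
  have Z2: "Z2 p = (D1 p, snd p)" for p by (cases p) (simp add: Z2_def)
  have d1: "D1 differentiable (at p)" "pd_u D1 differentiable (at p)" "pd_v D1 differentiable (at p)"
    and d2: "D2 differentiable (at p)" "pd_u D2 differentiable (at p)" "pd_v D2 differentiable (at p)" if "p \<in> square r" for p
    using smooth_on_differentiable[OF _ that] D1 D2 smooth_on_pd by blast+
  have in0: "(0, 0) \<in> square r" using r by simp
  have "diffeo_germ Z2 0 (0 + (D1 0 - fst (0 :: real \<times> real)) *\<^sub>R (1, 0))"
    unfolding Z2_def[abs_def]
  proof (rule diffeo_germ_add_direction[OF _ open_square])
    show "smooth_on (square r) (\<lambda>p. D1 p - fst p)" by (intro smooth_intros D1 open_square)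
    show "0 \<in> square r" using in0 by (simp add: zero)
    have "((\<lambda>p. D1 p - fst p) has_derivative (\<lambda>w. (fst w *\<^sub>R pd_u D1 (0,0) + snd w *\<^sub>R pd_v D1 (0,0)) - fst w)) (at (0,0))"
      by (intro has_derivative_diff has_derivative_pd d1 in0 bounded_linear_imp_has_derivative bounded_linear_fst)
    from fun_cong[OF frechet_derivative_at[OF this], of "(1, 0)"]
    have "frechet_derivative (\<lambda>p. D1 p - fst p) (at 0) (1, 0) = pd_u D1 (0, 0) - 1" by (simp add: zero)
    then show "1 + frechet_derivative (\<lambda>p. D1 p - fst p) (at 0) (1, 0) \<noteq> 0" using assms(5) by simp
  qed
  then have Z2_diffeo: "diffeo_germ Z2 0 0" using assms(4) by (simp add: zero_prod_def)
  obtain T where T: "diffeo_germ T 0 0" "\<forall>\<^sub>F x in nhds 0. T (Z2 x) = x" "\<forall>\<^sub>F y in nhds 0. Z2 (T y) = y"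
    using diffeo_germ_inverse[OF Z2_diffeo] .
  obtain e0 where e0: "e0 > 0" "smooth_on (square e0) T"
    using diffeo_germ_smooth[OF T(1)] by (auto simp: smooth_germ_square)
  have "\<forall>\<^sub>F p in nhds (0 :: real \<times> real). p \<in> square r"
    using eventually_nhds_in_open[OF open_square, of 0 r] in0 by (simp add: zero)
  from diffeo_germ_eventually[OF T(1) this] T(3)
  have "\<forall>\<^sub>F y in nhds 0. T y \<in> square r \<and> Z2 (T y) = y" by eventually_elim simp
  then obtain e1' where e1': "e1' > 0" "\<And>y. y \<in> square e1' \<Longrightarrow> T y \<in> square r \<and> Z2 (T y) = y"
    unfolding eventually_square by blast
  define e1 where "e1 = min e0 e1'"
  have e1: "e1 > 0" "smooth_on (square e1) T" "\<And>y. y \<in> square e1 \<Longrightarrow> T y \<in> square r" "\<And>y. y \<in> square e1 \<Longrightarrow> Z2 (T y) = y"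
    using e0 e1' square_mono[of e1 e0] square_mono[of e1 e1'] by (auto simp: e1_def intro: smooth_on_subset)
  define B where "B y = D2 (T y)" for y
  have B: "smooth_on (square e1) B" unfolding B_def[abs_def]
    by (rule smooth_on_compose[OF D2 e1(2)]) (use e1(3) in auto)
  have dB: "B differentiable (at p)" "pd_u B differentiable (at p)" "pd_v B differentiable (at p)" if "p \<in> square e1" for p
    using smooth_on_differentiable[OF _ that] B smooth_on_pd by blast+
  have "\<forall>\<^sub>F y in nhds (0 :: real \<times> real). y \<in> square e1"
    using eventually_nhds_in_open[OF open_square, of 0 e1] e1(1) by (simp add: zero_prod_def)
  from diffeo_germ_eventually[OF Z2_diffeo this] T(2)
  have "\<forall>\<^sub>F x in nhds 0. Z2 x \<in> square e1 \<and> T (Z2 x) = x" by eventually_elim simp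
  then obtain e2' where e2': "e2' > 0" "\<And>x. x \<in> square e2' \<Longrightarrow> Z2 x \<in> square e1 \<and> T (Z2 x) = x"
    unfolding eventually_square by blast
  define e2 where "e2 = min e2' r"
  have e2: "e2 > 0" "\<And>x. x \<in> square e2 \<Longrightarrow> Z2 x \<in> square e1" "\<And>x. x \<in> square e2 \<Longrightarrow> D2 x = B (Z2 x)"
    "square e2 \<subseteq> square r"
    using e2' r square_mono[of e2 e2'] square_mono[of e2 r] by (auto simp: e2_def B_def)
  have D2_pd: "pd_u D2 x = pd_u B (Z2 x) * pd_u D1 x" "pd_v D2 x = pd_u B (Z2 x) * pd_v D1 x + pd_v B (Z2 x)"
    if x: "x \<in> square e2" for x
  proof -
    have "\<forall>\<^sub>F x in nhds x. D2 x = B (D1 x, snd x)"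
      by (rule eventually_mono[OF eventually_nhds_in_open[OF open_square x]]) (simp add: e2(3) Z2)
    moreover have "x \<in> square r" "(D1 x, snd x) \<in> square e1" using e2(2,4) x by (auto simp: Z2)
    ultimately show "pd_u D2 x = pd_u B (Z2 x) * pd_u D1 x" "pd_v D2 x = pd_u B (Z2 x) * pd_v D1 x + pd_v B (Z2 x)"
      using pd_cong(2,3)[of D2 "\<lambda>x. B (D1 x, snd x)" x] pd_replace_first[of D1 x B] d1 d2 dB by (simp_all add: Z2)
  qed
  have Bv_axis: "\<forall>\<^sub>F u in nhds 0. pd_v B (u, 0) = 0"
  proof -
    have "isCont (pd_u D1) (0, 0)"
      using smooth_on_continuous[OF smooth_on_pd(1)[OF D1]] in0 by (simp add: continuous_on_eq_continuous_at)
    from tendsto_imp_eventually_ne[OF isCont_tendsto_nhds[OF this] assms(5)]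
    have "\<forall>\<^sub>F x in nhds 0. pd_u D1 x \<noteq> 0" by (simp add: zero)
    moreover have "\<forall>\<^sub>F x in nhds (0 :: real \<times> real). x \<in> square e2"
      using eventually_nhds_in_open[OF open_square, of 0 e2] e2(1) by (simp add: zero_prod_def)
    moreover have "filterlim fst (nhds 0) (nhds (0 :: real \<times> real))"
      using isCont_tendsto_nhds[of "0 :: real \<times> real" fst] by (simp add: continuous_fst)
    from eventually_compose_filterlim[OF jac this]
    have "\<forall>\<^sub>F x in nhds (0 :: real \<times> real).
        pd_u D1 (fst x, 0) * pd_v D2 (fst x, 0) = pd_v D1 (fst x, 0) * pd_u D2 (fst x, 0)" .
    ultimately have "\<forall>\<^sub>F x in nhds 0. snd x = 0 \<longrightarrow> pd_v B (Z2 x) = 0"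
    proof eventually_elim
      case (elim x)
      show ?case
      proof
        assume "snd x = 0"
        then have x: "x = (fst x, 0)" by (simp add: prod_eq_iff)
        have "pd_u D1 x * (pd_u B (Z2 x) * pd_v D1 x + pd_v B (Z2 x)) = pd_v D1 x * (pd_u B (Z2 x) * pd_u D1 x)"
          using elim(3) D2_pd[OF elim(2)] x by simp
        then have "pd_u D1 x * pd_v B (Z2 x) = 0" by (simp add: algebra_simps)
        then show "pd_v B (Z2 x) = 0" using elim(1) by simp
      qed
    qed
    from diffeo_germ_eventually[OF T(1) this] T(3)
    have "\<forall>\<^sub>F y in nhds 0. snd y = 0 \<longrightarrow> pd_v B y = 0"
    proof eventually_elim
      case (elim y)
      have "snd (T y) = snd y" using arg_cong[OF elim(2), of snd] by (simp add: Z2)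
      then show ?case using elim by simp
    qed
    moreover have "filterlim (\<lambda>u. (u, 0 :: real)) (nhds 0) (nhds (0 :: real))"
      using isCont_tendsto_nhds[of "0 :: real" "\<lambda>u. (u, 0 :: real)"]
      by (simp add: continuous_Pair continuous_ident zero)
    ultimately have "\<forall>\<^sub>F u in nhds 0. snd (u :: real, 0 :: real) = 0 \<longrightarrow> pd_v B (u, 0) = 0"
      by (rule eventually_compose_filterlim)
    then show ?thesis by simp
  qed
  then obtain e3' where e3': "e3' > 0" "\<And>u. \<bar>u\<bar> < e3' \<Longrightarrow> pd_v B (u, 0) = 0"
    unfolding eventually_nhds_metric by (auto simp: dist_real_def)
  define e3 where "e3 = min e3' e1"
  have e3: "e3 > 0" "e3 \<le> e1" "\<And>u. \<bar>u\<bar> < e3 \<Longrightarrow> pd_v B (u, 0) = 0" using e3' e1 by (auto simp: e3_def)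
  have B3: "smooth_on (square e3) B" by (rule smooth_on_subset[OF B square_mono[OF e3(2)]])
  have Z20: "Z2 (0, 0) = (0, 0)" using assms(4) by (simp add: Z2)
  have in2: "(0, 0) \<in> square e2" and in1: "(0, 0) \<in> square e1" using e2 e1 by auto
  have Bu0: "pd_u B (0, 0) = 0" using D2_pd(1)[OF in2] assms(5,7) Z20 by simp
  have Bvv0: "pd_v (pd_v B) (0, 0) = pd_v (pd_v D2) (0, 0)"
  proof -
    have near: "\<forall>\<^sub>F x in nhds (0, 0). pd_v D2 x = pd_u B (D1 x, snd x) * pd_v D1 x + pd_v B (D1 x, snd x)"
      by (rule eventually_mono[OF eventually_nhds_in_open[OF open_square in2]]) (use D2_pd(2) in \<open>simp add: Z2\<close>)
    have at0: "pd_u B differentiable (at (D1 (0, 0), snd (0, 0)))" "pd_v B differentiable (at (D1 (0, 0), snd (0, 0)))"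
      using dB in1 Z20 by (simp_all add: Z2)
    note c1 = pd_replace_first[OF d1(1)[OF in0] at0(1)] and c2 = pd_replace_first[OF d1(1)[OF in0] at0(2)]
    have "((\<lambda>t. pd_u B (D1 (0, t), t) * pd_v D1 (0, t) + pd_v B (D1 (0, t), t)) has_real_derivative
        (pd_v (\<lambda>p. pd_u B (D1 p, snd p)) (0, 0) * pd_v D1 (0, 0) + pd_v (pd_v D1) (0, 0) * pd_u B (D1 (0, 0), 0))
        + pd_v (\<lambda>p. pd_v B (D1 p, snd p)) (0, 0)) (at 0)"
      using DERIV_add[OF DERIV_mult[OF pd_real_slices(2)[OF c1(1)] pd_real_slices(2)[OF d1(3)[OF in0]]] pd_real_slices(2)[OF c2(1)]]
      by simp
    then have D: "((\<lambda>t. pd_u B (D1 (0, t), t) * pd_v D1 (0, t) + pd_v B (D1 (0, t), t)) has_real_derivative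
        pd_v (pd_v B) (0, 0)) (at 0)"
      using assms(4,6) Bu0 c2(3) by simp
    have "filterlim (\<lambda>t. (0 :: real, t)) (nhds (0, 0)) (nhds (0 :: real))"
      using isCont_tendsto_nhds[of "0 :: real" "\<lambda>t. (0 :: real, t)"]
      by (simp add: continuous_Pair continuous_ident)
    from eventually_compose_filterlim[OF near this]
    have "\<forall>\<^sub>F t in nhds 0. pd_v D2 (0, t) = pd_u B (D1 (0, t), t) * pd_v D1 (0, t) + pd_v B (D1 (0, t), t)" by simp
    from iffD2[OF DERIV_cong_ev[OF refl this refl] D]
    show ?thesis using DERIV_unique pd_real_slices(2)[OF d2(3)[OF in0]] by blast
  qed
  define b where "b u = B (u, 0)" for u
  have b_sm: "smooth_on (square e3) (\<lambda>p. B (fst p, 0))"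
    by (rule smooth_on_compose[OF B3]) (auto intro!: smooth_intros)
  define R where "R p = B p - B (fst p, 0)" for p
  have R: "smooth_on (square e3) R" unfolding R_def[abs_def] by (intro smooth_on_diff B3 b_sm open_square)
  have R_v: "pd_v R (u, 0) = pd_v B (u, 0)" if "\<bar>u\<bar> < e3" for u
  proof -
    have p: "(u, 0) \<in> square e3" using that e3(1) by simp
    have "((\<lambda>t. B (u, t) - B (u, 0)) has_real_derivative pd_v B (u, 0) - 0) (at 0)"
      by (intro DERIV_diff DERIV_const pd_real_slices smooth_on_differentiable[OF B3 p])
    then have "((\<lambda>t. R (u, t)) has_real_derivative pd_v B (u, 0)) (at 0)" by (simp add: R_def)
    from DERIV_unique[OF pd_real_slices(2)[OF smooth_on_differentiable[OF R p]] this] show ?thesis .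
  qed
  have R0: "R (u, 0) = 0" for u by (simp add: R_def)
  obtain h1 where h1: "smooth_on (square e3) h1" "\<And>u v. \<bar>u\<bar> < e3 \<Longrightarrow> \<bar>v\<bar> < e3 \<Longrightarrow> R (u, v) = v * h1 (u, v)"
    "\<And>u. \<bar>u\<bar> < e3 \<Longrightarrow> h1 (u, 0) = pd_v R (u, 0)"
    by (rule Hadamard_square[OF R R0]) (rule that)
  have h1_0: "h1 (u, 0) = 0" if "\<bar>u\<bar> < e3" for u using h1(3)[OF that] R_v[OF that] e3(3)[OF that] by simp
  obtain h2 where h2: "smooth_on (square e3) h2" "\<And>u v. \<bar>u\<bar> < e3 \<Longrightarrow> \<bar>v\<bar> < e3 \<Longrightarrow> h1 (u, v) = v * h2 (u, v)"
    by (rule Hadamard_square[OF h1(1)]) (rule h1_0, assumption, rule that)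
  have B_eq: "B (u, v) = b u + v\<^sup>2 * h2 (u, v)" if "\<bar>u\<bar> < e3" "\<bar>v\<bar> < e3" for u v
    using h1(2)[OF that] h2(2)[OF that] by (simp add: R_def b_def power2_eq_square algebra_simps)
  have in3: "(0, 0) \<in> square e3" using e3 by simp
  have slice_cont: "isCont (\<lambda>v. k (0, v)) 0" if "smooth_on (square e3) k" for k :: "real \<times> real \<Rightarrow> real"
    by (rule DERIV_isCont[OF pd_real_slices(2)[OF smooth_on_differentiable[OF that in3]]])
  have "pd_v (pd_v B) (0, 0) = 2 * h2 (0, 0)"
  proof -
    have "pd_v B (0, t) = t * (2 * h2 (0, t) + t * pd_v h2 (0, t))" if t: "\<bar>t\<bar> < e3" for t
    proof (rule DERIV_unique)
      have p: "(0, t) \<in> square e3" using t e3(1) by simp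
      show "((\<lambda>t. B (0, t)) has_real_derivative pd_v B (0, t)) (at t)"
        by (rule pd_real_slices(2)[OF smooth_on_differentiable[OF B3 p]])
      have "((\<lambda>t::real. t\<^sup>2) has_real_derivative 2 * t) (at t)" by (auto intro!: derivative_eq_intros)
      from DERIV_add[OF DERIV_const DERIV_mult[OF this pd_real_slices(2)[OF smooth_on_differentiable[OF h2(1) p]]], of "b 0"]
      have D: "((\<lambda>t. b 0 + t\<^sup>2 * h2 (0, t)) has_real_derivative t * (2 * h2 (0, t) + t * pd_v h2 (0, t))) (at t)"
        by (simp add: algebra_simps power2_eq_square)
      have "\<forall>\<^sub>F t in nhds t. B (0, t) = b 0 + t\<^sup>2 * h2 (0, t)"
        by (rule eventually_mono[OF eventually_nhds_in_open[of "{-e3<..<e3}" t]])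
          (use t e3(1) B_eq in \<open>auto simp: abs_less_iff\<close>)
      from iffD2[OF DERIV_cong_ev[OF refl this refl] D]
      show "((\<lambda>t. B (0, t)) has_real_derivative t * (2 * h2 (0, t) + t * pd_v h2 (0, t))) (at t)" .
    qed
    then have near: "\<forall>\<^sub>F t in nhds 0. pd_v B (0, t) = t * (2 * h2 (0, t) + t * pd_v h2 (0, t))"
      using eventually_abs_less[OF e3(1)] by (auto elim: eventually_mono)
    have "isCont (\<lambda>t. 2 * h2 (0, t) + t * pd_v h2 (0, t)) 0"
      by (intro continuous_add continuous_mult continuous_const continuous_ident slice_cont h2 smooth_on_pd)
    from vanishing_times_continuous[OF DERIV_ident _ this]
    have D: "((\<lambda>t. t * (2 * h2 (0, t) + t * pd_v h2 (0, t))) has_real_derivative 2 * h2 (0, 0)) (at 0)" by simp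
    from iffD2[OF DERIV_cong_ev[OF refl near refl] D]
    show ?thesis using DERIV_unique pd_real_slices(2)[OF dB(3)[OF in1]] by blast
  qed
  then have h2_0: "h2 (0, 0) \<noteq> 0" using Bvv0 assms(8) by simp
  define a where "a = sgn (h2 (0, 0))"
  have a: "a * a = 1" "a * h2 (0, 0) > 0" using h2_0 by (auto simp: a_def sgn_if mult_less_0_iff)
  have "isCont h2 (0, 0)" using smooth_on_continuous[OF h2(1)] in3 by (simp add: continuous_on_eq_continuous_at)
  then have "((\<lambda>p. a * h2 p) \<longlongrightarrow> a * h2 (0, 0)) (nhds (0, 0))" by (intro tendsto_mult tendsto_const isCont_tendsto_nhds)
  from order_tendstoD(1)[OF this a(2)] have "\<forall>\<^sub>F p in nhds 0. 0 < a * h2 p" by (simp add: zero)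
  then obtain e4' where e4': "e4' > 0" "\<And>p. p \<in> square e4' \<Longrightarrow> 0 < a * h2 p" unfolding eventually_square by blast
  define e4 where "e4 = min e4' e3"
  have e4: "e4 > 0" "e4 \<le> e3" "\<And>p. p \<in> square e4 \<Longrightarrow> 0 < a * h2 p"
    using e4' e3 square_mono[of e4 e4'] by (auto simp: e4_def)
  have in4: "(0, 0) \<in> square e4" using e4 by simp
  define w where "w p = sqrt (a * h2 p)" for p
  have w: "smooth_on (square e4) w" unfolding w_def[abs_def]
    by (intro smooth_intros smooth_on_subset[OF h2(1) square_mono[OF e4(2)]] open_square e4(3))
  \<comment> \<open>The root of the quadratic remainder becomes the second coordinate.\<close>
  define Z3 where "Z3 p = p + (snd p * (w p - 1)) *\<^sub>R (0, 1)" for p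
  have Z3: "Z3 p = (fst p, snd p * w p)" for p by (cases p) (simp add: Z3_def algebra_simps)
  have "diffeo_germ Z3 0 (0 + (snd (0 :: real \<times> real) * (w 0 - 1)) *\<^sub>R (0, 1))"
    unfolding Z3_def[abs_def]
  proof (rule diffeo_germ_add_direction[OF _ open_square])
    show sm: "smooth_on (square e4) (\<lambda>p. snd p * (w p - 1))" by (intro smooth_intros w open_square)
    show "0 \<in> square e4" using in4 by (simp add: zero)
    have "isCont (\<lambda>v. w (0, v)) 0"
      by (rule DERIV_isCont[OF pd_real_slices(2)[OF smooth_on_differentiable[OF w in4]]])
    then have "isCont (\<lambda>v. w (0, v) - 1) 0" by (intro continuous_diff continuous_const)
    from vanishing_times_continuous[OF DERIV_ident _ this]
    have "((\<lambda>v. v * (w (0, v) - 1)) has_real_derivative w (0, 0) - 1) (at 0)" by simp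
    with pd_real_slices(2)[OF smooth_on_differentiable[OF sm in4]]
    have "pd_v (\<lambda>p. snd p * (w p - 1)) (0, 0) = w (0, 0) - 1" using DERIV_unique by fastforce
    moreover have "w (0, 0) \<noteq> 0" using e4(3)[OF in4] h2_0 a(1) by (auto simp: w_def)
    ultimately show "1 + frechet_derivative (\<lambda>p. snd p * (w p - 1)) (at 0) (0, 1) \<noteq> 0"
      by (simp add: zero pd_v_def dir_deriv_def)
  qed
  then have Z3_diffeo: "diffeo_germ Z3 0 0" by (simp add: zero_prod_def)
  obtain T3 where T3: "diffeo_germ T3 0 0" "\<forall>\<^sub>F x in nhds 0. T3 (Z3 x) = x" "\<forall>\<^sub>F y in nhds 0. Z3 (T3 y) = y"
    using diffeo_germ_inverse[OF Z3_diffeo] .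
  have ev_e4: "\<forall>\<^sub>F p in nhds (0 :: real \<times> real). p \<in> square e4"
    using eventually_nhds_in_open[OF open_square, of 0 e4] in4 by (simp add: zero)
  from diffeo_germ_eventually[OF T3(1) ev_e4] T3(3)
  have "\<forall>\<^sub>F p in nhds 0. T3 p \<in> square e4 \<and> Z3 (T3 p) = p" by eventually_elim simp
  then obtain e5' where e5': "e5' > 0" "\<And>p. p \<in> square e5' \<Longrightarrow> T3 p \<in> square e4 \<and> Z3 (T3 p) = p"
    unfolding eventually_square by blast
  define e5 where "e5 = min e5' e3"
  have e5: "e5 > 0" "e5 \<le> e3" "\<And>p. p \<in> square e5 \<Longrightarrow> T3 p \<in> square e4 \<and> Z3 (T3 p) = p"
    using e5' e3 square_mono[of e5 e5'] by (auto simp: e5_def)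
  show thesis
  proof (rule that[of "\<lambda>p. T (T3 p)" a e5 b])
    show "diffeo_germ (\<lambda>p. T (T3 p)) 0 0" by (rule diffeo_germ_compose[OF T3(1) T(1)])
    show "a * a = 1" "e5 > 0" by fact+
    show "smooth_on {-e5<..<e5} b" unfolding b_def[abs_def]
      by (rule smooth_on_compose[OF B3]) (use e5 e3 in \<open>auto intro!: smooth_intros\<close>)
    show "D1 (T (T3 p)) = fst p \<and> D2 (T (T3 p)) = b (fst p) + a * (snd p)\<^sup>2" if p: "p \<in> square e5" for p
    proof -
      define y where "y = T3 p"
      have y: "y \<in> square e4" "Z3 y = p" using e5(3)[OF p] by (auto simp: y_def)
      then have y3: "\<bar>fst y\<bar> < e3" "\<bar>snd y\<bar> < e3" and y1: "y \<in> square e1"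
        using e4(2) e3(2) by (cases y; simp)+
      have p_eq: "fst p = fst y" "snd p = snd y * w y" using y(2) by (auto simp: Z3)
      have "D1 (T y) = fst y" using arg_cong[OF e1(4)[OF y1], of fst] by (simp add: Z2)
      moreover have "D2 (T y) = b (fst y) + (snd y)\<^sup>2 * h2 y" using B_eq[OF y3] by (simp add: B_def)
      moreover have "a * (snd p)\<^sup>2 = (snd y)\<^sup>2 * h2 y"
      proof -
        have "(w y)\<^sup>2 = a * h2 y" using e4(3)[OF y(1)] by (simp add: w_def)
        then have "a * (snd p)\<^sup>2 = (a * a) * ((snd y)\<^sup>2 * h2 y)" by (simp add: p_eq power_mult_distrib)
        then show ?thesis by (simp add: a(1))
      qed
      ultimately show ?thesis by (simp add: y_def[symmetric] p_eq(1))
    qed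
    have "\<forall>\<^sub>F x in nhds 0. T (T3 (Z3 (Z2 x))) = x"
      using T(2) diffeo_germ_eventually[OF Z2_diffeo T3(2)] by eventually_elim simp
    moreover have "filterlim (\<lambda>u. (u, 0 :: real)) (nhds 0) (nhds (0 :: real))"
      using isCont_tendsto_nhds[of "0 :: real" "\<lambda>u. (u, 0 :: real)"]
      by (simp add: continuous_Pair continuous_ident zero)
    ultimately have "\<forall>\<^sub>F u in nhds 0. T (T3 (Z3 (Z2 (u, 0)))) = (u, 0)" by (rule eventually_compose_filterlim)
    then show "\<forall>\<^sub>F u in nhds 0. T (T3 (D1 (u, 0), 0)) = (u, 0)" by (simp add: Z2 Z3)
  qed
qed

lemma pd_shear:
  fixes k :: "real \<times> real \<Rightarrow> real"
  assumes g: "(g has_real_derivative g') (at (fst p))" and k: "k differentiable (at (fst p, snd p + g (fst p)))"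
  shows "(\<lambda>p. k (fst p, snd p + g (fst p))) differentiable (at p)"
    and "pd_u (\<lambda>p. k (fst p, snd p + g (fst p))) p
      = pd_u k (fst p, snd p + g (fst p)) + g' * pd_v k (fst p, snd p + g (fst p))"
    and "pd_v (\<lambda>p. k (fst p, snd p + g (fst p))) p = pd_v k (fst p, snd p + g (fst p))"
proof -
  have "((\<lambda>p. (fst p, snd p + g (fst p))) has_derivative (\<lambda>w. (fst w, snd w + g' * fst w))) (at p)"
    by (intro has_derivative_Pair has_derivative_add bounded_linear_imp_has_derivative bounded_linear_snd bounded_linear_fst
      has_derivative_compose[OF bounded_linear_imp_has_derivative[OF bounded_linear_fst] g[unfolded has_field_derivative_def]])
  from has_derivative_compose[OF this has_derivative_pd[OF k]]
  have D: "((\<lambda>p. k (fst p, snd p + g (fst p))) has_derivative (\<lambda>w. fst (fst w, snd w + g' * fst w) *\<^sub>R pd_u k (fst p, snd p + g (fst p))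
      + snd (fst w, snd w + g' * fst w) *\<^sub>R pd_v k (fst p, snd p + g (fst p)))) (at p)" .
  show "(\<lambda>p. k (fst p, snd p + g (fst p))) differentiable (at p)" using D by (auto simp: differentiable_def)
  show "pd_u (\<lambda>p. k (fst p, snd p + g (fst p))) p
      = pd_u k (fst p, snd p + g (fst p)) + g' * pd_v k (fst p, snd p + g (fst p))"
    "pd_v (\<lambda>p. k (fst p, snd p + g (fst p))) p = pd_v k (fst p, snd p + g (fst p))"
    by (simp_all add: pd_u_eqI[OF D] pd_v_eqI[OF D])
qed

text \<open>
  A shear straightens the singular curve \<open>v = g u\<close>. The inverse coordinates are kept track of on that
  curve, because the final criterion is stated along it.
\<close>

lemma fold_coordinates:
  fixes D1 D2 :: "real \<times> real \<Rightarrow> real"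
  assumes r: "r > 0" and D1: "smooth_on (square r) D1" and D2: "smooth_on (square r) D2"
    and g: "smooth_on {-r<..<r} g" "g 0 = 0"
    and "D1 (0, 0) = 0" "pd_u D1 (0, 0) \<noteq> 0" "pd_v D1 (0, 0) = 0" "pd_u D2 (0, 0) = 0" "pd_v (pd_v D2) (0, 0) \<noteq> 0"
    and jac: "\<forall>\<^sub>F u in nhds 0. pd_u D1 (u, g u) * pd_v D2 (u, g u) = pd_v D1 (u, g u) * pd_u D2 (u, g u)"
  obtains \<theta> b a e where "diffeo_germ \<theta> 0 0" "a * a = (1::real)" "e > 0" "smooth_on {-e<..<e} b"
    "\<And>p. p \<in> square e \<Longrightarrow> D1 (\<theta> p) = fst p \<and> D2 (\<theta> p) = b (fst p) + a * (snd p)\<^sup>2"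
    "\<forall>\<^sub>F u in nhds 0. \<theta> (D1 (u, g u), 0) = (u, g u)"
proof -
  have zero: "(0, 0) = (0 :: real \<times> real)" by (simp add: zero_prod_def)
  define S where "S p = p + g (fst p) *\<^sub>R (0, 1)" for p :: "real \<times> real"
  have S: "S p = (fst p, snd p + g (fst p))" for p by (cases p) (simp add: S_def)
  have gf: "smooth_on (square r) (\<lambda>p. g (fst p))"
    by (rule smooth_on_compose[OF g(1)]) (auto simp: square_def intro!: smooth_intros open_Times)
  have g_d: "(g has_real_derivative deriv g u) (at u)" if "\<bar>u\<bar> < r" for u
    using smooth_on_differentiable[OF g(1), of u] that
    by (simp add: abs_less_iff DERIV_deriv_iff_real_differentiable)
  have "diffeo_germ S 0 (0 + g (fst (0 :: real \<times> real)) *\<^sub>R (0, 1))"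
    unfolding S_def[abs_def]
  proof (rule diffeo_germ_add_direction[OF gf open_square])
    show "0 \<in> square r" using r by (simp add: zero_prod_def)
    have "((\<lambda>p. g (fst p)) has_derivative (\<lambda>w. deriv g 0 * fst w)) (at (0 :: real \<times> real))"
      using g_d[of 0] r
      by (intro has_derivative_compose[OF bounded_linear_imp_has_derivative[OF bounded_linear_fst]])
        (simp add: has_field_derivative_def)
    from fun_cong[OF frechet_derivative_at[OF this], of "(0, 1)"]
    show "1 + frechet_derivative (\<lambda>p. g (fst p)) (at 0) ((0, 1) :: real \<times> real) \<noteq> 0" by simp
  qed
  then have S_diffeo: "diffeo_germ S 0 0" using g(2) by (simp add: zero_prod_def)
  have "\<forall>\<^sub>F p in nhds (0 :: real \<times> real). p \<in> square r"
    using eventually_nhds_in_open[OF open_square, of 0 r] r by (simp add: zero_prod_def)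
  with diffeo_germ_eventually[OF S_diffeo this] have "\<forall>\<^sub>F p in nhds 0. S p \<in> square r \<and> p \<in> square r"
    by eventually_elim simp
  then obtain d where d: "d > 0" "\<And>p. p \<in> square d \<Longrightarrow> S p \<in> square r \<and> p \<in> square r" unfolding eventually_square by blast
  have S_sm: "smooth_on (square d) S" unfolding S_def[abs_def]
    by (intro smooth_intros smooth_on_subset[OF gf] open_square) (use d in auto)
  define E1 where "E1 p = D1 (fst p, snd p + g (fst p))" for p
  define E2 where "E2 p = D2 (fst p, snd p + g (fst p))" for p
  have E_S: "E1 p = D1 (S p)" "E2 p = D2 (S p)" for p by (simp_all add: E1_def E2_def S)
  have E: "smooth_on (square d) E1" "smooth_on (square d) E2"
    unfolding E_S[abs_def] by (rule smooth_on_compose[OF D1 S_sm] smooth_on_compose[OF D2 S_sm]; use d in auto)+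
  have pd_E: "pd_u E1 p = pd_u D1 (S p) + deriv g (fst p) * pd_v D1 (S p)" "pd_v E1 p = pd_v D1 (S p)"
    "pd_u E2 p = pd_u D2 (S p) + deriv g (fst p) * pd_v D2 (S p)" "pd_v E2 p = pd_v D2 (S p)"
    if p: "p \<in> square d" for p
  proof -
    have "(g has_real_derivative deriv g (fst p)) (at (fst p))" using d(2)[OF p] by (intro g_d) (cases p; simp)
    note * = pd_shear[OF this]
    have "D1 differentiable (at (fst p, snd p + g (fst p)))" "D2 differentiable (at (fst p, snd p + g (fst p)))"
      using d(2)[OF p] smooth_on_differentiable D1 D2 unfolding S by blast+
    from *(2,3)[OF this(1)] *(2,3)[OF this(2)]
    show "pd_u E1 p = pd_u D1 (S p) + deriv g (fst p) * pd_v D1 (S p)" "pd_v E1 p = pd_v D1 (S p)"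
      "pd_u E2 p = pd_u D2 (S p) + deriv g (fst p) * pd_v D2 (S p)" "pd_v E2 p = pd_v D2 (S p)"
      by (simp_all add: E1_def[abs_def] E2_def[abs_def] S)
  qed
  have S0: "S (0, 0) = (0, 0)" using g(2) by (simp add: S)
  have in0: "(0, 0) \<in> square d" using d by simp
  have inr: "(0, 0) \<in> square r" using r by simp
  have D2v0: "pd_v D2 (0, 0) = 0"
    using eventually_nhds_x_imp_x[OF jac] assms(7,8) g(2) by simp
  have Evv: "pd_v (pd_v E2) (0, 0) = pd_v (pd_v D2) (0, 0)"
  proof -
    have *: "(\<lambda>p. pd_v D2 (fst p, snd p + g (fst p))) differentiable (at (0, 0))"
      "pd_v (\<lambda>p. pd_v D2 (fst p, snd p + g (fst p))) (0, 0) = pd_v (pd_v D2) (0, 0)"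
      using pd_shear(1,3)[of g "deriv g 0" "(0, 0)" "pd_v D2"] g_d[of 0] r g(2)
        smooth_on_differentiable[OF smooth_on_pd(2)[OF D2] inr] by simp_all
    have "\<forall>\<^sub>F p in nhds (0, 0). pd_v D2 (fst p, snd p + g (fst p)) = pd_v E2 p"
      by (rule eventually_mono[OF eventually_nhds_in_open[OF open_square in0]]) (use pd_E(4) in \<open>simp add: S\<close>)
    from pd_cong(3)[OF this *(1)] *(2) show ?thesis by simp
  qed
  have jacE: "\<forall>\<^sub>F u in nhds 0. pd_u E1 (u, 0) * pd_v E2 (u, 0) = pd_v E1 (u, 0) * pd_u E2 (u, 0)"
    using jac eventually_abs_less[OF d(1)]
  proof eventually_elim
    case (elim u)
    then have "(u, 0) \<in> square d" using d(1) by simp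
    from pd_E[OF this] elim(1) show ?case by (simp add: S algebra_simps)
  qed
  obtain \<theta> b a e where t: "diffeo_germ \<theta> 0 0" "a * a = (1::real)" "e > 0" "smooth_on {-e<..<e} b"
    "\<And>p. p \<in> square e \<Longrightarrow> E1 (\<theta> p) = fst p \<and> E2 (\<theta> p) = b (fst p) + a * (snd p)\<^sup>2"
    "\<forall>\<^sub>F u in nhds 0. \<theta> (E1 (u, 0), 0) = (u, 0)"
  proof (rule fold_coordinates_axis[OF d(1) E _ _ _ _ _ jacE])
    show "E1 (0, 0) = 0" "pd_u E1 (0, 0) \<noteq> 0" "pd_v E1 (0, 0) = 0" "pd_u E2 (0, 0) = 0" "pd_v (pd_v E2) (0, 0) \<noteq> 0"
      using assms(6-10) pd_E[OF in0] D2v0 Evv by (simp_all add: S0 E_S)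
  qed (rule that)
  show thesis
  proof (rule that[of "\<lambda>p. S (\<theta> p)" a e b])
    show "diffeo_germ (\<lambda>p. S (\<theta> p)) 0 0" by (rule diffeo_germ_compose[OF t(1) S_diffeo])
    show "a * a = 1" "e > 0" "smooth_on {-e<..<e} b" by fact+
    show "D1 (S (\<theta> p)) = fst p \<and> D2 (S (\<theta> p)) = b (fst p) + a * (snd p)\<^sup>2" if "p \<in> square e" for p
      using t(5)[OF that] by (simp add: E_S)
    show "\<forall>\<^sub>F u in nhds 0. S (\<theta> (D1 (u, g u), 0)) = (u, g u)"
      using t(6) by eventually_elim (simp add: E1_def S)
  qed
qed

section \<open>Rules for partial derivatives\<close>

text \<open>
  Schwarz's theorem, obtained from Hadamard's lemma: if \<open>f (u, v) = f (u, 0) + v h (u, v)\<close>, then both mixed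
  derivatives at the origin equal \<open>h\<^sub>u (0, 0)\<close>.
\<close>

lemma pd_commute_real:
  fixes f :: "real \<times> real \<Rightarrow> real"
  assumes "open S" "smooth_on S f" "p \<in> S"
  shows "pd_u (pd_v f) p = pd_v (pd_u f) p"
proof -
  obtain a b where p: "p = (a, b)" by (cases p)
  define F where "F q = f (fst q + a, snd q + b)" for q
  have "open ((\<lambda>q. (fst q + a, snd q + b)) -` S)"
    by (intro open_vimage assms(1)) (auto intro!: continuous_intros)
  moreover have "0 \<in> (\<lambda>q. (fst q + a, snd q + b)) -` S" using assms(3) p by simp
  ultimately obtain r where r: "r > 0" "square r \<subseteq> (\<lambda>q. (fst q + a, snd q + b)) -` S"
    using square_subset_open by blast
  have in_S: "(u + a, v + b) \<in> S" if "\<bar>u\<bar> < r" "\<bar>v\<bar> < r" for u v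
  proof -
    have "(u, v) \<in> square r" using that by simp
    from subsetD[OF r(2) this] show ?thesis by simp
  qed
  have F: "smooth_on (square r) F" unfolding F_def[abs_def]
    by (rule smooth_on_compose[OF assms(2)]) (use r assms(1) in \<open>auto intro!: smooth_intros\<close>)
  define R where "R q = F q - F (fst q, 0)" for q
  have R: "smooth_on (square r) R" unfolding R_def[abs_def]
    by (intro smooth_on_diff F open_square smooth_on_compose[OF F]) (auto simp: square_def open_Times intro!: smooth_intros)
  have R0: "R (u, 0) = 0" for u by (simp add: R_def)
  obtain h where h: "smooth_on (square r) h" "\<And>u v. \<bar>u\<bar> < r \<Longrightarrow> \<bar>v\<bar> < r \<Longrightarrow> R (u, v) = v * h (u, v)"
    "\<And>u. \<bar>u\<bar> < r \<Longrightarrow> h (u, 0) = pd_v R (u, 0)"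
    by (rule Hadamard_square[OF R R0]) (rule that)
  have d: "k differentiable (at (u, v))" if "smooth_on (square r) k" "\<bar>u\<bar> < r" "\<bar>v\<bar> < r" for k :: "real \<times> real \<Rightarrow> real" and u v
    using smooth_on_differentiable[OF that(1), of "(u, v)"] that(2,3) by simp
  have df: "k differentiable (at (u + a, v + b))" if "smooth_on S k" "\<bar>u\<bar> < r" "\<bar>v\<bar> < r" for k :: "real \<times> real \<Rightarrow> real" and u v
    using smooth_on_differentiable[OF that(1) in_S[OF that(2,3)]] .
  have shift: "((\<lambda>t. k (t + a)) has_real_derivative D) (at u) \<longleftrightarrow> (k has_real_derivative D) (at (u + a))"
    for k :: "real \<Rightarrow> real" and u a D by (rule DERIV_shift[symmetric])
  have hu: "h (u, 0) = pd_v f (u + a, b)" if u: "\<bar>u\<bar> < r" for u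
  proof -
    have "((\<lambda>t. f (u + a, t + b)) has_real_derivative pd_v f (u + a, b)) (at 0)"
      unfolding shift[of "\<lambda>t. f (u + a, t)"] using pd_real_slices(2)[OF df[OF assms(2) u, of 0]] r(1) by simp
    from DERIV_diff[OF this DERIV_const]
    have "((\<lambda>t. R (u, t)) has_real_derivative pd_v f (u + a, b)) (at 0)" by (simp add: R_def F_def)
    from DERIV_unique[OF pd_real_slices(2)[OF d[OF R u, of 0]] this] show ?thesis using h(3)[OF u] r(1) by simp
  qed
  have "pd_u h (0, 0) = pd_u (pd_v f) (a, b)"
  proof (rule DERIV_unique)
    show "((\<lambda>t. h (t, 0)) has_real_derivative pd_u h (0, 0)) (at 0)" by (rule pd_real_slices(1)[OF d[OF h(1)]]) (use r in auto)
    have D: "((\<lambda>t. pd_v f (t + a, b)) has_real_derivative pd_u (pd_v f) (a, b)) (at 0)"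
      unfolding shift[of "\<lambda>t. pd_v f (t, b)"] using pd_real_slices(1)[OF df[OF smooth_on_pd(2)[OF assms(2)], of 0 0]] r(1) by simp
    have "\<forall>\<^sub>F t in nhds 0. h (t, 0) = pd_v f (t + a, b)"
      using eventually_abs_less[OF r(1)] by eventually_elim (rule hu)
    from iffD2[OF DERIV_cong_ev[OF refl this refl] D]
    show "((\<lambda>t. h (t, 0)) has_real_derivative pd_u (pd_v f) (a, b)) (at 0)" .
  qed
  moreover have "pd_u h (0, 0) = pd_v (pd_u f) (a, b)"
  proof (rule DERIV_unique)
    have uF: "pd_u f (a, t + b) = pd_u f (a, b) + t * pd_u h (0, t)" if t: "\<bar>t\<bar> < r" for t
    proof (rule DERIV_unique)
      show "((\<lambda>u. f (u + a, t + b)) has_real_derivative pd_u f (a, t + b)) (at 0)"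
        unfolding shift[of "\<lambda>u. f (u, t + b)"] using pd_real_slices(1)[OF df[OF assms(2) _ t, of 0]] r(1) by simp
      have "((\<lambda>u. f (u + a, b)) has_real_derivative pd_u f (a, b)) (at 0)"
        unfolding shift[of "\<lambda>u. f (u, b)"] using pd_real_slices(1)[OF df[OF assms(2), of 0 0]] r(1) by simp
      moreover have "((\<lambda>u. t * h (u, t)) has_real_derivative t * pd_u h (0, t)) (at 0)"
        by (intro DERIV_cmult pd_real_slices(1) d[OF h(1)] t) (use r in simp)
      ultimately have D: "((\<lambda>u. f (u + a, b) + t * h (u, t)) has_real_derivative pd_u f (a, b) + t * pd_u h (0, t)) (at 0)"
        by (rule DERIV_add)
      have "\<forall>\<^sub>F u in nhds 0. f (u + a, t + b) = f (u + a, b) + t * h (u, t)"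
        using eventually_abs_less[OF r(1)]
        by eventually_elim (use h(2)[OF _ t] in \<open>simp add: R_def F_def algebra_simps\<close>)
      from iffD2[OF DERIV_cong_ev[OF refl this refl] D]
      show "((\<lambda>u. f (u + a, t + b)) has_real_derivative pd_u f (a, b) + t * pd_u h (0, t)) (at 0)" .
    qed
    have D: "((\<lambda>t. pd_u f (a, t + b)) has_real_derivative pd_v (pd_u f) (a, b)) (at 0)"
      unfolding shift[of "\<lambda>t. pd_u f (a, t)"] using pd_real_slices(2)[OF df[OF smooth_on_pd(1)[OF assms(2)], of 0 0]] r(1) by simp
    then show "((\<lambda>t. pd_u f (a, t + b)) has_real_derivative pd_v (pd_u f) (a, b)) (at 0)" .
    have "isCont (\<lambda>t. pd_u h (0, t)) 0"
      by (rule DERIV_isCont[OF pd_real_slices(2)[OF d[OF smooth_on_pd(1)[OF h(1)]]]]) (use r in auto)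
    from DERIV_add[OF DERIV_const vanishing_times_continuous[OF DERIV_ident _ this], of "pd_u f (a, b)"]
    have D2: "((\<lambda>t. pd_u f (a, b) + t * pd_u h (0, t)) has_real_derivative pd_u h (0, 0)) (at 0)" by simp
    have "\<forall>\<^sub>F t in nhds 0. pd_u f (a, t + b) = pd_u f (a, b) + t * pd_u h (0, t)"
      using eventually_abs_less[OF r(1)] by eventually_elim (rule uF)
    from iffD2[OF DERIV_cong_ev[OF refl this refl] D2]
    show "((\<lambda>t. pd_u f (a, t + b)) has_real_derivative pd_u h (0, 0)) (at 0)" .
  qed
  ultimately show ?thesis by (simp add: p)
qed

lemma pd_bounded_linear:
  assumes "bounded_linear L" "f differentiable (at p)"
  shows "(\<lambda>q. L (f q)) differentiable (at p)" "pd_u (\<lambda>q. L (f q)) p = L (pd_u f p)" "pd_v (\<lambda>q. L (f q)) p = L (pd_v f p)"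
proof -
  interpret bounded_linear L by fact
  have D: "((\<lambda>q. L (f q)) has_derivative (\<lambda>w. L (fst w *\<^sub>R pd_u f p + snd w *\<^sub>R pd_v f p))) (at p)"
    by (rule has_derivative[OF has_derivative_pd[OF assms(2)]])
  then show "(\<lambda>q. L (f q)) differentiable (at p)" by (auto simp: differentiable_def)
  show "pd_u (\<lambda>q. L (f q)) p = L (pd_u f p)" "pd_v (\<lambda>q. L (f q)) p = L (pd_v f p)"
    by (simp_all add: pd_u_eqI[OF D] pd_v_eqI[OF D])
qed

lemma pd_commute:
  fixes f :: "real \<times> real \<Rightarrow> real^3"
  assumes "open S" "smooth_on S f" "p \<in> S"
  shows "pd_u (pd_v f) p = pd_v (pd_u f) p"
proof -
  have "pd_u (pd_v f) p $ i = pd_v (pd_u f) p $ i" for i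
  proof -
    note L = pd_bounded_linear[OF bounded_linear_vec_nth[of i]]
    have d: "f differentiable (at q)" "pd_u f differentiable (at q)" "pd_v f differentiable (at q)" if "q \<in> S" for q
      using smooth_on_differentiable[OF _ that] assms(2) smooth_on_pd by blast+
    have "\<forall>\<^sub>F q in nhds p. pd_v f q $ i = pd_v (\<lambda>q. f q $ i) q" "\<forall>\<^sub>F q in nhds p. pd_u f q $ i = pd_u (\<lambda>q. f q $ i) q"
      by (rule eventually_mono[OF eventually_nhds_in_open[OF assms(1,3)]], simp add: L(2,3)[OF d(1)])+
    from pd_cong(2)[OF this(1) L(1)[OF d(3)[OF assms(3)]]] pd_cong(3)[OF this(2) L(1)[OF d(2)[OF assms(3)]]]
    have "pd_u (pd_v f) p $ i = pd_u (pd_v (\<lambda>q. f q $ i)) p" "pd_v (pd_u f) p $ i = pd_v (pd_u (\<lambda>q. f q $ i)) p"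
      by (simp_all add: L(2)[OF d(3)[OF assms(3)]] L(3)[OF d(2)[OF assms(3)]])
    then show ?thesis
      using pd_commute_real[OF assms(1) smooth_on_nth[OF assms(2,1)] assms(3), of i] by simp
  qed
  then show ?thesis by (simp add: vec_eq_iff)
qed

lemma pd_inner:
  fixes f g :: "real \<times> real \<Rightarrow> real^3"
  assumes "f differentiable (at p)" "g differentiable (at p)"
  shows "(\<lambda>q. f q \<bullet> g q) differentiable (at p)"
    "pd_u (\<lambda>q. f q \<bullet> g q) p = pd_u f p \<bullet> g p + f p \<bullet> pd_u g p"
    "pd_v (\<lambda>q. f q \<bullet> g q) p = pd_v f p \<bullet> g p + f p \<bullet> pd_v g p"
proof -
  have D: "((\<lambda>q. f q \<bullet> g q) has_derivative (\<lambda>w. f p \<bullet> (fst w *\<^sub>R pd_u g p + snd w *\<^sub>R pd_v g p)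
      + (fst w *\<^sub>R pd_u f p + snd w *\<^sub>R pd_v f p) \<bullet> g p)) (at p)"
    by (rule has_derivative_inner[OF has_derivative_pd[OF assms(1)] has_derivative_pd[OF assms(2)]])
  then show "(\<lambda>q. f q \<bullet> g q) differentiable (at p)" by (auto simp: differentiable_def)
  show "pd_u (\<lambda>q. f q \<bullet> g q) p = pd_u f p \<bullet> g p + f p \<bullet> pd_u g p"
    "pd_v (\<lambda>q. f q \<bullet> g q) p = pd_v f p \<bullet> g p + f p \<bullet> pd_v g p"
    by (simp_all add: pd_u_eqI[OF D] pd_v_eqI[OF D])
qed

lemma pd_compose:
  fixes \<theta> :: "real \<times> real \<Rightarrow> real \<times> real"
  assumes "\<theta> differentiable (at p)" "f differentiable (at (\<theta> p))"
  shows "(\<lambda>q. f (\<theta> q)) differentiable (at p)"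
    "pd_v (\<lambda>q. f (\<theta> q)) p = fst (pd_v \<theta> p) *\<^sub>R pd_u f (\<theta> p) + snd (pd_v \<theta> p) *\<^sub>R pd_v f (\<theta> p)"
proof -
  have D: "((\<lambda>q. f (\<theta> q)) has_derivative (\<lambda>w. fst (fst w *\<^sub>R pd_u \<theta> p + snd w *\<^sub>R pd_v \<theta> p) *\<^sub>R pd_u f (\<theta> p)
      + snd (fst w *\<^sub>R pd_u \<theta> p + snd w *\<^sub>R pd_v \<theta> p) *\<^sub>R pd_v f (\<theta> p))) (at p)"
    by (rule has_derivative_compose[OF has_derivative_pd[OF assms(1)] has_derivative_pd[OF assms(2)]])
  then show "(\<lambda>q. f (\<theta> q)) differentiable (at p)" by (auto simp: differentiable_def)
  show "pd_v (\<lambda>q. f (\<theta> q)) p = fst (pd_v \<theta> p) *\<^sub>R pd_u f (\<theta> p) + snd (pd_v \<theta> p) *\<^sub>R pd_v f (\<theta> p)"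
    by (simp add: pd_v_eqI[OF D])
qed

section \<open>A criterion for cuspidal cross caps\<close>

lemma has_cuspidal_cross_cap_cong:
  assumes "A_equivalent f p g q" "isCont f p" "isCont g q"
  shows "has_cuspidal_cross_cap f p \<longleftrightarrow> has_cuspidal_cross_cap g q"
  unfolding has_cuspidal_cross_cap_def
  using A_equivalent_trans[OF assms(1)] A_equivalent_trans[OF A_equivalent_sym[OF assms(1,2)]] by blast

lemma frame_coordinates_diffeo:
  fixes p q c :: "real^3"
  assumes "p \<bullet> q = 0" "p \<noteq> 0" "q \<noteq> 0"
  shows "diffeo_germ (\<lambda>z. vector [(z - c) \<bullet> p, (z - c) \<bullet> cross3 q p, (z - c) \<bullet> q] :: real^3) c 0"
proof -
  define w where "w = cross3 q p"
  have orth: "p \<bullet> q = 0" "q \<bullet> p = 0" "p \<bullet> w = 0" "w \<bullet> p = 0" "q \<bullet> w = 0" "w \<bullet> q = 0"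
    using assms(1) by (auto simp: w_def dot_cross_self inner_commute)
  have "w \<bullet> w = (q \<bullet> q) * (p \<bullet> p)"
    using norm_cross_dot[of q p] assms(1) by (simp add: w_def power2_norm_eq_inner power_mult_distrib inner_commute)
  then have nz: "p \<bullet> p \<noteq> 0" "q \<bullet> q \<noteq> 0" "w \<bullet> w \<noteq> 0" using assms(2,3) by auto
  define T where "T z = (vector [z \<bullet> p, z \<bullet> w, z \<bullet> q] :: real^3)" for z
  define S where "S y = (y $ 1 / (p \<bullet> p)) *\<^sub>R p + (y $ 2 / (w \<bullet> w)) *\<^sub>R w + (y $ 3 / (q \<bullet> q)) *\<^sub>R q" for y :: "real^3"
  have T: "linear T" unfolding T_def[abs_def] vector3_eq
    by (intro linearI) (simp_all add: inner_add_left scaleR_add_left algebra_simps)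
  have S: "linear S" unfolding S_def[abs_def]
    by (intro linearI) (simp_all add: add_divide_distrib scaleR_add_left algebra_simps)
  have TS: "T (S y) = y" for y
    using nz by (simp add: T_def S_def vec_eq_iff forall_3 inner_add_left orth)
  then have "surj T" by (metis surjI)
  then have "inj T" by (rule linear_surj_imp_inj[OF T])
  then have ST: "S (T z) = z" for z using TS[of "T z"] by (simp add: inj_eq)
  have "diffeo_germ (\<lambda>z. T (z - c)) c (T (c - c))"
    using T S ST TS by (intro diffeo_germ_affine[where S = S]) (auto simp: linear_conv_bounded_linear)
  then show ?thesis using linear_0[OF T] by (simp add: T_def[abs_def] w_def)
qed

lemma cross_inner_orthogonal:
  fixes p n V q :: "real^3"
  assumes "n \<bullet> p = 0" "V \<bullet> p = 0"
  shows "(cross3 V n \<bullet> q) * (p \<bullet> p) = - (p \<bullet> cross3 n V) * (p \<bullet> q)"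
proof -
  have "(cross3 V n \<bullet> q) * (p \<bullet> p) = - (p \<bullet> cross3 n V) * (p \<bullet> q)
      + (n \<bullet> p) * (cross3 V p \<bullet> q) - (V \<bullet> p) * (cross3 n p \<bullet> q)"
    by (simp add: inner_vec_def sum_3 cross3_def) (simp add: algebra_simps)
  then show ?thesis using assms by simp
qed

text \<open>
  Let \<open>\<eta> = \<partial>\<^sub>v - s \<partial>\<^sub>u\<close> be a null direction. This is the symmetry of the second
  fundamental form: \<open>dn(\<eta>) \<bullet> C\<^sub>u\<close> equals \<open>n\<^sub>u \<bullet> dC(\<eta>)\<close>, and \<open>dC(\<eta>) = 0\<close>.
\<close>

lemma normal_derivative_on_singular_curve:
  fixes C n :: surf
  assumes "open S" "smooth_on S C" "smooth_on S n" "p \<in> S"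
    and orth: "\<And>q. q \<in> S \<Longrightarrow> n q \<bullet> pd_u C q = 0 \<and> n q \<bullet> pd_v C q = 0"
    and null: "pd_v C p = s *\<^sub>R pd_u C p"
  shows "(pd_v n p - s *\<^sub>R pd_u n p) \<bullet> pd_u C p = 0"
proof -
  have d: "n differentiable (at p)" "pd_u C differentiable (at p)" "pd_v C differentiable (at p)"
    using smooth_on_differentiable[OF _ assms(4)] assms(2,3) smooth_on_pd by blast+
  have z: "\<forall>\<^sub>F q in nhds p. n q \<bullet> pd_u C q = 0" "\<forall>\<^sub>F q in nhds p. n q \<bullet> pd_v C q = 0"
    by (rule eventually_mono[OF eventually_nhds_in_open[OF assms(1,4)]], simp add: orth)+
  have const: "pd_u (\<lambda>q. 0 :: real) p = 0" "pd_v (\<lambda>q. 0 :: real) p = 0"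
    using pd_u_eqI[OF has_derivative_const] pd_v_eqI[OF has_derivative_const] by blast+
  have "pd_u n p \<bullet> pd_u C p + n p \<bullet> pd_u (pd_u C) p = 0" "pd_v n p \<bullet> pd_u C p + n p \<bullet> pd_v (pd_u C) p = 0"
    using pd_cong(2,3)[OF z(1) pd_inner(1)[OF d(1,2)]] pd_inner(2,3)[OF d(1,2)] const by simp_all
  moreover have "pd_u n p \<bullet> pd_v C p + n p \<bullet> pd_u (pd_v C) p = 0"
    using pd_cong(2)[OF z(2) pd_inner(1)[OF d(1,3)]] pd_inner(2)[OF d(1,3)] const by simp
  ultimately show ?thesis using pd_commute[OF assms(1,2,4)] null
    by (simp add: inner_diff_left algebra_simps)
qed

text \<open>
  The target coordinates remove what is a smooth function of the first two components: first \<open>b\<close> and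
  the sign \<open>a\<close> from the second component, then the even part \<open>k\<close> from the third.
\<close>

lemma fold_normal_form_target:
  fixes C :: surf and b :: "real \<Rightarrow> real" and k m :: "real \<times> real \<Rightarrow> real"
  assumes a: "a * a = (1::real)" and e: "e > 0" "smooth_on {-e<..<e} b"
    and d: "d > 0" "smooth_on ({-d<..<d} \<times> {-d<..<d}) k"
    and C: "\<And>p. p \<in> square d \<Longrightarrow> C p = vector [fst p, b (fst p) + a * (snd p)\<^sup>2, k (fst p, (snd p)\<^sup>2) + snd p ^ 3 * m (fst p, (snd p)\<^sup>2)]"
    and C0: "C 0 = 0"
  shows "A_equivalent C 0 (cuspidal_normal_form m) 0"
proof -
  have "(0, 0) \<in> square d" using d by simp
  from C[OF this] C0 have "(vector [0, b 0, k (0, 0)] :: real^3) = 0" by (simp add: zero_prod_def)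
  then have b0: "b 0 = 0" "k (0, 0) = 0" by (simp_all add: vec_eq_iff forall_3)
  have a0: "a \<noteq> 0" using a by auto
  define O1 where "O1 = {z :: real^3. z $ 1 \<in> {-e<..<e}}"
  have O1: "open O1" "0 \<in> O1" using e(1)
    by (auto simp: O1_def intro!: open_Collect_conj open_Collect_less continuous_intros)
  define Q1 where "Q1 z = a * (z $ 2 - b (z $ 1)) - z $ 2" for z :: "real^3"
  have Q1: "smooth_on O1 Q1" unfolding Q1_def[abs_def]
    by (intro smooth_intros smooth_on_compose[OF e(2)] O1 open_greaterThanLessThan) (auto simp: O1_def)
  have "diffeo_germ (\<lambda>z. z + Q1 z *\<^sub>R axis 2 1) 0 (0 + Q1 0 *\<^sub>R axis 2 1)"
  proof (rule diffeo_germ_add_direction[OF Q1 O1])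
    have "(b has_derivative frechet_derivative b (at ((0 :: real^3) $ 1))) (at ((0 :: real^3) $ 1))"
      using smooth_on_has_derivative[OF e(2), of 0] e(1) by simp
    from has_derivative_compose[OF bounded_linear_imp_has_derivative[OF bounded_linear_vec_nth[of 1]] this]
    have "((\<lambda>z. b (z $ 1)) has_derivative (\<lambda>w. frechet_derivative b (at 0) (w $ 1))) (at (0 :: real^3))" by simp
    from has_derivative_diff[OF has_derivative_mult_right[OF has_derivative_diff[OF bounded_linear_imp_has_derivative[OF bounded_linear_vec_nth[of 2]] this], of a]
       bounded_linear_imp_has_derivative[OF bounded_linear_vec_nth[of 2]]]
    have D: "(Q1 has_derivative (\<lambda>w. a * (w $ 2 - frechet_derivative b (at 0) (w $ 1)) - w $ 2)) (at 0)"
      unfolding Q1_def[abs_def] .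
    have "frechet_derivative b (at 0) 0 = 0"
      using smooth_on_has_derivative[OF e(2), of 0] e(1) by (intro linear_0 has_derivative_linear) simp
    then show "1 + frechet_derivative Q1 (at 0) (axis 2 1) \<noteq> 0"
      using fun_cong[OF frechet_derivative_at[OF D], of "axis 2 1"] a0 by (simp add: axis_def)
  qed
  then have G1: "diffeo_germ (\<lambda>z. z + Q1 z *\<^sub>R axis 2 1) 0 0" by (simp add: Q1_def b0)
  define pr where "pr z = (z $ 1, z $ 2)" for z :: "real^3"
  have pr_bl: "bounded_linear pr" unfolding pr_def[abs_def]
    by (intro bounded_linear_Pair bounded_linear_vec_nth)
  define O2 where "O2 = pr -` square d"
  have O2: "open O2" "0 \<in> O2" unfolding O2_def
    using open_vimage[OF open_square linear_continuous_on[OF pr_bl]] d(1) by (simp_all add: pr_def)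
  have pr_smooth: "smooth_on O2 pr" by (intro smooth_on_bounded_linear[OF pr_bl O2(1)] smooth_on_id O2)
  have k: "smooth_on (square d) k" using d(2) by (simp add: square_def)
  define Q2 where "Q2 z = - k (pr z)" for z
  have Q2: "smooth_on O2 Q2" unfolding Q2_def[abs_def]
    by (intro smooth_intros smooth_on_compose[OF k pr_smooth] O2 open_square) (auto simp: O2_def)
  have "diffeo_germ (\<lambda>z. z + Q2 z *\<^sub>R axis 3 1) 0 (0 + Q2 0 *\<^sub>R axis 3 1)"
  proof (rule diffeo_germ_add_direction[OF Q2 O2])
    have "pr 0 \<in> square d" using O2 by (simp add: O2_def)
    from has_derivative_minus[OF has_derivative_compose[OF bounded_linear_imp_has_derivative[OF pr_bl] smooth_on_has_derivative[OF k this]]]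
    have D: "(Q2 has_derivative (\<lambda>w. - frechet_derivative k (at (pr 0)) (pr w))) (at 0)" unfolding Q2_def[abs_def] .
    have "frechet_derivative k (at (pr 0)) 0 = 0"
      using smooth_on_has_derivative[OF k \<open>pr 0 \<in> square d\<close>] by (intro linear_0 has_derivative_linear)
    moreover have "pr (axis 3 1) = 0" by (simp add: pr_def axis_def zero_prod_def)
    ultimately show "1 + frechet_derivative Q2 (at 0) (axis 3 1) \<noteq> 0"
      using fun_cong[OF frechet_derivative_at[OF D], of "axis 3 1"] by simp
  qed
  then have G2: "diffeo_germ (\<lambda>z. z + Q2 z *\<^sub>R axis 3 1) 0 0" by (simp add: Q2_def pr_def b0)
  show ?thesis
  proof (rule A_equivalent_target)
    show "diffeo_germ (\<lambda>z. (z + Q1 z *\<^sub>R axis 2 1) + Q2 (z + Q1 z *\<^sub>R axis 2 1) *\<^sub>R axis 3 1) (C 0) 0"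
      unfolding C0 by (rule diffeo_germ_compose[OF G1 G2])
    have "(C p + Q1 (C p) *\<^sub>R axis 2 1) + Q2 (C p + Q1 (C p) *\<^sub>R axis 2 1) *\<^sub>R axis 3 1 = cuspidal_normal_form m p"
      if p: "p \<in> square d" for p
    proof -
      have 1: "C p + Q1 (C p) *\<^sub>R axis 2 1 = vector [fst p, (snd p)\<^sup>2, k (fst p, (snd p)\<^sup>2) + snd p ^ 3 * m (fst p, (snd p)\<^sup>2)]"
        using a by (simp add: C[OF p] Q1_def vec_eq_iff forall_3 axis_def algebra_simps)
      show ?thesis unfolding 1
        by (cases p) (simp add: Q2_def pr_def vec_eq_iff forall_3 axis_def cuspidal_normal_form_def)
    qed
    then show "\<forall>\<^sub>F p in nhds 0. (C p + Q1 (C p) *\<^sub>R axis 2 1) + Q2 (C p + Q1 (C p) *\<^sub>R axis 2 1) *\<^sub>R axis 3 1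
        = cuspidal_normal_form m p"
      unfolding eventually_square using d(1) by blast
  qed
qed

text \<open>
  The criterion of Fujimori, Saji, Umehara and Yamada for a frontal \<open>C\<close> with normal direction \<open>n\<close> (not
  necessarily of unit length) whose singular curve \<open>(t, g t)\<close> passes through the origin with null
  direction \<open>\<partial>\<^sub>v - s t \<partial>\<^sub>u\<close>: a cuspidal cross cap occurs exactly where the determinant \<open>\<psi>\<close> of
  \<open>C\<^sub>u\<close>, \<open>n\<close> and the derivative of \<open>n\<close> in the null direction has a simple zero.

  In the frame \<open>p0 = C\<^sub>u\<close>, \<open>w0\<close>, \<open>x0 = n\<close> at the origin, the first two components of \<open>C\<close> form a fold of
  the plane, so in suitable source coordinates they are \<open>u\<close> and \<open>b u \<plusminus> v\<^sup>2\<close>. The third component \<open>c\<close>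
  satisfies \<open>c\<^sub>v = \<plusminus> 2 v \<tau>\<close> with the slope \<open>\<tau>\<close> of the tangent plane, since \<open>n\<close> is orthogonal to \<open>dC\<close>. By
  \<open>fold_primitive\<close> it equals \<open>k (u, v\<^sup>2) + v ^ 3 m (u, v\<^sup>2)\<close>, which is the normal form up to target coordinates,
  and \<open>m (u, 0)\<close> is a multiple of the derivative of \<open>\<tau>\<close> in the null direction. This derivative is \<open>\<psi>\<close>
  times a nonvanishing continuous factor, so \<open>m (u, 0)\<close> and \<open>\<psi>\<close> have simple zeros simultaneously.
\<close>

theorem cuspidal_cross_cap_criterion:
  fixes C n :: surf and g s :: "real \<Rightarrow> real"
  assumes C: "smooth_germ 0 C" and n: "smooth_germ 0 n"
    and orth: "\<forall>\<^sub>F q in nhds 0. n q \<bullet> pd_u C q = 0 \<and> n q \<bullet> pd_v C q = 0"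
    and n0: "n (0, 0) \<noteq> 0" and Cu0: "pd_u C (0, 0) \<noteq> 0" and Cv0: "pd_v C (0, 0) = 0"
    and fold: "pd_v (pd_v C) (0, 0) \<bullet> cross3 (n (0, 0)) (pd_u C (0, 0)) \<noteq> 0"
    and g: "\<delta> > 0" "smooth_on {-\<delta><..<\<delta>} g" "g 0 = 0"
    and null: "\<forall>\<^sub>F t in nhds 0. pd_v C (t, g t) = s t *\<^sub>R pd_u C (t, g t)"
    and \<psi>: "\<And>t. \<psi> t = pd_u C (t, g t) \<bullet> cross3 (n (t, g t)) (pd_v n (t, g t) - s t *\<^sub>R pd_u n (t, g t))"
  shows "has_cuspidal_cross_cap C 0 \<longleftrightarrow> \<psi> 0 = 0 \<and> (\<exists>D. D \<noteq> 0 \<and> (\<psi> has_real_derivative D) (at 0))"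
proof -
  have zero: "(0, 0) = (0 :: real \<times> real)" by (simp add: zero_prod_def)
  define p0 where "p0 = pd_u C (0, 0)"
  define x0 where "x0 = n (0, 0)"
  define w0 where "w0 = cross3 x0 p0"
  have px: "p0 \<bullet> x0 = 0" using eventually_nhds_x_imp_x[OF orth] by (simp add: p0_def x0_def zero inner_commute)
  have orthw: "p0 \<bullet> w0 = 0" "x0 \<bullet> w0 = 0" by (simp_all add: w0_def dot_cross_self)
  have ww: "w0 \<bullet> w0 = (x0 \<bullet> x0) * (p0 \<bullet> p0)"
    using norm_cross_dot[of x0 p0] px by (simp add: w0_def power2_norm_eq_inner power_mult_distrib inner_commute)
  have pp: "p0 \<bullet> p0 > 0" "x0 \<bullet> x0 > 0" using Cu0 n0 by (simp_all add: p0_def x0_def)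
  obtain rC where rC: "rC > 0" "smooth_on (square rC) C" using C by (auto simp: smooth_germ_square)
  obtain rn where rn: "rn > 0" "smooth_on (square rn) n" using n by (auto simp: smooth_germ_square)
  obtain ro where ro: "ro > 0" "\<And>q. q \<in> square ro \<Longrightarrow> n q \<bullet> pd_u C q = 0 \<and> n q \<bullet> pd_v C q = 0"
    using orth unfolding eventually_square by blast
  define r where "r = min (min rC rn) (min ro \<delta>)"
  have r: "r > 0" "r \<le> rC" "r \<le> rn" "r \<le> ro" "r \<le> \<delta>" using rC rn ro g by (auto simp: r_def)
  have C_sm: "smooth_on (square r) C" by (rule smooth_on_subset[OF rC(2) square_mono[OF r(2)]])
  have n_sm: "smooth_on (square r) n" by (rule smooth_on_subset[OF rn(2) square_mono[OF r(3)]])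
  have orth_r: "n q \<bullet> pd_u C q = 0 \<and> n q \<bullet> pd_v C q = 0" if "q \<in> square r" for q
    using ro(2) square_mono[OF r(4)] that by blast
  have g_sm: "smooth_on {-r<..<r} g" by (rule smooth_on_subset[OF g(2)]) (use r in auto)
  have dC: "C differentiable (at q)" "pd_u C differentiable (at q)" "pd_v C differentiable (at q)" "n differentiable (at q)"
    if "q \<in> square r" for q
    using smooth_on_differentiable[OF _ that] C_sm n_sm smooth_on_pd by blast+
  have in0: "(0, 0) \<in> square r" using r by simp
  define coord where "coord d q = (C q - C (0, 0)) \<bullet> d" for d q
  have coord_sm: "smooth_on (square r) (coord d)" for d
    unfolding coord_def[abs_def] by (intro smooth_intros C_sm open_square)
  have coord_pd: "pd_u (coord d) q = pd_u C q \<bullet> d" "pd_v (coord d) q = pd_v C q \<bullet> d" if q: "q \<in> square r" for d q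
  proof -
    have "((\<lambda>q. (C q - C (0, 0)) \<bullet> d) has_derivative (\<lambda>w. (fst w *\<^sub>R pd_u C q + snd w *\<^sub>R pd_v C q - 0) \<bullet> d)) (at q)"
      by (intro has_derivative_inner_left has_derivative_diff has_derivative_pd dC(1)[OF q] has_derivative_const)
    then have D: "(coord d has_derivative (\<lambda>w. (fst w *\<^sub>R pd_u C q + snd w *\<^sub>R pd_v C q - 0) \<bullet> d)) (at q)"
      unfolding coord_def[abs_def] .
    show "pd_u (coord d) q = pd_u C q \<bullet> d" "pd_v (coord d) q = pd_v C q \<bullet> d"
      by (simp_all add: pd_u_eqI[OF D] pd_v_eqI[OF D])
  qed
  have vv: "pd_v (pd_v (coord w0)) (0, 0) = pd_v (pd_v C) (0, 0) \<bullet> w0"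
  proof -
    have "\<forall>\<^sub>F q in nhds (0, 0). pd_v C q \<bullet> w0 = pd_v (coord w0) q"
      by (rule eventually_mono[OF eventually_nhds_in_open[OF open_square in0]]) (simp add: coord_pd(2))
    from pd_cong(3)[OF this pd_bounded_linear(1)[OF bounded_linear_inner_left dC(3)[OF in0]]]
    show ?thesis by (simp add: pd_bounded_linear(3)[OF bounded_linear_inner_left dC(3)[OF in0]])
  qed
  have curve_ev: "\<forall>\<^sub>F t in nhds 0. P (t, g t)" if "\<forall>\<^sub>F q in nhds 0. P q" for P :: "real \<times> real \<Rightarrow> bool"
  proof (rule eventually_compose_filterlim[OF that])
    have "isCont g 0" using smooth_on_continuous[OF g(2)] g(1) by (simp add: continuous_on_eq_continuous_at)
    then have "isCont (\<lambda>t. (t, g t)) 0" by (intro continuous_Pair continuous_ident)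
    from isCont_tendsto_nhds[OF this] show "filterlim (\<lambda>t. (t, g t)) (nhds 0) (nhds 0)" by (simp add: g(3) zero)
  qed
  have in_r: "\<forall>\<^sub>F q in nhds (0 :: real \<times> real). q \<in> square r"
    using eventually_nhds_in_open[OF open_square, of 0 r] in0 by (simp add: zero)
  have jac: "\<forall>\<^sub>F u in nhds 0. pd_u (coord p0) (u, g u) * pd_v (coord w0) (u, g u) = pd_v (coord p0) (u, g u) * pd_u (coord w0) (u, g u)"
    using null curve_ev[OF in_r] by eventually_elim (simp add: coord_pd)
  have at0: "coord p0 (0, 0) = 0" "pd_u (coord p0) (0, 0) \<noteq> 0" "pd_v (coord p0) (0, 0) = 0" "pd_u (coord w0) (0, 0) = 0"
    "pd_v (pd_v (coord w0)) (0, 0) \<noteq> 0"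
    using pp Cv0 orthw fold vv by (simp_all add: coord_pd[OF in0] p0_def[symmetric] x0_def[symmetric] w0_def[symmetric] coord_def)
  obtain \<theta> b a e where \<theta>: "diffeo_germ \<theta> 0 0" "a * a = (1::real)" "e > 0" "smooth_on {-e<..<e} b"
    "\<And>p. p \<in> square e \<Longrightarrow> coord p0 (\<theta> p) = fst p \<and> coord w0 (\<theta> p) = b (fst p) + a * (snd p)\<^sup>2"
    "\<forall>\<^sub>F u in nhds 0. \<theta> (coord p0 (u, g u), 0) = (u, g u)"
    by (rule fold_coordinates[OF r(1) coord_sm coord_sm g_sm g(3) at0 jac]) (rule that)
  have \<theta>0: "\<theta> (0, 0) = (0, 0)" using \<theta>(1) by (simp add: diffeo_germ_def zero)
  have "isCont (\<lambda>q. n q \<bullet> x0) (0, 0)"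
    using smooth_on_continuous[OF smooth_on_inner[OF n_sm smooth_on_const open_square]] in0
    by (simp add: continuous_on_eq_continuous_at)
  moreover have "0 < n (0, 0) \<bullet> x0" using pp(2) by (simp only: x0_def)
  ultimately have "\<forall>\<^sub>F q in nhds (0, 0). 0 < n q \<bullet> x0" by (rule order_tendstoD(1)[OF isCont_tendsto_nhds])
  then have pos: "\<forall>\<^sub>F q in nhds 0. 0 < n q \<bullet> x0" by (simp only: zero)
  obtain e\<theta> where e\<theta>: "e\<theta> > 0" "smooth_on (square e\<theta>) \<theta>"
    using diffeo_germ_smooth[OF \<theta>(1)] by (auto simp: smooth_germ_square)
  from diffeo_germ_eventually[OF \<theta>(1) in_r] diffeo_germ_eventually[OF \<theta>(1) pos]
  have "\<forall>\<^sub>F q in nhds 0. \<theta> q \<in> square r \<and> 0 < n (\<theta> q) \<bullet> x0" by eventually_elim simp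
  then obtain e' where e': "e' > 0" "\<And>q. q \<in> square e' \<Longrightarrow> \<theta> q \<in> square r \<and> 0 < n (\<theta> q) \<bullet> x0"
    unfolding eventually_square by blast
  define \<epsilon> where "\<epsilon> = min e (min e\<theta> e')"
  have \<epsilon>: "\<epsilon> > 0" "\<epsilon> \<le> e" "\<epsilon> \<le> e\<theta>" "\<epsilon> \<le> e'" using \<theta>(3) e\<theta> e' by (auto simp: \<epsilon>_def)
  have \<theta>_sm: "smooth_on (square \<epsilon>) \<theta>" by (rule smooth_on_subset[OF e\<theta>(2) square_mono[OF \<epsilon>(3)]])
  have \<theta>_in: "\<theta> q \<in> square r" "0 < n (\<theta> q) \<bullet> x0" if "q \<in> square \<epsilon>" for q
    using e'(2)[of q] square_mono[OF \<epsilon>(4)] that by auto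
  have \<theta>_coord: "coord p0 (\<theta> q) = fst q" "coord w0 (\<theta> q) = b (fst q) + a * (snd q)\<^sup>2" if "q \<in> square \<epsilon>" for q
    using \<theta>(5)[of q] square_mono[OF \<epsilon>(2)] that by auto
  have \<theta>_img: "\<theta> ` square \<epsilon> \<subseteq> square r" using \<theta>_in(1) by auto
  define c where "c q = coord x0 (\<theta> q)" for q
  have c_sm: "smooth_on (square \<epsilon>) c" unfolding c_def[abs_def]
    by (rule smooth_on_compose[OF coord_sm \<theta>_sm \<theta>_img open_square open_square])
  \<comment> \<open>The slope of the tangent plane: a vector \<open>Y\<close> that is orthogonal to \<open>n\<close> and \<open>p0\<close> satisfies
    \<open>Y \<bullet> x0 = \<tau> (Y \<bullet> w0)\<close>.\<close>
  define \<tau> where "\<tau> q = - ((n q \<bullet> w0) / ((n q \<bullet> x0) * (p0 \<bullet> p0)))" for q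
  have n\<theta>_sm: "smooth_on (square \<epsilon>) (\<lambda>q. n (\<theta> q))"
    by (rule smooth_on_compose[OF n_sm \<theta>_sm \<theta>_img open_square open_square])
  have T_sm: "smooth_on (square \<epsilon>) (\<lambda>q. \<tau> (\<theta> q))" unfolding \<tau>_def
    by (intro smooth_intros n\<theta>_sm open_square) (use \<theta>_in pp in fastforce)
  have \<theta>_d: "\<theta> differentiable (at q)" if "q \<in> square \<epsilon>" for q by (rule smooth_on_differentiable[OF \<theta>_sm that])
  \<comment> \<open>The derivative of \<open>C \<circ> \<theta>\<close> in the direction \<open>\<partial>\<^sub>v\<close> of the fold coordinates.\<close>
  define Y where "Y q = fst (pd_v \<theta> q) *\<^sub>R pd_u C (\<theta> q) + snd (pd_v \<theta> q) *\<^sub>R pd_v C (\<theta> q)" for q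
  have Y_coord: "pd_v (\<lambda>q. coord d (\<theta> q)) q = Y q \<bullet> d" if q: "q \<in> square \<epsilon>" for d q
    using pd_compose(2)[OF \<theta>_d[OF q] smooth_on_differentiable[OF coord_sm \<theta>_in(1)[OF q]], of d] coord_pd[OF \<theta>_in(1)[OF q], of d]
    by (simp add: Y_def inner_add_left)
  have Y_p: "Y q \<bullet> p0 = 0" and Y_w: "Y q \<bullet> w0 = 2 * a * snd q" and Y_x: "Y q \<bullet> x0 = pd_v c q" if q: "q \<in> square \<epsilon>" for q
  proof -
    obtain u v where uv: "q = (u, v)" by (cases q)
    have uv': "\<bar>u\<bar> < \<epsilon>" "\<bar>v\<bar> < \<epsilon>" using q uv by auto
    have dc: "(\<lambda>q. coord d (\<theta> q)) differentiable (at (u, v))" for d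
      using pd_compose(1)[OF \<theta>_d[OF q] smooth_on_differentiable[OF coord_sm \<theta>_in(1)[OF q]]] uv by simp
    have ev: "\<forall>\<^sub>F t in nhds v. \<bar>t\<bar> < \<epsilon>"
      by (rule eventually_mono[OF eventually_nhds_in_open[of "{-\<epsilon><..<\<epsilon>}" v]]) (use uv' in \<open>auto simp: abs_less_iff\<close>)
    have "\<forall>\<^sub>F t in nhds v. coord p0 (\<theta> (u, t)) = u"
      using ev by eventually_elim (use \<theta>_coord(1) uv' in simp)
    from iffD2[OF DERIV_cong_ev[OF refl this refl] DERIV_const]
    have "((\<lambda>t. coord p0 (\<theta> (u, t))) has_real_derivative 0) (at v)" .
    from DERIV_unique[OF pd_real_slices(2)[OF dc] this] show "Y q \<bullet> p0 = 0" using Y_coord[OF q] uv by simp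
    have "\<forall>\<^sub>F t in nhds v. coord w0 (\<theta> (u, t)) = b u + a * t\<^sup>2"
      using ev by eventually_elim (use \<theta>_coord(2) uv' in simp)
    moreover have "((\<lambda>t. b u + a * t\<^sup>2) has_real_derivative 2 * a * v) (at v)" by (auto intro!: derivative_eq_intros)
    ultimately have "((\<lambda>t. coord w0 (\<theta> (u, t))) has_real_derivative 2 * a * v) (at v)"
      using DERIV_cong_ev[OF refl _ refl] by fast
    from DERIV_unique[OF pd_real_slices(2)[OF dc] this] show "Y q \<bullet> w0 = 2 * a * snd q" using Y_coord[OF q] uv by simp
    show "Y q \<bullet> x0 = pd_v c q" using Y_coord[OF q, of x0] by (simp add: c_def[abs_def])
  qed
  have c_v: "pd_v c q = 2 * a * snd q * \<tau> (\<theta> q)" if q: "q \<in> square \<epsilon>" for q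
  proof -
    have nY: "n (\<theta> q) \<bullet> Y q = 0" using orth_r[OF \<theta>_in(1)[OF q]] by (simp add: Y_def inner_add_right)
    have "(n (\<theta> q) \<bullet> w0) * (2 * a * snd q) + (n (\<theta> q) \<bullet> x0) * pd_v c q * (p0 \<bullet> p0) = 0"
      using inner_orthogonal_frame[OF px, of "n (\<theta> q)" "Y q"] nY Y_p[OF q] Y_w[OF q] Y_x[OF q] by (simp add: w0_def[symmetric])
    then show ?thesis using \<theta>_in(2)[OF q] pp by (simp add: \<tau>_def field_simps)
  qed
  obtain d k m where d: "0 < d" "d \<le> \<epsilon>"
    and k: "smooth_on ({-d<..<d} \<times> {-d\<^sup>2<..<d\<^sup>2}) k" and m: "smooth_on ({-d<..<d} \<times> {-d\<^sup>2<..<d\<^sup>2}) m"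
    and c_eq: "\<And>u v. \<bar>u\<bar> < d \<Longrightarrow> \<bar>v\<bar> < d \<Longrightarrow> c (u, v) = k (u, v\<^sup>2) + v ^ 3 * m (u, v\<^sup>2)"
    and m_eq: "\<And>u. \<bar>u\<bar> < d \<Longrightarrow> m (u, 0) = 2 * a / 3 * pd_v (\<lambda>q. \<tau> (\<theta> q)) (u, 0)"
  proof (rule fold_primitive[OF \<epsilon>(1) c_sm T_sm])
    show "pd_v c (u, v) = 2 * a * v * \<tau> (\<theta> (u, v))" if "\<bar>u\<bar> < \<epsilon>" "\<bar>v\<bar> < \<epsilon>" for u v
      using c_v[of "(u, v)"] that by simp
  qed (rule that)
  obtain d' where d': "d' > 0" "d' \<le> d" "d' \<le> d\<^sup>2"
    using d(1) by (intro that[of "min d (d\<^sup>2)"]) auto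
  have sub: "{-d'<..<d'} \<times> {-d'<..<d'} \<subseteq> {-d<..<d} \<times> {-d\<^sup>2<..<d\<^sup>2}" using d' by auto
  have m_germ: "smooth_germ 0 m"
    unfolding smooth_germ_square using smooth_on_subset[OF m sub] d'(1) by (auto simp: square_def)
  define F where "F z = (vector [(z - C (0, 0)) \<bullet> p0, (z - C (0, 0)) \<bullet> cross3 x0 p0, (z - C (0, 0)) \<bullet> x0] :: real^3)" for z
  have F: "diffeo_germ F (C (0, 0)) 0"
    unfolding F_def[abs_def] by (rule frame_coordinates_diffeo[OF px]) (use pp in auto)
  have "smooth_germ 0 (\<lambda>q. C (\<theta> q))"
    unfolding smooth_germ_square using smooth_on_compose[OF C_sm \<theta>_sm \<theta>_img open_square open_square] \<epsilon>(1) by blast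
  then have cont\<theta>: "isCont (\<lambda>q. C (\<theta> q)) 0" by (rule smooth_germ_isCont)
  have contC: "isCont C 0" by (rule smooth_germ_isCont[OF C])
  have nf_cont: "isCont (cuspidal_normal_form m) 0"
  proof -
    obtain d1 where d1: "d1 > 0" "d1 \<le> d'" "d1\<^sup>2 \<le> d'" using small_square[OF d'(1)] .
    have "smooth_on (square d1) (\<lambda>p. vector [fst p, (snd p)\<^sup>2, snd p ^ 3 * m (fst p, (snd p)\<^sup>2)] :: real^3)"
      using d1 by (intro smooth_intros smooth_on_fold_map[of d' m] smooth_on_subset[OF m sub, folded square_def] open_square) auto
    moreover have "(\<lambda>p. vector [fst p, (snd p)\<^sup>2, snd p ^ 3 * m (fst p, (snd p)\<^sup>2)] :: real^3) = cuspidal_normal_form m"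
      by (auto simp: fun_eq_iff cuspidal_normal_form_def)
    ultimately show ?thesis using smooth_on_continuous d1(1)
      by (intro smooth_germ_isCont) (auto simp: smooth_germ_square)
  qed
  have FC_eq: "F (C (\<theta> q)) = vector [fst q, b (fst q) + a * (snd q)\<^sup>2, k (fst q, (snd q)\<^sup>2) + snd q ^ 3 * m (fst q, (snd q)\<^sup>2)]"
    if q: "q \<in> square d'" for q
  proof -
    have "q \<in> square \<epsilon>" "\<bar>fst q\<bar> < d" "\<bar>snd q\<bar> < d" using q d' d(2) by (cases q; simp)+
    then show ?thesis using \<theta>_coord[of q] c_eq[of "fst q" "snd q"]
      by (simp add: F_def coord_def c_def w0_def)
  qed
  have FC0: "F (C (\<theta> 0)) = 0" using \<theta>0 by (simp add: F_def zero[symmetric] vec_eq_iff forall_3)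
  have "A_equivalent (\<lambda>q. F (C (\<theta> q))) 0 (cuspidal_normal_form m) 0"
    by (rule fold_normal_form_target[OF \<theta>(2,3,4) d'(1) smooth_on_subset[OF k sub] FC_eq FC0])
  moreover have "A_equivalent (\<lambda>q. C (\<theta> q)) 0 (\<lambda>q. F (C (\<theta> q))) 0"
    by (rule A_equivalent_target[of F _ _ 0]) (use F \<theta>0 in \<open>simp_all add: zero\<close>)
  ultimately have "A_equivalent (\<lambda>q. C (\<theta> q)) 0 (cuspidal_normal_form m) 0" using A_equivalent_trans by blast
  moreover have "A_equivalent (\<lambda>q. C (\<theta> q)) 0 C 0" by (rule A_equivalent_source[OF \<theta>(1)]) simp
  ultimately have "has_cuspidal_cross_cap C 0 \<longleftrightarrow> has_cuspidal_cross_cap (cuspidal_normal_form m) 0"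
    using has_cuspidal_cross_cap_cong cont\<theta> contC nf_cont by blast
  also have "\<dots> \<longleftrightarrow> m (0, 0) = 0 \<and> pd_u m (0, 0) \<noteq> 0"
    using cuspidal_cross_cap_if_normal_form[OF m_germ] normal_form_if_cuspidal_cross_cap[OF m_germ] by (auto simp: zero)
  also have "\<dots> \<longleftrightarrow> \<psi> 0 = 0 \<and> (\<exists>D. D \<noteq> 0 \<and> (\<psi> has_real_derivative D) (at 0))"
  proof -
    \<comment> \<open>The singular curve, parametrized by the first fold coordinate.\<close>
    define U where "U t = coord p0 (t, g t)" for t
    define K where "K t = 2 * a / 3 * snd (pd_v \<theta> (U t, 0)) * (x0 \<bullet> x0) * (pd_u C (t, g t) \<bullet> p0)
      / ((pd_u C (t, g t) \<bullet> pd_u C (t, g t)) * (n (t, g t) \<bullet> x0)\<^sup>2 * (p0 \<bullet> p0))" for t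
    have g_d: "(g has_real_derivative deriv g 0) (at 0)"
      using smooth_on_differentiable[OF g(2), of 0] g(1) by (simp add: DERIV_deriv_iff_real_differentiable)
    have U': "(U has_real_derivative p0 \<bullet> p0) (at 0)"
    proof -
      have c0: "((\<lambda>t. (t, g t)) has_derivative (\<lambda>h. (h, deriv g 0 * h))) (at 0)"
        by (intro has_derivative_Pair has_derivative_ident g_d[unfolded has_field_derivative_def])
      have "(coord p0 has_derivative (\<lambda>w. fst w *\<^sub>R (p0 \<bullet> p0) + snd w *\<^sub>R 0)) (at (0, g 0))"
        using has_derivative_pd[OF smooth_on_differentiable[OF coord_sm in0], of p0] coord_pd[OF in0, of p0] Cv0 g(3)
        by (simp add: p0_def)
      from has_derivative_compose[OF c0 this]
      have "(U has_derivative (\<lambda>h. fst (h, deriv g 0 * h) *\<^sub>R (p0 \<bullet> p0) + snd (h, deriv g 0 * h) *\<^sub>R 0)) (at 0)"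
        unfolding U_def[abs_def] .
      then show ?thesis unfolding has_field_derivative_def
        by (rule has_derivative_eq_rhs) (simp add: fun_eq_iff mult.commute)
    qed
    have U0: "U 0 = 0" using g(3) by (simp add: U_def coord_def)
    have U_cont: "isCont U 0" by (rule DERIV_isCont[OF U'])
    have g_cont: "isCont (\<lambda>t. (t, g t)) 0" by (intro continuous_Pair continuous_ident DERIV_isCont[OF g_d])
    have along: "isCont (\<lambda>t. h (t, g t)) 0" if "smooth_on (square r) h" for h :: "real \<times> real \<Rightarrow> real^3"
    proof (rule isCont_o2[where f = "\<lambda>t. (t, g t)" and g = h, OF g_cont])
      show "isCont h (0, g 0)" using smooth_on_continuous[OF that] in0 g(3) by (simp add: continuous_on_eq_continuous_at)
    qed
    have y_cont: "isCont (\<lambda>t. pd_v \<theta> (U t, 0)) 0"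
    proof (rule isCont_o2[where f = "\<lambda>t. (U t, 0)" and g = "pd_v \<theta>"])
      show "isCont (\<lambda>t. (U t, 0 :: real)) 0" by (intro continuous_Pair U_cont continuous_const)
      show "isCont (pd_v \<theta>) (U 0, 0)"
        using smooth_on_continuous[OF smooth_on_pd(2)[OF \<theta>_sm]] \<epsilon>(1) U0 by (simp add: continuous_on_eq_continuous_at)
    qed
    have K_cont: "isCont K 0"
      unfolding K_def[abs_def]
      by (intro isCont_divide continuous_mult continuous_const continuous_inner isCont_power continuous_snd y_cont along
          smooth_on_pd C_sm n_sm) (use pp g(3) in \<open>simp_all add: p0_def[symmetric] x0_def[symmetric]\<close>)
    have near: "\<forall>\<^sub>F t in nhds 0. \<bar>U t\<bar> < d"
      using tendstoD[OF isCont_tendsto_nhds[OF U_cont] d(1)] by (simp add: U0 dist_real_def)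
    have Cu_ne: "\<forall>\<^sub>F q in nhds 0. pd_u C q \<noteq> 0"
    proof -
      have "isCont (pd_u C) (0, 0)"
        using smooth_on_continuous[OF smooth_on_pd(1)[OF C_sm]] in0 by (simp add: continuous_on_eq_continuous_at)
      from tendsto_imp_eventually_ne[OF isCont_tendsto_nhds[OF this] Cu0] show ?thesis by (simp add: zero)
    qed
    have y_eq: "Y (U t, 0) = 0 \<and> fst (pd_v \<theta> (U t, 0)) = - s t * snd (pd_v \<theta> (U t, 0))"
      if t: "\<bar>U t\<bar> < d" "\<theta> (U t, 0) = (t, g t)" "pd_v C (t, g t) = s t *\<^sub>R pd_u C (t, g t)" "pd_u C (t, g t) \<noteq> 0" for t
    proof -
      have q: "(U t, 0) \<in> square \<epsilon>" using t(1) d by simp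
      have "(p0 \<bullet> p0) * (x0 \<bullet> x0) * (Y (U t, 0) \<bullet> Y (U t, 0)) = 0"
        using inner_orthogonal_frame[OF px, of "Y (U t, 0)" "Y (U t, 0)"] Y_p[OF q] Y_w[OF q] Y_x[OF q] c_v[OF q]
        by (simp add: w0_def[symmetric])
      then have "Y (U t, 0) = 0" using pp by simp
      then have "(fst (pd_v \<theta> (U t, 0)) + snd (pd_v \<theta> (U t, 0)) * s t) *\<^sub>R pd_u C (t, g t) = 0"
        using t(2,3) by (simp add: Y_def algebra_simps)
      then have "fst (pd_v \<theta> (U t, 0)) + snd (pd_v \<theta> (U t, 0)) * s t = 0" using t(4) by (simp only: scaleR_eq_0_iff) simp
      then have "fst (pd_v \<theta> (U t, 0)) = - s t * snd (pd_v \<theta> (U t, 0))" by (simp add: add_eq_0_iff2 mult.commute)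
      then show ?thesis using \<open>Y (U t, 0) = 0\<close> by blast
    qed
    have key: "m (U t, 0) = K t * \<psi> t"
      if t: "\<bar>U t\<bar> < d" "\<theta> (U t, 0) = (t, g t)" "pd_v C (t, g t) = s t *\<^sub>R pd_u C (t, g t)" "pd_u C (t, g t) \<noteq> 0" for t
    proof -
      have q: "(U t, 0) \<in> square \<epsilon>" using t(1) d by simp
      define \<beta> where "\<beta> = (t, g t)"
      have \<beta>: "\<beta> \<in> square r" "0 < n \<beta> \<bullet> x0" using \<theta>_in[OF q] t(2) by (simp_all add: \<beta>_def)
      define V where "V = pd_v n \<beta> - s t *\<^sub>R pd_u n \<beta>"
      define p where "p = pd_u C \<beta>"
      define y where "y = snd (pd_v \<theta> (U t, 0))"
      have nA: "(\<lambda>q. n q \<bullet> w0) differentiable (at \<beta>)" "pd_u (\<lambda>q. n q \<bullet> w0) \<beta> = pd_u n \<beta> \<bullet> w0" "pd_v (\<lambda>q. n q \<bullet> w0) \<beta> = pd_v n \<beta> \<bullet> w0"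
        and nB: "(\<lambda>q. n q \<bullet> x0) differentiable (at \<beta>)" "pd_u (\<lambda>q. n q \<bullet> x0) \<beta> = pd_u n \<beta> \<bullet> x0" "pd_v (\<lambda>q. n q \<bullet> x0) \<beta> = pd_v n \<beta> \<bullet> x0"
        using pd_bounded_linear[OF bounded_linear_inner_left dC(4)[OF \<beta>(1)]] by auto
      define dA where "dA w = fst w *\<^sub>R (pd_u n \<beta> \<bullet> w0) + snd w *\<^sub>R (pd_v n \<beta> \<bullet> w0)" for w :: "real \<times> real"
      define dB where "dB w = fst w *\<^sub>R (pd_u n \<beta> \<bullet> x0) + snd w *\<^sub>R (pd_v n \<beta> \<bullet> x0)" for w :: "real \<times> real"
      have "((\<lambda>q. n q \<bullet> w0) has_derivative dA) (at \<beta>)" "((\<lambda>q. n q \<bullet> x0) has_derivative dB) (at \<beta>)"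
        using has_derivative_pd[OF nA(1)] has_derivative_pd[OF nB(1)] by (simp_all add: nA nB dA_def[abs_def] dB_def[abs_def])
      moreover have "(n \<beta> \<bullet> x0) * (p0 \<bullet> p0) \<noteq> 0" using \<beta>(2) pp by simp
      ultimately have D\<tau>: "(\<tau> has_derivative (\<lambda>w. - ((dA w * ((n \<beta> \<bullet> x0) * (p0 \<bullet> p0)) - (n \<beta> \<bullet> w0) * (dB w * (p0 \<bullet> p0)))
          / (((n \<beta> \<bullet> x0) * (p0 \<bullet> p0)) * ((n \<beta> \<bullet> x0) * (p0 \<bullet> p0)))))) (at \<beta>)"
        unfolding \<tau>_def[abs_def] by (intro has_derivative_minus has_derivative_divide' has_derivative_mult_left)
      have \<tau>_d: "\<tau> differentiable (at (\<theta> (U t, 0)))" using D\<tau> t(2) by (auto simp: differentiable_def \<beta>_def)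
      have "pd_v (\<lambda>q. \<tau> (\<theta> q)) (U t, 0) = y * (pd_v \<tau> \<beta> - s t * pd_u \<tau> \<beta>)"
        using pd_compose(2)[OF \<theta>_d[OF q] \<tau>_d] y_eq[OF t] t(2) by (simp add: \<beta>_def[symmetric] y_def[symmetric] algebra_simps)
      also have "pd_v \<tau> \<beta> - s t * pd_u \<tau> \<beta> = - ((V \<bullet> w0) * (n \<beta> \<bullet> x0) - (n \<beta> \<bullet> w0) * (V \<bullet> x0)) / ((n \<beta> \<bullet> x0)\<^sup>2 * (p0 \<bullet> p0))"
        using \<beta>(2) pp unfolding pd_u_eqI[OF D\<tau>] pd_v_eqI[OF D\<tau>] V_def
        by (simp add: dA_def dB_def inner_diff_left power2_eq_square divide_simps) (simp add: algebra_simps)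
      also have "(V \<bullet> w0) * (n \<beta> \<bullet> x0) - (n \<beta> \<bullet> w0) * (V \<bullet> x0) = (x0 \<bullet> x0) * (cross3 V (n \<beta>) \<bullet> p0)"
      proof -
        have "(V \<bullet> w0) * (n \<beta> \<bullet> x0) - (n \<beta> \<bullet> w0) * (V \<bullet> x0)
            = (x0 \<bullet> x0) * (cross3 V (n \<beta>) \<bullet> p0) - (p0 \<bullet> x0) * (cross3 V (n \<beta>) \<bullet> x0)"
          unfolding w0_def by (simp add: inner_vec_def sum_3 cross3_def) (simp add: algebra_simps)
        then show ?thesis using px by simp
      qed
      also have "cross3 V (n \<beta>) \<bullet> p0 = - \<psi> t * (p \<bullet> p0) / (p \<bullet> p)"
      proof -
        have "V \<bullet> p = 0" unfolding V_def p_def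
          by (rule normal_derivative_on_singular_curve[OF open_square C_sm n_sm \<beta>(1) orth_r]) (use t(3) in \<open>simp_all add: \<beta>_def\<close>)
        moreover have "n \<beta> \<bullet> p = 0" using orth_r[OF \<beta>(1)] by (simp add: p_def)
        ultimately have "(cross3 V (n \<beta>) \<bullet> p0) * (p \<bullet> p) = - (p \<bullet> cross3 (n \<beta>) V) * (p \<bullet> p0)"
          by (intro cross_inner_orthogonal)
        moreover have "\<psi> t = p \<bullet> cross3 (n \<beta>) V" by (simp add: \<psi> p_def V_def \<beta>_def)
        moreover have "p \<bullet> p \<noteq> 0" using t(4) by (simp add: p_def \<beta>_def)
        ultimately show ?thesis by (simp add: field_simps)
      qed
      finally have "pd_v (\<lambda>q. \<tau> (\<theta> q)) (U t, 0)
          = y * (- ((x0 \<bullet> x0) * (- \<psi> t * (p \<bullet> p0) / (p \<bullet> p))) / ((n \<beta> \<bullet> x0)\<^sup>2 * (p0 \<bullet> p0)))" .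
      then show ?thesis using m_eq[OF t(1)] by (simp add: K_def y_def p_def \<beta>_def mult_ac)
    qed
    have good: "\<forall>\<^sub>F t in nhds 0. \<bar>U t\<bar> < d \<and> \<theta> (U t, 0) = (t, g t) \<and> pd_v C (t, g t) = s t *\<^sub>R pd_u C (t, g t) \<and> pd_u C (t, g t) \<noteq> 0"
      using near \<theta>(6) null curve_ev[OF Cu_ne] by eventually_elim (simp add: U_def)
    from eventually_nhds_x_imp_x[OF this]
    have good0: "\<bar>U 0\<bar> < d" "\<theta> (U 0, 0) = (0, g 0)" "pd_v C (0, g 0) = s 0 *\<^sub>R pd_u C (0, g 0)" "pd_u C (0, g 0) \<noteq> 0" by auto
    have "snd (pd_v \<theta> (0, 0)) \<noteq> 0"
    proof
      assume *: "snd (pd_v \<theta> (0, 0)) = 0"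
      then have "fst (pd_v \<theta> (0, 0)) = 0" using y_eq[OF good0] U0 by simp
      with * have "frechet_derivative \<theta> (at 0) (0, 1) = 0" by (simp add: pd_v_def dir_deriv_def zero prod_eq_iff)
      from diffeo_germ_derivative_injective[OF \<theta>(1) this] show False by (simp add: zero_prod_def)
    qed
    moreover have "a \<noteq> 0" using \<theta>(2) by auto
    ultimately have K0: "K 0 \<noteq> 0" using pp g(3) U0 by (simp add: K_def p0_def[symmetric] x0_def[symmetric])
    have M: "((\<lambda>t. m (U t, 0)) has_real_derivative pd_u m (0, 0) * (p0 \<bullet> p0)) (at 0)"
    proof (rule DERIV_chain2[OF _ U'])
      have "m differentiable (at (0, 0))" using smooth_on_differentiable[OF m, of "(0, 0)"] d(1) by simp
      from pd_real_slices(1)[OF this] show "((\<lambda>u. m (u, 0)) has_real_derivative pd_u m (0, 0)) (at (U 0))" by (simp add: U0)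
    qed
    have m0: "m (0, 0) = K 0 * \<psi> 0" using key[OF good0] U0 by simp
    have K_ne: "\<forall>\<^sub>F t in nhds 0. K t \<noteq> 0" by (rule tendsto_imp_eventually_ne[OF isCont_tendsto_nhds[OF K_cont] K0])
    have \<psi>': "(\<psi> has_real_derivative pd_u m (0, 0) * (p0 \<bullet> p0) * inverse (K 0)) (at 0)" if "m (0, 0) = 0"
    proof -
      have "isCont (\<lambda>t. inverse (K t)) 0" by (rule continuous_at_within_inverse[OF K_cont K0])
      then have D: "((\<lambda>t. m (U t, 0) * inverse (K t)) has_real_derivative pd_u m (0, 0) * (p0 \<bullet> p0) * inverse (K 0)) (at 0)"
        using that by (intro vanishing_times_continuous[OF M]) (simp add: U0)
      have "\<forall>\<^sub>F t in nhds 0. \<psi> t = m (U t, 0) * inverse (K t)"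
        using good K_ne by eventually_elim (use key in simp)
      from iffD2[OF DERIV_cong_ev[OF refl this refl] D] show ?thesis .
    qed
    show ?thesis
    proof
      assume "m (0, 0) = 0 \<and> pd_u m (0, 0) \<noteq> 0"
      then show "\<psi> 0 = 0 \<and> (\<exists>D. D \<noteq> 0 \<and> (\<psi> has_real_derivative D) (at 0))"
        using m0 K0 \<psi>' pp by (intro conjI exI[of _ "pd_u m (0, 0) * (p0 \<bullet> p0) * inverse (K 0)"]) auto
    next
      assume *: "\<psi> 0 = 0 \<and> (\<exists>D. D \<noteq> 0 \<and> (\<psi> has_real_derivative D) (at 0))"
      then have "m (0, 0) = 0" using m0 by simp
      moreover obtain D where D: "D \<noteq> 0" "(\<psi> has_real_derivative D) (at 0)" using * by blast
      ultimately show "m (0, 0) = 0 \<and> pd_u m (0, 0) \<noteq> 0"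
        using DERIV_unique[OF D(2) \<psi>'] by auto
    qed
  qed
  finally show ?thesis .
qed

section \<open>Frontals in adapted coordinates\<close>

lemma cross_cross_right: "cross3 z (cross3 a b) = (z \<bullet> b) *\<^sub>R a - (z \<bullet> a) *\<^sub>R b"
  by (simp add: vec_eq_iff forall_3 cross3_def inner_vec_def sum_3) (simp add: algebra_simps)

lemma eq_zero_if_orthogonal_to_frame:
  fixes a b n z :: "real^3"
  assumes ab: "(a \<bullet> a) * (b \<bullet> b) - (a \<bullet> b)\<^sup>2 \<noteq> 0" and n: "n \<bullet> n = 1" "a \<bullet> n = 0" "b \<bullet> n = 0"
    and z: "z \<bullet> a = 0" "z \<bullet> b = 0" "z \<bullet> n = 0"
  shows "z = 0"
proof -
  define w where "w = cross3 a b"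
  have "w \<bullet> w + (a \<bullet> b)\<^sup>2 = (a \<bullet> a) * (b \<bullet> b)"
    using norm_cross_dot[of a b] by (simp add: w_def power2_norm_eq_inner power_mult_distrib)
  then have "w \<bullet> w = (a \<bullet> a) * (b \<bullet> b) - (a \<bullet> b)\<^sup>2" by (simp only: eq_diff_eq)
  then have ww: "w \<bullet> w \<noteq> 0" using ab by (simp only: not_False_eq_True)
  have par: "(y \<bullet> w)\<^sup>2 = (y \<bullet> y) * (w \<bullet> w)" if "y \<bullet> a = 0" "y \<bullet> b = 0" for y
    using norm_cross_dot[of y w] that by (simp add: w_def cross_cross_right power2_norm_eq_inner power_mult_distrib)
  have "(n \<bullet> w)\<^sup>2 = w \<bullet> w" using par[of n] n by (simp add: inner_commute)
  then have nw: "n \<bullet> w \<noteq> 0" using ww by auto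
  have "cross3 n w = 0" using n by (simp add: w_def cross_cross_right inner_commute)
  moreover have "cross3 z (cross3 n w) = (z \<bullet> w) *\<^sub>R n - (z \<bullet> n) *\<^sub>R w" by (rule cross_cross_right)
  ultimately have "(z \<bullet> w) *\<^sub>R n = 0" using z by simp
  then have "z \<bullet> w = 0" using n by auto
  then show ?thesis using par[OF z(1,2)] ww by simp
qed

lemma pd_scaleR:
  fixes a :: "real \<times> real \<Rightarrow> real" and F :: "real \<times> real \<Rightarrow> real^3"
  assumes "a differentiable (at p)" "F differentiable (at p)"
  shows "(\<lambda>q. a q *\<^sub>R F q) differentiable (at p)"
    "pd_u (\<lambda>q. a q *\<^sub>R F q) p = pd_u a p *\<^sub>R F p + a p *\<^sub>R pd_u F p"
    "pd_v (\<lambda>q. a q *\<^sub>R F q) p = pd_v a p *\<^sub>R F p + a p *\<^sub>R pd_v F p"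
proof -
  have D: "((\<lambda>q. a q *\<^sub>R F q) has_derivative (\<lambda>w. a p *\<^sub>R (fst w *\<^sub>R pd_u F p + snd w *\<^sub>R pd_v F p)
      + (fst w *\<^sub>R pd_u a p + snd w *\<^sub>R pd_v a p) *\<^sub>R F p)) (at p)"
    by (rule has_derivative_scaleR[OF has_derivative_pd[OF assms(1)] has_derivative_pd[OF assms(2)]])
  then show "(\<lambda>q. a q *\<^sub>R F q) differentiable (at p)" by (auto simp: differentiable_def)
  show "pd_u (\<lambda>q. a q *\<^sub>R F q) p = pd_u a p *\<^sub>R F p + a p *\<^sub>R pd_u F p"
    "pd_v (\<lambda>q. a q *\<^sub>R F q) p = pd_v a p *\<^sub>R F p + a p *\<^sub>R pd_v F p"
    by (simp_all add: pd_u_eqI[OF D] pd_v_eqI[OF D])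
qed

lemma pd_add:
  fixes F G :: "real \<times> real \<Rightarrow> 'a::real_normed_vector"
  assumes "F differentiable (at p)" "G differentiable (at p)"
  shows "pd_u (\<lambda>q. F q + G q) p = pd_u F p + pd_u G p" "pd_v (\<lambda>q. F q + G q) p = pd_v F p + pd_v G p"
proof -
  have D: "((\<lambda>q. F q + G q) has_derivative (\<lambda>w. (fst w *\<^sub>R pd_u F p + snd w *\<^sub>R pd_v F p)
      + (fst w *\<^sub>R pd_u G p + snd w *\<^sub>R pd_v G p))) (at p)"
    by (rule has_derivative_add[OF has_derivative_pd[OF assms(1)] has_derivative_pd[OF assms(2)]])
  show "pd_u (\<lambda>q. F q + G q) p = pd_u F p + pd_u G p" "pd_v (\<lambda>q. F q + G q) p = pd_v F p + pd_v G p"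
    by (simp_all add: pd_u_eqI[OF D] pd_v_eqI[OF D])
qed

lemma pd_inverse:
  fixes k :: "real \<times> real \<Rightarrow> real"
  assumes "k differentiable (at p)" "k p \<noteq> 0"
  shows "(\<lambda>q. 1 / k q) differentiable (at p)" "pd_u (\<lambda>q. 1 / k q) p = - pd_u k p / (k p)\<^sup>2" "pd_v (\<lambda>q. 1 / k q) p = - pd_v k p / (k p)\<^sup>2"
proof -
  have D: "((\<lambda>q. 1 / k q) has_derivative (\<lambda>w. (0 * k p - 1 * (fst w *\<^sub>R pd_u k p + snd w *\<^sub>R pd_v k p)) / (k p * k p))) (at p)"
    by (rule has_derivative_divide'[OF has_derivative_const has_derivative_pd[OF assms(1)] assms(2)])
  then show "(\<lambda>q. 1 / k q) differentiable (at p)" by (auto simp: differentiable_def)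
  show "pd_u (\<lambda>q. 1 / k q) p = - pd_u k p / (k p)\<^sup>2" "pd_v (\<lambda>q. 1 / k q) p = - pd_v k p / (k p)\<^sup>2"
    by (simp_all add: pd_u_eqI[OF D] pd_v_eqI[OF D] power2_eq_square)
qed

lemma pd_inner_const:
  fixes F G :: "real \<times> real \<Rightarrow> real^3"
  assumes "F differentiable (at p)" "G differentiable (at p)" "\<forall>\<^sub>F q in nhds p. F q \<bullet> G q = c"
  shows "pd_u F p \<bullet> G p + F p \<bullet> pd_u G p = 0" "pd_v F p \<bullet> G p + F p \<bullet> pd_v G p = 0"
proof -
  have "pd_u (\<lambda>q. c) p = 0" "pd_v (\<lambda>q. c) p = 0"
    using pd_u_eqI[OF has_derivative_const] pd_v_eqI[OF has_derivative_const] by blast+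
  then show "pd_u F p \<bullet> G p + F p \<bullet> pd_u G p = 0" "pd_v F p \<bullet> G p + F p \<bullet> pd_v G p = 0"
    using pd_cong(2,3)[OF assms(3) pd_inner(1)[OF assms(1,2)]] pd_inner(2,3)[OF assms(1,2)] by simp_all
qed

text \<open>
  Relations that hold for \<open>f\<^sub>v\<close> and \<open>\<nu>\<^sub>v\<close> pass to \<open>h\<close> and \<open>\<nu>1\<close> by cancelling \<open>v\<close>, and to the axis by
  continuity.
\<close>

lemma eq_zero_if_eq_zero_off_axis:
  fixes k :: "real \<times> real \<Rightarrow> real"
  assumes k: "smooth_on (square r) k" and zero: "\<And>q. q \<in> square r \<Longrightarrow> snd q * k q = 0" and q: "q \<in> square r"
  shows "k q = 0"
proof (cases "snd q = 0")
  case False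
  then show ?thesis using zero[OF q] by simp
next
  case True
  then have q0: "q = (fst q, 0)" by (simp add: prod_eq_iff)
  have "\<bar>fst q\<bar> < r" using q by (cases q) simp
  then have r: "0 < r" "\<bar>fst q\<bar> < r" by linarith+
  have "isCont (\<lambda>v. k (fst q, v)) 0"
    using r by (intro DERIV_isCont[OF pd_real_slices(2)] smooth_on_differentiable[OF k]) simp
  then have "k (fst q, 0) = 0"
  proof (rule eq_at_limit_point[where f = "\<lambda>v. k (fst q, v)" and g = "\<lambda>_. 0", OF _ continuous_const r(1)])
    show "k (fst q, t) = 0" if "0 < \<bar>t\<bar>" "\<bar>t\<bar> < r" for t using zero[of "(fst q, t)"] that r(2) by simp
  qed
  then show ?thesis using q0 by simp
qed

lemma smooth_on_isCont: "smooth_on S f \<Longrightarrow> open S \<Longrightarrow> p \<in> S \<Longrightarrow> isCont f p"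
  using smooth_on_continuous continuous_on_eq_continuous_at by blast

text \<open>
  The germ conditions that describe a frontal in adapted coordinates become identities on a fixed
  square, and norms become inner products, so that they can be used as rewrite rules.
\<close>

locale adapted_frontal =
  fixes f \<nu> h \<nu>1 :: surf and r :: real
  assumes r_pos: "r > 0"
    and smooth: "smooth_on (square r) f" "smooth_on (square r) \<nu>" "smooth_on (square r) h" "smooth_on (square r) \<nu>1"
    and f_v: "\<And>q. q \<in> square r \<Longrightarrow> pd_v f q = snd q *\<^sub>R h q"
    and \<nu>_v: "\<And>q. q \<in> square r \<Longrightarrow> pd_v \<nu> q = snd q *\<^sub>R \<nu>1 q"
    and unit_normal: "\<And>q. q \<in> square r \<Longrightarrow> \<nu> q \<bullet> \<nu> q = 1"
    and f_u_normal: "\<And>q. q \<in> square r \<Longrightarrow> pd_u f q \<bullet> \<nu> q = 0"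
    and f_v_normal: "\<And>q. q \<in> square r \<Longrightarrow> pd_v f q \<bullet> \<nu> q = 0"
    and axis: "\<And>u. \<bar>u\<bar> < r \<Longrightarrow> pd_u f (u, 0) \<bullet> pd_u f (u, 0) = 1"
      "\<And>u. \<bar>u\<bar> < r \<Longrightarrow> h (u, 0) \<bullet> h (u, 0) = 1" "\<And>u. \<bar>u\<bar> < r \<Longrightarrow> pd_u f (u, 0) \<bullet> h (u, 0) = 0"
begin

abbreviation "E \<equiv> Et f"
abbreviation "F \<equiv> Ft f h"
abbreviation "G \<equiv> Gt h"
abbreviation "L \<equiv> Lt f \<nu>"
abbreviation "M \<equiv> Mt \<nu> h"
abbreviation "N \<equiv> N1t h \<nu>1"

lemma smooth_forms:
  "smooth_on (square r) E" "smooth_on (square r) F" "smooth_on (square r) G"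
  "smooth_on (square r) L" "smooth_on (square r) M" "smooth_on (square r) N"
  unfolding Et_def[abs_def] Ft_def[abs_def] Gt_def[abs_def] Lt_def[abs_def] Mt_def[abs_def] N1t_def[abs_def]
  by (intro smooth_intros smooth open_square)+

lemma diff:
  assumes "q \<in> square r"
  shows "f differentiable (at q)" "\<nu> differentiable (at q)" "h differentiable (at q)" "\<nu>1 differentiable (at q)"
    "pd_u f differentiable (at q)" "pd_v f differentiable (at q)" "pd_u \<nu> differentiable (at q)" "pd_v \<nu> differentiable (at q)"
    "E differentiable (at q)" "F differentiable (at q)" "G differentiable (at q)"
    "L differentiable (at q)" "M differentiable (at q)" "N differentiable (at q)"
  using smooth_on_differentiable[OF _ assms] smooth smooth_forms smooth_on_pd by blast+

lemma eventually_square_at: "q \<in> square r \<Longrightarrow> (\<And>q. q \<in> square r \<Longrightarrow> P q) \<Longrightarrow> \<forall>\<^sub>F q in nhds q. P q"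
  by (rule eventually_mono[OF eventually_nhds_in_open[OF open_square]])

lemma axis_in: "\<bar>u\<bar> < r \<Longrightarrow> (u, 0) \<in> square r" using r_pos by simp

lemma h_normal: "q \<in> square r \<Longrightarrow> h q \<bullet> \<nu> q = 0"
  by (rule eq_zero_if_eq_zero_off_axis[where k = "\<lambda>q. h q \<bullet> \<nu> q"])
    (use f_v f_v_normal in \<open>auto intro!: smooth_intros smooth simp: inner_scaleR_left[symmetric] simp del: inner_scaleR_left\<close>)

lemma \<nu>_u_normal: "q \<in> square r \<Longrightarrow> pd_u \<nu> q \<bullet> \<nu> q = 0"
  and \<nu>_v_normal: "q \<in> square r \<Longrightarrow> pd_v \<nu> q \<bullet> \<nu> q = 0"
  using pd_inner_const[OF diff(2) diff(2) eventually_square_at, OF _ _ _ unit_normal] by (auto simp: inner_commute)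

lemma \<nu>1_normal: "q \<in> square r \<Longrightarrow> \<nu>1 q \<bullet> \<nu> q = 0"
  by (rule eq_zero_if_eq_zero_off_axis[where k = "\<lambda>q. \<nu>1 q \<bullet> \<nu> q"])
    (use \<nu>_v \<nu>_v_normal in \<open>auto intro!: smooth_intros smooth simp: inner_scaleR_left[symmetric] simp del: inner_scaleR_left\<close>)

text \<open>
  Symmetry of the second fundamental form, divided by \<open>v\<close>.
\<close>

lemma f_u_\<nu>1: "q \<in> square r \<Longrightarrow> pd_u f q \<bullet> \<nu>1 q = h q \<bullet> pd_u \<nu> q"
proof -
  assume q: "q \<in> square r"
  have "pd_u f q \<bullet> \<nu>1 q - h q \<bullet> pd_u \<nu> q = 0"
  proof (rule eq_zero_if_eq_zero_off_axis[where k = "\<lambda>q. pd_u f q \<bullet> \<nu>1 q - h q \<bullet> pd_u \<nu> q", OF _ _ q])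
    show "smooth_on (square r) (\<lambda>q. pd_u f q \<bullet> \<nu>1 q - h q \<bullet> pd_u \<nu> q)" by (intro smooth_intros smooth open_square)
    fix q assume q: "q \<in> square r"
    have "pd_v (pd_u f) q \<bullet> \<nu> q + pd_u f q \<bullet> pd_v \<nu> q = 0"
      by (rule pd_inner_const(2)[OF diff(5)[OF q] diff(2)[OF q] eventually_square_at[OF q f_u_normal]])
    moreover have "pd_u (pd_v f) q \<bullet> \<nu> q + pd_v f q \<bullet> pd_u \<nu> q = 0"
      by (rule pd_inner_const(1)[OF diff(6)[OF q] diff(2)[OF q] eventually_square_at[OF q f_v_normal]])
    ultimately have "pd_u f q \<bullet> pd_v \<nu> q = pd_v f q \<bullet> pd_u \<nu> q"
      using pd_commute[OF open_square smooth(1) q] by simp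
    then show "snd q * (pd_u f q \<bullet> \<nu>1 q - h q \<bullet> pd_u \<nu> q) = 0"
      unfolding f_v[OF q] \<nu>_v[OF q] by (simp add: right_diff_distrib)
  qed
  then show ?thesis by simp
qed

lemma form_products:
  assumes "q \<in> square r"
  shows "pd_u f q \<bullet> pd_u f q = E q" "pd_u f q \<bullet> h q = F q" "h q \<bullet> pd_u f q = F q" "h q \<bullet> h q = G q"
    "pd_u \<nu> q \<bullet> pd_u f q = - L q" "pd_u \<nu> q \<bullet> h q = - M q" "\<nu>1 q \<bullet> pd_u f q = - M q" "\<nu>1 q \<bullet> h q = - N q"
  using f_u_\<nu>1[OF assms] by (auto simp: Et_def Ft_def Gt_def Lt_def Mt_def N1t_def inner_commute)

lemma forms_axis: "\<bar>u\<bar> < r \<Longrightarrow> E (u, 0) = 1" "\<bar>u\<bar> < r \<Longrightarrow> F (u, 0) = 0" "\<bar>u\<bar> < r \<Longrightarrow> G (u, 0) = 1"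
  using axis by (auto simp: Et_def Ft_def Gt_def)

lemma mixed_derivative_axis:
  assumes u: "\<bar>u\<bar> < r"
  shows "pd_v (pd_u f) (u, 0) = 0" "pd_v (pd_u \<nu>) (u, 0) = 0"
proof -
  note q = axis_in[OF u]
  have "snd differentiable (at (u, 0 :: real))" by (simp add: bounded_linear_imp_differentiable bounded_linear_snd)
  moreover have "pd_u snd (u, 0 :: real) = (0 :: real)"
    using pd_u_eqI[OF bounded_linear_imp_has_derivative[OF bounded_linear_snd]] by simp
  ultimately have *: "(\<lambda>q. snd q *\<^sub>R H q) differentiable (at (u, 0))" "pd_u (\<lambda>q. snd q *\<^sub>R H q) (u, 0) = 0"
    if "H differentiable (at (u, 0))" for H :: surf
    using pd_scaleR(1,2)[OF _ that, of snd] by simp_all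
  have "\<forall>\<^sub>F q in nhds (u, 0). snd q *\<^sub>R h q = pd_v f q" "\<forall>\<^sub>F q in nhds (u, 0). snd q *\<^sub>R \<nu>1 q = pd_v \<nu> q"
    by (rule eventually_square_at[OF q], simp add: f_v \<nu>_v)+
  from pd_cong(2)[OF this(1) *(1)[OF diff(3)[OF q]]] pd_cong(2)[OF this(2) *(1)[OF diff(4)[OF q]]]
  show "pd_v (pd_u f) (u, 0) = 0" "pd_v (pd_u \<nu>) (u, 0) = 0"
    using *(2)[OF diff(3)[OF q]] *(2)[OF diff(4)[OF q]]
      pd_commute[OF open_square smooth(1) q] pd_commute[OF open_square smooth(2) q] by simp_all
qed

text \<open>
  On the axis the mixed derivatives of \<open>f\<close> and \<open>\<nu>\<close> vanish, because \<open>f\<^sub>v\<close> and \<open>\<nu>\<^sub>v\<close> carry a factor \<open>v\<close>.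
  The value of \<open>M\<^sub>v\<close> comes from expanding \<open>\<nu>\<^sub>u\<close> in the orthonormal frame \<open>f\<^sub>u\<close>, \<open>h\<close>, \<open>\<nu>\<close>.
\<close>

lemma forms_v_axis:
  assumes u: "\<bar>u\<bar> < r"
  shows "pd_v E (u, 0) = 0" "pd_v L (u, 0) = 0"
    "pd_v M (u, 0) = L (u, 0) * pd_v F (u, 0) + M (u, 0) * pd_v G (u, 0) / 2"
proof -
  note q = axis_in[OF u] and mixed = mixed_derivative_axis[OF u]
  show "pd_v E (u, 0) = 0"
    unfolding Et_def[abs_def] using pd_inner(3)[OF diff(5)[OF q] diff(5)[OF q]] mixed by simp
  have neg: "pd_v (\<lambda>q. - k q) (u, 0) = - pd_v k (u, 0)" if "k differentiable (at (u, 0))" for k :: "real \<times> real \<Rightarrow> real"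
    using pd_v_eqI[OF has_derivative_minus[OF has_derivative_pd[OF that]]] by simp
  show "pd_v L (u, 0) = 0"
    unfolding Lt_def[abs_def] using neg[OF pd_inner(1)[OF diff(5)[OF q] diff(7)[OF q]]]
      pd_inner(3)[OF diff(5)[OF q] diff(7)[OF q]] mixed by simp
  have Fv: "pd_v F (u, 0) = pd_u f (u, 0) \<bullet> pd_v h (u, 0)"
    unfolding Ft_def[abs_def] using pd_inner(3)[OF diff(5)[OF q] diff(3)[OF q]] mixed by simp
  have Gv: "pd_v G (u, 0) = 2 * (h (u, 0) \<bullet> pd_v h (u, 0))"
    unfolding Gt_def[abs_def] using pd_inner(3)[OF diff(3)[OF q] diff(3)[OF q]] by (simp add: inner_commute)
  have "pd_u \<nu> (u, 0) + L (u, 0) *\<^sub>R pd_u f (u, 0) + M (u, 0) *\<^sub>R h (u, 0) = 0"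
    by (rule eq_zero_if_orthogonal_to_frame[of "pd_u f (u, 0)" "h (u, 0)" "\<nu> (u, 0)"])
      (simp_all add: form_products[OF q] forms_axis[OF u] unit_normal[OF q] f_u_normal[OF q] h_normal[OF q] \<nu>_u_normal[OF q] inner_add_left)
  then have "pd_u \<nu> (u, 0) = - (L (u, 0) *\<^sub>R pd_u f (u, 0) + M (u, 0) *\<^sub>R h (u, 0))"
    by (simp only: add.assoc eq_neg_iff_add_eq_0)
  then have \<nu>u: "pd_u \<nu> (u, 0) = - L (u, 0) *\<^sub>R pd_u f (u, 0) - M (u, 0) *\<^sub>R h (u, 0)" by simp
  have "pd_v M (u, 0) = - (pd_v h (u, 0) \<bullet> pd_u \<nu> (u, 0))"
    unfolding Mt_def[abs_def] using neg[OF pd_inner(1)[OF diff(3)[OF q] diff(7)[OF q]]]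
      pd_inner(3)[OF diff(3)[OF q] diff(7)[OF q]] mixed by simp
  also have "\<dots> = L (u, 0) * (pd_u f (u, 0) \<bullet> pd_v h (u, 0)) + M (u, 0) * (h (u, 0) \<bullet> pd_v h (u, 0))"
    unfolding \<nu>u by (simp add: inner_diff_right inner_commute)
  finally show "pd_v M (u, 0) = L (u, 0) * pd_v F (u, 0) + M (u, 0) * pd_v G (u, 0) / 2" by (simp add: Fv Gv)
qed

end

section \<open>Focal surfaces\<close>

text \<open>
  The function \<open>k\<close> stands for either principal curvature. It is given implicitly, as a smooth and
  nonvanishing root of the characteristic equation of the Weingarten map, because every fact about
  principal curvatures below comes from that equation or one of its derivatives.
\<close>

locale focal_frontal = adapted_frontal +
  fixes k :: "real \<times> real \<Rightarrow> real"
  assumes k_smooth: "smooth_on (square r) k"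
    and k_nz: "\<And>q. q \<in> square r \<Longrightarrow> k q \<noteq> 0"
    and k_char: "\<And>q. q \<in> square r \<Longrightarrow> (k q)\<^sup>2 * (E q * G q - (F q)\<^sup>2)
        - k q * (E q * N q - 2 * F q * M q + G q * L q) + (L q * N q - (M q)\<^sup>2) = 0"
    and regular: "\<And>q. q \<in> square r \<Longrightarrow> E q * G q - (F q)\<^sup>2 \<noteq> 0"
    and torsion: "M (0, 0) \<noteq> 0"
begin

text \<open>
  \<open>V1\<close> and \<open>V2\<close> are the components of the principal vector, \<open>x\<close> is the (not normalized) normal of the
  focal surface \<open>C\<close>, and \<open>\<l>\<close> is the derivative of \<open>k\<close> in the principal direction.
\<close>

definition V1 where "V1 q = - snd q * (M q - k q * F q)"
definition V2 where "V2 q = L q - k q * E q"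
definition x :: surf where "x q = - (M q - k q * F q) *\<^sub>R pd_u f q + V2 q *\<^sub>R h q"
definition C :: surf where "C q = f q + (1 / k q) *\<^sub>R \<nu> q"
definition \<l> where "\<l> q = V1 q * pd_u k q + V2 q * pd_v k q"

lemma V_smooth: "smooth_on (square r) V1" "smooth_on (square r) V2" "smooth_on (square r) \<l>" "smooth_on (square r) x"
  "smooth_on (square r) C"
proof -
  show V: "smooth_on (square r) V1" "smooth_on (square r) V2"
    unfolding V1_def[abs_def] V2_def[abs_def] by (intro smooth_intros smooth_forms k_smooth open_square)+
  show "smooth_on (square r) \<l>" "smooth_on (square r) x" "smooth_on (square r) C"
    unfolding \<l>_def[abs_def] x_def[abs_def] C_def[abs_def]
    by (intro smooth_intros smooth smooth_forms k_smooth open_square V k_nz; assumption?)+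
qed

lemma kd: "q \<in> square r \<Longrightarrow> k differentiable (at q)" by (rule smooth_on_differentiable[OF k_smooth])

lemma x_products:
  assumes q: "q \<in> square r"
  shows "x q \<bullet> \<nu> q = 0" "x q \<bullet> pd_u f q = L q * F q - M q * E q" "x q \<bullet> h q = - (M q - k q * F q) * F q + V2 q * G q"
    "x q \<bullet> pd_u \<nu> q = k q * (E q * M q - F q * L q)" "x q \<bullet> \<nu>1 q = (M q - k q * F q) * M q - V2 q * N q"
  using form_products[OF q] f_u_normal[OF q] h_normal[OF q]
  by (simp_all add: x_def V2_def inner_add_left inner_commute[of _ "pd_u \<nu> q"] inner_commute[of _ "\<nu>1 q"] algebra_simps)

lemma x_conormal: "q \<in> square r \<Longrightarrow> x q \<bullet> \<nu>1 q = - k q * (x q \<bullet> h q)"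
  using k_char[of q] by (simp add: x_products V2_def power2_eq_square) (simp add: algebra_simps)

text \<open>
  Rodrigues' formula \<open>d\<nu>(V) = - k df(V)\<close> for the principal vector, divided by \<open>v\<close>. Both sides
  have the same products with the frame \<open>f\<^sub>u\<close>, \<open>h\<close>, \<open>\<nu>\<close>, and the product with \<open>h\<close> is the
  characteristic equation.
\<close>

lemma Weingarten:
  assumes q: "q \<in> square r"
  shows "- (M q - k q * F q) *\<^sub>R pd_u \<nu> q + V2 q *\<^sub>R \<nu>1 q = - k q *\<^sub>R x q"
proof -
  have "- (M q - k q * F q) *\<^sub>R pd_u \<nu> q + V2 q *\<^sub>R \<nu>1 q + k q *\<^sub>R x q = 0" (is "?z = 0")
  proof (rule eq_zero_if_orthogonal_to_frame[of "pd_u f q" "h q" "\<nu> q"])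
    show "?z \<bullet> h q = 0" using k_char[OF q]
      by (simp add: inner_add_left form_products[OF q] x_products[OF q] V2_def power2_eq_square) (simp add: algebra_simps)
    show "?z \<bullet> pd_u f q = 0"
      by (simp add: inner_add_left form_products[OF q] x_products[OF q] V2_def) (simp add: algebra_simps)
  qed (use regular[OF q] in \<open>simp_all add: form_products[OF q] unit_normal[OF q] f_u_normal[OF q] h_normal[OF q] \<nu>_u_normal[OF q]
      \<nu>1_normal[OF q] inner_add_left x_products[OF q]\<close>)
  then show ?thesis by (simp add: eq_neg_iff_add_eq_0)
qed

lemma C_pd:
  assumes q: "q \<in> square r"
  shows "pd_u C q = pd_u f q + (- pd_u k q / (k q)\<^sup>2) *\<^sub>R \<nu> q + (1 / k q) *\<^sub>R pd_u \<nu> q"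
    "pd_v C q = snd q *\<^sub>R h q + (- pd_v k q / (k q)\<^sup>2) *\<^sub>R \<nu> q + (snd q / k q) *\<^sub>R \<nu>1 q"
proof -
  note i = pd_inverse[OF kd[OF q] k_nz[OF q]]
  note s = pd_scaleR[OF i(1) diff(2)[OF q]]
  show "pd_u C q = pd_u f q + (- pd_u k q / (k q)\<^sup>2) *\<^sub>R \<nu> q + (1 / k q) *\<^sub>R pd_u \<nu> q"
    "pd_v C q = snd q *\<^sub>R h q + (- pd_v k q / (k q)\<^sup>2) *\<^sub>R \<nu> q + (snd q / k q) *\<^sub>R \<nu>1 q"
    unfolding C_def[abs_def] using pd_add[OF diff(1)[OF q] s(1)] s(2,3) i(2,3) f_v[OF q] \<nu>_v[OF q]
    by simp_all
qed

lemma x_normal: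
  assumes q: "q \<in> square r"
  shows "x q \<bullet> pd_u C q = 0" "x q \<bullet> pd_v C q = 0"
  using k_nz[OF q] x_conormal[OF q]
  by (simp_all add: C_pd[OF q] inner_add_right inner_diff_right x_products(1,2,4)[OF q] field_simps)

text \<open>
  By Rodrigues' formula the tangential parts of \<open>dC(V) = df(V) + (1 / k) d\<nu>(V) + d(1 / k)(V) \<nu>\<close> cancel. So
  near the origin the focal surface is singular along the curve \<open>\<l> = 0\<close>, with the principal vector as null direction.
\<close>

lemma C_null_direction:
  assumes q: "q \<in> square r"
  shows "V1 q *\<^sub>R pd_u C q + V2 q *\<^sub>R pd_v C q = (- \<l> q / (k q)\<^sup>2) *\<^sub>R \<nu> q"
proof -
  have "V1 q *\<^sub>R pd_u C q + V2 q *\<^sub>R pd_v C q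
      = snd q *\<^sub>R (- (M q - k q * F q) *\<^sub>R pd_u f q + V2 q *\<^sub>R h q)
      + (snd q / k q) *\<^sub>R (- (M q - k q * F q) *\<^sub>R pd_u \<nu> q + V2 q *\<^sub>R \<nu>1 q)
      + (V1 q * (- pd_u k q / (k q)\<^sup>2) + V2 q * (- pd_v k q / (k q)\<^sup>2)) *\<^sub>R \<nu> q"
    by (simp add: C_pd[OF q] V1_def algebra_simps)
  also have "snd q *\<^sub>R (- (M q - k q * F q) *\<^sub>R pd_u f q + V2 q *\<^sub>R h q)
      + (snd q / k q) *\<^sub>R (- (M q - k q * F q) *\<^sub>R pd_u \<nu> q + V2 q *\<^sub>R \<nu>1 q) = 0"
    unfolding Weingarten[OF q] using k_nz[OF q] by (simp add: x_def)
  also have "V1 q * (- pd_u k q / (k q)\<^sup>2) + V2 q * (- pd_v k q / (k q)\<^sup>2) = - \<l> q / (k q)\<^sup>2"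
    using k_nz[OF q] by (simp add: \<l>_def field_simps)
  finally show ?thesis by simp
qed

text \<open>
  Since the frame is orthonormal on the axis, the characteristic equation has its usual form there.
  It is the source of all relations between \<open>k\<close> and the invariants of the singular curve.
\<close>

lemma char_axis:
  assumes u: "\<bar>u\<bar> < r"
  shows "(L (u, 0) - k (u, 0)) * (N (u, 0) - k (u, 0)) = (M (u, 0))\<^sup>2"
  using k_char[OF axis_in[OF u]] by (simp add: forms_axis[OF u] algebra_simps power2_eq_square)

lemma V_axis: "\<bar>u\<bar> < r \<Longrightarrow> V1 (u, 0) = 0" "\<bar>u\<bar> < r \<Longrightarrow> V2 (u, 0) = L (u, 0) - k (u, 0)"
  by (simp_all add: V1_def V2_def forms_axis)

lemma V2_origin: "V2 (0, 0) \<noteq> 0"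
  using char_axis[of 0] torsion r_pos by (auto simp: V_axis)

text \<open>
  The factor \<open>(L - k)\<^sup>2 + M\<^sup>2\<close> that appears in this determinant is nonzero because the cuspidal torsion is.
\<close>

lemma transversal_origin: "pd_u C (0, 0) \<bullet> cross3 (\<nu> (0, 0)) (x (0, 0)) \<noteq> 0"
proof -
  have u: "\<bar>0\<bar> < r" and q: "(0, 0) \<in> square r" using r_pos by auto
  define \<delta> where "\<delta> = h (0, 0) \<bullet> cross3 (\<nu> (0, 0)) (pd_u f (0, 0))"
  have swap: "pd_u f (0, 0) \<bullet> cross3 (\<nu> (0, 0)) (h (0, 0)) = - \<delta>"
    unfolding \<delta>_def by (simp add: cross3_def inner_vec_def sum_3 algebra_simps)
  have "pd_u \<nu> (0, 0) + L (0, 0) *\<^sub>R pd_u f (0, 0) + M (0, 0) *\<^sub>R h (0, 0) = 0"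
    by (rule eq_zero_if_orthogonal_to_frame[of "pd_u f (0, 0)" "h (0, 0)" "\<nu> (0, 0)"])
      (simp_all add: form_products[OF q] forms_axis[OF u] unit_normal[OF q] f_u_normal[OF q] h_normal[OF q] \<nu>_u_normal[OF q] inner_add_left)
  then have "pd_u \<nu> (0, 0) = - (L (0, 0) *\<^sub>R pd_u f (0, 0) + M (0, 0) *\<^sub>R h (0, 0))"
    by (simp only: add.assoc eq_neg_iff_add_eq_0)
  then have \<nu>u: "pd_u \<nu> (0, 0) = - L (0, 0) *\<^sub>R pd_u f (0, 0) - M (0, 0) *\<^sub>R h (0, 0)" by simp
  define a where "a = L (0, 0) - k (0, 0)"
  have x0: "x (0, 0) = - M (0, 0) *\<^sub>R pd_u f (0, 0) + a *\<^sub>R h (0, 0)"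
    by (simp add: x_def V_axis[OF u] forms_axis[OF u] a_def)
  have cr: "cross3 (\<nu> (0, 0)) (x (0, 0)) = - M (0, 0) *\<^sub>R cross3 (\<nu> (0, 0)) (pd_u f (0, 0)) + a *\<^sub>R cross3 (\<nu> (0, 0)) (h (0, 0))"
    unfolding x0 by (simp only: cross_add_right cross_mult_right)
  have "pd_u C (0, 0) \<bullet> cross3 (\<nu> (0, 0)) (x (0, 0)) = (1 - L (0, 0) / k (0, 0)) * (a * (- \<delta>))
      + (- M (0, 0) / k (0, 0)) * (- M (0, 0) * \<delta>)"
    unfolding cr C_pd(1)[OF q] \<nu>u
    by (simp add: inner_add_left inner_add_right inner_diff_left dot_cross_self swap \<delta>_def[symmetric] algebra_simps)
  also have "\<dots> = \<delta> / k (0, 0) * (a\<^sup>2 + (M (0, 0))\<^sup>2)"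
    using k_nz[OF q] by (simp add: a_def power2_eq_square field_simps)
  also have "\<dots> \<noteq> 0"
  proof -
    have "\<delta> \<noteq> 0"
    proof
      assume \<delta>: "\<delta> = 0"
      define w where "w = cross3 (\<nu> (0, 0)) (pd_u f (0, 0))"
      have "\<nu> (0, 0) \<bullet> pd_u f (0, 0) = 0" "\<nu> (0, 0) \<bullet> h (0, 0) = 0"
        using f_u_normal[OF q] h_normal[OF q] by (simp_all add: inner_commute)
      have "w = 0"
        by (rule eq_zero_if_orthogonal_to_frame[of "pd_u f (0, 0)" "h (0, 0)" "\<nu> (0, 0)"])
          (use \<delta> \<open>\<nu> (0, 0) \<bullet> pd_u f (0, 0) = 0\<close> \<open>\<nu> (0, 0) \<bullet> h (0, 0) = 0\<close> in \<open>simp_all add: form_products[OF q] forms_axis[OF u] unit_normal[OF q] f_u_normal[OF q] h_normal[OF q] w_def dot_cross_self \<delta>_def inner_commute\<close>)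
      then show False
        using norm_cross_dot[of "\<nu> (0, 0)" "pd_u f (0, 0)"] unit_normal[OF q] axis(1)[OF u] f_u_normal[OF q]
        by (simp add: w_def power2_norm_eq_inner power_mult_distrib inner_commute)
    qed
    moreover have "a\<^sup>2 + (M (0, 0))\<^sup>2 \<noteq> 0" using torsion by (simp add: sum_power2_eq_zero_iff)
    ultimately show ?thesis using k_nz[OF q] by simp
  qed
  finally show ?thesis .
qed

text \<open>
  Differentiate the characteristic equation in \<open>v\<close> and use that \<open>M\<^sup>2 = (L - k) (N - k)\<close> on the axis. The
  secondary cuspidal curvature is the combination of derivatives that remains, so it measures the
  derivative of the principal curvature along the null direction \<open>\<partial>\<^sub>v\<close>.
\<close>

lemma k_v_axis:
  assumes u: "\<bar>u\<bar> < r"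
  shows "24 * pd_v k (u, 0) * ((L (u, 0) - k (u, 0))\<^sup>2 + (M (u, 0))\<^sup>2)
    = secondary_cuspidal_curv f \<nu> h \<nu>1 u * (L (u, 0) - k (u, 0))\<^sup>2"
proof -
  note q = axis_in[OF u]
  note s = pd_real_slices(2)
  define k' where "k' = pd_v k (u, 0)"
  define N' where "N' = pd_v N (u, 0)"
  define F' where "F' = pd_v F (u, 0)"
  define G' where "G' = pd_v G (u, 0)"
  have D: "((\<lambda>t. (k (u, t))\<^sup>2 * (E (u, t) * G (u, t) - (F (u, t))\<^sup>2)
        - k (u, t) * (E (u, t) * N (u, t) - 2 * F (u, t) * M (u, t) + G (u, t) * L (u, t))
        + (L (u, t) * N (u, t) - (M (u, t))\<^sup>2)) has_real_derivative
      2 * k (u, 0) * k' + (k (u, 0))\<^sup>2 * G' - k' * (N (u, 0) + L (u, 0))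
      - k (u, 0) * (N' - 2 * F' * M (u, 0) + G' * L (u, 0))
      + (L (u, 0) * N' - 2 * M (u, 0) * (L (u, 0) * F' + M (u, 0) * G' / 2))) (at 0)"
    using forms_axis[OF u] forms_v_axis[OF u]
    by (auto intro!: derivative_eq_intros s[OF kd[OF q]] s[OF diff(9)[OF q]] s[OF diff(10)[OF q]] s[OF diff(11)[OF q]]
        s[OF diff(12)[OF q]] s[OF diff(13)[OF q]] s[OF diff(14)[OF q]] simp: k'_def N'_def F'_def G'_def algebra_simps)
  have "\<forall>\<^sub>F t in nhds 0. (k (u, t))\<^sup>2 * (E (u, t) * G (u, t) - (F (u, t))\<^sup>2)
        - k (u, t) * (E (u, t) * N (u, t) - 2 * F (u, t) * M (u, t) + G (u, t) * L (u, t))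
        + (L (u, t) * N (u, t) - (M (u, t))\<^sup>2) = 0"
    using eventually_abs_less[OF r_pos] by eventually_elim (rule k_char, use u in simp)
  from DERIV_unique[OF D iffD2[OF DERIV_cong_ev[OF refl this refl] DERIV_const]]
  have 1: "2 * k (u, 0) * k' + (k (u, 0))\<^sup>2 * G' - k' * (N (u, 0) + L (u, 0))
      - k (u, 0) * (N' - 2 * F' * M (u, 0) + G' * L (u, 0))
      + (L (u, 0) * N' - 2 * M (u, 0) * (L (u, 0) * F' + M (u, 0) * G' / 2)) = 0" .
  have "secondary_cuspidal_curv f \<nu> h \<nu>1 u = 24 * (N' - 2 * F' * M (u, 0) - G' * N (u, 0))"
    by (simp add: secondary_cuspidal_curv_def N'_def F'_def G'_def)
  moreover have "k' * ((L (u, 0) - k (u, 0))\<^sup>2 + (M (u, 0))\<^sup>2)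
      = (N' - 2 * F' * M (u, 0) - G' * N (u, 0)) * (L (u, 0) - k (u, 0))\<^sup>2"
    using 1 char_axis[OF u] by algebra
  ultimately show ?thesis unfolding k'_def[symmetric] by algebra
qed

text \<open>
  The characteristic equation differentiated along the axis. The right-hand side is the bracket in
  the second inequality of the theorem.
\<close>

lemma k_u_origin:
  "pd_u k (0, 0) * ((L (0, 0) - k (0, 0))\<^sup>2 + (M (0, 0))\<^sup>2)
    = (M (0, 0))\<^sup>2 * pd_u L (0, 0) + 2 * M (0, 0) * pd_u M (0, 0) * (k (0, 0) - L (0, 0))
      + pd_u N (0, 0) * (k (0, 0) - L (0, 0))\<^sup>2"
proof -
  have u: "\<bar>0\<bar> < r" and q: "(0, 0) \<in> square r" using r_pos by auto
  note s = pd_real_slices(1)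
  have D: "((\<lambda>t. (L (t, 0) - k (t, 0)) * (N (t, 0) - k (t, 0)) - (M (t, 0))\<^sup>2) has_real_derivative
      (pd_u L (0, 0) - pd_u k (0, 0)) * (N (0, 0) - k (0, 0)) + (L (0, 0) - k (0, 0)) * (pd_u N (0, 0) - pd_u k (0, 0))
      - 2 * M (0, 0) * pd_u M (0, 0)) (at 0)"
    by (auto intro!: derivative_eq_intros s[OF kd[OF q]] s[OF diff(12)[OF q]] s[OF diff(13)[OF q]] s[OF diff(14)[OF q]]
        simp: algebra_simps)
  have "\<forall>\<^sub>F t in nhds 0. (L (t, 0) - k (t, 0)) * (N (t, 0) - k (t, 0)) - (M (t, 0))\<^sup>2 = 0"
    using eventually_abs_less[OF r_pos] by eventually_elim (simp add: char_axis)
  from DERIV_unique[OF D iffD2[OF DERIV_cong_ev[OF refl this refl] DERIV_const]]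
  have "(pd_u L (0, 0) - pd_u k (0, 0)) * (N (0, 0) - k (0, 0)) + (L (0, 0) - k (0, 0)) * (pd_u N (0, 0) - pd_u k (0, 0))
      - 2 * M (0, 0) * pd_u M (0, 0) = 0" .
  with char_axis[OF u] V2_origin show ?thesis unfolding V_axis(2)[OF u] by algebra
qed

text \<open>
  The bracket equals \<open>k\<^sub>u S\<close> with \<open>S = (L - k)\<^sup>2 + M\<^sup>2\<close>. At a ridge point \<open>k\<^sub>v = 0\<close>, so the radius of
  curvature has derivative \<open>- k\<^sub>u / k\<^sup>2\<close> along the singular curve, and the left-hand side is
  \<open>- (k\<^sub>u / k)\<^sup>2 S \<le> 0\<close>. By the characteristic equation the right-hand side is \<open>S\<^sup>2 > 0\<close>.
\<close>

lemma radius_derivative_inequality: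
  assumes "\<l> (0, 0) = 0" and g: "g 0 = 0" "(g has_real_derivative g') (at 0)"
  shows "deriv (\<lambda>t. 1 / k (t, g t)) 0 * ((M (0, 0))\<^sup>2 * pd_u L (0, 0) + 2 * M (0, 0) * pd_u M (0, 0) * (k (0, 0) - L (0, 0))
      + pd_u N (0, 0) * (k (0, 0) - L (0, 0))\<^sup>2)
    < ((M (0, 0))\<^sup>2 + (k (0, 0) - L (0, 0))\<^sup>2) * (N (0, 0) + L (0, 0) - 2 * k (0, 0)) * (L (0, 0) - k (0, 0))"
proof -
  have u: "\<bar>0\<bar> < r" and q: "(0, 0) \<in> square r" using r_pos by auto
  define S where "S = (L (0, 0) - k (0, 0))\<^sup>2 + (M (0, 0))\<^sup>2"
  have S: "S > 0" using torsion by (simp add: S_def add_nonneg_pos)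
  have kv: "pd_v k (0, 0) = 0" using assms(1) V2_origin by (simp add: \<l>_def V_axis[OF u])
  have c0: "((\<lambda>t. (t, g t)) has_derivative (\<lambda>t. (t, g' * t))) (at 0)"
    by (intro has_derivative_Pair has_derivative_ident g(2)[unfolded has_field_derivative_def])
  have "((\<lambda>q. 1 / k q) has_derivative (\<lambda>w. fst w *\<^sub>R (- pd_u k (0, 0) / (k (0, 0))\<^sup>2) + snd w *\<^sub>R 0)) (at (0, g 0))"
    using has_derivative_pd[OF pd_inverse(1)[OF kd[OF q] k_nz[OF q]]] pd_inverse(2,3)[OF kd[OF q] k_nz[OF q]] kv g(1) by simp
  from has_derivative_compose[OF c0 this]
  have D: "((\<lambda>t. 1 / k (t, g t)) has_derivative (\<lambda>t. fst (t, g' * t) *\<^sub>R (- pd_u k (0, 0) / (k (0, 0))\<^sup>2) + snd (t, g' * t) *\<^sub>R 0)) (at 0)" .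
  have "((\<lambda>t. 1 / k (t, g t)) has_real_derivative - pd_u k (0, 0) / (k (0, 0))\<^sup>2) (at 0)"
    unfolding has_field_derivative_def by (rule has_derivative_eq_rhs[OF D]) (simp add: fun_eq_iff mult.commute)
  then have \<rho>': "deriv (\<lambda>t. 1 / k (t, g t)) 0 = - pd_u k (0, 0) / (k (0, 0))\<^sup>2" by (rule DERIV_imp_deriv)
  have "- pd_u k (0, 0) / (k (0, 0))\<^sup>2 * (pd_u k (0, 0) * S) = - ((pd_u k (0, 0) / k (0, 0))\<^sup>2 * S)"
    by (simp add: power2_eq_square)
  also have "\<dots> \<le> 0" using S by simp
  also have "0 < S * S" using S by simp
  also have "S * S = ((M (0, 0))\<^sup>2 + (k (0, 0) - L (0, 0))\<^sup>2) * (N (0, 0) + L (0, 0) - 2 * k (0, 0)) * (L (0, 0) - k (0, 0))"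
    using char_axis[OF u] unfolding S_def by algebra
  finally show ?thesis unfolding \<rho>' k_u_origin[symmetric] S_def .
qed

text \<open>
  By \<open>k_v_axis\<close> the restriction of \<open>\<l>\<close> to the axis is a nonvanishing multiple of the secondary
  cuspidal curvature, so \<open>r\<^sub>c' \<noteq> 0\<close> says that \<open>\<l>\<^sub>u \<noteq> 0\<close> at the origin. Differentiating
  \<open>\<l> (t, g t) = 0\<close> gives \<open>\<l>\<^sub>u + g' \<l>\<^sub>v = 0\<close> with \<open>\<l>\<^sub>v \<noteq> 0\<close>.
\<close>

lemma ridge_curve:
  assumes l0: "\<l> (0, 0) = 0" and lv: "pd_v \<l> (0, 0) \<noteq> 0"
    and g: "g 0 = 0" "(g has_real_derivative g') (at 0)" and curve: "\<forall>\<^sub>F t in nhds 0. \<l> (t, g t) = 0"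
  shows "deriv (secondary_cuspidal_curv f \<nu> h \<nu>1) 0 \<noteq> 0 \<longleftrightarrow> g' \<noteq> 0"
proof -
  have u: "\<bar>0\<bar> < r" and q: "(0, 0) \<in> square r" using r_pos by auto
  define rc where "rc = secondary_cuspidal_curv f \<nu> h \<nu>1"
  define a where "a t = L (t, 0) - k (t, 0)" for t
  define K where "K t = (a t) ^ 3 / (24 * ((a t)\<^sup>2 + (M (t, 0))\<^sup>2))" for t
  have a0: "a 0 \<noteq> 0" using V2_origin by (simp add: a_def V_axis[OF u])
  have ev: "\<forall>\<^sub>F t in nhds (0 :: real). \<bar>t\<bar> < r" by (rule eventually_abs_less[OF r_pos])
  have slice: "((\<lambda>t. p (t, 0)) has_real_derivative pd_u p (0, 0)) (at 0)" if "smooth_on (square r) p" for p :: "real \<times> real \<Rightarrow> real"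
    by (rule pd_real_slices(1)[OF smooth_on_differentiable[OF that q]])
  have l_eq: "\<l> (t, 0) = rc t * K t" if t: "\<bar>t\<bar> < r" "a t \<noteq> 0" for t
  proof -
    have "(a t)\<^sup>2 + (M (t, 0))\<^sup>2 > 0" using t(2) by (simp add: add_pos_nonneg)
    moreover have "24 * pd_v k (t, 0) * ((a t)\<^sup>2 + (M (t, 0))\<^sup>2) = rc t * (a t)\<^sup>2"
      using k_v_axis[OF t(1)] by (simp add: a_def rc_def)
    moreover have "\<l> (t, 0) = a t * pd_v k (t, 0)" using t(1) by (simp add: \<l>_def V_axis a_def)
    ultimately show ?thesis by (simp add: K_def field_simps power2_eq_square power3_eq_cube)
  qed
  have a_cont: "isCont a 0" unfolding a_def[abs_def]
    by (intro continuous_diff DERIV_isCont[OF slice] smooth_forms k_smooth)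
  have nz: "24 * ((a 0)\<^sup>2 + (M (0, 0))\<^sup>2) \<noteq> 0"
    using a0 by (simp add: sum_power2_eq_zero_iff del: distrib_left_numeral)
  have K_cont: "isCont K 0" unfolding K_def[abs_def]
    by (intro isCont_divide isCont_power continuous_mult continuous_add continuous_const a_cont DERIV_isCont[OF slice] smooth_forms)
      (rule nz)
  have K0: "K 0 \<noteq> 0" using a0 nz by (simp add: K_def del: distrib_left_numeral)
  have rc0: "rc 0 = 0" using l_eq[OF u a0] l0 K0 by simp
  define rc' where "rc' = 24 * (pd_u (pd_v N) (0, 0) - (2 * pd_u (pd_v F) (0, 0) * M (0, 0) + 2 * pd_v F (0, 0) * pd_u M (0, 0))
      - (pd_u (pd_v G) (0, 0) * N (0, 0) + pd_v G (0, 0) * pd_u N (0, 0)))"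
  have rc': "(rc has_real_derivative rc') (at 0)"
    unfolding rc_def secondary_cuspidal_curv_def[abs_def] rc'_def
    by (auto intro!: derivative_eq_intros slice smooth_forms smooth_on_pd simp: algebra_simps)
  have "((\<lambda>t. rc t * K t) has_real_derivative rc' * K 0) (at 0)"
    by (rule vanishing_times_continuous[OF rc' rc0 K_cont])
  moreover have "\<forall>\<^sub>F t in nhds 0. \<l> (t, 0) = rc t * K t"
    using ev tendsto_imp_eventually_ne[OF isCont_tendsto_nhds[OF a_cont] a0] by eventually_elim (rule l_eq)
  ultimately have "((\<lambda>t. \<l> (t, 0)) has_real_derivative rc' * K 0) (at 0)" by (subst DERIV_cong_ev[OF refl _ refl])
  from DERIV_unique[OF slice[OF V_smooth(3)] this] have lu: "pd_u \<l> (0, 0) = rc' * K 0" .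
  have c0: "((\<lambda>t. (t, g t)) has_derivative (\<lambda>t. (t, g' * t))) (at 0)"
    by (intro has_derivative_Pair has_derivative_ident g(2)[unfolded has_field_derivative_def])
  have "(\<l> has_derivative (\<lambda>w. fst w *\<^sub>R pd_u \<l> (0, 0) + snd w *\<^sub>R pd_v \<l> (0, 0))) (at (0, g 0))"
    using has_derivative_pd[OF smooth_on_differentiable[OF V_smooth(3) q]] g(1) by simp
  from has_derivative_compose[OF c0 this]
  have D: "((\<lambda>t. \<l> (t, g t)) has_derivative (\<lambda>t. fst (t, g' * t) *\<^sub>R pd_u \<l> (0, 0) + snd (t, g' * t) *\<^sub>R pd_v \<l> (0, 0))) (at 0)" .
  have "((\<lambda>t. \<l> (t, g t)) has_real_derivative pd_u \<l> (0, 0) + g' * pd_v \<l> (0, 0)) (at 0)"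
    unfolding has_field_derivative_def by (rule has_derivative_eq_rhs[OF D]) (simp add: fun_eq_iff algebra_simps)
  from DERIV_unique[OF this iffD2[OF DERIV_cong_ev[OF refl curve refl] DERIV_const]]
  have "rc' * K 0 + g' * pd_v \<l> (0, 0) = 0" by (simp add: lu)
  then have "rc' \<noteq> 0 \<longleftrightarrow> g' \<noteq> 0" using K0 lv by auto
  then show ?thesis using DERIV_imp_deriv[OF rc'] by (simp add: rc_def)
qed

text \<open>
  Where \<open>\<l> \<noteq> 0\<close>, the vector \<open>\<nu>\<close> lies in the image of \<open>dC\<close>, and \<open>C\<^sub>u\<close> is not a multiple of it. Hence \<open>dC\<close>
  has rank two there.
\<close>

lemma singular_curve_is_ridge_curve:
  assumes "singular_curve C 0 (\<lambda>t. (t, g t))"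
  shows "\<forall>\<^sub>F t in nhds 0. \<l> (t, g t) = 0"
proof -
  obtain \<delta> W where W: "0 < \<delta>" "smooth_on {-\<delta><..<\<delta>} (\<lambda>t. (t, g t))"
    "(\<lambda>t. (t, g t)) ` {-\<delta><..<\<delta>} = singular_set C \<inter> W"
    using assms[unfolded singular_curve_def] by (elim conjE exE) (rule that; assumption)
  have g0: "(0 :: real, g 0) = 0" using assms unfolding singular_curve_def by (rule conjunct1)
  have q0: "(0, 0) \<in> square r" using r_pos by simp
  have "isCont (\<lambda>q. pd_u C q \<bullet> cross3 (\<nu> q) (x q)) (0, 0)"
    using q0 smooth_on_continuous[OF smooth_on_pd(1)[OF V_smooth(5)]] smooth_on_continuous[OF smooth(2)] smooth_on_continuous[OF V_smooth(4)]
    by (intro continuous_inner continuous_cross) (simp_all add: continuous_on_eq_continuous_at)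
  from tendsto_imp_eventually_ne[OF isCont_tendsto_nhds[OF this] transversal_origin]
  have "\<forall>\<^sub>F q in nhds (0, 0). pd_u C q \<bullet> cross3 (\<nu> q) (x q) \<noteq> 0" .
  with eventually_nhds_in_open[OF open_square q0]
  have ev: "\<forall>\<^sub>F q in nhds (0, 0). q \<in> square r \<and> pd_u C q \<bullet> cross3 (\<nu> q) (x q) \<noteq> 0" by eventually_elim simp
  have "isCont (\<lambda>t. (t, g t)) 0" using smooth_on_continuous[OF W(2)] W(1) by (simp add: continuous_on_eq_continuous_at)
  from isCont_tendsto_nhds[OF this] have "filterlim (\<lambda>t. (t, g t)) (nhds (0, 0)) (nhds 0)" using g0 by (simp add: zero_prod_def)
  from eventually_compose_filterlim[OF ev this]
  have "\<forall>\<^sub>F t in nhds 0. (t, g t) \<in> square r \<and> pd_u C (t, g t) \<bullet> cross3 (\<nu> (t, g t)) (x (t, g t)) \<noteq> 0" .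
  with eventually_abs_less[OF W(1)]
  show ?thesis
  proof eventually_elim
    case (elim t)
    define q where "q = (t, g t)"
    have q: "q \<in> square r" "pd_u C q \<bullet> cross3 (\<nu> q) (x q) \<noteq> 0" using elim by (auto simp: q_def)
    have "q \<in> singular_set C" using W(3) elim(1) unfolding q_def by (auto simp: abs_less_iff)
    then have dim: "dim (range (frechet_derivative C (at q))) < 2" by (simp add: singular_set_def)
    have dC: "C differentiable (at q)" by (rule smooth_on_differentiable[OF V_smooth(5) q(1)])
    show "\<l> (t, g t) = 0"
    proof (rule ccontr)
      assume "\<l> (t, g t) \<noteq> 0"
      then have l: "- \<l> q / (k q)\<^sup>2 \<noteq> 0" using k_nz[OF q(1)] by (simp add: q_def)
      define y where "y = (- \<l> q / (k q)\<^sup>2) *\<^sub>R \<nu> q"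
      have "frechet_derivative C (at q) (1, 0) = pd_u C q" "frechet_derivative C (at q) (V1 q, V2 q) = y"
        using C_null_direction[OF q(1)] by (simp_all add: frechet_derivative_pd[OF dC] y_def)
      then have sub: "{pd_u C q, y} \<subseteq> range (frechet_derivative C (at q))" by (metis insert_subset empty_subsetI rangeI)
      have y_cross: "y \<bullet> cross3 (\<nu> q) (x q) = 0" by (simp add: y_def dot_cross_self)
      have y0: "y \<noteq> 0" using l unit_normal[OF q(1)] by (auto simp: y_def)
      have "pd_u C q \<notin> span {y}"
      proof
        assume "pd_u C q \<in> span {y}"
        then obtain c where "pd_u C q = c *\<^sub>R y" by (auto simp: span_singleton)
        then show False using q(2) y_cross by simp
      qed
      then have "independent {pd_u C q, y}" using y0 by (intro independent_insertI) (auto simp: independent_empty)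
      moreover have "pd_u C q \<noteq> y" using \<open>pd_u C q \<notin> span {y}\<close> span_base by blast
      ultimately have "2 \<le> dim (range (frechet_derivative C (at q)))"
        using independent_card_le_dim[OF sub] by simp
      then show False using dim by simp
    qed
  qed
qed

text \<open>
  The criterion applies with the normal \<open>x\<close> and the null direction \<open>V\<close>, in the form \<open>\<partial>\<^sub>v - s \<partial>\<^sub>u\<close>
  with \<open>s = - V1 / V2\<close>. The component of \<open>dx(V)\<close> along \<open>\<nu>\<close> is \<open>- x \<bullet> d\<nu>(V) = v k \<bar>x\<bar>\<^sup>2\<close> by Rodrigues'
  formula. As \<open>dx(V)\<close> is orthogonal to \<open>C\<^sub>u\<close>, this determines \<open>\<psi>\<close>, which therefore is \<open>v\<close> times a nonvanishing
  function. On the singular curve \<open>v = g t\<close>, so \<open>\<psi>\<close> has a simple zero if and only if \<open>g' \<noteq> 0\<close>.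
\<close>

theorem focal_cuspidal_cross_cap:
  assumes l0: "\<l> (0, 0) = 0" and lv: "pd_v \<l> (0, 0) \<noteq> 0"
    and g: "\<delta> > 0" "smooth_on {-\<delta><..<\<delta>} g" "g 0 = 0" and curve: "\<forall>\<^sub>F t in nhds 0. \<l> (t, g t) = 0"
  shows "has_cuspidal_cross_cap C 0 \<longleftrightarrow> deriv g 0 \<noteq> 0"
proof -
  have u: "\<bar>0\<bar> < r" and q: "(0, 0) \<in> square r" using r_pos by auto
  have zero: "(0, 0) = (0 :: real \<times> real)" by (simp add: zero_prod_def)
  have g': "(g has_real_derivative deriv g 0) (at 0)"
    using smooth_on_differentiable[OF g(2), of 0] g(1) by (simp add: DERIV_deriv_iff_real_differentiable)
  have V10: "V1 (0, 0) = 0" by (rule V_axis(1)[OF u])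
  define A where "A q = (- \<l> q / (k q)\<^sup>2) / V2 q" for q
  define B where "B q = - V1 q / V2 q" for q
  have "isCont V2 (0, 0)" using smooth_on_continuous[OF V_smooth(2)] q by (simp add: continuous_on_eq_continuous_at)
  from tendsto_imp_eventually_ne[OF isCont_tendsto_nhds[OF this] V2_origin]
  have "\<forall>\<^sub>F p in nhds (0, 0). V2 p \<noteq> 0" .
  with eventually_nhds_in_open[OF open_square q]
  have near0: "\<forall>\<^sub>F p in nhds (0, 0). p \<in> square r \<and> V2 p \<noteq> 0" by eventually_elim simp
  have C_v: "pd_v C p = A p *\<^sub>R \<nu> p + B p *\<^sub>R pd_u C p" if p: "p \<in> square r" "V2 p \<noteq> 0" for p
  proof -
    have "V2 p *\<^sub>R pd_v C p = (- \<l> p / (k p)\<^sup>2) *\<^sub>R \<nu> p - V1 p *\<^sub>R pd_u C p"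
      using C_null_direction[OF p(1)] by (simp add: algebra_simps)
    then have "(1 / V2 p) *\<^sub>R (V2 p *\<^sub>R pd_v C p) = (1 / V2 p) *\<^sub>R ((- \<l> p / (k p)\<^sup>2) *\<^sub>R \<nu> p - V1 p *\<^sub>R pd_u C p)" by simp
    then show ?thesis using p(2) by (simp add: A_def B_def scaleR_diff_right)
  qed
  have Cd: "C differentiable (at q)" "pd_u C differentiable (at q)" "pd_v C differentiable (at q)" "x differentiable (at q)"
    "V1 differentiable (at q)" "V2 differentiable (at q)" "\<l> differentiable (at q)" if "q \<in> square r" for q
    using smooth_on_differentiable[OF _ that] V_smooth smooth_on_pd by blast+
  have Cv0: "pd_v C (0, 0) = 0" using C_v[OF q V2_origin] l0 V10 by (simp add: A_def B_def)
  have Cu0: "pd_u C (0, 0) \<noteq> 0" using transversal_origin by auto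
  have x0: "x (0, 0) \<noteq> 0" using transversal_origin by auto
  have fold: "pd_v (pd_v C) (0, 0) \<bullet> cross3 (x (0, 0)) (pd_u C (0, 0)) \<noteq> 0"
  proof -
    have dl: "((\<lambda>p. - \<l> p / (k p)\<^sup>2) has_derivative (\<lambda>w. (- (fst w *\<^sub>R pd_u \<l> (0,0) + snd w *\<^sub>R pd_v \<l> (0,0)) * (k (0,0))\<^sup>2
        - (- \<l> (0,0)) * (of_nat 2 * (fst w *\<^sub>R pd_u k (0,0) + snd w *\<^sub>R pd_v k (0,0)) * (k (0,0)) ^ (2 - 1))) / ((k (0,0))\<^sup>2 * (k (0,0))\<^sup>2))) (at (0, 0))"
      by (intro has_derivative_divide' has_derivative_minus has_derivative_power has_derivative_pd Cd kd q) (use k_nz[OF q] in simp)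
    have dA: "(A has_derivative (\<lambda>w. ((- (fst w *\<^sub>R pd_u \<l> (0,0) + snd w *\<^sub>R pd_v \<l> (0,0)) * (k (0,0))\<^sup>2
        - (- \<l> (0,0)) * (of_nat 2 * (fst w *\<^sub>R pd_u k (0,0) + snd w *\<^sub>R pd_v k (0,0)) * (k (0,0)) ^ (2 - 1))) / ((k (0,0))\<^sup>2 * (k (0,0))\<^sup>2) * V2 (0,0)
        - (- \<l> (0,0) / (k (0,0))\<^sup>2) * (fst w *\<^sub>R pd_u V2 (0,0) + snd w *\<^sub>R pd_v V2 (0,0))) / (V2 (0,0) * V2 (0,0)))) (at (0, 0))"
      unfolding A_def[abs_def] by (intro has_derivative_divide' dl has_derivative_pd Cd q V2_origin)
    have Av: "pd_v A (0, 0) \<noteq> 0" and Ad: "A differentiable (at (0, 0))"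
      using pd_v_eqI[OF dA] dA l0 lv k_nz[OF q] V2_origin by (auto simp: differentiable_def)
    have Bd: "B differentiable (at (0, 0))"
      unfolding B_def[abs_def] by (intro differentiable_divide differentiable_minus Cd q V2_origin)
    have AB0: "A (0, 0) = 0" "B (0, 0) = 0" using l0 V10 by (simp_all add: A_def B_def)
    note sA = pd_scaleR[OF Ad diff(2)[OF q]] and sB = pd_scaleR[OF Bd Cd(2)[OF q]]
    have "\<forall>\<^sub>F p in nhds (0, 0). pd_v C p = A p *\<^sub>R \<nu> p + B p *\<^sub>R pd_u C p"
      using near0 by eventually_elim (simp add: C_v)
    from pd_cong(3)[OF this Cd(3)[OF q]]
    have "pd_v (pd_v C) (0, 0) = pd_v A (0, 0) *\<^sub>R \<nu> (0, 0) + pd_v B (0, 0) *\<^sub>R pd_u C (0, 0)"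
      using pd_add(2)[OF sA(1) sB(1)] sA(3) sB(3) AB0 by simp
    then have "pd_v (pd_v C) (0, 0) \<bullet> cross3 (x (0, 0)) (pd_u C (0, 0))
        = pd_v A (0, 0) * (\<nu> (0, 0) \<bullet> cross3 (x (0, 0)) (pd_u C (0, 0)))"
      by (simp add: inner_add_left dot_cross_self)
    also have "\<nu> (0, 0) \<bullet> cross3 (x (0, 0)) (pd_u C (0, 0)) = pd_u C (0, 0) \<bullet> cross3 (\<nu> (0, 0)) (x (0, 0))"
      by (simp add: cross3_def inner_vec_def sum_3 algebra_simps)
    finally show ?thesis using Av transversal_origin by simp
  qed
  define s where "s t = B (t, g t)" for t
  define \<psi> where "\<psi> t = pd_u C (t, g t) \<bullet> cross3 (x (t, g t)) (pd_v x (t, g t) - s t *\<^sub>R pd_u x (t, g t))" for t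
  have isg: "isCont (\<lambda>t. (t, g t)) 0" by (intro continuous_Pair continuous_ident DERIV_isCont[OF g'])
  then have flim: "filterlim (\<lambda>t. (t, g t)) (nhds (0, 0)) (nhds 0)" using isCont_tendsto_nhds[OF isg] g(3) by simp
  have near: "\<forall>\<^sub>F t in nhds 0. (t, g t) \<in> square r \<and> V2 (t, g t) \<noteq> 0" by (rule eventually_compose_filterlim[OF near0 flim])
  have null: "\<forall>\<^sub>F t in nhds 0. pd_v C (t, g t) = s t *\<^sub>R pd_u C (t, g t)"
    using near curve by eventually_elim (simp add: C_v s_def A_def)
  have "smooth_germ 0 C" "smooth_germ 0 x" using V_smooth r_pos by (auto simp: smooth_germ_square)
  moreover have "\<forall>\<^sub>F q in nhds 0. x q \<bullet> pd_u C q = 0 \<and> x q \<bullet> pd_v C q = 0"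
    using eventually_nhds_in_open[OF open_square q] by (auto simp: zero x_normal elim: eventually_mono)
  ultimately have "has_cuspidal_cross_cap C 0 \<longleftrightarrow> \<psi> 0 = 0 \<and> (\<exists>D. D \<noteq> 0 \<and> (\<psi> has_real_derivative D) (at 0))"
    by (rule cuspidal_cross_cap_criterion[where n = x and g = g and s = s and \<psi> = \<psi>, OF _ _ _ x0 Cu0 Cv0 fold g null \<psi>_def])
  also have "\<dots> \<longleftrightarrow> deriv g 0 \<noteq> 0"
  proof -
    define T where "T q = pd_u C q \<bullet> cross3 (\<nu> q) (x q)" for q
    \<comment> \<open>The factor by which \<open>\<psi>\<close> differs from \<open>v\<close>.\<close>
    define R where "R q = - k q * (x q \<bullet> x q)\<^sup>2 * (pd_u C q \<bullet> pd_u C q) / (V2 q * T q)" for q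
    have \<psi>_eq: "\<psi> t = g t * R (t, g t)"
      if t: "(t, g t) \<in> square r" "V2 (t, g t) \<noteq> 0" "pd_v C (t, g t) = s t *\<^sub>R pd_u C (t, g t)" "T (t, g t) \<noteq> 0" for t
    proof -
      define q where "q = (t, g t)"
      have q: "q \<in> square r" "V2 q \<noteq> 0" "T q \<noteq> 0" using t by (simp_all add: q_def)
      define Vx where "Vx = pd_v x q - s t *\<^sub>R pd_u x q"
      define p where "p = pd_u C q"
      have "Vx \<bullet> p = 0" unfolding Vx_def p_def
        by (rule normal_derivative_on_singular_curve[OF open_square V_smooth(5,4) q(1)]) (use x_normal t(3) in \<open>simp_all add: q_def\<close>)
      moreover have "x q \<bullet> p = 0" using x_normal[OF q(1)] by (simp add: p_def)
      moreover have "x q \<bullet> \<nu> q = 0" by (rule x_products(1)[OF q(1)])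
      moreover have "(p \<bullet> cross3 (x q) Vx) * (p \<bullet> cross3 (\<nu> q) (x q)) = - (Vx \<bullet> \<nu> q) * (p \<bullet> p) * (x q \<bullet> x q)"
        if "Vx \<bullet> p = 0" "x q \<bullet> p = 0" "x q \<bullet> \<nu> q = 0"
      proof -
        have gram: "(p \<bullet> cross3 y Vx) * (p \<bullet> cross3 n y)
            = (p \<bullet> p) * ((y \<bullet> n) * (Vx \<bullet> y) - (y \<bullet> y) * (Vx \<bullet> n))
            - (p \<bullet> n) * ((y \<bullet> p) * (Vx \<bullet> y) - (y \<bullet> y) * (Vx \<bullet> p))
            + (p \<bullet> y) * ((y \<bullet> p) * (Vx \<bullet> n) - (y \<bullet> n) * (Vx \<bullet> p))" for y n
          by (simp add: inner_vec_def sum_3 cross3_def algebra_simps)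
        show ?thesis unfolding gram using that by (simp add: inner_commute)
      qed
      ultimately have gr: "\<psi> t * T q = - (Vx \<bullet> \<nu> q) * (p \<bullet> p) * (x q \<bullet> x q)"
        by (simp add: \<psi>_def T_def p_def Vx_def q_def)
      have xn: "pd_u x q \<bullet> \<nu> q + x q \<bullet> pd_u \<nu> q = 0" "pd_v x q \<bullet> \<nu> q + x q \<bullet> pd_v \<nu> q = 0"
        using pd_inner_const[OF Cd(4)[OF q(1)] diff(2)[OF q(1)] eventually_square_at[OF q(1) x_products(1)]] by blast+
      have "x q \<bullet> (- (M q - k q * F q) *\<^sub>R pd_u \<nu> q + V2 q *\<^sub>R \<nu>1 q) = - k q * (x q \<bullet> x q)"
        unfolding Weingarten[OF q(1)] by simp
      then have w: "- (M q - k q * F q) * (x q \<bullet> pd_u \<nu> q) + V2 q * (x q \<bullet> \<nu>1 q) = - k q * (x q \<bullet> x q)"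
        by (simp only: inner_add_right inner_scaleR_right)
      have sV: "s t * V2 q = - V1 q" using q(2) by (simp add: s_def B_def q_def)
      have "V2 q * (Vx \<bullet> \<nu> q) = V2 q * (pd_v x q \<bullet> \<nu> q) - (s t * V2 q) * (pd_u x q \<bullet> \<nu> q)"
        by (simp add: Vx_def inner_diff_left algebra_simps)
      also have "\<dots> = V2 q * (pd_v x q \<bullet> \<nu> q) + V1 q * (pd_u x q \<bullet> \<nu> q)" unfolding sV by simp
      also have "\<dots> = - (V2 q * (x q \<bullet> pd_v \<nu> q) + V1 q * (x q \<bullet> pd_u \<nu> q))"
        using xn by (simp add: add_eq_0_iff2)
      also have "\<dots> = - (snd q * (- (M q - k q * F q) * (x q \<bullet> pd_u \<nu> q) + V2 q * (x q \<bullet> \<nu>1 q)))"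
        by (simp add: \<nu>_v[OF q(1)] V1_def algebra_simps)
      finally have vx: "V2 q * (Vx \<bullet> \<nu> q) = snd q * k q * (x q \<bullet> x q)" unfolding w by simp
      have "\<psi> t * T q * V2 q = - (snd q * k q * (x q \<bullet> x q)) * (p \<bullet> p) * (x q \<bullet> x q)"
        unfolding gr vx[symmetric] by simp
      then have "\<psi> t = snd q * R q" using q by (simp add: R_def p_def field_simps power2_eq_square)
      then show ?thesis by (simp add: q_def)
    qed
    have cont: "isCont (pd_u C) (0, 0)" "isCont \<nu> (0, 0)" "isCont x (0, 0)" "isCont k (0, 0)" "isCont V2 (0, 0)"
      by (rule smooth_on_isCont[OF _ open_square q], intro smooth_on_pd V_smooth smooth k_smooth)+
    have T_cont: "isCont T (0, 0)" unfolding T_def[abs_def] by (intro continuous_inner continuous_cross cont)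
    have T0: "T (0, 0) \<noteq> 0" using transversal_origin by (simp add: T_def)
    have "isCont R (0, g 0)" unfolding R_def[abs_def] g(3)
      by (intro isCont_divide continuous_mult isCont_power continuous_minus continuous_inner cont T_cont) (use T0 V2_origin in simp)
    then have R_cont: "isCont (\<lambda>t. R (t, g t)) 0" by (rule isCont_o2[where f = "\<lambda>t. (t, g t)" and g = R, OF isg])
    have R0: "R (0, g 0) \<noteq> 0" using x0 Cu0 k_nz[OF q] T0 V2_origin by (simp add: R_def g(3))
    have "\<forall>\<^sub>F t in nhds 0. T (t, g t) \<noteq> 0"
      by (rule eventually_compose_filterlim[OF tendsto_imp_eventually_ne[OF isCont_tendsto_nhds[OF T_cont] T0] flim])
    with near null have ev: "\<forall>\<^sub>F t in nhds 0. \<psi> t = g t * R (t, g t)" by eventually_elim (simp add: \<psi>_eq)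
    from iffD2[OF DERIV_cong_ev[OF refl this refl] vanishing_times_continuous[OF g' g(3) R_cont]]
    have D: "(\<psi> has_real_derivative deriv g 0 * R (0, g 0)) (at 0)" .
    have "\<psi> 0 = 0" using eventually_nhds_x_imp_x[OF ev] g(3) by simp
    then show ?thesis using D R0 DERIV_unique[OF D] by (auto intro!: exI[of _ "deriv g 0 * R (0, g 0)"])
  qed
  finally show ?thesis .
qed

end

section \<open>Cuspidal cross caps of focal surfaces\<close>

lemma smooth_germ_compose:
  fixes \<phi> :: "'a::euclidean_space \<Rightarrow> 'b::euclidean_space" and f :: "'b \<Rightarrow> 'c::real_normed_vector"
  assumes "smooth_germ p \<phi>" "smooth_germ (\<phi> p) f"
  shows "smooth_germ p (f \<circ> \<phi>)"
proof -
  obtain U where U: "open U" "p \<in> U" "smooth_on U \<phi>" using assms(1) unfolding smooth_germ_def by blast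
  obtain V where V: "open V" "\<phi> p \<in> V" "smooth_on V f" using assms(2) unfolding smooth_germ_def by blast
  define A where "A = U \<inter> \<phi> -` V"
  have A: "open A" "p \<in> A" "A \<subseteq> U" "\<phi> ` A \<subseteq> V"
    unfolding A_def using continuous_open_preimage[OF smooth_on_continuous[OF U(3)] U(1) V(1)] U V by auto
  have "smooth_on A (\<lambda>x. f (\<phi> x))"
    by (rule smooth_on_compose[OF V(3) smooth_on_subset[OF U(3) A(3)] A(4,1) V(1)])
  then show ?thesis unfolding smooth_germ_def comp_def using A by blast
qed

lemma smooth_germ_eventually_differentiable:
  assumes "smooth_germ p f" shows "\<forall>\<^sub>F q in nhds p. f differentiable (at q)"
proof -
  obtain U where U: "open U" "p \<in> U" "smooth_on U f" using assms unfolding smooth_germ_def by blast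
  show ?thesis by (rule eventually_mono[OF eventually_nhds_in_open[OF U(1,2)]]) (rule smooth_on_differentiable[OF U(3)])
qed

lemma frontal_germ_reparametrize:
  assumes "frontal_germ f \<nu> q" "diffeo_germ \<phi> p q"
  shows "frontal_germ (f \<circ> \<phi>) (\<nu> \<circ> \<phi>) p"
proof -
  have fr: "smooth_germ q f" "smooth_germ q \<nu>"
    "\<forall>\<^sub>F q in nhds q. norm (\<nu> q) = 1 \<and> (\<forall>X. frechet_derivative f (at q) X \<bullet> \<nu> q = 0)"
    using assms(1) by (auto simp: frontal_germ_def)
  have \<phi>: "smooth_germ p \<phi>" "\<phi> p = q" using assms(2) by (auto simp: diffeo_germ_def intro: diffeo_germ_smooth[OF assms(2)])
  have "\<forall>\<^sub>F x in nhds p. norm ((\<nu> \<circ> \<phi>) x) = 1 \<and> (\<forall>X. frechet_derivative (f \<circ> \<phi>) (at x) X \<bullet> (\<nu> \<circ> \<phi>) x = 0)"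
    using diffeo_germ_eventually[OF assms(2) fr(3)] diffeo_germ_eventually[OF assms(2) smooth_germ_eventually_differentiable[OF fr(1)]]
      smooth_germ_eventually_differentiable[OF \<phi>(1)]
  proof eventually_elim
    case (elim x)
    note chain = has_derivative_compose[OF elim(3)[unfolded frechet_derivative_works] elim(2)[unfolded frechet_derivative_works]]
    have "frechet_derivative (f \<circ> \<phi>) (at x) X = frechet_derivative f (at (\<phi> x)) (frechet_derivative \<phi> (at x) X)" for X
      unfolding comp_def frechet_derivative_at[OF chain, symmetric] by (rule refl)
    then show ?case using elim(1) by (simp only: comp_apply simp_thms)
  qed
  then show ?thesis
    unfolding frontal_germ_def using smooth_germ_compose[OF \<phi>(1)] fr(1,2) \<phi>(2) by auto
qed

text \<open>
  The second \<open>v\<close>-derivative of \<open>f\<close> equals \<open>h\<close> on the axis, so the orthonormality of the adapted frame is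
  one of \<open>f\<^sub>u\<close>, \<open>h\<close>, \<open>\<nu>\<close>.
\<close>

lemma adapted_frontal_exists:
  assumes "frontal_germ f \<nu> 0" "v_factor f h" "v_factor \<nu> \<nu>1"
    and frame: "\<forall>\<^sub>F u in nhds 0. let a = pd_u f (u, 0); b = pd_v (pd_v f) (u, 0); c = \<nu> (u, 0)
        in norm a = 1 \<and> norm b = 1 \<and> norm c = 1 \<and> a \<bullet> b = 0 \<and> a \<bullet> c = 0 \<and> b \<bullet> c = 0"
  obtains r where "adapted_frontal f \<nu> h \<nu>1 r"
proof -
  have sm: "smooth_germ 0 f" "smooth_germ 0 \<nu>" "smooth_germ 0 h" "smooth_germ 0 \<nu>1"
    and fr: "\<forall>\<^sub>F q in nhds 0. norm (\<nu> q) = 1 \<and> (\<forall>X. frechet_derivative f (at q) X \<bullet> \<nu> q = 0)"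
    and vf: "\<forall>\<^sub>F q in nhds 0. pd_v f q = snd q *\<^sub>R h q" "\<forall>\<^sub>F q in nhds 0. pd_v \<nu> q = snd q *\<^sub>R \<nu>1 q"
    using assms(1-3) by (auto simp: frontal_germ_def v_factor_def)
  obtain r1 where r1: "r1 > 0" "smooth_on (square r1) f" using sm(1) by (auto simp: smooth_germ_square)
  obtain r2 where r2: "r2 > 0" "smooth_on (square r2) \<nu>" using sm(2) by (auto simp: smooth_germ_square)
  obtain r3 where r3: "r3 > 0" "smooth_on (square r3) h" using sm(3) by (auto simp: smooth_germ_square)
  obtain r4 where r4: "r4 > 0" "smooth_on (square r4) \<nu>1" using sm(4) by (auto simp: smooth_germ_square)
  from fr vf have "\<forall>\<^sub>F q in nhds 0. (norm (\<nu> q) = 1 \<and> (\<forall>X. frechet_derivative f (at q) X \<bullet> \<nu> q = 0))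
      \<and> pd_v f q = snd q *\<^sub>R h q \<and> pd_v \<nu> q = snd q *\<^sub>R \<nu>1 q" by eventually_elim simp
  then obtain r5 where r5: "r5 > 0" "\<And>q. q \<in> square r5 \<Longrightarrow> (norm (\<nu> q) = 1 \<and> (\<forall>X. frechet_derivative f (at q) X \<bullet> \<nu> q = 0))
      \<and> pd_v f q = snd q *\<^sub>R h q \<and> pd_v \<nu> q = snd q *\<^sub>R \<nu>1 q"
    unfolding eventually_square by blast
  obtain r6 where r6: "r6 > 0" "\<And>u. \<bar>u\<bar> < r6 \<Longrightarrow> norm (pd_u f (u, 0)) = 1 \<and> norm (pd_v (pd_v f) (u, 0)) = 1
      \<and> pd_u f (u, 0) \<bullet> pd_v (pd_v f) (u, 0) = 0"
    using frame unfolding eventually_nhds_metric Let_def by (auto simp: dist_real_def)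
  define r where "r = min (min r1 r2) (min (min r3 r4) (min r5 r6))"
  have r: "r > 0" "r \<le> r1" "r \<le> r2" "r \<le> r3" "r \<le> r4" "r \<le> r5" "r \<le> r6"
    using r1 r2 r3 r4 r5 r6 by (auto simp: r_def)
  have P: "norm (\<nu> q) = 1" "frechet_derivative f (at q) X \<bullet> \<nu> q = 0" "pd_v f q = snd q *\<^sub>R h q" "pd_v \<nu> q = snd q *\<^sub>R \<nu>1 q"
    if "q \<in> square r" for q X
    using r5(2)[OF subsetD[OF square_mono[OF r(6)] that]] by blast+
  have h_axis: "h (u, 0) = pd_v (pd_v f) (u, 0)" if u: "\<bar>u\<bar> < r" for u
  proof -
    have q: "(u, 0) \<in> square r" using u r by simp
    have hd: "h differentiable (at (u, 0))" using smooth_on_differentiable[OF r3(2)] square_mono[OF r(4)] q by blast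
    have sd: "snd differentiable (at (u, 0 :: real))" by (simp add: bounded_linear_imp_differentiable bounded_linear_snd)
    have s1: "pd_v snd (u, 0 :: real) = (1 :: real)"
      using pd_v_eqI[OF bounded_linear_imp_has_derivative[OF bounded_linear_snd]] by simp
    have "\<forall>\<^sub>F q in nhds (u, 0). snd q *\<^sub>R h q = pd_v f q"
      by (rule eventually_mono[OF eventually_nhds_in_open[OF open_square q]]) (simp add: P)
    from pd_cong(3)[OF this pd_scaleR(1)[OF sd hd]] pd_scaleR(3)[OF sd hd] s1 show ?thesis by simp
  qed
  have "adapted_frontal f \<nu> h \<nu>1 r"
  proof
    show "r > 0" by fact
    show "smooth_on (square r) f" "smooth_on (square r) \<nu>" "smooth_on (square r) h" "smooth_on (square r) \<nu>1"
      using smooth_on_subset r1(2) r2(2) r3(2) r4(2) square_mono r by blast+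
  next
    fix q assume q: "q \<in> square r"
    show "pd_v f q = snd q *\<^sub>R h q" "pd_v \<nu> q = snd q *\<^sub>R \<nu>1 q" using P[OF q] by auto
    show "\<nu> q \<bullet> \<nu> q = 1" using P(1)[OF q] by (simp add: norm_eq_1)
    show "pd_u f q \<bullet> \<nu> q = 0" "pd_v f q \<bullet> \<nu> q = 0" using P(2)[OF q] by (simp_all add: pd_u_def pd_v_def dir_deriv_def)
  next
    fix u :: real assume u: "\<bar>u\<bar> < r"
    then have "\<bar>u\<bar> < r6" using r by simp
    from r6(2)[OF this] show "pd_u f (u, 0) \<bullet> pd_u f (u, 0) = 1" "h (u, 0) \<bullet> h (u, 0) = 1" "pd_u f (u, 0) \<bullet> h (u, 0) = 0"
      by (simp_all add: h_axis[OF u] norm_eq_1)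
  qed
  then show thesis by (rule that)
qed

lemma (in adapted_frontal) adapted_frontal_mono:
  assumes "0 < r'" "r' \<le> r" shows "adapted_frontal f \<nu> h \<nu>1 r'"
proof
  have sub: "square r' \<subseteq> square r" by (rule square_mono[OF assms(2)])
  show "r' > 0" by fact
  show "smooth_on (square r') f" "smooth_on (square r') \<nu>" "smooth_on (square r') h" "smooth_on (square r') \<nu>1"
    using smooth sub smooth_on_subset by blast+
  show "pd_v f q = snd q *\<^sub>R h q" "pd_v \<nu> q = snd q *\<^sub>R \<nu>1 q" "\<nu> q \<bullet> \<nu> q = 1" "pd_u f q \<bullet> \<nu> q = 0" "pd_v f q \<bullet> \<nu> q = 0"
    if "q \<in> square r'" for q
    using f_v \<nu>_v unit_normal f_u_normal f_v_normal that sub by blast+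
  show "pd_u f (u, 0) \<bullet> pd_u f (u, 0) = 1" "h (u, 0) \<bullet> h (u, 0) = 1" "pd_u f (u, 0) \<bullet> h (u, 0) = 0" if "\<bar>u\<bar> < r'" for u
    using axis[of u] that assms(2) by auto
qed

lemma princ_curv_characteristic:
  assumes "Et f q * Gt h q - (Ft f h q)\<^sup>2 \<noteq> 0"
    and "gauss_curv f \<nu> h \<nu>1 q \<le> (mean_curv f \<nu> h \<nu>1 q)\<^sup>2"
  shows "(princ_curv f \<nu> h \<nu>1 j q)\<^sup>2 * (Et f q * Gt h q - (Ft f h q)\<^sup>2)
      - princ_curv f \<nu> h \<nu>1 j q * (Et f q * N1t h \<nu>1 q - 2 * Ft f h q * Mt \<nu> h q + Gt h q * Lt f \<nu> q)
      + (Lt f \<nu> q * N1t h \<nu>1 q - (Mt \<nu> h q)\<^sup>2) = 0"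
proof -
  define D where "D = Et f q * Gt h q - (Ft f h q)\<^sup>2"
  define k where "k = princ_curv f \<nu> h \<nu>1 j q"
  define H where "H = mean_curv f \<nu> h \<nu>1 q"
  define K where "K = gauss_curv f \<nu> h \<nu>1 q"
  have D: "D \<noteq> 0" using assms(1) by (simp add: D_def)
  have "(sqrt (H\<^sup>2 - K))\<^sup>2 = H\<^sup>2 - K" using assms(2) by (simp add: H_def K_def)
  moreover have "k = H + sqrt (H\<^sup>2 - K) \<or> k = H - sqrt (H\<^sup>2 - K)"
    by (simp add: k_def princ_curv_def H_def K_def Let_def)
  ultimately have "(k - H)\<^sup>2 = H\<^sup>2 - K" by auto
  then have "k\<^sup>2 - 2 * H * k + K = 0" by (simp add: power2_eq_square algebra_simps)
  then have "D * (k\<^sup>2 - 2 * H * k + K) = 0" by simp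
  moreover have "2 * H * D = Et f q * N1t h \<nu>1 q - 2 * Ft f h q * Mt \<nu> h q + Gt h q * Lt f \<nu> q"
    using D by (simp add: H_def mean_curv_def D_def[symmetric])
  moreover have "K * D = Lt f \<nu> q * N1t h \<nu>1 q - (Mt \<nu> h q)\<^sup>2"
    using D by (simp add: K_def gauss_curv_def D_def[symmetric])
  ultimately show ?thesis unfolding k_def[symmetric] D_def[symmetric] by algebra
qed

text \<open>
  At the origin the discriminant \<open>H\<^sup>2 - K\<close> equals \<open>((L - N) / 2)\<^sup>2 + M\<^sup>2\<close>. Hence nonzero cuspidal torsion
  separates the principal curvatures, and the square root in their definition is smooth nearby.
\<close>

lemma (in adapted_frontal) focal_frontal_exists:
  assumes M0: "M (0, 0) \<noteq> 0" and nz: "\<forall>\<^sub>F q in nhds 0. princ_curv f \<nu> h \<nu>1 j q \<noteq> 0"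
  obtains r' where "focal_frontal f \<nu> h \<nu>1 r' (princ_curv f \<nu> h \<nu>1 j)"
proof -
  have u: "\<bar>0\<bar> < r" and q0: "(0, 0) \<in> square r" using r_pos by auto
  have zero: "(0, 0) = (0 :: real \<times> real)" by (simp add: zero_prod_def)
  define D where "D q = E q * G q - (F q)\<^sup>2" for q
  have D_sm: "smooth_on (square r) D" unfolding D_def[abs_def] by (intro smooth_intros smooth_forms open_square)
  have D0: "D (0, 0) = 1" by (simp add: D_def forms_axis[OF u])
  have "\<forall>\<^sub>F q in nhds (0, 0). D q \<noteq> 0"
    by (rule tendsto_imp_eventually_ne[OF isCont_tendsto_nhds[OF smooth_on_isCont[OF D_sm open_square q0]]]) (simp add: D0)
  then obtain d1 where d1: "d1 > 0" "\<And>q. q \<in> square d1 \<Longrightarrow> D q \<noteq> 0" unfolding zero eventually_square by blast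
  define e1 where "e1 = min r d1"
  have e1: "e1 > 0" "e1 \<le> r" "\<And>q. q \<in> square e1 \<Longrightarrow> D q \<noteq> 0"
    using d1 r_pos square_mono[of e1 d1] by (auto simp: e1_def)
  have forms1: "smooth_on (square e1) E" "smooth_on (square e1) F" "smooth_on (square e1) G"
    "smooth_on (square e1) L" "smooth_on (square e1) M" "smooth_on (square e1) N"
    using smooth_forms smooth_on_subset square_mono[OF e1(2)] by blast+
  define H where "H = mean_curv f \<nu> h \<nu>1"
  define K where "K = gauss_curv f \<nu> h \<nu>1"
  have H_sm: "smooth_on (square e1) H"
    unfolding H_def mean_curv_def[abs_def]
    by (intro smooth_intros forms1 open_square) (use e1(3) in \<open>simp add: D_def\<close>)
  have K_sm: "smooth_on (square e1) K"
    unfolding K_def gauss_curv_def[abs_def]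
    by (intro smooth_intros forms1 open_square) (use e1(3) in \<open>simp add: D_def\<close>)
  have q1: "(0, 0) \<in> square e1" using e1 by simp
  have S_sm: "smooth_on (square e1) (\<lambda>q. (H q)\<^sup>2 - K q)" by (intro smooth_intros H_sm K_sm open_square)
  have "(H (0, 0))\<^sup>2 - K (0, 0) = ((L (0, 0) - N (0, 0)) / 2)\<^sup>2 + (M (0, 0))\<^sup>2"
    by (simp add: H_def K_def mean_curv_def gauss_curv_def forms_axis[OF u] power2_eq_square field_simps)
  also have "\<dots> > 0" using M0 by (simp add: add_nonneg_pos)
  finally have "0 < (H (0, 0))\<^sup>2 - K (0, 0)" .
  from order_tendstoD(1)[OF isCont_tendsto_nhds[OF smooth_on_isCont[OF S_sm open_square q1]] this]
  have "\<forall>\<^sub>F q in nhds 0. 0 < (H q)\<^sup>2 - K q" by (simp only: zero)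
  with nz have "\<forall>\<^sub>F q in nhds 0. 0 < (H q)\<^sup>2 - K q \<and> princ_curv f \<nu> h \<nu>1 j q \<noteq> 0" by eventually_elim simp
  then obtain d2 where d2: "d2 > 0" "\<And>q. q \<in> square d2 \<Longrightarrow> 0 < (H q)\<^sup>2 - K q \<and> princ_curv f \<nu> h \<nu>1 j q \<noteq> 0"
    unfolding eventually_square by blast
  define e2 where "e2 = min e1 d2"
  have e2: "e2 > 0" "e2 \<le> e1" "e2 \<le> d2" using e1 d2 by (auto simp: e2_def)
  have in_e2: "0 < (H q)\<^sup>2 - K q" "princ_curv f \<nu> h \<nu>1 j q \<noteq> 0" "D q \<noteq> 0" if "q \<in> square e2" for q
    using d2(2)[of q] e1(3)[of q] square_mono[OF e2(2)] square_mono[OF e2(3)] that by auto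
  have HK: "smooth_on (square e2) H" "smooth_on (square e2) K"
    using H_sm K_sm smooth_on_subset square_mono[OF e2(2)] by blast+
  have root: "smooth_on (square e2) (\<lambda>q. sqrt ((H q)\<^sup>2 - K q))"
    by (intro smooth_intros HK open_square in_e2(1))
  have "focal_frontal f \<nu> h \<nu>1 e2 (princ_curv f \<nu> h \<nu>1 j)"
  proof (rule focal_frontal.intro[OF adapted_frontal_mono focal_frontal_axioms.intro])
    show "0 < e2" "e2 \<le> r" using e1 e2 by auto
    have pc: "princ_curv f \<nu> h \<nu>1 j = (\<lambda>q. if odd j then H q + sqrt ((H q)\<^sup>2 - K q) else H q - sqrt ((H q)\<^sup>2 - K q))"
      by (simp add: fun_eq_iff princ_curv_def H_def K_def Let_def)
    show "smooth_on (square e2) (princ_curv f \<nu> h \<nu>1 j)"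
      unfolding pc by (cases "odd j") (simp_all add: smooth_on_add smooth_on_diff HK root)
    show "M (0, 0) \<noteq> 0" by (rule M0)
  next
    fix q assume q: "q \<in> square e2"
    show "princ_curv f \<nu> h \<nu>1 j q \<noteq> 0" by (rule in_e2(2)[OF q])
    show D: "E q * G q - (F q)\<^sup>2 \<noteq> 0" using in_e2(3)[OF q] by (simp add: D_def)
    show "(princ_curv f \<nu> h \<nu>1 j q)\<^sup>2 * (E q * G q - (F q)\<^sup>2)
        - princ_curv f \<nu> h \<nu>1 j q * (E q * N q - 2 * F q * M q + G q * L q) + (L q * N q - (M q)\<^sup>2) = 0"
      by (rule princ_curv_characteristic[OF D]) (use in_e2(1)[OF q] in \<open>simp add: H_def K_def\<close>)
  qed
  then show thesis by (rule that)
qed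

lemma princ_curv_consecutive_sum:
  "princ_curv f \<nu> h \<nu>1 (j + 1) q + princ_curv f \<nu> h \<nu>1 j q = 2 * mean_curv f \<nu> h \<nu>1 q"
  by (simp add: princ_curv_def Let_def)

text \<open>
  The principal vector is vertical on the axis, which reduces the second derivative in its
  direction to \<open>V2 \<l>\<^sub>v\<close>.
\<close>

lemma (in focal_frontal) ridge_origin:
  assumes V: "\<And>q. q \<in> square r \<Longrightarrow> V q = (V1 q, V2 q)"
    and ridge: "dir_deriv V k (0, 0) = 0" "dir_deriv V (dir_deriv V k) (0, 0) \<noteq> 0"
  shows "\<l> (0, 0) = 0" "pd_v \<l> (0, 0) \<noteq> 0"
proof -
  have q: "(0, 0) \<in> square r" and u: "\<bar>0\<bar> < r" using r_pos by auto
  have Vk: "\<l> q = dir_deriv V k q" if "q \<in> square r" for q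
    unfolding dir_deriv_def \<l>_def frechet_derivative_pd[OF kd[OF that]] V[OF that] by simp
  show "\<l> (0, 0) = 0" using ridge(1) Vk[OF q] by simp
  have "\<forall>\<^sub>F q in nhds (0, 0). \<l> q = dir_deriv V k q" by (rule eventually_square_at[OF q]) (rule Vk)
  note cong = pd_cong[OF this smooth_on_differentiable[OF V_smooth(3) q]]
  have "dir_deriv V (dir_deriv V k) (0, 0) = V2 (0, 0) * pd_v \<l> (0, 0)"
    unfolding dir_deriv_def[of V "dir_deriv V k"] frechet_derivative_pd[OF cong(1)] V[OF q] cong(3)
    by (simp add: V_axis(1)[OF u])
  then show "pd_v \<l> (0, 0) \<noteq> 0" using ridge(2) by auto
qed

lemma (in focal_frontal) cuspidal_cross_cap_characterization:
  assumes l: "\<l> (0, 0) = 0" "pd_v \<l> (0, 0) \<noteq> 0"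
    and curve: "singular_curve C 0 (\<lambda>t. (t, g t))" and g0: "g 0 = 0"
  shows "has_cuspidal_cross_cap C 0 \<longleftrightarrow> deriv (secondary_cuspidal_curv f \<nu> h \<nu>1) 0 \<noteq> 0"
    and "deriv (\<lambda>t. 1 / k (t, g t)) 0 *
      ((M (0, 0))\<^sup>2 * deriv (limiting_normal_curv f \<nu>) 0
       + 2 * M (0, 0) * deriv (cuspidal_torsion \<nu> h) 0 * (k (0, 0) - L (0, 0))
       + deriv (bias h \<nu>1) 0 / 3 * (k (0, 0) - L (0, 0))\<^sup>2)
    < ((M (0, 0))\<^sup>2 + (k (0, 0) - L (0, 0))\<^sup>2) * (2 * mean_curv f \<nu> h \<nu>1 (0, 0) - k (0, 0) - k (0, 0)) * (L (0, 0) - k (0, 0))"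
proof -
  have q: "(0, 0) \<in> square r" and u: "\<bar>0\<bar> < r" using r_pos by auto
  obtain \<delta> where \<delta>: "\<delta> > 0" "smooth_on {-\<delta><..<\<delta>} (\<lambda>t. (t, g t))"
    using curve unfolding singular_curve_def by blast
  have "smooth_on {-\<delta><..<\<delta>} (\<lambda>t. snd (t, g t))"
    by (rule smooth_on_bounded_linear[OF bounded_linear_snd open_greaterThanLessThan \<delta>(2)])
  then have g: "smooth_on {-\<delta><..<\<delta>} g" by simp
  have "g differentiable (at 0)" by (rule smooth_on_differentiable[OF g]) (use \<delta>(1) in simp)
  then have g': "(g has_real_derivative deriv g 0) (at 0)"
    by (simp add: DERIV_deriv_iff_real_differentiable)
  note ridge = singular_curve_is_ridge_curve[OF curve]
  show "has_cuspidal_cross_cap C 0 \<longleftrightarrow> deriv (secondary_cuspidal_curv f \<nu> h \<nu>1) 0 \<noteq> 0"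
    using focal_cuspidal_cross_cap[OF l \<delta>(1) g g0 ridge] ridge_curve[OF l g0 g' ridge] by simp
  have forms_d: "L differentiable (at (0, 0))" "M differentiable (at (0, 0))" "N differentiable (at (0, 0))"
    using smooth_on_differentiable[OF _ q] smooth_forms by blast+
  have d1: "deriv (limiting_normal_curv f \<nu>) 0 = pd_u L (0, 0)" "deriv (cuspidal_torsion \<nu> h) 0 = pd_u M (0, 0)"
    unfolding limiting_normal_curv_def[abs_def] cuspidal_torsion_def[abs_def]
    using pd_real_slices(1)[OF forms_d(1)] pd_real_slices(1)[OF forms_d(2)] by (blast intro: DERIV_imp_deriv)+
  have d2: "deriv (bias h \<nu>1) 0 = 3 * pd_u N (0, 0)"
    unfolding bias_def[abs_def] by (rule DERIV_imp_deriv[OF DERIV_cmult[OF pd_real_slices(1)[OF forms_d(3)]]])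
  have H: "2 * mean_curv f \<nu> h \<nu>1 (0, 0) - k (0, 0) - k (0, 0) = N (0, 0) + L (0, 0) - 2 * k (0, 0)"
    by (simp add: mean_curv_def forms_axis[OF u])
  show "deriv (\<lambda>t. 1 / k (t, g t)) 0 *
      ((M (0, 0))\<^sup>2 * deriv (limiting_normal_curv f \<nu>) 0
       + 2 * M (0, 0) * deriv (cuspidal_torsion \<nu> h) 0 * (k (0, 0) - L (0, 0))
       + deriv (bias h \<nu>1) 0 / 3 * (k (0, 0) - L (0, 0))\<^sup>2)
    < ((M (0, 0))\<^sup>2 + (k (0, 0) - L (0, 0))\<^sup>2) * (2 * mean_curv f \<nu> h \<nu>1 (0, 0) - k (0, 0) - k (0, 0)) * (L (0, 0) - k (0, 0))"
    unfolding d1 d2 H using radius_derivative_inequality[OF l(1) g0 g'] by simp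
qed

theorem theorem4p10:
  fixes f \<nu> f' \<nu>' h \<nu>1 C :: "real \<times> real \<Rightarrow> real^3"
    and \<phi> :: "real \<times> real \<Rightarrow> real \<times> real"
    and \<kappa> :: "nat \<Rightarrow> real \<times> real \<Rightarrow> real"
    and \<kappa>\<^sub>\<nu> \<kappa>\<^sub>t r\<^sub>b r\<^sub>c g \<rho> :: "real \<Rightarrow> real"
    and j :: nat
  defines "f' \<equiv> f \<circ> \<phi>" and "\<nu>' \<equiv> \<nu> \<circ> \<phi>"
    and "\<kappa> \<equiv> princ_curv f' \<nu>' h \<nu>1"
    and "\<kappa>\<^sub>\<nu> \<equiv> limiting_normal_curv f' \<nu>'"
    and "\<kappa>\<^sub>t \<equiv> cuspidal_torsion \<nu>' h"
    and "r\<^sub>b \<equiv> bias h \<nu>1"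
    and "r\<^sub>c \<equiv> secondary_cuspidal_curv f' \<nu>' h \<nu>1"
    and "C \<equiv> focal_surface f' \<nu>' h \<nu>1 j"
    and "\<rho> \<equiv> (\<lambda>t. curv_radius f' \<nu>' h \<nu>1 j (t, g t))"
  assumes "frontal_germ f \<nu> 0" and "f 0 = 0"
    and "pure_frontal_singular f \<nu> 0"
    and "adapted_coordinates f \<nu> \<phi>"
    and "v_factor f' h" and "v_factor \<nu>' \<nu>1"
    and "\<kappa>\<^sub>t 0 \<noteq> 0"
    and "\<forall>\<^sub>F q in nhds 0. \<kappa> 1 q \<noteq> 0 \<and> \<kappa> 2 q \<noteq> 0"
    and "j \<in> {1, 2}"
    and "first_order_ridge f' \<nu>' h \<nu>1 j 0"
    and "first_kind C (focal_normal f' \<nu>' h \<nu>1 j) 0"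
    and "singular_curve C 0 (\<lambda>t. (t, g t))" and "g 0 = 0"
  shows "has_cuspidal_cross_cap C 0 \<longleftrightarrow>
    deriv r\<^sub>c 0 \<noteq> 0 \<and>
    deriv \<rho> 0 *
      ((\<kappa>\<^sub>t 0)\<^sup>2 * deriv \<kappa>\<^sub>\<nu> 0
       + 2 * \<kappa>\<^sub>t 0 * deriv \<kappa>\<^sub>t 0 * (\<kappa> j 0 - \<kappa>\<^sub>\<nu> 0)
       + deriv r\<^sub>b 0 / 3 * (\<kappa> j 0 - \<kappa>\<^sub>\<nu> 0)\<^sup>2)
    \<noteq> ((\<kappa>\<^sub>t 0)\<^sup>2 + (\<kappa> j 0 - \<kappa>\<^sub>\<nu> 0)\<^sup>2)
        * (\<kappa> (j + 1) 0 - \<kappa> j 0) * (\<kappa>\<^sub>\<nu> 0 - \<kappa> j 0)"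
proof -
  have zero: "0 = (0 :: real, 0 :: real)" by (simp add: zero_prod_def)
  note hyp = assms(10-22)
  have \<phi>: "diffeo_germ \<phi> 0 0"
    and frame: "\<forall>\<^sub>F u in nhds 0. let a = pd_u f' (u, 0); b = pd_v (pd_v f') (u, 0); c = \<nu>' (u, 0)
        in norm a = 1 \<and> norm b = 1 \<and> norm c = 1 \<and> a \<bullet> b = 0 \<and> a \<bullet> c = 0 \<and> b \<bullet> c = 0"
    using hyp(4) unfolding adapted_coordinates_def f'_def \<nu>'_def by (simp_all only: comp_apply)
  have "frontal_germ f' \<nu>' 0" unfolding f'_def \<nu>'_def by (rule frontal_germ_reparametrize[OF hyp(1) \<phi>])
  from adapted_frontal_exists[OF this hyp(5,6) frame] obtain r0 where r0: "adapted_frontal f' \<nu>' h \<nu>1 r0" .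
  have M0: "Mt \<nu>' h (0, 0) \<noteq> 0" using hyp(7) by (simp add: \<kappa>\<^sub>t_def cuspidal_torsion_def)
  have nz: "\<forall>\<^sub>F q in nhds 0. princ_curv f' \<nu>' h \<nu>1 j q \<noteq> 0"
    using hyp(8) by (rule eventually_mono) (use hyp(9) in \<open>auto simp: \<kappa>_def\<close>)
  from adapted_frontal.focal_frontal_exists[OF r0 M0 nz]
  obtain r where r: "focal_frontal f' \<nu>' h \<nu>1 r (princ_curv f' \<nu>' h \<nu>1 j)" .
  interpret ff: focal_frontal f' \<nu>' h \<nu>1 r "princ_curv f' \<nu>' h \<nu>1 j" by (rule r)
  have C: "C = ff.C"
    unfolding assms(8) fun_eq_iff ff.C_def focal_surface_def curv_radius_def by simp
  have V: "princ_vec f' \<nu>' h \<nu>1 j q = (ff.V1 q, ff.V2 q)" for q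
    by (simp add: princ_vec_def ff.V1_def ff.V2_def Let_def)
  have ridge: "dir_deriv (princ_vec f' \<nu>' h \<nu>1 j) (princ_curv f' \<nu>' h \<nu>1 j) (0, 0) = 0"
    "dir_deriv (princ_vec f' \<nu>' h \<nu>1 j) (dir_deriv (princ_vec f' \<nu>' h \<nu>1 j) (princ_curv f' \<nu>' h \<nu>1 j)) (0, 0) \<noteq> 0"
    using hyp(10) unfolding first_order_ridge_def Let_def zero by blast+
  note char = ff.cuspidal_cross_cap_characterization[OF ff.ridge_origin[OF V ridge] hyp(12)[unfolded C] hyp(13)]
  have next_curv: "\<kappa> (j + 1) 0 = 2 * mean_curv f' \<nu>' h \<nu>1 (0, 0) - princ_curv f' \<nu>' h \<nu>1 j (0, 0)"
    using princ_curv_consecutive_sum[of f' \<nu>' h \<nu>1 j "(0, 0)"] unfolding \<kappa>_def zero by linarith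
  have vals: "\<rho> = (\<lambda>t. 1 / princ_curv f' \<nu>' h \<nu>1 j (t, g t))" "\<kappa>\<^sub>t 0 = Mt \<nu>' h (0, 0)" "\<kappa>\<^sub>\<nu> 0 = Lt f' \<nu>' (0, 0)"
    "\<kappa> j 0 = princ_curv f' \<nu>' h \<nu>1 j (0, 0)"
    unfolding \<rho>_def \<kappa>\<^sub>t_def \<kappa>\<^sub>\<nu>_def \<kappa>_def curv_radius_def cuspidal_torsion_def limiting_normal_curv_def zero by (rule refl)+
  show ?thesis
    using char(1) less_imp_neq[OF char(2)] unfolding next_curv vals C unfolding \<kappa>\<^sub>\<nu>_def \<kappa>\<^sub>t_def r\<^sub>b_def r\<^sub>c_def by blast
qed

end
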